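(* Let $k\ge 0$, $n\ge 1$, let $(E_\eta)_{\eta\in\mathbb N_0^n}$ be the non-symmetric and $(P_\lambda)_{\lambda\in\Lambda_n^+}$ the symmetric Jack polynomials of index $1/k$. Then for all $\mu\in\mathbb C$ with $\mathrm{Re}\,\mu>\mu_0$ and all $z\in\mathbb C^n$ with $\mathrm{Re}\,z>0$ (componentwise): (1) for every $\eta\in\mathbb N_0^n$, $$\int_{\mathbb R_+^n}E(-z,x)\,E_\eta(x)\,\Delta(x)^{\mu-\mu_0-1}\,\omega(x)\,dx=\Gamma_n(\eta_++\underline\mu)\,E_\eta\bigl(\tfrac1z\bigr)\,\Delta(z)^{-\mu};$$ (2) for every $\lambda\in\Lambda_n^+$, $$\int_{\mathbb R_+^n}J(-z,x)\,P_\lambda(x)\,\Delta(x)^{\mu-\mu_0-1}\,\omega(x)\,dx=\Gamma_n(\lambda+\underline\mu)\,P_\lambda\bigl(\tfrac1z\bigr)\,\Delta(z)^{-\mu}.$$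
   Context: Notation: $\langle z,w\rangle=\sum_i z_iw_i$ (bilinear on $\mathbb C^n$); $\underline s=(s,\dots,s)\in\mathbb C^n$; $\mathbb R_+=(0,\infty)$; inequalities between vectors and expressions such as $1/z$ are componentwise. $s_{ij}$ denotes the transposition interchanging coordinates $i$ and $j$; $\mathcal S_n$ acts on $\mathbb C^n$ by permuting coordinates. For $\xi\in\mathbb R^n$ the Dunkl operator of type $A_{n-1}$ with multiplicity $k\ge0$ is $T_\xi f(x)=\partial_\xi f(x)+k\sum_{1\le i<j\le n}(\xi_i-\xi_j)\frac{f(x)-f(s_{ij}x)}{x_i-x_j}$; $T_j:=T_{e_j}$. The Dunkl kernel $E(\lambda,z)$ is the unique function holomorphic on $\mathbb C^n\times\mathbb C^n$ such that for each $\lambda$, $T_\xi E(\lambda,\cdot)=\langle\lambda,\xi\rangle E(\lambda,\cdot)$ for all $\xi\in\mathbb R^n$ and $E(\lambda,0)=1$; the Bessel function is $J(\lambda,z)=\frac1{n!}\sum_{\sigma\in\mathcal S_n}E(\lambda,\sigma z)$. Put $\omega(x)=\prod_{i<j}|x_i-x_j|^{2k}$, $\Delta(z)=\prod_j z_j$, $\mu_0=k(n-1)$, and for $\mathrm{Re}\,z>0$, $s\in\mathbb C$: $\Delta(z)^s=\exp(s\sum_j\mathrm{Log}\,z_j)$ (principal branch). $\Gamma_n(\lambda)=d_n(k)\prod_{j=1}^n\Gamma(\lambda_j-k(j-1))$ for $\lambda\in\mathbb C^n$, with $d_n(k)=\prod_{j=1}^n\Gamma(1+jk)/\Gamma(1+k)$.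 Jack polynomials: $\Lambda_n^+=\{\lambda\in\mathbb N_0^n:\lambda_1\ge\dots\ge\lambda_n\}$; for $\eta\in\mathbb N_0^n$, $|\eta|=\sum\eta_i$ and $\eta_+\in\Lambda_n^+$ is the decreasing rearrangement. Dominance order on $\Lambda_n^+$: $\mu\le_D\lambda$ iff $|\mu|=|\lambda|$ and $\sum_{j\le r}\mu_j\le\sum_{j\le r}\lambda_j$ for all $r$. On $\mathbb N_0^n$: $\kappa\prec\eta$ iff either $\kappa_+\le_D\eta_+$ with $\kappa_+\ne\eta_+$, or $\kappa_+=\eta_+$ and $w_\eta<w_\kappa$ in the Bruhat order, where $w_\eta\in\mathcal S_n$ is the shortest permutation with $w_\eta\eta_+=\eta$. Let $\mathcal D_j=x_jT_j+k(1-n)+k\sum_{i>j}s_{ij}$ ($s_{ij}$ acting on functions by interchanging $x_i,x_j$), and $\overline\eta_j=\eta_j-k\#\{i<j:\eta_i\ge\eta_j\}-k\#\{i>j:\eta_i>\eta_j\}$. The non-symmetric Jack polynomial $E_\eta$ of index $1/k$ is the unique polynomial of the form $x^\eta+\sum_{\kappa\prec\eta}c_{\eta\kappa}x^\kappa$ with $\mathcal D_jE_\eta=\overline\eta_jE_\eta$ for $j=1,\dots,n$ (for $k=0$, $E_\eta=x^\eta$). For $\lambda\in\Lambda_n^+$, $P_\lambda$ is the unique scalar multiple of $x\mapsto\sum_{\sigma\in\mathcal S_n}E_\lambda(\sigma x)$ whose coefficient of $x^\lambda$ equals $1$. *)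

theory Defs
  imports "HOL-Analysis.Analysis" "HOL-Combinatorics.Permutations"
begin

text \<open>Vectors in C^n / R^n / N_0^n are represented as functions on nat; only the
coordinates 0..n-1 matter (coordinate j+1 of the paper is index j here).\<close>

definition cvec :: "(nat \<Rightarrow> real) \<Rightarrow> nat \<Rightarrow> complex" where
  "cvec x = (\<lambda>i. complex_of_real (x i))"

definition depends_on_first :: "nat \<Rightarrow> ((nat \<Rightarrow> 'a) \<Rightarrow> 'b) \<Rightarrow> bool" where
  "depends_on_first n f \<longleftrightarrow> (\<forall>z w. (\<forall>i<n. z i = w i) \<longrightarrow> f z = f w)"

text \<open>Holomorphic on C^n: continuous and holomorphic in each variable separately
(equivalent to holomorphy by Osgood's lemma).\<close>
definition holomorphic_n :: "nat \<Rightarrow> ((nat \<Rightarrow> complex) \<Rightarrow> complex) \<Rightarrow> bool" where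
  "holomorphic_n n f \<longleftrightarrow> depends_on_first n f \<and> continuous_on UNIV f \<and>
     (\<forall>z. \<forall>i<n. (\<lambda>w. f (z(i := w))) holomorphic_on UNIV)"

definition pderiv_n :: "((nat \<Rightarrow> complex) \<Rightarrow> complex) \<Rightarrow> nat \<Rightarrow> (nat \<Rightarrow> complex) \<Rightarrow> complex" where
  "pderiv_n f j z = deriv (\<lambda>w. f (z(j := w))) (z j)"

definition swap_coords :: "nat \<Rightarrow> nat \<Rightarrow> (nat \<Rightarrow> 'a) \<Rightarrow> nat \<Rightarrow> 'a" where
  "swap_coords i j x = x(i := x j, j := x i)"

definition distinct_coords :: "nat \<Rightarrow> (nat \<Rightarrow> 'a) \<Rightarrow> bool" where
  "distinct_coords n z \<longleftrightarrow> (\<forall>i<n. \<forall>j<n. i \<noteq> j \<longrightarrow> z i \<noteq> z j)"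

definition bil :: "nat \<Rightarrow> (nat \<Rightarrow> complex) \<Rightarrow> (nat \<Rightarrow> complex) \<Rightarrow> complex" where
  "bil n z w = (\<Sum>i<n. z i * w i)"

definition dunkl_op :: "nat \<Rightarrow> real \<Rightarrow> (nat \<Rightarrow> real) \<Rightarrow> ((nat \<Rightarrow> complex) \<Rightarrow> complex)
    \<Rightarrow> (nat \<Rightarrow> complex) \<Rightarrow> complex" where
  "dunkl_op n k \<xi> f x =
     (\<Sum>j<n. complex_of_real (\<xi> j) * pderiv_n f j x)
     + complex_of_real k * (\<Sum>j<n. \<Sum>i<j. complex_of_real (\<xi> i - \<xi> j)
            * (f x - f (swap_coords i j x)) / (x i - x j))"

text \<open>Dunkl kernel E(lambda, .): the unique holomorphic function with the eigen-equations
(stated off the diagonals, where the difference quotients are literal) and E(lambda,0)=1.\<close>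
definition dunkl_kernel :: "nat \<Rightarrow> real \<Rightarrow> (nat \<Rightarrow> complex) \<Rightarrow> (nat \<Rightarrow> complex) \<Rightarrow> complex" where
  "dunkl_kernel n k lam = (THE f. holomorphic_n n f \<and> f (\<lambda>_. 0) = 1 \<and>
     (\<forall>\<xi> z. distinct_coords n z \<longrightarrow> dunkl_op n k \<xi> f z = bil n lam (cvec \<xi>) * f z))"

definition perm_act :: "(nat \<Rightarrow> nat) \<Rightarrow> (nat \<Rightarrow> 'a) \<Rightarrow> nat \<Rightarrow> 'a" where
  "perm_act \<sigma> z = (\<lambda>i. z (inv \<sigma> i))"

definition bessel :: "nat \<Rightarrow> real \<Rightarrow> (nat \<Rightarrow> complex) \<Rightarrow> (nat \<Rightarrow> complex) \<Rightarrow> complex" where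
  "bessel n k lam z = (1 / of_nat (fact n)) *
     (\<Sum>\<sigma>\<in>{\<sigma>. \<sigma> permutes {..<n}}. dunkl_kernel n k lam (perm_act \<sigma> z))"

definition mindex :: "nat \<Rightarrow> (nat \<Rightarrow> nat) \<Rightarrow> bool" where
  "mindex n \<alpha> \<longleftrightarrow> (\<forall>i\<ge>n. \<alpha> i = 0)"

definition mono :: "nat \<Rightarrow> (nat \<Rightarrow> nat) \<Rightarrow> (nat \<Rightarrow> complex) \<Rightarrow> complex" where
  "mono n \<alpha> x = (\<Prod>i<n. x i ^ \<alpha> i)"

definition is_partition :: "nat \<Rightarrow> (nat \<Rightarrow> nat) \<Rightarrow> bool" where
  "is_partition n lam \<longleftrightarrow> mindex n lam \<and> (\<forall>i j. i \<le> j \<longrightarrow> j < n \<longrightarrow> lam j \<le> lam i)"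

definition eta_plus :: "nat \<Rightarrow> (nat \<Rightarrow> nat) \<Rightarrow> nat \<Rightarrow> nat" where
  "eta_plus n \<eta> = (\<lambda>i. if i < n then rev (sort (map \<eta> [0..<n])) ! i else 0)"

definition dom_le :: "nat \<Rightarrow> (nat \<Rightarrow> nat) \<Rightarrow> (nat \<Rightarrow> nat) \<Rightarrow> bool" where
  "dom_le n \<mu> lam \<longleftrightarrow> (\<Sum>i<n. \<mu> i) = (\<Sum>i<n. lam i) \<and>
     (\<forall>r\<le>n. (\<Sum>i<r. \<mu> i) \<le> (\<Sum>i<r. lam i))"

definition inv_count :: "nat \<Rightarrow> (nat \<Rightarrow> nat) \<Rightarrow> nat" where
  "inv_count n \<sigma> = card {(i, j). i < j \<and> j < n \<and> \<sigma> j < \<sigma> i}"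

definition transp_nat :: "nat \<Rightarrow> nat \<Rightarrow> nat \<Rightarrow> nat" where
  "transp_nat i j = (\<lambda>m. if m = i then j else if m = j then i else m)"

definition bruhat_lt :: "nat \<Rightarrow> (nat \<Rightarrow> nat) \<Rightarrow> (nat \<Rightarrow> nat) \<Rightarrow> bool" where
  "bruhat_lt n v w \<longleftrightarrow> (v, w) \<in> trancl {(u, u \<circ> transp_nat i j) | u i j.
      u permutes {..<n} \<and> i < n \<and> j < n \<and> i \<noteq> j \<and>
      inv_count n u < inv_count n (u \<circ> transp_nat i j)}"

definition min_perm :: "nat \<Rightarrow> (nat \<Rightarrow> nat) \<Rightarrow> nat \<Rightarrow> nat" where
  "min_perm n \<eta> = (THE w. w permutes {..<n} \<and> perm_act w (eta_plus n \<eta>) = \<eta> \<and>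
     (\<forall>v. v permutes {..<n} \<and> perm_act v (eta_plus n \<eta>) = \<eta> \<longrightarrow> inv_count n w \<le> inv_count n v))"

definition jack_prec :: "nat \<Rightarrow> (nat \<Rightarrow> nat) \<Rightarrow> (nat \<Rightarrow> nat) \<Rightarrow> bool" where
  "jack_prec n \<kappa> \<eta> \<longleftrightarrow>
     (dom_le n (eta_plus n \<kappa>) (eta_plus n \<eta>) \<and> eta_plus n \<kappa> \<noteq> eta_plus n \<eta>) \<or>
     (eta_plus n \<kappa> = eta_plus n \<eta> \<and> bruhat_lt n (min_perm n \<eta>) (min_perm n \<kappa>))"

definition eta_bar :: "nat \<Rightarrow> real \<Rightarrow> (nat \<Rightarrow> nat) \<Rightarrow> nat \<Rightarrow> real" where
  "eta_bar n k \<eta> j = real (\<eta> j) - k * real (card {i. i < j \<and> \<eta> j \<le> \<eta> i})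
      - k * real (card {i. j < i \<and> i < n \<and> \<eta> j < \<eta> i})"

definition unit_vec :: "nat \<Rightarrow> nat \<Rightarrow> real" where
  "unit_vec j = (\<lambda>i. if i = j then 1 else 0)"

definition cher_op :: "nat \<Rightarrow> real \<Rightarrow> nat \<Rightarrow> ((nat \<Rightarrow> complex) \<Rightarrow> complex)
    \<Rightarrow> (nat \<Rightarrow> complex) \<Rightarrow> complex" where
  "cher_op n k j f x = x j * dunkl_op n k (unit_vec j) f x
     + complex_of_real (k * (1 - real n)) * f x
     + complex_of_real k * (\<Sum>i\<in>{j<..<n}. f (swap_coords i j x))"

definition nsjack :: "nat \<Rightarrow> real \<Rightarrow> (nat \<Rightarrow> nat) \<Rightarrow> (nat \<Rightarrow> complex) \<Rightarrow> complex" where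
  "nsjack n k \<eta> = (THE p.
     (\<exists>c. \<forall>x. p x = mono n \<eta> x + (\<Sum>\<kappa>\<in>{\<kappa>. mindex n \<kappa> \<and> jack_prec n \<kappa> \<eta>}. c \<kappa> * mono n \<kappa> x)) \<and>
     (\<forall>j<n. \<forall>x. distinct_coords n x \<longrightarrow>
        cher_op n k j p x = complex_of_real (eta_bar n k \<eta> j) * p x))"

definition poly_rep :: "nat \<Rightarrow> ((nat \<Rightarrow> complex) \<Rightarrow> complex) \<Rightarrow> ((nat \<Rightarrow> nat) \<Rightarrow> complex) \<Rightarrow> bool" where
  "poly_rep n p c \<longleftrightarrow> finite {\<alpha>. c \<alpha> \<noteq> 0} \<and> (\<forall>\<alpha>. c \<alpha> \<noteq> 0 \<longrightarrow> mindex n \<alpha>) \<and>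
     (\<forall>x. p x = (\<Sum>\<alpha>\<in>{\<alpha>. c \<alpha> \<noteq> 0}. c \<alpha> * mono n \<alpha> x))"

definition poly_coeff :: "nat \<Rightarrow> ((nat \<Rightarrow> complex) \<Rightarrow> complex) \<Rightarrow> (nat \<Rightarrow> nat) \<Rightarrow> complex" where
  "poly_coeff n p \<alpha> = (THE a. \<exists>c. poly_rep n p c \<and> c \<alpha> = a)"

definition symjack :: "nat \<Rightarrow> real \<Rightarrow> (nat \<Rightarrow> nat) \<Rightarrow> (nat \<Rightarrow> complex) \<Rightarrow> complex" where
  "symjack n k lam = (THE p.
     (\<exists>c::complex. \<forall>x. p x = c * (\<Sum>\<sigma>\<in>{\<sigma>. \<sigma> permutes {..<n}}. nsjack n k lam (perm_act \<sigma> x))) \<and>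
     poly_coeff n p lam = 1)"

definition d_const :: "nat \<Rightarrow> real \<Rightarrow> real" where
  "d_const n k = (\<Prod>j\<in>{1..n}. Gamma (1 + real j * k) / Gamma (1 + k))"

definition Gamma_n :: "nat \<Rightarrow> real \<Rightarrow> (nat \<Rightarrow> complex) \<Rightarrow> complex" where
  "Gamma_n n k lam = complex_of_real (d_const n k) * (\<Prod>j<n. Gamma (lam j - complex_of_real (k * real j)))"

definition Delta_pow :: "nat \<Rightarrow> (nat \<Rightarrow> complex) \<Rightarrow> complex \<Rightarrow> complex" where
  "Delta_pow n z s = exp (s * (\<Sum>j<n. Ln (z j)))"

definition omega :: "nat \<Rightarrow> real \<Rightarrow> (nat \<Rightarrow> real) \<Rightarrow> real" where
  "omega n k x = (\<Prod>j<n. \<Prod>i<j. (if k = 0 then 1 else \<bar>x i - x j\<bar> powr (2 * k)))"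

definition lebesgue_n :: "nat \<Rightarrow> (nat \<Rightarrow> real) measure" where
  "lebesgue_n n = PiM {..<n} (\<lambda>_. lborel)"

definition pos_orthant :: "nat \<Rightarrow> (nat \<Rightarrow> real) set" where
  "pos_orthant n = {x \<in> space (lebesgue_n n). \<forall>i<n. 0 < x i}"

end

theory Submission
  imports Defs "HOL-Complex_Analysis.Complex_Analysis" "HOL-Combinatorics.List_Permutation"
begin

text \<open>Write n = m + 1. The kernel is constructed as a series of homogeneous eigenpolynomials, which gives the growth
  bounds, the symmetry E(l, x) = E(x, l) and the decay of E(-z, x) for Re z > 0. Integration by parts in the last
  coordinate shows that multiplying the integrand by the last coordinate corresponds to division by the last z-coordinate,
  up to the factor (eigenvalue + mu). All non-symmetric Jack polynomials arise from 1 by the raising operator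
  p(x) \<mapsto> x_m p(x_m, x_0, ..., x_(m-1)) and by exchanging adjacent coordinates, so formula (1) reduces to the
  constant polynomial. For the latter the transform solves a first order equation in each z-coordinate, which leaves
  one constant: a Selberg integral. Its shift equation in mu, a concentration estimate for large mu and a boundary term that
  lowers n determine it. Formula (2) follows by symmetrisation.\<close>

section \<open>The Dunkl kernel\<close>

text \<open>For k >= 0 the operator m + k (sum over reflections of 1 - s) is a diagonally dominant
  system on each finite orbit. Its inverse is a nonnegative measure on the symmetric group of mass
  1/m; this mass is the source of the factor 1/m! in the bound for the degree m component, and all
  uniqueness questions about the kernel reduce to the same system. The bound exp(L |x|) that results
  says nothing about decay of E(-z, x); for that a symmetric exponential is split off first.
  Difference quotients are literal in the definitions, so identities hold off the diagonals and are
  extended by continuity or up to null sets. For 2k < 1 the derivative of |x_i - x_j|^(2k) blows up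
  there, so integrability is settled before any integration by parts. The shift equation in mu fixes
  the Selberg integral only up to a factor of period 1; the behaviour for large mu forces that
  factor to be constant. Starting from 1, the recursion yields polynomials with positive
  coefficients only, so neither a leading coefficient nor a symmetrisation can vanish, and the
  eigenvalues alone identify the Jack polynomials.\<close>

definition pairs :: "nat => (nat \<times> nat) set" where
  "pairs n = {(i, j). i < j \<and> j < n}"

definition symg :: "nat => (nat => nat) set" where
  "symg n = {\<sigma>. \<sigma> permutes {..<n}}"

definition tr :: "nat \<times> nat => nat => nat" where
  "tr p = Transposition.transpose (fst p) (snd p)"

lemma finite_pairs [simp]: "finite (pairs n)"
  by (rule finite_subset[of _ "{..<n} \<times> {..<n}"]) (auto simp: pairs_def)

lemma finite_symg [simp]: "finite (symg n)"
  by (simp add: symg_def finite_permutations)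

lemma symgD: "\<sigma> \<in> symg n ==> \<sigma> permutes {..<n}" by (simp add: symg_def)

lemma id_symg [simp]: "id \<in> symg n" by (simp add: symg_def permutes_id)

lemma symg_comp: "\<sigma> \<in> symg n ==> \<tau> \<in> symg n ==> \<sigma> \<circ> \<tau> \<in> symg n"
  by (simp add: symg_def permutes_compose)

lemma symg_inv: "\<sigma> \<in> symg n ==> inv \<sigma> \<in> symg n"
  by (simp add: symg_def permutes_inv)

lemma tr_symg: "p \<in> pairs n ==> tr p \<in> symg n"
  by (auto simp: pairs_def symg_def tr_def intro!: permutes_swap_id)

lemma tr_tr [simp]: "tr p \<circ> tr p = id" by (simp add: tr_def)

lemma tr_tr_apply [simp]: "tr p (tr p i) = i"
  by (simp add: tr_def)

lemma symg_lt: "\<sigma> \<in> symg n ==> \<sigma> i < n \<longleftrightarrow> i < n"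
  using permutes_in_image[OF symgD, of \<sigma> n i] by simp

lemma symg_inv_o [simp]: "\<sigma> \<in> symg n ==> inv \<sigma> \<circ> \<sigma> = id" "\<sigma> \<in> symg n ==> \<sigma> \<circ> inv \<sigma> = id"
  using permutes_inv_o[OF symgD] by auto

lemma symg_inv_apply [simp]: "\<sigma> \<in> symg n ==> inv \<sigma> (\<sigma> i) = i" "\<sigma> \<in> symg n ==> \<sigma> (inv \<sigma> i) = i"
  using permutes_inverses[OF symgD] by auto

lemma symg_inj: "\<sigma> \<in> symg n ==> \<sigma> i = \<sigma> j \<longleftrightarrow> i = j"
  by (metis symg_inv_apply(1))

lemma swap_coords_eq: "swap_coords i j x = x \<circ> Transposition.transpose i j"
  by (auto simp: swap_coords_def fun_eq_iff Transposition.transpose_def)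

lemma swap_coords_tr: "swap_coords (fst p) (snd p) x = x \<circ> tr p"
  by (simp add: swap_coords_eq tr_def)

lemma sum_pairs: "(\<Sum>j<n. \<Sum>i<j. g i j) = (\<Sum>p\<in>pairs n. g (fst p) (snd p))"
proof -
  have "(\<Sum>j<n. \<Sum>i<j. g i j) = (\<Sum>q\<in>(SIGMA j:{..<n}. {..<j}). g (snd q) (fst q))"
    by (subst sum.Sigma) (auto simp: case_prod_unfold)
  also have "\<dots> = (\<Sum>p\<in>pairs n. g (fst p) (snd p))"
    by (rule sum.reindex_bij_witness[of _ "\<lambda>p. (snd p, fst p)" "\<lambda>p. (snd p, fst p)"])
       (auto simp: pairs_def)
  finally show ?thesis .
qed

lemma prod_pairs: "(\<Prod>j<n. \<Prod>i<j. g i j) = (\<Prod>p\<in>pairs n. g (fst p) (snd p))"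
proof -
  have "(\<Prod>j<n. \<Prod>i<j. g i j) = (\<Prod>q\<in>(SIGMA j:{..<n}. {..<j}). g (snd q) (fst q))"
    by (subst prod.Sigma) (auto simp: case_prod_unfold)
  also have "\<dots> = (\<Prod>p\<in>pairs n. g (fst p) (snd p))"
    by (rule prod.reindex_bij_witness[of _ "\<lambda>p. (snd p, fst p)" "\<lambda>p. (snd p, fst p)"])
       (auto simp: pairs_def)
  finally show ?thesis .
qed

definition permpair :: "(nat => nat) => nat \<times> nat => nat \<times> nat" where
  "permpair \<tau> p = (min (\<tau> (fst p)) (\<tau> (snd p)), max (\<tau> (fst p)) (\<tau> (snd p)))"

lemma permpair_bij:
  assumes "\<tau> \<in> symg n"
  shows "bij_betw (permpair \<tau>) (pairs n) (pairs n)"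
proof (rule bij_betw_byWitness[where f' = "permpair (inv \<tau>)"])
  have *: "permpair \<tau> ` pairs n \<subseteq> pairs n" if "\<tau> \<in> symg n" for \<tau>
  proof
    fix q assume "q \<in> permpair \<tau> ` pairs n"
    then obtain i j where q: "q = permpair \<tau> (i, j)" and ij: "i < j" "j < n" by (auto simp: pairs_def)
    have "\<tau> i \<noteq> \<tau> j" "\<tau> i < n" "\<tau> j < n" using ij that by (auto simp: symg_inj symg_lt)
    thus "q \<in> pairs n" by (auto simp: q permpair_def pairs_def)
  qed
  show "permpair \<tau> ` pairs n \<subseteq> pairs n" "permpair (inv \<tau>) ` pairs n \<subseteq> pairs n"
    using * assms symg_inv by auto
  show "\<forall>p\<in>pairs n. permpair (inv \<tau>) (permpair \<tau> p) = p"
    "\<forall>p\<in>pairs n. permpair \<tau> (permpair (inv \<tau>) p) = p"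
    using assms by (auto simp: permpair_def pairs_def min_def max_def)
qed

lemma sum_pairs_permute:
  assumes "\<tau> \<in> symg n" "\<And>i j. g i j = g j i"
  shows "(\<Sum>p\<in>pairs n. g (\<tau> (fst p)) (\<tau> (snd p))) = (\<Sum>p\<in>pairs n. g (fst p) (snd p))"
proof -
  have "(\<Sum>p\<in>pairs n. g (fst p) (snd p)) = (\<Sum>p\<in>pairs n. g (fst (permpair \<tau> p)) (snd (permpair \<tau> p)))"
    by (rule sum.reindex_bij_betw[symmetric, OF permpair_bij[OF assms(1)]])
  also have "\<dots> = (\<Sum>p\<in>pairs n. g (\<tau> (fst p)) (\<tau> (snd p)))"
    by (intro sum.cong refl) (auto simp: permpair_def min_def max_def assms(2))
  finally show ?thesis by simp
qed

lemma prod_pairs_permute: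
  assumes "\<tau> \<in> symg n" "\<And>i j. g i j = g j i"
  shows "(\<Prod>p\<in>pairs n. g (\<tau> (fst p)) (\<tau> (snd p))) = (\<Prod>p\<in>pairs n. g (fst p) (snd p))"
proof -
  have "(\<Prod>p\<in>pairs n. g (fst p) (snd p)) = (\<Prod>p\<in>pairs n. g (fst (permpair \<tau> p)) (snd (permpair \<tau> p)))"
    by (rule prod.reindex_bij_betw[symmetric, OF permpair_bij[OF assms(1)]])
  also have "\<dots> = (\<Prod>p\<in>pairs n. g (\<tau> (fst p)) (\<tau> (snd p)))"
    by (intro prod.cong refl) (auto simp: permpair_def min_def max_def assms(2))
  finally show ?thesis by simp
qed

lemma transpose_conj:
  assumes "\<tau> \<in> symg n"
  shows "Transposition.transpose i j \<circ> \<tau> = \<tau> \<circ> Transposition.transpose (inv \<tau> i) (inv \<tau> j)"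
proof -
  have "Transposition.transpose i j (\<tau> x) = \<tau> (Transposition.transpose (inv \<tau> i) (inv \<tau> j) x)" for x
    using symg_inv_apply[OF assms] by (auto simp: Transposition.transpose_def)
  thus ?thesis by (auto simp: fun_eq_iff)
qed

lemma bij_symg_left: "\<tau> \<in> symg n ==> bij_betw (\<lambda>\<sigma>. \<tau> \<circ> \<sigma>) (symg n) (symg n)"
  by (rule bij_betw_byWitness[where f' = "\<lambda>\<sigma>. inv \<tau> \<circ> \<sigma>"])
     (auto simp: symg_comp symg_inv fun_eq_iff)

lemma bij_symg_inv: "bij_betw inv (symg n) (symg n)"
  by (rule bij_betw_byWitness[where f' = inv])
     (auto simp: symg_inv inv_inv_eq intro!: inv_inv_eq permutes_bij symgD)

lemma sum_symg_left:
  assumes "\<tau> \<in> symg n"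
  shows "(\<Sum>\<sigma>\<in>symg n. g (\<tau> \<circ> \<sigma>)) = (\<Sum>\<sigma>\<in>symg n. g \<sigma>)"
  using sum.reindex_bij_betw[OF bij_symg_left[OF assms]] .

text \<open>Maximum principle: at a point where the norm of F is maximal, the average of F over
  neighbours cannot compensate the positive term m F.\<close>

lemma max_principle:
  fixes F :: "'x => 'a :: real_normed_vector"
  assumes X: "finite X" "x \<in> X" and P: "finite P" and \<tau>: "\<And>x p. x \<in> X ==> p \<in> P ==> \<tau> p x \<in> X"
    and m: "m > 0" and k: "k \<ge> 0"
    and eq: "\<And>x. x \<in> X ==> m *\<^sub>R F x + k *\<^sub>R (\<Sum>p\<in>P. F x - F (\<tau> p x)) = 0"
  shows "F x = 0"
proof -
  obtain y where y: "y \<in> X" and max: "\<And>x. x \<in> X ==> norm (F x) \<le> norm (F y)"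
  proof -
    have "Max ((\<lambda>x. norm (F x)) ` X) \<in> (\<lambda>x. norm (F x)) ` X"
      using X by (intro Max_in) auto
    then obtain y where "y \<in> X" "Max ((\<lambda>x. norm (F x)) ` X) = norm (F y)" by auto
    thus ?thesis using X by (intro that[of y]) (auto intro: Max_ge simp flip: \<open>Max _ = _\<close>)
  qed
  have "(m + k * card P) *\<^sub>R F y = k *\<^sub>R (\<Sum>p\<in>P. F (\<tau> p y))"
    using eq[OF y] by (simp add: sum_subtractf algebra_simps scaleR_conv_of_real flip: scaleR_scaleR)
      (simp add: sum_constant_scaleR algebra_simps)
  hence "(m + k * card P) * norm (F y) = norm (k *\<^sub>R (\<Sum>p\<in>P. F (\<tau> p y)))"
    using m k by (metis abs_of_nonneg norm_scaleR add_nonneg_nonneg less_imp_le mult_nonneg_nonneg of_nat_0_le_iff)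
  also have "\<dots> \<le> k * (\<Sum>p\<in>P. norm (F y))"
    using k by (simp del: sum_constant) (intro mult_left_mono sum_norm_le max \<tau> y; simp)
  finally have "m * norm (F y) \<le> 0" by (simp add: algebra_simps)
  hence "F y = 0" using m by (simp add: mult_le_0_iff)
  thus ?thesis using max[OF X(2)] by simp
qed

section \<open>Inverting the reflection Laplacian on the symmetric group\<close>

text \<open>The terms of the Neumann series, in the real group algebra, for the inverse of m + k N
  minus k times the sum of all transpositions, where N is the number of pairs. For k >= 0 every
  coefficient is nonnegative, and the ratio k N / (m + k N) is below 1.\<close>

fun neumann :: "nat => real => real => nat => (nat => nat) => real" where
  "neumann n k m 0 \<sigma> = (if \<sigma> = id then 1 / (m + k * card (pairs n)) else 0)"
| "neumann n k m (Suc l) \<sigma> = k / (m + k * card (pairs n)) * (\<Sum>p\<in>pairs n. neumann n k m l (tr p \<circ> \<sigma>))"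

definition green :: "nat => real => real => (nat => nat) => real" where
  "green n k m \<sigma> = (\<Sum>l. neumann n k m l \<sigma>)"

lemma neumann_nonneg: "m > 0 ==> k \<ge> 0 ==> neumann n k m l \<sigma> \<ge> 0"
  by (induction l arbitrary: \<sigma>) (auto intro!: divide_nonneg_nonneg mult_nonneg_nonneg sum_nonneg add_nonneg_nonneg)

text \<open>Left translation by a transposition permutes the group, so each step multiplies the
  total mass by k N / (m + k N).\<close>

lemma neumann_sum:
  assumes "m > 0" "k \<ge> 0"
  shows "(\<Sum>\<sigma>\<in>symg n. neumann n k m l \<sigma>) =
    (k * card (pairs n) / (m + k * card (pairs n))) ^ l / (m + k * card (pairs n))"
proof (induction l)
  case 0
  show ?case by (simp add: sum.delta')
next
  case (Suc l)
  have "(\<Sum>\<sigma>\<in>symg n. neumann n k m (Suc l) \<sigma>) = k / (m + k * card (pairs n)) *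
      (\<Sum>p\<in>pairs n. \<Sum>\<sigma>\<in>symg n. neumann n k m l (tr p \<circ> \<sigma>))"
    by (subst sum.swap) (simp add: sum_distrib_left)
  also have "(\<Sum>p\<in>pairs n. \<Sum>\<sigma>\<in>symg n. neumann n k m l (tr p \<circ> \<sigma>)) =
      (\<Sum>p\<in>pairs n. \<Sum>\<sigma>\<in>symg n. neumann n k m l \<sigma>)"
    by (intro sum.cong refl sum_symg_left tr_symg)
  finally show ?case by (simp add: Suc.IH)
qed

lemma neumann_summable:
  assumes "m > 0" "k \<ge> 0" "\<sigma> \<in> symg n"
  shows "summable (\<lambda>l. neumann n k m l \<sigma>)"
proof (rule summable_comparison_test')
  let ?q = "k * card (pairs n) / (m + k * card (pairs n))"
  have "0 \<le> k * card (pairs n)" using assms by simp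
  hence "?q \<ge> 0" "?q < 1" using assms(1) by (auto simp: divide_less_eq)
  thus "summable (\<lambda>l. ?q ^ l / (m + k * card (pairs n)))"
    by (intro summable_divide summable_geometric) (simp only: real_norm_def abs_of_nonneg)
  fix l
  have "neumann n k m l \<sigma> \<le> (\<Sum>\<sigma>\<in>symg n. neumann n k m l \<sigma>)"
    using assms by (intro member_le_sum neumann_nonneg) auto
  thus "norm (neumann n k m l \<sigma>) \<le> ?q ^ l / (m + k * card (pairs n))"
    using neumann_nonneg[OF assms(1,2)] by (simp add: neumann_sum[OF assms(1,2)])
qed

lemma green_nonneg: "m > 0 ==> k \<ge> 0 ==> \<sigma> \<in> symg n ==> green n k m \<sigma> \<ge> 0"
  unfolding green_def by (intro suminf_nonneg neumann_summable neumann_nonneg)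

lemma green_eq:
  fixes m k :: real
  assumes "m > 0" "k \<ge> 0" "\<sigma> \<in> symg n"
  shows "(m + k * card (pairs n)) * green n k m \<sigma> - k * (\<Sum>p\<in>pairs n. green n k m (tr p \<circ> \<sigma>)) =
     (if \<sigma> = id then 1 else 0)"
proof -
  let ?c = "m + k * card (pairs n)"
  have c: "?c > 0" using assms by (simp add: add_pos_nonneg)
  have sm: "summable (\<lambda>l. neumann n k m l (tr p \<circ> \<sigma>))" if "p \<in> pairs n" for p
    using that assms by (intro neumann_summable symg_comp tr_symg) auto
  have "green n k m \<sigma> = neumann n k m 0 \<sigma> + (\<Sum>l. neumann n k m (Suc l) \<sigma>)"
    unfolding green_def using suminf_split_initial_segment[OF neumann_summable[OF assms], of 1] by simp
  also have "(\<Sum>l. neumann n k m (Suc l) \<sigma>) = k / ?c * (\<Sum>l. \<Sum>p\<in>pairs n. neumann n k m l (tr p \<circ> \<sigma>))"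
    using suminf_mult[OF summable_sum[of "pairs n" "\<lambda>p l. neumann n k m l (tr p \<circ> \<sigma>)"], of "k / ?c"] sm by simp
  also have "(\<Sum>l. \<Sum>p\<in>pairs n. neumann n k m l (tr p \<circ> \<sigma>)) = (\<Sum>p\<in>pairs n. green n k m (tr p \<circ> \<sigma>))"
    unfolding green_def by (rule suminf_sum) (use sm in auto)
  finally have g: "green n k m \<sigma> = neumann n k m 0 \<sigma> + k / ?c * (\<Sum>p\<in>pairs n. green n k m (tr p \<circ> \<sigma>))" .
  have "?c * green n k m \<sigma> = ?c * neumann n k m 0 \<sigma> + k * (\<Sum>p\<in>pairs n. green n k m (tr p \<circ> \<sigma>))"
    using c by (subst g) (simp add: distrib_left del: neumann.simps)
  thus ?thesis using c by auto
qed

text \<open>Summing \<open>green_eq\<close> over the group turns every translate into the same total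
  mass, and all contributions of k cancel. Together with nonnegativity, \<open>green\<close> is 1/m
  times a probability distribution.\<close>

lemma green_sum:
  assumes "m > 0" "k \<ge> 0"
  shows "(\<Sum>\<sigma>\<in>symg n. green n k m \<sigma>) = 1 / m"
proof -
  let ?c = "m + k * card (pairs n)" and ?S = "\<Sum>\<sigma>\<in>symg n. green n k m \<sigma>"
  have "(\<Sum>\<sigma>\<in>symg n. if \<sigma> = id then 1 else 0 :: real) =
      (\<Sum>\<sigma>\<in>symg n. ?c * green n k m \<sigma> - k * (\<Sum>p\<in>pairs n. green n k m (tr p \<circ> \<sigma>)))"
    using green_eq[OF assms] by (intro sum.cong) auto
  also have "\<dots> = ?c * ?S - k * (\<Sum>p\<in>pairs n. \<Sum>\<sigma>\<in>symg n. green n k m (tr p \<circ> \<sigma>))"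
    by (subst sum.swap) (simp add: sum_subtractf sum_distrib_left)
  also have "(\<Sum>p\<in>pairs n. \<Sum>\<sigma>\<in>symg n. green n k m (tr p \<circ> \<sigma>)) = (\<Sum>p\<in>pairs n. ?S)"
    by (intro sum.cong refl sum_symg_left tr_symg)
  finally have "1 = m * ?S" by (simp add: sum.delta' algebra_simps flip: id_def)
  thus ?thesis using assms by (simp add: field_simps)
qed

definition pairing :: "nat => (nat => 'a) => (nat => 'a) => 'a :: comm_semiring_1" where
  "pairing n l x = (\<Sum>i<n. l i * x i)"

text \<open>The component of degree m of the Dunkl kernel. Summing the eigenvalue equations against the coordinates
  gives an equation for it that involves only the component of degree m - 1 and is solved by means of green.\<close>

fun dkp :: "nat => real => nat => (nat => 'a) => (nat => 'a) => 'a :: real_normed_field" where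
  "dkp n k 0 l x = 1"
| "dkp n k (Suc m) l x =
    (\<Sum>\<sigma>\<in>symg n. of_real (green n k (real (Suc m)) \<sigma>) * (pairing n l (x \<circ> \<sigma>) * dkp n k m l (x \<circ> \<sigma>)))"

text \<open>Reflecting x translates the argument of \<open>green\<close>; by \<open>green_eq\<close>
  only the term of the identity permutation survives, so averaging with \<open>green\<close> inverts
  the operator on the left.\<close>

lemma green_op_eq:
  fixes F :: "(nat => 'b) => 'a :: real_normed_field" and n :: nat
  assumes "m > 0" "k \<ge> 0"
  defines "G \<equiv> (\<lambda>x. \<Sum>\<sigma>\<in>symg n. of_real (green n k m \<sigma>) * F (x \<circ> \<sigma>))"
  shows "of_real m * G x + of_real k * (\<Sum>p\<in>pairs n. G x - G (x \<circ> tr p)) = F x"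
proof -
  let ?c = "m + k * card (pairs n)"
  have 1: "G (x \<circ> tr p) = (\<Sum>\<sigma>\<in>symg n. of_real (green n k m (tr p \<circ> \<sigma>)) * F (x \<circ> \<sigma>))" if "p \<in> pairs n" for p
  proof -
    have "G (x \<circ> tr p) = (\<Sum>\<sigma>\<in>symg n. of_real (green n k m \<sigma>) * F (x \<circ> (tr p \<circ> \<sigma>)))"
      by (simp add: G_def comp_assoc)
    also have "\<dots> = (\<Sum>\<sigma>\<in>symg n. of_real (green n k m (tr p \<circ> (tr p \<circ> \<sigma>))) * F (x \<circ> (tr p \<circ> \<sigma>)))"
      by (simp flip: comp_assoc)
    also have "\<dots> = (\<Sum>\<sigma>\<in>symg n. of_real (green n k m (tr p \<circ> \<sigma>)) * F (x \<circ> \<sigma>))"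
      by (rule sum_symg_left[OF tr_symg[OF that], where g = "\<lambda>\<sigma>. of_real (green n k m (tr p \<circ> \<sigma>)) * F (x \<circ> \<sigma>)"])
    finally show ?thesis .
  qed
  have "of_real m * G x + of_real k * (\<Sum>p\<in>pairs n. G x - G (x \<circ> tr p)) =
     of_real ?c * G x - of_real k * (\<Sum>p\<in>pairs n. G (x \<circ> tr p))"
    by (simp add: sum_subtractf algebra_simps)
  also have "(\<Sum>p\<in>pairs n. G (x \<circ> tr p)) =
      (\<Sum>\<sigma>\<in>symg n. of_real (\<Sum>p\<in>pairs n. green n k m (tr p \<circ> \<sigma>)) * F (x \<circ> \<sigma>))"
    by (simp add: 1 sum_distrib_right) (rule sum.swap)
  also have "of_real ?c * G x - of_real k * \<dots> =
     (\<Sum>\<sigma>\<in>symg n. of_real (?c * green n k m \<sigma> - k * (\<Sum>p\<in>pairs n. green n k m (tr p \<circ> \<sigma>))) * F (x \<circ> \<sigma>))"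
  proof -
    have *: "of_real c * (of_real g * f) - of_real k * (of_real s * f) = of_real (c * g - k * s) * (f :: 'a)" for c g s f
      by (simp add: algebra_simps)
    show ?thesis unfolding G_def sum_distrib_left[of "of_real _ :: 'a"] sum_subtractf[symmetric]
      by (intro sum.cong refl *)
  qed
  also have "\<dots> = (\<Sum>\<sigma>\<in>symg n. if \<sigma> = id then F (x \<circ> \<sigma>) else 0)"
    by (intro sum.cong refl, subst green_eq[OF assms(1,2)]) auto
  also have "\<dots> = F x" by (simp add: sum.delta')
  finally show ?thesis .
qed

text \<open>The number \<open>Suc m\<close> stands for the Euler operator, which acts on a
  homogeneous polynomial as multiplication by its degree. Read this way, the left side is the sum of
  x_j T_j applied to the component of degree \<open>Suc m\<close>.\<close>

lemma dkp_eq: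
  fixes l x :: "nat => 'a :: real_normed_field"
  assumes "k \<ge> 0"
  shows "of_nat (Suc m) * dkp n k (Suc m) l x +
     of_real k * (\<Sum>p\<in>pairs n. dkp n k (Suc m) l x - dkp n k (Suc m) l (x \<circ> tr p)) =
     pairing n l x * dkp n k m l x"
  using green_op_eq[of "real (Suc m)" k n "\<lambda>x. pairing n l x * dkp n k m l x" x] assms by simp

text \<open>Only the values on the orbit of x enter. The difference of two solutions solves the
  homogeneous finite system, and the maximum principle makes it vanish. The symmetries of
  \<open>dkp\<close> are all obtained by checking that a transformed expression solves this
  system.\<close>

lemma dkp_unique:
  fixes l :: "nat => 'a :: real_normed_field"
  assumes k: "k \<ge> 0"
    and eq: "\<And>\<sigma>. \<sigma> \<in> symg n ==> of_nat (Suc m) * F (x \<circ> \<sigma>) + of_real k * (\<Sum>p\<in>pairs n. F (x \<circ> \<sigma>) - F (x \<circ> \<sigma> \<circ> tr p)) =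
     pairing n l (x \<circ> \<sigma>) * dkp n k m l (x \<circ> \<sigma>)"
  shows "F x = dkp n k (Suc m) l x"
proof -
  have "F (x \<circ> id) - dkp n k (Suc m) l (x \<circ> id) = 0"
  proof (rule max_principle[where X = "symg n" and x = id and P = "pairs n" and m = "real (Suc m)" and k = k
        and \<tau> = "\<lambda>p \<sigma>. \<sigma> \<circ> tr p" and F = "\<lambda>\<sigma>. F (x \<circ> \<sigma>) - dkp n k (Suc m) l (x \<circ> \<sigma>)"])
    fix \<sigma> assume "\<sigma> \<in> symg n"
    have *: "(\<Sum>p\<in>pairs n. F (x \<circ> \<sigma>) - dkp n k (Suc m) l (x \<circ> \<sigma>) -
           (F (x \<circ> (\<sigma> \<circ> tr p)) - dkp n k (Suc m) l (x \<circ> (\<sigma> \<circ> tr p)))) =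
         (\<Sum>p\<in>pairs n. F (x \<circ> \<sigma>) - F (x \<circ> \<sigma> \<circ> tr p)) -
         (\<Sum>p\<in>pairs n. dkp n k (Suc m) l (x \<circ> \<sigma>) - dkp n k (Suc m) l (x \<circ> \<sigma> \<circ> tr p))"
      unfolding sum_subtractf[symmetric] by (intro sum.cong refl) (simp add: comp_assoc del: dkp.simps)
    from eq[OF \<open>\<sigma> \<in> symg n\<close>] dkp_eq[OF k, of m n l "x \<circ> \<sigma>"]
    show "real (Suc m) *\<^sub>R (F (x \<circ> \<sigma>) - dkp n k (Suc m) l (x \<circ> \<sigma>)) +
         k *\<^sub>R (\<Sum>p\<in>pairs n. F (x \<circ> \<sigma>) - dkp n k (Suc m) l (x \<circ> \<sigma>) -
           (F (x \<circ> (\<sigma> \<circ> tr p)) - dkp n k (Suc m) l (x \<circ> (\<sigma> \<circ> tr p)))) = 0"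
      unfolding * scaleR_conv_of_real of_real_of_nat_eq right_diff_distrib
      by (simp add: algebra_simps del: dkp.simps of_nat_Suc)
  qed (use k in \<open>auto intro: symg_comp tr_symg\<close>)
  thus ?thesis by simp
qed

lemma pairing_permute:
  assumes "\<tau> \<in> symg n"
  shows "pairing n (l \<circ> \<tau>) (x \<circ> \<tau>) = pairing n l x"
  unfolding pairing_def comp_def
  by (rule sum.reindex_bij_betw[OF permutes_imp_bij[OF symgD[OF assms]]])

lemma pairing_commute: "pairing n l x = pairing n x l"
  by (simp add: pairing_def mult.commute)

text \<open>Conjugation by \<tau> permutes the reflections among themselves, so the permuted
  expression satisfies the system of \<open>dkp_unique\<close>.\<close>

lemma dkp_permute:
  fixes l x :: "nat => 'a :: real_normed_field"
  assumes k: "k \<ge> 0" and "\<tau> \<in> symg n"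
  shows "dkp n k m (l \<circ> \<tau>) (x \<circ> \<tau>) = dkp n k m l x"
  using assms(2)
proof (induction m arbitrary: x \<tau>)
  case 0
  show ?case by simp
next
  case (Suc m)
  show ?case
  proof (rule dkp_unique[OF k, where F = "\<lambda>x. dkp n k (Suc m) (l \<circ> \<tau>) (x \<circ> \<tau>)"])
    fix \<sigma> assume "\<sigma> \<in> symg n"
    define y where "y = x \<circ> \<sigma>"
    have "(\<Sum>p\<in>pairs n. dkp n k (Suc m) (l \<circ> \<tau>) (y \<circ> tr p \<circ> \<tau>)) =
       (\<Sum>p\<in>pairs n. dkp n k (Suc m) (l \<circ> \<tau>) (y \<circ> \<tau> \<circ> Transposition.transpose (inv \<tau> (fst p)) (inv \<tau> (snd p))))"
      by (simp add: tr_def transpose_conj[OF Suc.prems] comp_assoc del: dkp.simps)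
    also have "\<dots> = (\<Sum>p\<in>pairs n. dkp n k (Suc m) (l \<circ> \<tau>) (y \<circ> \<tau> \<circ> Transposition.transpose (fst p) (snd p)))"
      by (rule sum_pairs_permute[OF symg_inv[OF Suc.prems]]) (simp add: transpose_commute)
    finally show "of_nat (Suc m) * dkp n k (Suc m) (l \<circ> \<tau>) (x \<circ> \<sigma> \<circ> \<tau>) + of_real k *
        (\<Sum>p\<in>pairs n. dkp n k (Suc m) (l \<circ> \<tau>) (x \<circ> \<sigma> \<circ> \<tau>) - dkp n k (Suc m) (l \<circ> \<tau>) (x \<circ> \<sigma> \<circ> tr p \<circ> \<tau>))
        = pairing n l (x \<circ> \<sigma>) * dkp n k m l (x \<circ> \<sigma>)"
      using dkp_eq[OF k, of m n "l \<circ> \<tau>" "y \<circ> \<tau>"] Suc.IH[OF Suc.prems, of y]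
      by (simp add: sum_subtractf pairing_permute[OF Suc.prems] tr_def flip: y_def del: dkp.simps)
  qed
qed

text \<open>By induction the right side of \<open>dkp_eq\<close> is symmetric in its two arguments,
  and \<open>dkp_permute\<close> moves a reflection from one argument to the other. Hence
  \<open>dkp\<close> with exchanged arguments solves the same system.\<close>

lemma dkp_commute:
  fixes l x :: "nat => 'a :: real_normed_field"
  assumes k: "k \<ge> 0"
  shows "dkp n k m l x = dkp n k m x l"
proof (induction m arbitrary: x)
  case 0
  show ?case by simp
next
  case (Suc m)
  show ?case
  proof (rule dkp_unique[OF k, where F = "\<lambda>x. dkp n k (Suc m) x l", symmetric])
    fix \<sigma> assume "\<sigma> \<in> symg n"
    define y where "y = x \<circ> \<sigma>"
    have "dkp n k (Suc m) (y \<circ> tr p) l = dkp n k (Suc m) y (l \<circ> tr p)" if "p \<in> pairs n" for p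
      using dkp_permute[OF k tr_symg[OF that], of "Suc m" "y \<circ> tr p" l] by (simp add: comp_assoc del: dkp.simps)
    thus "of_nat (Suc m) * dkp n k (Suc m) (x \<circ> \<sigma>) l + of_real k *
        (\<Sum>p\<in>pairs n. dkp n k (Suc m) (x \<circ> \<sigma>) l - dkp n k (Suc m) (x \<circ> \<sigma> \<circ> tr p) l)
        = pairing n l (x \<circ> \<sigma>) * dkp n k m l (x \<circ> \<sigma>)"
      using dkp_eq[OF k, of m n y l] Suc.IH[of y]
      by (simp add: sum_subtractf pairing_commute[of n l] flip: y_def del: dkp.simps)
  qed
qed

lemma dkp_cong:
  fixes l x :: "nat => 'a :: real_normed_field"
  shows "(\<And>i. i < n ==> x i = y i) ==> dkp n k m l x = dkp n k m l y"
proof (induction m arbitrary: x y)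
  case (Suc m)
  have "dkp n k m l (x \<circ> \<sigma>) = dkp n k m l (y \<circ> \<sigma>)" "pairing n l (x \<circ> \<sigma>) = pairing n l (y \<circ> \<sigma>)" if "\<sigma> \<in> symg n" for \<sigma>
    using Suc.prems that by (auto intro!: Suc.IH simp: symg_lt pairing_def)
  thus ?case by simp
qed simp

text \<open>The coordinate bounds y are permuted along with x, so their sum is the same for every
  summand. The total mass 1/(m+1) of \<open>green\<close> then supplies the new factor of the
  factorial.\<close>

lemma norm_dkp_le:
  fixes l x :: "nat => 'a :: real_normed_field"
  assumes k: "k \<ge> 0" and l: "\<And>i. i < n ==> norm (l i) \<le> L"
    and x: "\<And>i. i < n ==> norm (x i) \<le> y i"
  shows "norm (dkp n k m l x) \<le> (L * (\<Sum>i<n. y i)) ^ m / fact m"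
  using x
proof (induction m arbitrary: x y)
  case 0
  show ?case by simp
next
  case (Suc m)
  let ?s = "L * (\<Sum>i<n. y i)"
  have "norm (dkp n k (Suc m) l x) \<le> (\<Sum>\<sigma>\<in>symg n. green n k (Suc m) \<sigma> * (?s * (?s ^ m / fact m)))"
    unfolding dkp.simps
  proof (rule sum_norm_le)
    fix \<sigma> assume \<sigma>: "\<sigma> \<in> symg n"
    have yp: "(\<Sum>i<n. (y \<circ> \<sigma>) i) = (\<Sum>i<n. y i)"
      unfolding comp_def by (rule sum.reindex_bij_betw[OF permutes_imp_bij[OF symgD[OF \<sigma>]]])
    have xs: "norm ((x \<circ> \<sigma>) i) \<le> (y \<circ> \<sigma>) i" if "i < n" for i
      using Suc.prems[of "\<sigma> i"] that \<sigma> by (simp add: symg_lt)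
    have "norm (pairing n l (x \<circ> \<sigma>)) \<le> (\<Sum>i<n. L * (y \<circ> \<sigma>) i)"
      unfolding pairing_def
    proof (rule sum_norm_le)
      fix i assume "i \<in> {..<n}"
      thus "norm (l i * (x \<circ> \<sigma>) i) \<le> L * (y \<circ> \<sigma>) i"
        unfolding norm_mult using l[of i] xs[of i] 
        by (intro mult_mono) (auto intro: order_trans[OF norm_ge_zero])
    qed
    hence 1: "norm (pairing n l (x \<circ> \<sigma>)) \<le> ?s" by (metis yp sum_distrib_left)
    have 2: "norm (dkp n k m l (x \<circ> \<sigma>)) \<le> ?s ^ m / fact m"
      using Suc.IH[of "x \<circ> \<sigma>" "y \<circ> \<sigma>", OF xs] yp by (simp add: comp_def)
    have g: "green n k (real (Suc m)) \<sigma> \<ge> 0" using \<sigma> k by (intro green_nonneg) auto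
    show "norm (of_real (green n k (real (Suc m)) \<sigma>) * (pairing n l (x \<circ> \<sigma>) * dkp n k m l (x \<circ> \<sigma>)))
      \<le> green n k (Suc m) \<sigma> * (?s * (?s ^ m / fact m))"
      unfolding norm_mult norm_of_real abs_of_nonneg[OF g]
      by (intro mult_mono mult_left_mono g 1 2 mult_nonneg_nonneg order_trans[OF norm_ge_zero 1]) auto
  qed
  also have "\<dots> = (\<Sum>\<sigma>\<in>symg n. green n k (Suc m) \<sigma>) * (?s * (?s ^ m / fact m))"
    by (simp only: sum_distrib_right)
  also have "\<dots> = ?s ^ Suc m / fact (Suc m)"
    using k by (subst green_sum) auto
  finally show ?case .
qed

section \<open>Dunkl operators on separately holomorphic functions\<close>

definition sep_holo :: "nat => ((nat => complex) => complex) => bool" where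
  "sep_holo n f \<longleftrightarrow> (\<forall>z. \<forall>i<n. (\<lambda>w. f (z(i := w))) holomorphic_on UNIV)"

lemma sep_holoD: "sep_holo n f ==> i < n ==> (\<lambda>w. f (z(i := w))) holomorphic_on UNIV"
  by (simp add: sep_holo_def)

lemma sep_holo_diff: "sep_holo n f ==> i < n ==> (\<lambda>w. f (z(i := w))) field_differentiable at v"
  using sep_holoD[of n f i z] by (auto simp: holomorphic_on_def)

lemma upd_comp: "\<sigma> \<in> symg n ==> x(j := w) \<circ> \<sigma> = (x \<circ> \<sigma>)(inv \<sigma> j := w)"
  by (auto simp: fun_eq_iff)

lemma sep_holo_const [simp]: "sep_holo n (\<lambda>_. c)" by (simp add: sep_holo_def)

lemma sep_holo_add: "sep_holo n f ==> sep_holo n g ==> sep_holo n (\<lambda>x. f x + g x)"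
  by (auto simp: sep_holo_def intro!: holomorphic_intros)

lemma sep_holo_diff': "sep_holo n f ==> sep_holo n g ==> sep_holo n (\<lambda>x. f x - g x)"
  by (auto simp: sep_holo_def intro!: holomorphic_intros)

lemma sep_holo_mult: "sep_holo n f ==> sep_holo n g ==> sep_holo n (\<lambda>x. f x * g x)"
  by (auto simp: sep_holo_def intro!: holomorphic_intros)

lemma sep_holo_sum: "(\<And>i. i \<in> S ==> sep_holo n (f i)) ==> sep_holo n (\<lambda>x. \<Sum>i\<in>S. f i x)"
  by (auto simp: sep_holo_def intro!: holomorphic_intros)

lemma sep_holo_permute:
  assumes "sep_holo n f" "\<tau> \<in> symg n"
  shows "sep_holo n (\<lambda>x. f (x \<circ> \<tau>))"
  unfolding sep_holo_def upd_comp[OF assms(2)]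
  using assms by (auto intro!: sep_holoD simp: symg_lt symg_inv)

lemma sep_holo_coord: "sep_holo n (\<lambda>x. x i)"
  unfolding sep_holo_def by (auto simp: fun_upd_def intro!: holomorphic_intros split: if_splits)
    (case_tac "i = ia"; simp)

lemma sep_holo_pairing: "sep_holo n (pairing n l)"
  unfolding pairing_def by (intro sep_holo_sum sep_holo_mult sep_holo_const sep_holo_coord)

lemma sep_holo_dkp: "sep_holo n (dkp n k m l)"
proof (induction m)
  case (Suc m)
  have "sep_holo n (\<lambda>x. \<Sum>\<sigma>\<in>symg n. of_real (green n k (real (Suc m)) \<sigma>) * (pairing n l (x \<circ> \<sigma>) * dkp n k m l (x \<circ> \<sigma>)))"
    by (intro sep_holo_sum sep_holo_mult sep_holo_const
        sep_holo_permute[OF sep_holo_pairing] sep_holo_permute[OF Suc.IH]) auto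
  thus ?case by (simp add: sep_holo_def)
qed (simp add: sep_holo_def)

lemma pderiv_n_add: "sep_holo n f ==> sep_holo n g ==> j < n ==>
    pderiv_n (\<lambda>x. f x + g x) j x = pderiv_n f j x + pderiv_n g j x"
  unfolding pderiv_n_def by (intro deriv_add sep_holo_diff)

lemma pderiv_n_cmult: "sep_holo n f ==> j < n ==> pderiv_n (\<lambda>x. c * f x) j x = c * pderiv_n f j x"
  unfolding pderiv_n_def by (intro deriv_cmult sep_holo_diff)

lemma pderiv_n_mult: "sep_holo n f ==> sep_holo n g ==> j < n ==>
    pderiv_n (\<lambda>x. f x * g x) j x = f x * pderiv_n g j x + pderiv_n f j x * g x"
  unfolding pderiv_n_def by (subst deriv_mult) (auto intro: sep_holo_diff)

lemma dunkl_op_eq: "dunkl_op n k \<xi> f x =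
     (\<Sum>j<n. complex_of_real (\<xi> j) * pderiv_n f j x)
     + complex_of_real k * (\<Sum>p\<in>pairs n. complex_of_real (\<xi> (fst p) - \<xi> (snd p))
            * (f x - f (x \<circ> tr p)) / (x (fst p) - x (snd p)))"
  unfolding dunkl_op_def by (subst sum_pairs) (simp add: swap_coords_tr)

lemma dunkl_op_add:
  assumes "sep_holo n f" "sep_holo n g"
  shows "dunkl_op n k \<xi> (\<lambda>x. f x + g x) x = dunkl_op n k \<xi> f x + dunkl_op n k \<xi> g x"
proof -
  have 1: "(\<Sum>j<n. complex_of_real (\<xi> j) * pderiv_n (\<lambda>x. f x + g x) j x) =
      (\<Sum>j<n. complex_of_real (\<xi> j) * pderiv_n f j x) + (\<Sum>j<n. complex_of_real (\<xi> j) * pderiv_n g j x)"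
    unfolding sum.distrib[symmetric]
    by (intro sum.cong refl) (simp add: pderiv_n_add[OF assms] algebra_simps)
  have 2: "c * (f x + g x - (f y + g y)) / d = c * (f x - f y) / d + c * (g x - g y) / d" for c d y
    by (simp add: diff_divide_distrib add_divide_distrib algebra_simps)
  show ?thesis unfolding dunkl_op_eq 1 2 sum.distrib by (simp add: algebra_simps)
qed

lemma dunkl_op_cmult:
  assumes "sep_holo n f"
  shows "dunkl_op n k \<xi> (\<lambda>x. c * f x) x = c * dunkl_op n k \<xi> f x"
proof -
  have 1: "(\<Sum>j<n. complex_of_real (\<xi> j) * pderiv_n (\<lambda>x. c * f x) j x) =
      c * (\<Sum>j<n. complex_of_real (\<xi> j) * pderiv_n f j x)"
    unfolding sum_distrib_left
    by (intro sum.cong refl) (simp add: pderiv_n_cmult[OF assms] algebra_simps)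
  have 2: "a * (c * f x - c * f y) / d = c * (a * (f x - f y) / d)" for a d y
    by (simp add: diff_divide_distrib algebra_simps)
  show ?thesis unfolding dunkl_op_eq 1 2 sum_distrib_left[symmetric] by (simp add: algebra_simps)
qed

lemma dunkl_op_diff:
  assumes "sep_holo n f" "sep_holo n g"
  shows "dunkl_op n k \<xi> (\<lambda>x. f x - g x) x = dunkl_op n k \<xi> f x - dunkl_op n k \<xi> g x"
  using dunkl_op_add[OF assms(1) sep_holo_mult[OF sep_holo_const[of n "-1"] assms(2)]] dunkl_op_cmult[OF assms(2), where c = "-1"]
  by simp

lemma dunkl_op_0 [simp]: "dunkl_op n k \<xi> (\<lambda>_. c) x = 0"
  by (simp add: dunkl_op_eq pderiv_n_def)

lemma dunkl_op_sum:
  assumes "finite S" "\<And>i. i \<in> S ==> sep_holo n (f i)"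
  shows "dunkl_op n k \<xi> (\<lambda>x. \<Sum>i\<in>S. f i x) x = (\<Sum>i\<in>S. dunkl_op n k \<xi> (f i) x)"
  using assms
proof (induction S rule: finite_induct)
  case (insert i S)
  thus ?case by (simp add: dunkl_op_add sep_holo_sum)
qed simp

lemma pderiv_n_permute:
  assumes "\<tau> \<in> symg n"
  shows "pderiv_n (\<lambda>x. f (x \<circ> \<tau>)) j x = pderiv_n f (inv \<tau> j) (x \<circ> \<tau>)"
  using assms by (simp add: pderiv_n_def upd_comp)

lemma dunkl_op_permute:
  assumes \<tau>: "\<tau> \<in> symg n"
  shows "dunkl_op n k \<xi> (\<lambda>x. f (x \<circ> \<tau>)) x = dunkl_op n k (\<xi> \<circ> \<tau>) f (x \<circ> \<tau>)"
proof -
  have 1: "(\<Sum>j<n. complex_of_real (\<xi> j) * pderiv_n (\<lambda>x. f (x \<circ> \<tau>)) j x) =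
     (\<Sum>j<n. complex_of_real ((\<xi> \<circ> \<tau>) j) * pderiv_n f j (x \<circ> \<tau>))"
    using sum.reindex_bij_betw[OF permutes_imp_bij[OF symgD[OF \<tau>]], symmetric,
        of "\<lambda>j. complex_of_real (\<xi> j) * pderiv_n f (inv \<tau> j) (x \<circ> \<tau>)"]
    by (simp add: pderiv_n_permute[OF \<tau>] symg_inv_apply[OF \<tau>])
  \<comment> \<open>The factors xi_i - xi_j and x_i - x_j both change sign when i and j are
    exchanged, so the summand depends only on the unordered pair; \<tau> may reverse the order
    within a pair.\<close>
  define g where "g i j = complex_of_real ((\<xi> \<circ> \<tau>) i - (\<xi> \<circ> \<tau>) j)
            * (f (x \<circ> \<tau>) - f (x \<circ> \<tau> \<circ> Transposition.transpose i j)) / ((x \<circ> \<tau>) i - (x \<circ> \<tau>) j)" for i j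
  have g: "g i j = g j i" for i j
  proof -
    have "a * d / e = (- a) * d / (- e)" for a d e :: complex by simp
    note * = this[of "complex_of_real ((\<xi> \<circ> \<tau>) i - (\<xi> \<circ> \<tau>) j)"]
    show ?thesis unfolding g_def transpose_commute[of j i] * by (simp del: mult_minus_left)
  qed
  have "(\<Sum>p\<in>pairs n. complex_of_real (\<xi> (fst p) - \<xi> (snd p)) * (f (x \<circ> \<tau>) - f (x \<circ> tr p \<circ> \<tau>)) / (x (fst p) - x (snd p)))
     = (\<Sum>p\<in>pairs n. g (inv \<tau> (fst p)) (inv \<tau> (snd p)))"
    using \<tau> by (intro sum.cong refl) (simp add: g_def tr_def comp_assoc transpose_conj[OF \<tau>])
  also have "\<dots> = (\<Sum>p\<in>pairs n. g (fst p) (snd p))"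
    by (rule sum_pairs_permute[OF symg_inv[OF \<tau>] g])
  finally show ?thesis unfolding dunkl_op_eq 1 by (simp add: g_def tr_def)
qed

lemma pderiv_n_pairing: "j < n ==> pderiv_n (pairing n l) j x = l j"
proof -
  assume j: "j < n"
  have "pairing n l (x(j := w)) = l j * w + (\<Sum>i\<in>{..<n}-{j}. l i * x i)" for w
    unfolding pairing_def using j by (subst sum.remove[of _ j]) auto
  hence "(\<lambda>w. pairing n l (x(j := w))) = (\<lambda>w. l j * w + (\<Sum>i\<in>{..<n}-{j}. l i * x i))" by auto
  moreover have "((\<lambda>w. l j * w + (\<Sum>i\<in>{..<n}-{j}. l i * x i)) has_field_derivative l j) (at (x j))"
    by (auto intro!: derivative_eq_intros)
  ultimately show ?thesis unfolding pderiv_n_def by (simp add: DERIV_imp_deriv)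
qed

lemma pairing_tr:
  fixes l x :: "nat => 'a :: comm_ring_1"
  assumes "p \<in> pairs n"
  shows "pairing n l (x \<circ> tr p) = pairing n l x - (l (fst p) - l (snd p)) * (x (fst p) - x (snd p))"
proof -
  obtain i j where p: "p = (i, j)" "i < j" "j < n" using assms by (auto simp: pairs_def)
  have *: "pairing n l y = l i * y i + l j * y j + (\<Sum>q\<in>{..<n}-{i,j}. l q * y q)" for y
  proof -
    have "{..<n} = insert i (insert j ({..<n}-{i,j}))" using p by auto
    thus ?thesis unfolding pairing_def using p 
      by (metis (no_types, lifting) DiffE add.assoc finite_Diff finite_insert finite_lessThan insert_iff less_irrefl sum.insert)
  qed
  have "(\<Sum>q\<in>{..<n}-{i,j}. l q * (x \<circ> tr p) q) = (\<Sum>q\<in>{..<n}-{i,j}. l q * x q)"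
    by (intro sum.cong refl) (auto simp: tr_def p Transposition.transpose_def)
  thus ?thesis using p by (simp add: * tr_def algebra_simps)
qed

text \<open>The commutation relation of the rational Cherednik algebra: the commutator of T_xi with
  multiplication by a linear form is a scalar plus a combination of reflections. The extra terms
  arise because the linear form itself changes under reflection (\<open>pairing_tr\<close>).\<close>

lemma dunkl_op_pairing_mult:
  assumes h: "sep_holo n h" and x: "distinct_coords n x"
  shows "dunkl_op n k \<xi> (\<lambda>x. pairing n l x * h x) x =
    pairing n l x * dunkl_op n k \<xi> h x + pairing n l (cvec \<xi>) * h x
    + complex_of_real k * (\<Sum>p\<in>pairs n. (l (fst p) - l (snd p)) * complex_of_real (\<xi> (fst p) - \<xi> (snd p)) * h (x \<circ> tr p))"
proof -
  have 1: "(\<Sum>j<n. complex_of_real (\<xi> j) * pderiv_n (\<lambda>x. pairing n l x * h x) j x) =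
     pairing n l x * (\<Sum>j<n. complex_of_real (\<xi> j) * pderiv_n h j x) + pairing n l (cvec \<xi>) * h x"
    unfolding sum_distrib_left pairing_def[of n l "cvec \<xi>"] sum_distrib_right sum.distrib[symmetric]
    by (intro sum.cong refl)
       (subst pderiv_n_mult[OF sep_holo_pairing h], simp, subst pderiv_n_pairing, simp,
         simp add: cvec_def algebra_simps)
  have 2: "complex_of_real (\<xi> (fst p) - \<xi> (snd p)) * (pairing n l x * h x - pairing n l (x \<circ> tr p) * h (x \<circ> tr p)) / (x (fst p) - x (snd p))
     = pairing n l x * (complex_of_real (\<xi> (fst p) - \<xi> (snd p)) * (h x - h (x \<circ> tr p)) / (x (fst p) - x (snd p)))
     + (l (fst p) - l (snd p)) * complex_of_real (\<xi> (fst p) - \<xi> (snd p)) * h (x \<circ> tr p)" if "p \<in> pairs n" for p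
  proof -
    have "x (fst p) \<noteq> x (snd p)" using x that by (auto simp: distinct_coords_def pairs_def)
    thus ?thesis unfolding pairing_tr[OF that] by (simp add: field_simps)
  qed
  have "(\<Sum>p\<in>pairs n. complex_of_real (\<xi> (fst p) - \<xi> (snd p)) * (pairing n l x * h x - pairing n l (x \<circ> tr p) * h (x \<circ> tr p)) / (x (fst p) - x (snd p)))
     = pairing n l x * (\<Sum>p\<in>pairs n. complex_of_real (\<xi> (fst p) - \<xi> (snd p)) * (h x - h (x \<circ> tr p)) / (x (fst p) - x (snd p)))
     + (\<Sum>p\<in>pairs n. (l (fst p) - l (snd p)) * complex_of_real (\<xi> (fst p) - \<xi> (snd p)) * h (x \<circ> tr p))"
    unfolding sum_distrib_left sum.distrib[symmetric] by (intro sum.cong refl 2)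
  thus ?thesis unfolding dunkl_op_eq 1 by (simp only: distrib_left) (simp only: ac_simps)
qed

lemma distinct_coords_permute: "\<tau> \<in> symg n ==> distinct_coords n x ==> distinct_coords n (x \<circ> \<tau>)"
  by (auto simp: distinct_coords_def symg_lt symg_inj)

lemma cvec_comp: "cvec (x \<circ> \<tau>) = cvec x \<circ> \<tau>" by (auto simp: cvec_def)

text \<open>T_xi is applied to both sides of \<open>dkp_eq\<close>. On the left it passes through
  each reflection, which turns xi along; on the right the commutation relation and
  \<open>aux\<close> produce the same expression with T_xi d replaced by <l, xi> h. The difference F
  of the two therefore solves the homogeneous system.\<close>

lemma dunkl_op_dkp_step:
  assumes k: "k \<ge> 0" and x: "distinct_coords n x"
    and aux: "\<And>\<xi> x. distinct_coords n x ==> pairing n l x * dunkl_op n k \<xi> (dkp n k m l) x =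
      pairing n l (cvec \<xi>) * (of_nat m * dkp n k m l x +
         of_real k * (\<Sum>p\<in>pairs n. dkp n k m l x - dkp n k m l (x \<circ> tr p)))"
  shows "dunkl_op n k \<xi> (dkp n k (Suc m) l) x = pairing n l (cvec \<xi>) * dkp n k m l x"
proof -
  define d h where "d = dkp n k (Suc m) l" and "h = dkp n k m l"
  define F where "F \<xi> x = dunkl_op n k \<xi> d x - pairing n l (cvec \<xi>) * h x" for \<xi> x
  have sd: "sep_holo n d" and sh: "sep_holo n h"
    unfolding d_def h_def by (rule sep_holo_dkp)+
  have main: "of_nat (Suc m) * F \<xi> x + of_real k * (\<Sum>p\<in>pairs n. F \<xi> x - F (\<xi> \<circ> tr p) (x \<circ> tr p)) = 0"
    if x: "distinct_coords n x" for \<xi> x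
  proof -
    let ?S = "\<lambda>x. of_nat (Suc m) * d x + of_real k * (\<Sum>p\<in>pairs n. d x - d (x \<circ> tr p))"
    have s1: "sep_holo n (\<lambda>x. d (x \<circ> tr p))" if "p \<in> pairs n" for p
      using that sd by (intro sep_holo_permute tr_symg) 
    have s2: "sep_holo n (\<lambda>x. d x - d (x \<circ> tr p))" if "p \<in> pairs n" for p
      using that by (intro sep_holo_diff' sd s1)
    have s3: "sep_holo n (\<lambda>x. \<Sum>p\<in>pairs n. d x - d (x \<circ> tr p))"
      by (intro sep_holo_sum s2)
    have "dunkl_op n k \<xi> ?S x = of_nat (Suc m) * dunkl_op n k \<xi> d x +
       of_real k * (\<Sum>p\<in>pairs n. dunkl_op n k \<xi> d x - dunkl_op n k (\<xi> \<circ> tr p) d (x \<circ> tr p))"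
    proof -
      have "dunkl_op n k \<xi> ?S x = of_nat (Suc m) * dunkl_op n k \<xi> d x +
         of_real k * dunkl_op n k \<xi> (\<lambda>x. \<Sum>p\<in>pairs n. d x - d (x \<circ> tr p)) x"
        by (subst dunkl_op_add) (simp_all only: dunkl_op_cmult[OF sd] dunkl_op_cmult[OF s3] sep_holo_mult sep_holo_const sd s3)
      also have "dunkl_op n k \<xi> (\<lambda>x. \<Sum>p\<in>pairs n. d x - d (x \<circ> tr p)) x =
          (\<Sum>p\<in>pairs n. dunkl_op n k \<xi> (\<lambda>x. d x - d (x \<circ> tr p)) x)"
        by (rule dunkl_op_sum) (auto intro: s2)
      also have "\<dots> = (\<Sum>p\<in>pairs n. dunkl_op n k \<xi> d x - dunkl_op n k (\<xi> \<circ> tr p) d (x \<circ> tr p))"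
        by (intro sum.cong refl) (simp add: dunkl_op_diff[OF sd s1] dunkl_op_permute[OF tr_symg])
      finally show ?thesis .
    qed
    moreover have "?S = (\<lambda>x. pairing n l x * h x)"
      using dkp_eq[OF k, of m n l] by (simp add: d_def h_def del: dkp.simps)
    moreover have "dunkl_op n k \<xi> (\<lambda>x. pairing n l x * h x) x =
       of_nat (Suc m) * (pairing n l (cvec \<xi>) * h x) + of_real k *
          (\<Sum>p\<in>pairs n. pairing n l (cvec \<xi>) * h x - pairing n l (cvec (\<xi> \<circ> tr p)) * h (x \<circ> tr p))"
    proof -
      have "pairing n l (cvec \<xi>) * h x - pairing n l (cvec (\<xi> \<circ> tr p)) * h (x \<circ> tr p) =
         pairing n l (cvec \<xi>) * (h x - h (x \<circ> tr p)) +
         (l (fst p) - l (snd p)) * complex_of_real (\<xi> (fst p) - \<xi> (snd p)) * h (x \<circ> tr p)" if "p \<in> pairs n" for p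
        unfolding cvec_comp pairing_tr[OF that] by (simp add: cvec_def algebra_simps)
      hence "(\<Sum>p\<in>pairs n. pairing n l (cvec \<xi>) * h x - pairing n l (cvec (\<xi> \<circ> tr p)) * h (x \<circ> tr p)) =
         pairing n l (cvec \<xi>) * (\<Sum>p\<in>pairs n. h x - h (x \<circ> tr p)) +
         (\<Sum>p\<in>pairs n. (l (fst p) - l (snd p)) * complex_of_real (\<xi> (fst p) - \<xi> (snd p)) * h (x \<circ> tr p))"
        by (simp add: sum.distrib sum_distrib_left)
      thus ?thesis unfolding dunkl_op_pairing_mult[OF sh x] using aux[OF x, of \<xi>, folded h_def]
        by (simp add: algebra_simps)
    qed
    ultimately have eq: "of_nat (Suc m) * dunkl_op n k \<xi> d x +
       of_real k * (\<Sum>p\<in>pairs n. dunkl_op n k \<xi> d x - dunkl_op n k (\<xi> \<circ> tr p) d (x \<circ> tr p)) =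
       of_nat (Suc m) * (pairing n l (cvec \<xi>) * h x) + of_real k *
          (\<Sum>p\<in>pairs n. pairing n l (cvec \<xi>) * h x - pairing n l (cvec (\<xi> \<circ> tr p)) * h (x \<circ> tr p))"
      by simp
    have "(\<Sum>p\<in>pairs n. F \<xi> x - F (\<xi> \<circ> tr p) (x \<circ> tr p)) =
      (\<Sum>p\<in>pairs n. dunkl_op n k \<xi> d x - dunkl_op n k (\<xi> \<circ> tr p) d (x \<circ> tr p)) -
      (\<Sum>p\<in>pairs n. pairing n l (cvec \<xi>) * h x - pairing n l (cvec (\<xi> \<circ> tr p)) * h (x \<circ> tr p))"
      unfolding sum_subtractf[symmetric] F_def by (intro sum.cong refl) simp
    note sumeq = this
    have gen: "a * t + c * u = a * p + c * v ==> a * (t - p) + c * (u - v) = 0" for a t c u p v :: complex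
      by (simp add: algebra_simps)
    show ?thesis unfolding sumeq unfolding F_def[of \<xi> x] by (rule gen[OF eq])
  qed
  \<comment> \<open>The finite system lives on the joint orbit of the pair (xi, x): direction and
    point are permuted together.\<close>
  have "F (\<xi> \<circ> id) (x \<circ> id) = 0"
  proof (rule max_principle[where X = "symg n" and x = id and P = "pairs n" and m = "real (Suc m)" and k = k
        and \<tau> = "\<lambda>p \<sigma>. \<sigma> \<circ> tr p" and F = "\<lambda>\<sigma>. F (\<xi> \<circ> \<sigma>) (x \<circ> \<sigma>)"])
    fix \<sigma> assume "\<sigma> \<in> symg n"
    from main[OF distinct_coords_permute[OF this x], of "\<xi> \<circ> \<sigma>"]
    show "real (Suc m) *\<^sub>R F (\<xi> \<circ> \<sigma>) (x \<circ> \<sigma>) + k *\<^sub>R (\<Sum>p\<in>pairs n. F (\<xi> \<circ> \<sigma>) (x \<circ> \<sigma>) -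
       F (\<xi> \<circ> (\<sigma> \<circ> tr p)) (x \<circ> (\<sigma> \<circ> tr p))) = 0"
      by (simp add: scaleR_conv_of_real comp_assoc)
  qed (use k in \<open>auto intro: symg_comp tr_symg\<close>)
  thus ?thesis by (simp add: F_def d_def h_def del: dkp.simps)
qed

text \<open>At the next degree, the assumption \<open>aux\<close> of the step lemma is the induction
  hypothesis multiplied by the pairing and rewritten with \<open>dkp_eq\<close>; in degree 0 both
  sides of it are 0.\<close>

lemma dunkl_op_dkp:
  assumes k: "k \<ge> 0" and "distinct_coords n x"
  shows "dunkl_op n k \<xi> (dkp n k (Suc m) l) x = pairing n l (cvec \<xi>) * dkp n k m l x"
  using assms(2)
proof (induction m arbitrary: \<xi> x)
  case 0
  have "dkp n k 0 l = (\<lambda>_. 1)" by auto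
  thus ?case using 0 by (intro dunkl_op_dkp_step[OF k]) (simp_all del: dkp.simps)
next
  case (Suc m)
  show ?case
  proof (rule dunkl_op_dkp_step[OF k Suc.prems])
    fix \<xi> :: "nat => real" and x :: "nat => complex" assume x: "distinct_coords n x"
    show "pairing n l x * dunkl_op n k \<xi> (dkp n k (Suc m) l) x =
      pairing n l (cvec \<xi>) * (of_nat (Suc m) * dkp n k (Suc m) l x +
         of_real k * (\<Sum>p\<in>pairs n. dkp n k (Suc m) l x - dkp n k (Suc m) l (x \<circ> tr p)))"
      unfolding dkp_eq[OF k] Suc.IH[OF x] by simp
  qed
qed

section \<open>Convergence of the kernel series and its eigenvalue equations\<close>

definition dk :: "nat => real => (nat => complex) => (nat => complex) => complex" where
  "dk n k l x = (\<Sum>m. dkp n k m l x)"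

lemma summable_pow_fact: "summable (\<lambda>m. (y::real) ^ m / fact m)"
  using exp_converges[of y] by (auto simp: sums_iff scaleR_conv_of_real field_simps)

lemma norm_le_sum_norm: "(i::nat) < n ==> norm (l i) \<le> (\<Sum>i<n. norm (l i :: complex))"
  by (rule member_le_sum) auto

lemma dkp_sums:
  assumes "k \<ge> 0"
  shows "(\<lambda>m. dkp n k m l x) sums dk n k l x" "summable (\<lambda>m. norm (dkp n k m l x))"
proof -
  let ?y = "(\<Sum>i<n. norm (l i)) * (\<Sum>i<n. norm (x i))"
  have "norm (norm (dkp n k m l x)) \<le> ?y ^ m / fact m" for m
    by (simp, rule norm_dkp_le[OF assms norm_le_sum_norm]) auto
  thus s: "summable (\<lambda>m. norm (dkp n k m l x))"
    by (intro summable_comparison_test'[OF summable_pow_fact[of ?y]])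
  thus "(\<lambda>m. dkp n k m l x) sums dk n k l x"
    unfolding dk_def by (rule summable_sums[OF summable_norm_cancel])
qed

lemma dk_uniform_limit:
  assumes "k \<ge> 0"
  shows "uniform_limit {x. \<forall>i<n. norm (x i) \<le> B} (\<lambda>N x. \<Sum>m<N. dkp n k m l x) (dk n k l) sequentially"
  unfolding dk_def
proof (rule Weierstrass_m_test)
  fix m and x :: "nat => complex" assume "x \<in> {x. \<forall>i<n. norm (x i) \<le> B}"
  thus "norm (dkp n k m l x) \<le> ((\<Sum>i<n. norm (l i)) * (\<Sum>i<n. B)) ^ m / fact m"
    by (intro norm_dkp_le[OF assms norm_le_sum_norm]) auto
qed (rule summable_pow_fact)

lemma continuous_dkp: "continuous_on UNIV (dkp n k m (l :: nat => complex))"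
proof (induction m)
  case (Suc m)
  have c: "continuous_on UNIV (\<lambda>x :: nat => complex. x \<circ> \<sigma>)" for \<sigma> :: "nat => nat"
    unfolding comp_def by (intro continuous_on_coordinatewise_then_product) simp
  have "continuous_on UNIV (\<lambda>x. dkp n k m l (x \<circ> \<sigma>))" for \<sigma> :: "nat => nat"
    by (rule continuous_on_compose2[OF Suc.IH c]) auto
  hence "continuous_on UNIV (\<lambda>x. \<Sum>\<sigma>\<in>symg n. of_real (green n k (real (Suc m)) \<sigma>) * (pairing n l (x \<circ> \<sigma>) * dkp n k m l (x \<circ> \<sigma>)))"
    unfolding pairing_def comp_def by (intro continuous_intros) auto
  thus ?case by simp
qed simp

lemma open_bounded_coords: "open {x :: nat => complex. \<forall>i<n. norm (x i) < B}"
proof -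
  have "{x :: nat => complex. \<forall>i<n. norm (x i) < B} = (\<Inter>i\<in>{..<n}. {x. norm (x i) < B})" by auto
  also have "open \<dots>"
    by (intro open_INT finite_lessThan ballI open_Collect_less continuous_intros) simp
  finally show ?thesis .
qed

text \<open>Points are functions on all naturals with the product topology. The sets that bound only
  the first n coordinates are open there and cover the space, and on each of them convergence is
  uniform.\<close>

lemma continuous_dk:
  assumes "k \<ge> 0"
  shows "continuous_on UNIV (dk n k l)"
proof -
  have "continuous_on (\<Union>B::nat. {x :: nat => complex. \<forall>i<n. norm (x i) < real B}) (dk n k l)"
  proof (rule continuous_on_open_UN)
    fix B :: nat
    have "continuous_on {x. \<forall>i<n. norm (x i) \<le> real B} (dk n k l)"
      by (rule uniform_limit_theorem[OF _ dk_uniform_limit[OF assms]])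
         (intro always_eventually allI continuous_on_sum continuous_on_subset[OF continuous_dkp], auto)
    thus "continuous_on {x :: nat => complex. \<forall>i<n. norm (x i) < real B} (dk n k l)"
      by (rule continuous_on_subset) auto
  qed (rule open_bounded_coords)
  moreover have "x \<in> (\<Union>B::nat. {x :: nat => complex. \<forall>i<n. norm (x i) < real B})" for x
  proof -
    obtain B :: nat where "(\<Sum>i<n. norm (x i)) < real B" using reals_Archimedean2 by blast
    hence "\<forall>i<n. norm (x i) < real B" using norm_le_sum_norm[of _ n x] by fastforce
    thus ?thesis by blast
  qed
  ultimately show ?thesis by (metis (no_types, lifting) UNIV_eq_I)
qed

lemma uniform_limit_dk_coord:
  assumes "k \<ge> 0"
  shows "uniform_limit (cball v r) (\<lambda>N w. \<Sum>m<N. dkp n k m l (x(j := w))) (\<lambda>w. dk n k l (x(j := w))) sequentially"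
proof -
  let ?B = "(\<Sum>i<n. norm (x i)) + norm v + r"
  have "uniform_limit (cball v r) (\<lambda>N w. (\<lambda>y. \<Sum>m<N. dkp n k m l y) (x(j := w))) (\<lambda>w. dk n k l (x(j := w))) sequentially"
  proof (rule uniform_limit_compose'[OF dk_uniform_limit[OF assms, where B = ?B]])
    show "(\<lambda>w. x(j := w)) \<in> cball v r \<rightarrow> {x. \<forall>i<n. norm (x i) \<le> ?B}"
    proof (intro Pi_I CollectI allI impI)
      fix w i assume w: "w \<in> cball v r" and i: "i < n"
      have "norm w \<le> norm v + r" using w norm_triangle_ineq2[of w v] by (simp add: dist_norm norm_minus_commute)
      moreover have "0 \<le> r" using w by (meson dist_not_less_zero mem_cball order_trans not_le zero_le_dist)
      ultimately show "norm ((x(j := w)) i) \<le> ?B"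
        using norm_le_sum_norm[OF i, of x] sum_nonneg[of "{..<n}" "\<lambda>i. norm (x i)"] norm_ge_zero[of v]
        by (simp only: fun_upd_apply) (smt (verit) norm_ge_zero)
    qed
  qed
  thus ?thesis by simp
qed

lemma sep_holo_dk:
  assumes "k \<ge> 0"
  shows "sep_holo n (dk n k l)"
  unfolding sep_holo_def
proof (intro allI impI)
  fix z i assume i: "i < n"
  show "(\<lambda>w. dk n k l (z(i := w))) holomorphic_on UNIV"
    by (rule holomorphic_uniform_sequence[where f = "\<lambda>N w. \<Sum>m<N. dkp n k m l (z(i := w))"])
       (auto intro!: holomorphic_intros sep_holoD[OF sep_holo_dkp] exI[of _ 1] uniform_limit_dk_coord assms i)
qed

lemma pderiv_n_dk:
  assumes "k \<ge> 0" "j < n"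
  shows "(\<lambda>N. pderiv_n (\<lambda>x. \<Sum>m<N. dkp n k m l x) j x) \<longlonglongrightarrow> pderiv_n (dk n k l) j x"
  unfolding pderiv_n_def
  by (rule deriv_complex_uniform_limit[OF uniform_limit_on_subset[OF uniform_limit_dk_coord[OF assms(1), where v = "x j" and r = 1] ball_subset_cball]])
     (auto intro!: always_eventually holomorphic_intros holomorphic_on_subset[OF sep_holoD[OF sep_holo_dkp assms(2)]])

text \<open>T_xi lowers the degree by one, so it maps the partial sum up to N + 1 to <l, xi> times
  the partial sum up to N. Partial derivatives pass to the limit because convergence is locally
  uniform in each coordinate.\<close>

lemma dunkl_op_dk:
  assumes k: "k \<ge> 0" and x: "distinct_coords n x"
  shows "dunkl_op n k \<xi> (dk n k l) x = pairing n l (cvec \<xi>) * dk n k l x"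
proof -
  define S where "S N = (\<lambda>x. \<Sum>m<N. dkp n k m l x)" for N
  have lim: "(\<lambda>N. S N y) \<longlonglongrightarrow> dk n k l y" for y
    using dkp_sums(1)[OF k, of n l y] by (simp add: S_def sums_def)
  have "(\<lambda>N. dunkl_op n k \<xi> (S N) x) \<longlonglongrightarrow> dunkl_op n k \<xi> (dk n k l) x"
    unfolding dunkl_op_eq
  proof (intro tendsto_intros lim)
    fix j assume "j \<in> {..<n}"
    thus "(\<lambda>N. pderiv_n (S N) j x) \<longlonglongrightarrow> pderiv_n (dk n k l) j x"
      unfolding S_def by (intro pderiv_n_dk k) auto
  qed (use x in \<open>auto simp: distinct_coords_def pairs_def\<close>)
  hence 1: "(\<lambda>N. dunkl_op n k \<xi> (S (Suc N)) x) \<longlonglongrightarrow> dunkl_op n k \<xi> (dk n k l) x"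
    by (rule LIMSEQ_Suc)
  have "dunkl_op n k \<xi> (S (Suc N)) x = pairing n l (cvec \<xi>) * S N x" for N
  proof -
    have c: "dkp n k 0 l = (\<lambda>_. 1)" by auto
    have "dunkl_op n k \<xi> (S (Suc N)) x = (\<Sum>m<Suc N. dunkl_op n k \<xi> (dkp n k m l) x)"
      unfolding S_def by (intro dunkl_op_sum sep_holo_dkp) auto
    also have "\<dots> = (\<Sum>m<N. dunkl_op n k \<xi> (dkp n k (Suc m) l) x)"
      by (subst sum.lessThan_Suc_shift) (simp only: c dunkl_op_0 add_0)
    also have "\<dots> = pairing n l (cvec \<xi>) * S N x"
      by (simp only: dunkl_op_dkp[OF k x] S_def sum_distrib_left)
    finally show ?thesis .
  qed
  hence "(\<lambda>N. dunkl_op n k \<xi> (S (Suc N)) x) \<longlonglongrightarrow> pairing n l (cvec \<xi>) * dk n k l x"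
    using lim by (auto intro!: tendsto_intros)
  with 1 show ?thesis by (rule LIMSEQ_unique)
qed

lemma dk_cong: "(\<And>i. i < n ==> x i = y i) ==> dk n k l x = dk n k l y"
  unfolding dk_def by (intro arg_cong[of _ _ suminf] ext dkp_cong)

lemma dk_permute: "k \<ge> 0 ==> \<tau> \<in> symg n ==> dk n k (l \<circ> \<tau>) (x \<circ> \<tau>) = dk n k l x"
  unfolding dk_def by (intro arg_cong[of _ _ suminf] ext dkp_permute)

lemma dk_commute: "k \<ge> 0 ==> dk n k l x = dk n k x l"
  unfolding dk_def by (intro arg_cong[of _ _ suminf] ext dkp_commute)

lemma dkp_0: "dkp n k (Suc m) l (\<lambda>_. 0) = (0 :: complex)"
  by (simp add: pairing_def)

lemma dk_0 [simp]: "dk n k l (\<lambda>_. 0) = 1"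
proof -
  have "(\<lambda>m. dkp n k m l (\<lambda>_. 0)) sums (\<Sum>m\<in>{0}. dkp n k m l (\<lambda>_. 0))"
  proof (rule sums_finite)
    fix m assume "m \<notin> {0::nat}"
    then obtain m' where "m = Suc m'" by (cases m) auto
    thus "dkp n k m l (\<lambda>_. 0) = 0" by (simp only: dkp_0)
  qed auto
  thus ?thesis by (simp add: dk_def sums_iff)
qed

lemma holomorphic_n_dk: "k \<ge> 0 ==> holomorphic_n n (dk n k l)"
  unfolding holomorphic_n_def depends_on_first_def
proof (intro conjI)
  assume k: "k \<ge> 0"
  show "\<forall>z w. (\<forall>i<n. z i = w i) --> dk n k l z = dk n k l w"
    by (intro allI impI dk_cong) blast
  show "continuous_on UNIV (dk n k l)" by (rule continuous_dk[OF k])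
  show "\<forall>z. \<forall>i<n. (\<lambda>w. dk n k l (z(i := w))) holomorphic_on UNIV"
    using sep_holo_dk[OF k] unfolding sep_holo_def .
qed

section \<open>Uniqueness of the kernel\<close>

lemma continuous_on_fun_upd:
  "continuous_on S f ==> continuous_on S g ==> continuous_on S (\<lambda>x. (f x)(j := g x :: complex))"
proof (rule continuous_on_coordinatewise_then_product)
  fix i assume "continuous_on S f" "continuous_on S g"
  thus "continuous_on S (\<lambda>x. ((f x)(j := g x)) i)"
    by (cases "i = j") (auto dest: continuous_on_product_then_coordinatewise)
qed

lemma holomorphic_n_sep: "holomorphic_n n f ==> sep_holo n f"
  by (simp add: holomorphic_n_def sep_holo_def)

text \<open>The base point z is treated as a parameter. By compactness of the unit disc, f
  restricted to the disc in direction j converges uniformly as z tends to z0, and uniform limits of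
  holomorphic functions carry the derivative along.\<close>

lemma continuous_pderiv_n:
  assumes f: "holomorphic_n n f" and j: "j < n"
  shows "continuous_on UNIV (pderiv_n f j)"
  unfolding continuous_on_eq_continuous_at[OF open_UNIV]
proof
  fix z0 :: "nat => complex"
  define \<phi> where "\<phi> z v = f (z(j := z j + v))" for z v
  have shift: "pderiv_n f j z = deriv (\<phi> z) 0" for z
  proof -
    have "((\<lambda>w. f (z(j := w))) has_field_derivative pderiv_n f j z) (at (0 + z j))"
      unfolding pderiv_n_def using sep_holo_diff[OF holomorphic_n_sep[OF f] j, of z "z j"]
      by (simp add: field_differentiable_derivI)
    hence "((\<lambda>v. f (z(j := v + z j))) has_field_derivative pderiv_n f j z) (at 0)"
      by (subst (asm) DERIV_shift)
    thus ?thesis unfolding \<phi>_def by (simp add: DERIV_imp_deriv add.commute)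
  qed
  have cont: "continuous_on (UNIV \<times> cball 0 1) (\<lambda>(z, v). \<phi> z v)"
  proof -
    have "continuous_on UNIV f" using f by (simp add: holomorphic_n_def)
    moreover have "continuous_on (UNIV \<times> cball 0 1) (\<lambda>p :: (nat => complex) \<times> complex. (fst p)(j := fst p j + snd p))"
    proof -
      have "continuous_on (UNIV \<times> cball 0 1) (\<lambda>p :: (nat => complex) \<times> complex. fst p j)"
        by (rule continuous_on_compose2[OF continuous_on_product_coordinates continuous_on_fst[OF continuous_on_id]]) auto
      thus ?thesis by (intro continuous_on_fun_upd continuous_on_add continuous_on_fst[OF continuous_on_id] continuous_on_snd[OF continuous_on_id])
    qed
    ultimately have "continuous_on (UNIV \<times> cball 0 1) (\<lambda>p. f ((fst p)(j := fst p j + snd p)))"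
      by (rule continuous_on_compose2) auto
    thus ?thesis by (simp add: \<phi>_def case_prod_unfold)
  qed
  have "uniform_limit (cball 0 1) \<phi> (\<phi> z0) (nhds z0)"
  proof (rule uniform_limitI)
    fix e :: real assume "e > 0"
    hence e2: "e / 2 > 0" by simp
    obtain X0 where X0: "z0 \<in> X0" "open X0"
      "\<forall>x\<in>X0 \<inter> UNIV. \<forall>t\<in>cball 0 1. dist ((\<lambda>(z, v). \<phi> z v) (x, t)) ((\<lambda>(z, v). \<phi> z v) (z0, t)) \<le> e / 2"
      by (rule continuous_on_prod_compactE[OF cont compact_cball UNIV_I e2])
    have le: "dist (\<phi> x t) (\<phi> z0 t) < e" if "x \<in> X0" "t \<in> cball 0 1" for x t
      using bspec[OF bspec[OF X0(3), of x], of t] that \<open>e > 0\<close> by simp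
    have "eventually (\<lambda>x. x \<in> X0) (nhds z0)" using X0 by (intro eventually_nhds_in_open)
    thus "\<forall>\<^sub>F z in nhds z0. \<forall>x\<in>cball 0 1. dist (\<phi> z x) (\<phi> z0 x) < e"
      by eventually_elim (use le in blast)
  qed
  hence ul: "uniform_limit (ball 0 1) \<phi> (\<phi> z0) (nhds z0)"
    by (rule uniform_limit_on_subset) auto
  have "\<phi> z holomorphic_on ball 0 1" for z
  proof -
    have "(\<lambda>w. f (z(j := w))) \<circ> (\<lambda>v. z j + v) holomorphic_on ball 0 1"
      by (rule holomorphic_on_compose_gen[OF _ sep_holoD[OF holomorphic_n_sep[OF f] j]])
         (auto intro!: holomorphic_intros)
    thus ?thesis by (simp add: \<phi>_def[abs_def] comp_def)
  qed
  hence "((\<lambda>z. deriv (\<phi> z) 0) \<longlongrightarrow> deriv (\<phi> z0) 0) (nhds z0)"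
    by (intro deriv_complex_uniform_limit[OF ul]) auto
  thus "isCont (pderiv_n f j) z0"
    unfolding isCont_def tendsto_at_iff_tendsto_nhds by (simp only: shift[symmetric])
qed

text \<open>A chain rule from partial derivatives: the coordinates are moved one at a time,
  \<open>y m t\<close> having the first m of them at t and the others still at t0. Each increment is
  controlled by the mean value inequality in one variable and by continuity of the partial
  derivative.\<close>

lemma has_derivative_along_ray:
  assumes f: "holomorphic_n n f"
  shows "((\<lambda>t. f (\<lambda>i. t * x i)) has_field_derivative (\<Sum>j<n. x j * pderiv_n f j (\<lambda>i. t0 * x i))) (at t0)"
proof -
  define z0 where "z0 = (\<lambda>i. t0 * x i)"
  define y where "y m t = (\<lambda>i. if i < m then t * x i else t0 * x i)" for m t
  have y0: "y m t0 = z0" for m by (auto simp: y_def z0_def)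
  have claim: "((\<lambda>t. f (y m t)) has_field_derivative (\<Sum>j<m. x j * pderiv_n f j z0)) (at t0)" if "m \<le> n" for m
    using that
  proof (induction m)
    case 0
    have "(\<lambda>t. f (y 0 t)) = (\<lambda>_. f z0)" by (auto simp: y_def z0_def)
    thus ?case by simp
  next
    case (Suc m)
    hence m: "m < n" by simp
    define D where "D = pderiv_n f m z0"
    define h where "h t = f (y (Suc m) t) - f (y m t)" for t
    have h: "h t = f ((y m t)(m := t * x m)) - f ((y m t)(m := t0 * x m))" for t
    proof -
      have "y (Suc m) t = (y m t)(m := t * x m)" "y m t = (y m t)(m := t0 * x m)"
        by (auto simp: y_def fun_eq_iff)
      thus ?thesis unfolding h_def by simp
    qed
    have "(h has_field_derivative x m * D) (at t0)"
      unfolding has_field_derivative_def has_derivative_at_alt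
    proof (intro conjI allI impI bounded_linear_mult_right)
      fix e :: real assume e: "e > 0"
      \<comment> \<open>The increment in coordinate m has length |t - t0| |x_m|, so the tolerance
        for the derivative is scaled by the size of x_m.\<close>
      define e' where "e' = e / (1 + norm (x m))"
      have e': "e' > 0" using e by (simp add: e'_def add_pos_nonneg)
      have cQ: "continuous_on UNIV (\<lambda>p. pderiv_n f m ((y m (fst p))(m := snd p)))"
      proof (rule continuous_on_compose2[OF continuous_pderiv_n[OF f m]])
        show "continuous_on UNIV (\<lambda>p. (y m (fst p))(m := snd p))"
          unfolding y_def
        proof (intro continuous_on_fun_upd continuous_on_coordinatewise_then_product continuous_intros)
          fix i show "continuous_on UNIV (\<lambda>xa::complex \<times> complex. if i < m then fst xa * x i else t0 * x i)"
            by (cases "i < m") (auto intro!: continuous_intros)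
        qed
      qed auto
      have "isCont (\<lambda>p. pderiv_n f m ((y m (fst p))(m := snd p))) (t0, t0 * x m)"
        using cQ by (simp add: continuous_on_eq_continuous_at)
      then obtain d where d: "d > 0" and dd: "\<And>p. dist p (t0, t0 * x m) < d ==>
         dist (pderiv_n f m ((y m (fst p))(m := snd p))) (pderiv_n f m ((y m t0)(m := t0 * x m))) < e'"
        unfolding continuous_at_eps_delta using e' by fastforce
      have D: "pderiv_n f m ((y m t0)(m := t0 * x m)) = D"
      proof -
        have "(y m t0)(m := t0 * x m) = z0" by (auto simp: y_def z0_def)
        thus ?thesis by (simp add: D_def)
      qed
      show "\<exists>d>0. \<forall>t. norm (t - t0) < d --> norm (h t - h t0 - x m * D * (t - t0)) \<le> e * norm (t - t0)"
      \<comment> \<open>A pair (t, w) with w on the segment has distance at most |t - t0| (1 +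
        |x_m|) from (t0, t0 x_m); the radius keeps this below d.\<close>
      proof (intro exI[of _ "d / (2 + norm (x m))"] conjI allI impI)
        show "d / (2 + norm (x m)) > 0" using d by (simp add: add_pos_nonneg)
        fix t assume t: "norm (t - t0) < d / (2 + norm (x m))"
        have t': "norm (t - t0) * (2 + norm (x m)) < d"
          using t by (simp add: less_divide_eq add_pos_nonneg)
        define \<psi> where "\<psi> w = f ((y m t)(m := w)) - D * w" for w
        let ?a = "t0 * x m" and ?b = "t * x m"
        have "norm (\<psi> ?b - \<psi> ?a) \<le> e' * norm (?b - ?a)"
        proof (rule field_differentiable_bound[where S = "closed_segment ?a ?b" and f' = "\<lambda>w. pderiv_n f m ((y m t)(m := w)) - D"])
          fix w assume w: "w \<in> closed_segment ?a ?b"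
          have "((\<lambda>w. f ((y m t)(m := w))) has_field_derivative pderiv_n f m ((y m t)(m := w))) (at w)"
            unfolding pderiv_n_def using sep_holo_diff[OF holomorphic_n_sep[OF f] m, of "y m t" w]
            by (simp add: field_differentiable_derivI)
          thus "(\<psi> has_field_derivative pderiv_n f m ((y m t)(m := w)) - D) (at w within closed_segment ?a ?b)"
            unfolding \<psi>_def by (auto intro!: derivative_eq_intros intro: has_field_derivative_at_within)
          have "norm (w - ?a) \<le> norm (?b - ?a)" using w by (rule segment_bound)
          also have "\<dots> = norm (t - t0) * norm (x m)" by (simp add: norm_mult flip: left_diff_distrib)
          finally have w': "norm (w - ?a) \<le> norm (t - t0) * norm (x m)" .
          have "dist (t, w) (t0, ?a) \<le> dist t t0 + dist w ?a"
            by (simp add: dist_Pair_Pair sqrt_sum_squares_le_sum)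
          also have "\<dots> \<le> norm (t - t0) * (1 + norm (x m))" using w' by (simp add: dist_norm algebra_simps)
          also have "\<dots> \<le> norm (t - t0) * (2 + norm (x m))" by (intro mult_left_mono) auto
          also have "\<dots> < d" by (rule t')
          finally have "dist (pderiv_n f m ((y m t)(m := w))) D < e'" using dd[of "(t, w)"] D by simp
          thus "norm (pderiv_n f m ((y m t)(m := w)) - D) \<le> e'" by (simp add: dist_norm)
        qed auto
        also have "\<dots> = e' * norm (x m) * norm (t - t0)" by (simp add: norm_mult flip: left_diff_distrib)
        also have "\<dots> \<le> e * norm (t - t0)"
          using e by (intro mult_right_mono) (auto simp: e'_def field_simps add_pos_nonneg)
        also have "\<psi> ?b - \<psi> ?a = h t - h t0 - x m * D * (t - t0)"
          by (simp add: \<psi>_def h y0 algebra_simps)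
        finally show "norm (h t - h t0 - x m * D * (t - t0)) \<le> e * norm (t - t0)" .
      qed
    qed
    hence "((\<lambda>t. f (y m t) + h t) has_field_derivative (\<Sum>j<m. x j * pderiv_n f j z0) + x m * D) (at t0)"
      using Suc by (intro derivative_intros) auto
    thus ?case by (simp add: h_def D_def)
  qed
  have "(\<lambda>t. f (y n t)) = (\<lambda>t. f (\<lambda>i. t * x i))"
  proof
    fix t show "f (y n t) = f (\<lambda>i. t * x i)"
      using f unfolding holomorphic_n_def depends_on_first_def by (auto simp: y_def)
  qed
  thus ?thesis using claim[of n] by (simp add: z0_def)
qed

lemma euler_dunkl:
  assumes "distinct_coords n x"
  shows "(\<Sum>j<n. x j * dunkl_op n k (unit_vec j) f x) =
    (\<Sum>j<n. x j * pderiv_n f j x) + of_real k * (\<Sum>p\<in>pairs n. f x - f (x \<circ> tr p))"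
proof -
  have 1: "(\<Sum>i<n. complex_of_real (unit_vec j i) * pderiv_n f i x) = pderiv_n f j x" if "j < n" for j
  proof -
    have "(\<Sum>i<n. complex_of_real (unit_vec j i) * pderiv_n f i x) = (\<Sum>i<n. if i = j then pderiv_n f i x else 0)"
      by (intro sum.cong) (auto simp: unit_vec_def)
    thus ?thesis using that by simp
  qed
  have 2: "(\<Sum>j<n. x j * (complex_of_real (unit_vec j (fst p) - unit_vec j (snd p)) * (f x - f (x \<circ> tr p)) / (x (fst p) - x (snd p)))) = f x - f (x \<circ> tr p)"
    if p: "p \<in> pairs n" for p
  proof -
    obtain a b where ab: "p = (a, b)" "a < b" "b < n" using p by (auto simp: pairs_def)
    have s: "(\<Sum>j<n. x j * complex_of_real (unit_vec j a - unit_vec j b)) = x a - x b"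
    proof -
      have "(\<Sum>j<n. x j * complex_of_real (unit_vec j a - unit_vec j b)) = (\<Sum>j<n. (if j = a then x j else 0) - (if j = b then x j else 0))"
        by (intro sum.cong) (auto simp: unit_vec_def)
      thus ?thesis using ab by (simp add: sum_subtractf)
    qed
    have "(\<Sum>j<n. x j * (complex_of_real (unit_vec j a - unit_vec j b) * (f x - f (x \<circ> tr p)) / (x a - x b))) =
       (\<Sum>j<n. x j * complex_of_real (unit_vec j a - unit_vec j b)) * ((f x - f (x \<circ> tr p)) / (x a - x b))"
      unfolding sum_distrib_right by (intro sum.cong) auto
    also have "\<dots> = f x - f (x \<circ> tr p)"
      unfolding s using assms ab by (auto simp: distinct_coords_def)
    finally show ?thesis by (simp add: ab)
  qed
  have "(\<Sum>j<n. x j * dunkl_op n k (unit_vec j) f x) = (\<Sum>j<n. x j * pderiv_n f j x) +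
    of_real k * (\<Sum>j<n. \<Sum>p\<in>pairs n. x j * (complex_of_real (unit_vec j (fst p) - unit_vec j (snd p)) * (f x - f (x \<circ> tr p)) / (x (fst p) - x (snd p))))"
    unfolding dunkl_op_eq by (simp add: 1 distrib_left sum.distrib sum_distrib_left mult.left_commute del: of_real_diff)
  also have "(\<Sum>j<n. \<Sum>p\<in>pairs n. x j * (complex_of_real (unit_vec j (fst p) - unit_vec j (snd p)) * (f x - f (x \<circ> tr p)) / (x (fst p) - x (snd p)))) = (\<Sum>p\<in>pairs n. f x - f (x \<circ> tr p))"
    by (subst sum.swap) (intro sum.cong refl 2)
  finally show ?thesis .
qed

text \<open>For m = 0 the truncated \<open>m - 1\<close> is multiplied by 0.\<close>

lemma higher_deriv_times_ident:
  assumes "g holomorphic_on UNIV"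
  shows "(deriv ^^ m) (\<lambda>t. t * g t) = (\<lambda>t. t * (deriv ^^ m) g t + of_nat m * (deriv ^^ (m - 1)) g t)"
proof (induction m)
  case (Suc m)
  have D: "((deriv ^^ j) g has_field_derivative (deriv ^^ Suc j) g t) (at t)" for j t
  proof -
    have "(deriv ^^ j) g holomorphic_on UNIV" using assms by (intro holomorphic_higher_deriv) auto
    thus ?thesis by (simp add: holomorphic_derivI[of _ UNIV])
  qed
  show ?case
  proof
    fix t
    have "((\<lambda>t. t * (deriv ^^ m) g t + of_nat m * (deriv ^^ (m - 1)) g t) has_field_derivative
       (t * (deriv ^^ Suc m) g t + of_nat (Suc m) * (deriv ^^ m) g t)) (at t)"
    proof (cases m)
      case 0
      show ?thesis using D[of 0 t] by (auto simp: 0 intro!: derivative_eq_intros)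
    next
      case (Suc m')
      show ?thesis using D[of m t] D[of m' t] unfolding Suc
        by (auto intro!: derivative_eq_intros simp: algebra_simps)
    qed
    thus "(deriv ^^ Suc m) (\<lambda>t. t * g t) t = t * (deriv ^^ Suc m) g t + of_nat (Suc m) * (deriv ^^ (Suc m - 1)) g t"
      by (simp add: Suc.IH DERIV_imp_deriv)
  qed
qed simp

lemma higher_deriv_sum:
  assumes "finite A" "\<And>i. i \<in> A ==> f i holomorphic_on UNIV"
  shows "(deriv ^^ m) (\<lambda>t. \<Sum>i\<in>A. f i t) z = (\<Sum>i\<in>A. (deriv ^^ m) (f i) z)"
  using assms
proof (induction A rule: finite_induct)
  case empty
  show ?case by simp
next
  case (insert i A)
  have "(deriv ^^ m) (\<lambda>t. f i t + (\<Sum>i\<in>A. f i t)) z = (deriv ^^ m) (f i) z + (deriv ^^ m) (\<lambda>t. \<Sum>i\<in>A. f i t) z"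
    by (rule higher_deriv_add[of _ UNIV]) (use insert in \<open>auto intro!: holomorphic_intros\<close>)
  thus ?case using insert by simp
qed

text \<open>Along the rays through the orbit of x, the eigenvalue equations contracted with the
  coordinates become a linear system with a regular singular point: t u' + k (sum of differences) =
  t a u. Comparing derivatives at t = 0, each order is determined by the previous one through the
  system of the maximum principle. So all Taylor coefficients vanish.\<close>

lemma dunkl_eigen_zero:
  assumes k: "k \<ge> 0" and d: "holomorphic_n n d" and d0: "d (\<lambda>_. 0) = 0"
    and eig: "\<And>\<xi> z. distinct_coords n z ==> dunkl_op n k \<xi> d z = pairing n l (cvec \<xi>) * d z"
    and x: "distinct_coords n x"
  shows "d x = 0"
proof -
  define u where "u \<sigma> t = d (\<lambda>i. t * (x \<circ> \<sigma>) i)" for \<sigma> t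
  define a where "a \<sigma> = pairing n l (x \<circ> \<sigma>)" for \<sigma>
  have der: "(u \<sigma> has_field_derivative (\<Sum>j<n. (x \<circ> \<sigma>) j * pderiv_n d j (\<lambda>i. t * (x \<circ> \<sigma>) i))) (at t)" for \<sigma> t
    unfolding u_def[abs_def] by (rule has_derivative_along_ray[OF d])
  have hol: "u \<sigma> holomorphic_on UNIV" for \<sigma>
    using der unfolding holomorphic_on_def field_differentiable_def by fastforce
  have hol': "deriv (u \<sigma>) holomorphic_on UNIV" for \<sigma> using hol by (intro holomorphic_deriv) auto
  have ode: "t * deriv (u \<sigma>) t + of_real k * (\<Sum>p\<in>pairs n. u \<sigma> t - u (\<sigma> \<circ> tr p) t) = t * (a \<sigma> * u \<sigma> t)"
    if \<sigma>: "\<sigma> \<in> symg n" for \<sigma> t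
  proof (cases "t = 0")
    case True
    thus ?thesis by (simp add: u_def)
  next
    case False
    define y where "y = (\<lambda>i. t * (x \<circ> \<sigma>) i)"
    have y: "distinct_coords n y"
      using distinct_coords_permute[OF \<sigma> x] False by (auto simp: distinct_coords_def y_def)
    have "(\<Sum>j<n. y j * dunkl_op n k (unit_vec j) d y) = pairing n l y * d y"
    proof -
      have "pairing n l (cvec (unit_vec j)) = l j" if "j < n" for j
      proof -
        have "pairing n l (cvec (unit_vec j)) = (\<Sum>i<n. if i = j then l i else 0)"
          unfolding pairing_def by (intro sum.cong) (auto simp: cvec_def unit_vec_def)
        thus ?thesis using that by simp
      qed
      hence "(\<Sum>j<n. y j * dunkl_op n k (unit_vec j) d y) = (\<Sum>j<n. l j * y j * d y)"
        by (intro sum.cong refl) (simp add: eig[OF y])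
      thus ?thesis by (simp add: pairing_def sum_distrib_right)
    qed
    hence "(\<Sum>j<n. y j * pderiv_n d j y) + of_real k * (\<Sum>p\<in>pairs n. d y - d (y \<circ> tr p)) = pairing n l y * d y"
      using euler_dunkl[OF y, of k d] by simp
    moreover have "(\<Sum>j<n. y j * pderiv_n d j y) = t * deriv (u \<sigma>) t"
      unfolding DERIV_imp_deriv[OF der] y_def by (simp add: sum_distrib_left mult.assoc)
    moreover have "pairing n l y = t * a \<sigma>"
      by (simp add: a_def y_def pairing_def sum_distrib_left algebra_simps)
    moreover have "d (y \<circ> tr p) = u (\<sigma> \<circ> tr p) t" for p
      by (simp add: u_def y_def comp_def)
    moreover have "d y = u \<sigma> t" by (simp add: y_def u_def)
    ultimately show ?thesis by (simp add: mult.assoc)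
  qed
  have van: "\<forall>\<sigma>\<in>symg n. (deriv ^^ m) (u \<sigma>) 0 = 0" for m
  proof (induction m)
    case 0
    show ?case by (simp add: u_def d0)
  next
    case (Suc m)
    show ?case
    proof
      fix \<tau> assume \<tau>: "\<tau> \<in> symg n"
      show "(deriv ^^ Suc m) (u \<tau>) 0 = 0"
      proof (rule max_principle[where X = "symg n" and P = "pairs n" and m = "real (Suc m)" and k = k
          and \<tau> = "\<lambda>p \<sigma>. \<sigma> \<circ> tr p" and F = "\<lambda>\<sigma>. (deriv ^^ Suc m) (u \<sigma>) 0"])
        fix \<sigma> assume \<sigma>: "\<sigma> \<in> symg n"
        have "(\<lambda>t. t * deriv (u \<sigma>) t + of_real k * (\<Sum>p\<in>pairs n. u \<sigma> t - u (\<sigma> \<circ> tr p) t)) = (\<lambda>t. t * (a \<sigma> * u \<sigma> t))"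
          using ode[OF \<sigma>] by auto
        hence "(deriv ^^ Suc m) (\<lambda>t. t * deriv (u \<sigma>) t + of_real k * (\<Sum>p\<in>pairs n. u \<sigma> t - u (\<sigma> \<circ> tr p) t)) 0 =
          (deriv ^^ Suc m) (\<lambda>t. t * (a \<sigma> * u \<sigma> t)) 0" by simp
        \<comment> \<open>The factor t leaves only the derivative of order m at 0, which vanishes by
          induction.\<close>
        also have "(deriv ^^ Suc m) (\<lambda>t. t * (a \<sigma> * u \<sigma> t)) 0 = 0"
        proof -
          have "(deriv ^^ m) (\<lambda>t. a \<sigma> * u \<sigma> t) 0 = a \<sigma> * (deriv ^^ m) (u \<sigma>) 0"
            using hol by (intro higher_deriv_cmult[of _ UNIV]) auto
          thus ?thesis using Suc.IH \<sigma>
            by (subst higher_deriv_times_ident) (auto intro!: holomorphic_intros hol simp del: funpow.simps)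
        qed
        also have "(deriv ^^ Suc m) (\<lambda>t. t * deriv (u \<sigma>) t + of_real k * (\<Sum>p\<in>pairs n. u \<sigma> t - u (\<sigma> \<circ> tr p) t)) 0 =
          (deriv ^^ Suc m) (\<lambda>t. t * deriv (u \<sigma>) t) 0 + (deriv ^^ Suc m) (\<lambda>t. of_real k * (\<Sum>p\<in>pairs n. u \<sigma> t - u (\<sigma> \<circ> tr p) t)) 0"
          by (rule higher_deriv_add[of _ UNIV]) (auto intro!: holomorphic_intros hol hol')
        also have "(deriv ^^ Suc m) (\<lambda>t. t * deriv (u \<sigma>) t) 0 = of_nat (Suc m) * (deriv ^^ Suc m) (u \<sigma>) 0"
          by (subst higher_deriv_times_ident[OF hol']) (simp add: funpow_Suc_right del: funpow.simps)
        also have "(deriv ^^ Suc m) (\<lambda>t. of_real k * (\<Sum>p\<in>pairs n. u \<sigma> t - u (\<sigma> \<circ> tr p) t)) 0 =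
           of_real k * (deriv ^^ Suc m) (\<lambda>t. \<Sum>p\<in>pairs n. u \<sigma> t - u (\<sigma> \<circ> tr p) t) 0"
          by (rule higher_deriv_cmult[of _ UNIV]) (auto intro!: holomorphic_intros hol)
        also have "(deriv ^^ Suc m) (\<lambda>t. \<Sum>p\<in>pairs n. u \<sigma> t - u (\<sigma> \<circ> tr p) t) 0 =
            (\<Sum>p\<in>pairs n. (deriv ^^ Suc m) (\<lambda>t. u \<sigma> t - u (\<sigma> \<circ> tr p) t) 0)"
          by (rule higher_deriv_sum) (auto intro!: holomorphic_intros hol)
        also have "\<dots> = (\<Sum>p\<in>pairs n. (deriv ^^ Suc m) (u \<sigma>) 0 - (deriv ^^ Suc m) (u (\<sigma> \<circ> tr p)) 0)"
          by (intro sum.cong refl higher_deriv_diff[of _ UNIV] hol) auto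
        finally show "real (Suc m) *\<^sub>R (deriv ^^ Suc m) (u \<sigma>) 0 + k *\<^sub>R (\<Sum>p\<in>pairs n.
            (deriv ^^ Suc m) (u \<sigma>) 0 - (deriv ^^ Suc m) (u (\<sigma> \<circ> tr p)) 0) = 0"
          by (simp only: scaleR_conv_of_real of_real_of_nat_eq)
      qed (use k \<tau> in \<open>auto intro: symg_comp tr_symg\<close>)
    qed
  qed
  have "u id 1 = 0"
    by (rule holomorphic_fun_eq_0_on_connected[OF hol, where z = 0]) (use van in auto)
  thus ?thesis by (simp add: u_def)
qed

text \<open>Points with distinct coordinates are dense: on the line x + t (0, 1, 2, ...) a
  coincidence of coordinates i and j happens for at most one t, and T collects these finitely many
  values.\<close>

lemma continuous_zero_distinct:
  fixes d :: "(nat => complex) => complex"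
  assumes c: "continuous_on UNIV d" and z: "\<And>x. distinct_coords n x ==> d x = 0"
  shows "d x = 0"
proof -
  define y where "y t = (\<lambda>i. x i + of_real t * of_nat i)" for t :: real
  have "continuous_on UNIV y" unfolding y_def
    by (intro continuous_on_coordinatewise_then_product continuous_intros)
  hence "continuous_on UNIV (\<lambda>t. d (y t))" by (intro continuous_on_compose2[OF c]) auto
  hence "isCont (\<lambda>t. d (y t)) 0" by (simp add: continuous_on_eq_continuous_at)
  hence lim: "((\<lambda>t. d (y t)) \<longlongrightarrow> d (y 0)) (at 0)" by (simp add: isCont_def)
  define T where "T = (\<lambda>(i, j). Re ((x j - x i) / (of_nat i - of_nat j))) ` ({..<n} \<times> {..<n})"
  have "distinct_coords n (y t)" if "t \<notin> T" for t
    unfolding distinct_coords_def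
  proof (intro allI impI notI)
    fix i j assume ij: "i < n" "j < n" "i \<noteq> j" "y t i = y t j"
    hence "of_real t * (of_nat i - of_nat j) = x j - x i" by (simp add: y_def algebra_simps)
    hence "of_real t = (x j - x i) / (of_nat i - of_nat j)" using ij by (simp add: field_simps)
    hence "t = Re ((x j - x i) / (of_nat i - of_nat j))" by (metis Re_complex_of_real)
    thus False using that ij by (auto simp: T_def)
  qed
  moreover have "eventually (\<lambda>t. t \<notin> T) (at 0)"
  proof -
    have "finite (T - {0})" by (simp add: T_def)
    hence "open (- (T - {0}))" by (intro open_Compl finite_imp_closed)
    hence "eventually (\<lambda>t. t \<in> - (T - {0})) (nhds 0)" by (intro eventually_nhds_in_open) auto
    thus ?thesis by (auto simp: eventually_at_filter elim: eventually_mono)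
  qed
  ultimately have "eventually (\<lambda>t. d (y t) = 0) (at 0)" using z by (auto elim!: eventually_mono)
  hence "((\<lambda>t. d (y t)) \<longlongrightarrow> 0) (at 0)" by (rule tendsto_eventually)
  from tendsto_unique[OF _ lim this] show ?thesis by (simp add: y_def)
qed

lemma dk_unique:
  assumes k: "k \<ge> 0" and f: "holomorphic_n n f" and f0: "f (\<lambda>_. 0) = 1"
    and eig: "\<And>\<xi> z. distinct_coords n z ==> dunkl_op n k \<xi> f z = pairing n l (cvec \<xi>) * f z"
  shows "f = dk n k l"
proof
  fix x
  let ?d = "\<lambda>x. f x - dk n k l x"
  have d: "holomorphic_n n ?d"
    using f holomorphic_n_dk[OF k, of n l]
    unfolding holomorphic_n_def depends_on_first_def by (auto intro!: continuous_intros holomorphic_intros) metis+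
  have "?d x = 0"
  proof (rule continuous_zero_distinct[where n = n and d = ?d])
    show "continuous_on UNIV ?d" using d by (simp add: holomorphic_n_def)
    fix x :: "nat => complex" assume x: "distinct_coords n x"
    show "?d x = 0"
    proof (rule dunkl_eigen_zero[OF k d _ _ x, where l = l])
      fix \<xi> and z :: "nat => complex" assume "distinct_coords n z"
      thus "dunkl_op n k \<xi> ?d z = pairing n l (cvec \<xi>) * ?d z"
        by (simp add: dunkl_op_diff[OF holomorphic_n_sep[OF f] sep_holo_dk[OF k]] eig dunkl_op_dk[OF k] algebra_simps)
    qed (simp add: f0)
  qed
  thus "f x = dk n k l x" by simp
qed

lemma bil_eq_pairing: "bil = pairing"
  by (auto simp: bil_def pairing_def fun_eq_iff)

lemma dunkl_kernel_eq: "k \<ge> 0 ==> dunkl_kernel n k l = dk n k l"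
  unfolding dunkl_kernel_def bil_eq_pairing
proof (rule the_equality, intro conjI allI impI)
  assume k: "k \<ge> 0"
  show "holomorphic_n n (dk n k l)" by (rule holomorphic_n_dk[OF k])
  show "dunkl_op n k \<xi> (dk n k l) z = pairing n l (cvec \<xi>) * dk n k l z" if "distinct_coords n z" for \<xi> z
    by (rule dunkl_op_dk[OF k that])
  show "f = dk n k l" if "holomorphic_n n f \<and> f (\<lambda>_. 0) = 1 \<and>
     (\<forall>\<xi> z. distinct_coords n z --> dunkl_op n k \<xi> f z = pairing n l (cvec \<xi>) * f z)" for f
    using that by (intro dk_unique[OF k]) auto
qed simp

section \<open>Shift of the spectral parameter and decay\<close>

lemma sum_coords_symg: "\<tau> \<in> symg n ==> (\<Sum>i<n. (x \<circ> \<tau>) i) = (\<Sum>i<n. x i)"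
  unfolding comp_def by (rule sum.reindex_bij_betw[OF permutes_imp_bij[OF symgD]])

text \<open>The exponential is a symmetric function, so the reflection part of T_xi treats it as a
  constant and the derivative part adds s (xi_1 + ... + xi_n). The product thus has the eigenvalues
  of the shifted parameter, and uniqueness identifies it.\<close>

lemma dk_shift:
  assumes k: "k \<ge> 0"
  shows "dk n k (\<lambda>i. s + l i) x = exp (s * (\<Sum>i<n. x i)) * dk n k l x"
proof -
  define e where "e x = exp (s * (\<Sum>i<n. x i))" for x :: "nat => complex"
  define g where "g x = e x * dk n k l x" for x
  have ed: "((\<lambda>w. e (x(j := w))) has_field_derivative s * e (x(j := w))) (at w)" if "j < n" for x j w
  proof -
    have "e (x(j := w)) = exp (s * (w + (\<Sum>i\<in>{..<n}-{j}. x i)))" for w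
      unfolding e_def using that by (subst sum.remove[of _ j]) auto
    thus ?thesis by (auto intro!: derivative_eq_intros)
  qed
  have se: "sep_holo n e"
    unfolding sep_holo_def holomorphic_on_def field_differentiable_def using ed by fastforce
  have sg: "sep_holo n g" unfolding g_def[abs_def] by (intro sep_holo_mult se sep_holo_dk k)
  have "continuous_on UNIV e" unfolding e_def by (intro continuous_intros) simp
  hence hg: "holomorphic_n n g" unfolding holomorphic_n_def
    using sg continuous_dk[OF k] unfolding g_def[abs_def] sep_holo_def depends_on_first_def
    by (auto intro!: continuous_intros dk_cong arg_cong2[of _ _ _ _ "(*)"] simp: e_def)
  have "g = dk n k (\<lambda>i. s + l i)"
  proof (rule dk_unique[OF k hg])
    show "g (\<lambda>_. 0) = 1" by (simp add: g_def e_def)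
    fix \<xi> and z :: "nat => complex" assume z: "distinct_coords n z"
    have "pderiv_n g j z = e z * pderiv_n (dk n k l) j z + s * e z * dk n k l z" if "j < n" for j
    proof -
      have "pderiv_n e j z = s * e z" unfolding pderiv_n_def using ed[OF that, of z "z j"] by (simp add: DERIV_imp_deriv)
      thus ?thesis unfolding g_def[abs_def] using that by (subst pderiv_n_mult[OF se sep_holo_dk[OF k]]) auto
    qed
    note pd = this
    have ep: "e (z \<circ> tr p) = e z" if "p \<in> pairs n" for p
      using sum_coords_symg[OF tr_symg[OF that], of z] by (simp add: e_def)
    have A: "(\<Sum>j<n. complex_of_real (\<xi> j) * pderiv_n g j z) =
        e z * (\<Sum>j<n. complex_of_real (\<xi> j) * pderiv_n (dk n k l) j z) + s * (\<Sum>j<n. cvec \<xi> j) * g z"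
      unfolding sum_distrib_left sum_distrib_right sum.distrib[symmetric]
      by (intro sum.cong refl) (simp add: pd g_def cvec_def algebra_simps)
    have B: "(\<Sum>p\<in>pairs n. complex_of_real (\<xi> (fst p) - \<xi> (snd p)) * (g z - g (z \<circ> tr p)) / (z (fst p) - z (snd p))) =
       e z * (\<Sum>p\<in>pairs n. complex_of_real (\<xi> (fst p) - \<xi> (snd p)) * (dk n k l z - dk n k l (z \<circ> tr p)) / (z (fst p) - z (snd p)))"
      unfolding sum_distrib_left by (intro sum.cong refl) (simp add: g_def ep flip: right_diff_distrib)
    have "dunkl_op n k \<xi> g z = e z * dunkl_op n k \<xi> (dk n k l) z + s * (\<Sum>j<n. cvec \<xi> j) * g z"
      unfolding dunkl_op_eq A B by (simp add: distrib_left)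
    also have "\<dots> = pairing n (\<lambda>i. s + l i) (cvec \<xi>) * g z"
      by (simp add: dunkl_op_dk[OF k z] g_def pairing_def algebra_simps sum.distrib sum_distrib_left)
    finally show "dunkl_op n k \<xi> g z = pairing n (\<lambda>i. s + l i) (cvec \<xi>) * g z" .
  qed
  thus ?thesis by (metis g_def e_def)
qed

lemma norm_dk_le:
  assumes "k \<ge> 0" "\<And>i. i < n ==> norm (l i) \<le> L"
  shows "norm (dk n k l x) \<le> exp (L * (\<Sum>i<n. norm (x i)))"
proof -
  let ?y = "L * (\<Sum>i<n. norm (x i))"
  have "norm (dk n k l x) \<le> (\<Sum>m. norm (dkp n k m l x))"
    unfolding dk_def by (rule summable_norm[OF dkp_sums(2)[OF assms(1)]])
  also have "\<dots> \<le> (\<Sum>m. ?y ^ m / fact m)"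
    by (intro suminf_le dkp_sums assms(1) summable_pow_fact norm_dkp_le assms(2)) auto
  also have "\<dots> = exp ?y"
    using exp_converges[of ?y] by (simp add: sums_iff scaleR_conv_of_real field_simps)
  finally show ?thesis .
qed

text \<open>Shifting by a large M and using that the kernel has nonnegative coefficients.\<close>

lemma norm_dk_decay:
  assumes "k \<ge> 0" "\<And>i. i < n ==> norm (of_real M - z i) \<le> M - \<epsilon>"
  shows "norm (dk n k (\<lambda>i. - z i) x) \<le> exp (- M * (\<Sum>i<n. Re (x i)) + (M - \<epsilon>) * (\<Sum>i<n. norm (x i)))"
proof -
  have "dk n k (\<lambda>i. - z i) x = exp (- of_real M * (\<Sum>i<n. x i)) * dk n k (\<lambda>i. of_real M - z i) x"
    using dk_shift[OF assms(1), of n "- of_real M" "\<lambda>i. of_real M - z i" x] by (simp add: algebra_simps)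
  moreover have "norm (dk n k (\<lambda>i. of_real M - z i) x) \<le> exp ((M - \<epsilon>) * (\<Sum>i<n. norm (x i)))"
    by (rule norm_dk_le[OF assms])
  moreover have "norm (exp (- of_real M * (\<Sum>i<n. x i))) = exp (- M * (\<Sum>i<n. Re (x i)))" by simp
  ultimately show ?thesis unfolding exp_add by (simp only: norm_mult) (intro mult_left_mono, auto)
qed

section \<open>Jack polynomials\<close>

lemma eta_plus_perm:
  assumes "mindex n \<eta>"
  shows "\<exists>\<sigma>\<in>symg n. eta_plus n \<eta> = \<eta> \<circ> \<sigma>"
proof -
  have "mset (rev (sort (map \<eta> [0..<n]))) = mset (map \<eta> [0..<n])" by simp
  then obtain \<sigma> where \<sigma>: "\<sigma> permutes {..<length (map \<eta> [0..<n])}" "permute_list \<sigma> (map \<eta> [0..<n]) = rev (sort (map \<eta> [0..<n]))"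
    by (rule mset_eq_permutation)
  have s: "\<sigma> \<in> symg n" using \<sigma>(1) by (simp add: symg_def)
  have "eta_plus n \<eta> i = (\<eta> \<circ> \<sigma>) i" for i
  proof (cases "i < n")
    case True
    hence "eta_plus n \<eta> i = permute_list \<sigma> (map \<eta> [0..<n]) ! i" by (simp add: eta_plus_def \<sigma>(2))
    also have "\<dots> = map \<eta> [0..<n] ! \<sigma> i" using True \<sigma>(1) by (intro permute_list_nth) auto
    also have "\<dots> = \<eta> (\<sigma> i)" using True symg_lt[OF s, of i] by simp
    finally show ?thesis by simp
  next
    case False
    hence "\<not> \<sigma> i < n" using symg_lt[OF s, of i] by simp
    thus ?thesis using False assms by (simp add: eta_plus_def mindex_def)
  qed
  thus ?thesis using s by blast
qed

lemma eta_plus_antimono: "i \<le> j ==> j < n ==> eta_plus n \<eta> j \<le> eta_plus n \<eta> i"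
  unfolding eta_plus_def by (auto intro!: sorted_rev_nth_mono)

lemma sort_cong_mset: "mset xs = mset ys ==> sort xs = sort ys"
  by (rule properties_for_sort) auto

lemma eta_plus_comp:
  assumes "\<tau> \<in> symg n"
  shows "eta_plus n (\<eta> \<circ> \<tau>) = eta_plus n \<eta>"
proof -
  have "mset (map (\<eta> \<circ> \<tau>) [0..<n]) = image_mset \<eta> (image_mset \<tau> (mset_set {0..<n}))"
    by (simp add: image_mset.compositionality)
  also have "image_mset \<tau> (mset_set {0..<n}) = mset_set (\<tau> ` {0..<n})"
    by (intro image_mset_mset_set permutes_inj_on[OF symgD[OF assms]])
  also have "\<tau> ` {0..<n} = {0..<n}" using permutes_image[OF symgD[OF assms]] by (simp add: lessThan_atLeast0)
  finally have "sort (map (\<eta> \<circ> \<tau>) [0..<n]) = sort (map \<eta> [0..<n])"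
    by (intro sort_cong_mset) (simp add: comp_def)
  thus ?thesis unfolding eta_plus_def by (simp only:)
qed

lemma eta_plus_partition: "is_partition n lam ==> eta_plus n lam = lam"
proof -
  assume p: "is_partition n lam"
  have "sorted (rev (map lam [0..<n]))"
    using p by (auto simp: sorted_rev_iff_nth_mono is_partition_def)
  hence "sort (map lam [0..<n]) = rev (map lam [0..<n])" by (intro properties_for_sort) auto
  thus ?thesis using p by (auto simp: eta_plus_def is_partition_def mindex_def fun_eq_iff)
qed

lemma mindex_comp: "mindex n \<eta> ==> \<tau> \<in> symg n ==> mindex n (\<eta> \<circ> \<tau>)"
  using symg_lt[of \<tau> n] by (auto simp: mindex_def not_less[symmetric])

text \<open>The strict linear order on positions that lists the entries decreasingly, ties from left
  to right. \<open>rk\<close> is the place of a position in this list, counted from 0; it is the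
  inverse of the shortest permutation that sorts the exponent.\<close>

definition before :: "(nat => nat) => nat => nat => bool" where
  "before \<eta> q p \<longleftrightarrow> \<eta> p < \<eta> q \<or> (\<eta> q = \<eta> p \<and> q < p)"

definition rk :: "nat => (nat => nat) => nat => nat" where
  "rk n \<eta> p = card {q. q < n \<and> before \<eta> q p}"

lemma before_total: "p \<noteq> q ==> before \<eta> q p \<longleftrightarrow> \<not> before \<eta> p q"
  by (auto simp: before_def)

lemma rk_less:
  assumes "before \<eta> q p" "q < n"
  shows "rk n \<eta> q < rk n \<eta> p"
  unfolding rk_def by (rule psubset_card_mono) (use assms in \<open>auto simp: before_def\<close>)

lemma eta_bar_rk:
  assumes "j < n"
  shows "eta_bar n k \<eta> j = real (\<eta> j) - k * real (rk n \<eta> j)"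
proof -
  have "{q. q < n \<and> before \<eta> q j} = {i. i < j \<and> \<eta> j \<le> \<eta> i} \<union> {i. j < i \<and> i < n \<and> \<eta> j < \<eta> i}"
    using assms by (auto simp: before_def) (metis less_irrefl linorder_neqE_nat)
  moreover have "card ({i. i < j \<and> \<eta> j \<le> \<eta> i} \<union> {i. j < i \<and> i < n \<and> \<eta> j < \<eta> i}) =
      card {i. i < j \<and> \<eta> j \<le> \<eta> i} + card {i. j < i \<and> i < n \<and> \<eta> j < \<eta> i}"
    by (rule card_Un_disjoint) auto
  ultimately have "rk n \<eta> j = card {i. i < j \<and> \<eta> j \<le> \<eta> i} + card {i. j < i \<and> i < n \<and> \<eta> j < \<eta> i}"
    by (simp only: rk_def)
  thus ?thesis by (simp add: eta_bar_def algebra_simps)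
qed

text \<open>For k > 0 the eigenvalue strictly decreases along \<open>before\<close>, since the entry
  does not grow and the rank does. The tuple of eigenvalues therefore reveals all ranks, and then
  the entries. For k = 0 the eigenvalues are the entries.\<close>

lemma eta_bar_inj:
  assumes k: "k \<ge> 0" and "mindex n \<eta>" "mindex n \<kappa>" and eq: "\<And>j. j < n ==> eta_bar n k \<eta> j = eta_bar n k \<kappa> j"
  shows "\<eta> = \<kappa>"
proof -
  have less: "eta_bar n k \<eta> p < eta_bar n k \<eta> q" if "k > 0" "before \<eta> q p" "q < n" "p < n" for \<eta> p q
  proof -
    have "real (\<eta> p) \<le> real (\<eta> q)" using that by (auto simp: before_def)
    moreover have "k * rk n \<eta> q < k * rk n \<eta> p" using rk_less[OF that(2,3)] that(1) by simp
    ultimately show ?thesis unfolding eta_bar_rk[OF that(3)] eta_bar_rk[OF that(4)] by linarith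
  qed
  have iff: "before \<eta> q p \<longleftrightarrow> eta_bar n k \<eta> p < eta_bar n k \<eta> q" if "k > 0" "q < n" "p < n" for \<eta> p q
    using less[OF that(1), of \<eta> q p] less[OF that(1), of \<eta> p q] before_total[of p q \<eta>] that
    by (cases "p = q") (auto simp: before_def)
  have "k * real (rk n \<eta> p) = k * real (rk n \<kappa> p)" if "p < n" for p
  proof (cases "k = 0")
    case False
    hence "{q. q < n \<and> before \<eta> q p} = {q. q < n \<and> before \<kappa> q p}" using iff[of _ p] eq that k by auto
    thus ?thesis by (simp add: rk_def)
  qed auto
  hence "real (\<eta> p) = real (\<kappa> p)" if "p < n" for p
    using eq[OF that] that by (force simp: eta_bar_rk)
  thus ?thesis using assms(2,3) by (auto simp: mindex_def fun_eq_iff) (metis not_le of_nat_eq_iff)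
qed

lemma transp_nat_eq: "transp_nat i j = Transposition.transpose i j"
  by (auto simp: transp_nat_def Transposition.transpose_def fun_eq_iff)

section \<open>Shortest permutations and the Bruhat order\<close>

text \<open>Inversions of u inject into those of the product: a pair is moved by the transposition
  if its order survives and is kept otherwise. The pair (i, j) itself is a new inversion outside the
  image.\<close>

lemma inv_count_edge:
  assumes u: "u \<in> symg n" and ij: "i < j" "j < n" "u i < u j"
  shows "inv_count n u < inv_count n (u \<circ> transp_nat i j)"
proof -
  let ?t = "transp_nat i j"
  define I where "I u = {(a, b). a < b \<and> b < n \<and> u b < (u a :: nat)}" for u :: "nat => nat"
  define f where "f = (\<lambda>(a, b). if ?t a < ?t b then (?t a, ?t b) else (a, b))"
  have fin: "finite (I v)" for v
    by (rule finite_subset[of _ "{..<n} \<times> {..<n}"]) (auto simp: I_def)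
  have "f ` I u \<subset> I (u \<circ> ?t)"
  proof
    show "f ` I u \<subseteq> I (u \<circ> ?t)"
      using ij by (auto simp: I_def f_def transp_nat_def split: if_splits)
    have "(i, j) \<in> I (u \<circ> ?t)" using ij by (auto simp: I_def transp_nat_def)
    moreover have "(i, j) \<notin> f ` I u"
      using ij by (auto simp: I_def f_def transp_nat_def split: if_splits)
    ultimately show "f ` I u \<noteq> I (u \<circ> ?t)" by blast
  qed
  hence "card (f ` I u) < card (I (u \<circ> ?t))" by (intro psubset_card_mono fin)
  moreover have "inj_on f (I u)"
    by (auto simp: inj_on_def f_def I_def transp_nat_def split: if_splits)
  ultimately show ?thesis by (simp add: card_image inv_count_def I_def)
qed

text \<open>Minimality forces increasing order on each block of equal entries, so a shortest
  permutation enumerates positions in the order \<open>before\<close> and its inverse is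
  \<open>rk\<close>. This also gives the uniqueness behind the definite description.\<close>

lemma min_perm_props:
  assumes m: "mindex n \<eta>"
  shows "min_perm n \<eta> \<in> symg n" "\<And>p. p < n ==> inv (min_perm n \<eta>) p = rk n \<eta> p"
    "\<And>w. w \<in> symg n ==> (\<And>p. p < n ==> inv w p = rk n \<eta> p) ==> w = min_perm n \<eta>"
proof -
  let ?e = "eta_plus n \<eta>"
  define V where "V = {v. v \<in> symg n \<and> perm_act v ?e = \<eta>}"
  obtain \<sigma> where \<sigma>: "\<sigma> \<in> symg n" "?e = \<eta> \<circ> \<sigma>" using eta_plus_perm[OF m] by auto
  have "\<sigma> \<in> V" using \<sigma> by (auto simp: V_def perm_act_def fun_eq_iff)
  have uniq: "w = w'" if "w \<in> symg n" "w' \<in> symg n" "\<And>p. p < n ==> inv w p = inv w' p" for w w'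
  proof -
    have "inv w p = inv w' p" for p
    proof (cases "p < n")
      case False
      thus ?thesis using permutes_not_in[OF symgD[OF symg_inv[OF that(1)]], of p] permutes_not_in[OF symgD[OF symg_inv[OF that(2)]], of p] by auto
    qed (use that in auto)
    hence "inv w = inv w'" by auto
    thus ?thesis by (metis that(1,2) inv_inv_eq permutes_bij symgD)
  qed
  have rk: "inv v p = rk n \<eta> p" if v: "v \<in> V" "\<And>u. u \<in> V ==> inv_count n v \<le> inv_count n u" and p: "p < n" for v p
  proof -
    have vs: "v \<in> symg n" and ve: "\<eta> q = ?e (inv v q)" for q using v(1) by (auto simp: V_def perm_act_def fun_eq_iff)
    have ve': "\<eta> (v r) = ?e r" for r using ve[of "v r"] vs by simp
    \<comment> \<open>Otherwise exchanging the two values still realises the exponent, because the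
      sorted entries agree at r and r', and has fewer inversions.\<close>
    have mono: "v r < v r'" if "r < r'" "r' < n" "?e r = ?e r'" for r r'
    proof (rule ccontr)
      assume "\<not> v r < v r'"
      moreover have "v r \<noteq> v r'" using that by (simp add: symg_inj[OF vs])
      ultimately have lt: "v r' < v r" by simp
      let ?u = "v \<circ> transp_nat r r'"
      have tS: "transp_nat r r' \<in> symg n"
        using tr_symg[of "(r, r')" n] that by (simp add: pairs_def tr_def transp_nat_eq)
      have us: "?u \<in> symg n" by (intro symg_comp vs tS)
      have "\<eta> (?u q) = ?e q" for q using that(3) by (auto simp: ve' transp_nat_def)
      note q = this
      have "perm_act ?u ?e = \<eta>"
      proof
        fix i
        show "perm_act ?u ?e i = \<eta> i" using q[of "inv ?u i"] unfolding perm_act_def symg_inv_apply(2)[OF us] by simp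
      qed
      hence "?u \<in> V" using us by (simp add: V_def)
      moreover have "inv_count n ?u < inv_count n (?u \<circ> transp_nat r r')"
        using that lt by (intro inv_count_edge us) (auto simp: transp_nat_def)
      moreover have "?u \<circ> transp_nat r r' = v" by (auto simp: fun_eq_iff transp_nat_def)
      ultimately show False using v(2)[of ?u] by simp
    qed
    have "before \<eta> (v r) (v r') \<longleftrightarrow> r < r'" if "r < n" "r' < n" for r r'
    proof (cases r r' rule: linorder_cases)
      case less
      hence "?e r' \<le> ?e r" using that by (intro eta_plus_antimono) auto
      thus ?thesis using mono[of r r'] less that by (auto simp: before_def ve')
    next
      case greater
      hence "?e r \<le> ?e r'" using that by (intro eta_plus_antimono) auto
      thus ?thesis using mono[of r' r] greater that by (auto simp: before_def ve')
    qed (simp add: before_def)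
    hence "before \<eta> q p \<longleftrightarrow> inv v q < inv v p" if "q < n" for q
    proof -
      have "inv v q < n" "inv v p < n" using that p vs by (simp_all add: symg_lt[OF symg_inv])
      thus ?thesis using \<open>\<And>r r'. r < n ==> r' < n ==> before \<eta> (v r) (v r') \<longleftrightarrow> r < r'\<close>[of "inv v q" "inv v p"] vs by simp
    qed
    hence "{q. q < n \<and> before \<eta> q p} = v ` {..<inv v p}"
    proof (intro set_eqI iffI)
      fix q assume "q \<in> {q. q < n \<and> before \<eta> q p}"
      hence "inv v q < inv v p" "q = v (inv v q)" using \<open>\<And>q. q < n ==> before \<eta> q p \<longleftrightarrow> _\<close> vs by auto
      thus "q \<in> v ` {..<inv v p}" by blast
    next
      fix q assume "q \<in> v ` {..<inv v p}"
      then obtain r where r: "q = v r" "r < inv v p" by auto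
      have "inv v p < n" using p vs by (simp add: symg_lt[OF symg_inv])
      hence "r < n" using r by simp
      hence "q < n" using r vs by (simp add: symg_lt)
      thus "q \<in> {q. q < n \<and> before \<eta> q p}" using \<open>\<And>q. q < n ==> before \<eta> q p \<longleftrightarrow> _\<close> r vs by auto
    qed
    hence "rk n \<eta> p = card {..<inv v p}"
      unfolding rk_def by (simp add: card_image permutes_inj_on[OF symgD[OF vs]])
    thus ?thesis by simp
  qed
  obtain v where v: "v \<in> V" "\<And>u. u \<in> V ==> inv_count n v \<le> inv_count n u"
    using arg_min_nat_lemma[of "\<lambda>v. v \<in> V" \<sigma> "inv_count n"] \<open>\<sigma> \<in> V\<close> by blast
  have "min_perm n \<eta> = v"
    unfolding min_perm_def
  proof (rule the_equality)
    show "v permutes {..<n} \<and> perm_act v ?e = \<eta> \<and> (\<forall>u. u permutes {..<n} \<and> perm_act u ?e = \<eta> --> inv_count n v \<le> inv_count n u)"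
      using v by (auto simp: V_def symg_def)
    fix w assume w: "w permutes {..<n} \<and> perm_act w ?e = \<eta> \<and> (\<forall>u. u permutes {..<n} \<and> perm_act u ?e = \<eta> --> inv_count n w \<le> inv_count n u)"
    hence w': "w \<in> V" "\<And>u. u \<in> V ==> inv_count n w \<le> inv_count n u" by (auto simp: V_def symg_def)
    show "w = v"
      using rk[OF w'] rk[OF v] w'(1) v(1) by (intro uniq) (auto simp: V_def)
  qed
  thus 1: "min_perm n \<eta> \<in> symg n" and 2: "\<And>p. p < n ==> inv (min_perm n \<eta>) p = rk n \<eta> p"
    using v rk[OF v] by (auto simp: V_def)
  show "\<And>w. w \<in> symg n ==> (\<And>p. p < n ==> inv w p = rk n \<eta> p) ==> w = min_perm n \<eta>"
    using 1 2 by (intro uniq) auto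
qed

lemma bruhat_lt_trans: "bruhat_lt n u v ==> bruhat_lt n v w ==> bruhat_lt n u w"
  unfolding bruhat_lt_def by (rule trancl_trans)

lemma bruhat_lt_inv_count: "bruhat_lt n u v ==> inv_count n u < inv_count n v"
  unfolding bruhat_lt_def by (induction rule: trancl_induct) (auto simp: comp_def)

lemma bruhat_edge:
  assumes "u \<in> symg n" "i < j" "j < n" "u i < u j"
  shows "bruhat_lt n u (u \<circ> transp_nat i j)"
  unfolding bruhat_lt_def
  by (rule r_into_trancl, intro CollectI exI[of _ u] exI[of _ i] exI[of _ j])
     (use assms inv_count_edge[OF assms] in \<open>auto simp: symg_def\<close>)

lemma swap_symg: "i < n ==> j < n ==> Transposition.transpose i j \<in> symg n"
  by (simp add: symg_def permutes_swap_id)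

text \<open>If no entry strictly between the two positions equals either exchanged value, the
  exchange conjugates \<open>before\<close> by the transposition t: ties keep their order. So t
  composed with the shortest permutation is again the shortest one, and passing t to the other side
  makes it a single Bruhat edge.\<close>

lemma bruhat_swap_direct:
  assumes m: "mindex n \<eta>" and ij: "i < j" "j < n" "\<eta> j < \<eta> i"
    and gap: "\<And>p. i < p ==> p < j ==> \<eta> p \<noteq> \<eta> i \<and> \<eta> p \<noteq> \<eta> j"
  shows "bruhat_lt n (min_perm n \<eta>) (min_perm n (swap_coords i j \<eta>))"
proof -
  define t where "t = Transposition.transpose i j"
  define w where "w = min_perm n \<eta>"
  have t: "t \<in> symg n" unfolding t_def using ij by (intro swap_symg) auto
  have tt: "t (t p) = p" for p by (simp add: t_def)
  have w: "w \<in> symg n" "\<And>p. p < n ==> inv w p = rk n \<eta> p"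
    unfolding w_def using min_perm_props(1,2)[OF m] by blast+
  have bef: "before (\<eta> \<circ> t) q p \<longleftrightarrow> before \<eta> (t q) (t p)" for p q
  proof (cases "\<eta> (t q) = \<eta> (t p)")
    case True
    have t_else: "t x = x" if "x \<noteq> i" "x \<noteq> j" for x using that by (simp add: t_def)
    have t_i: "t i = j" and t_j: "t j = i" by (simp_all add: t_def)
    \<comment> \<open>A position whose entry can tie with an exchanged one lies outside the interval
      from i to j, hence on the same side of i as of j.\<close>
    have out: "(i < x \<longleftrightarrow> j < x) \<and> (x < i \<longleftrightarrow> x < j)" if "x \<noteq> i" "x \<noteq> j" "\<eta> x = \<eta> i \<or> \<eta> x = \<eta> j" for x
      using gap[of x] that ij by (metis linorder_neqE_nat order.strict_trans)
    consider "p = q" | "q = i" "p = j" | "q = j" "p = i" | "q = i" "p \<noteq> i" "p \<noteq> j" | "q = j" "p \<noteq> i" "p \<noteq> j"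
      | "p = i" "q \<noteq> i" "q \<noteq> j" | "p = j" "q \<noteq> i" "q \<noteq> j" | "q \<noteq> i" "q \<noteq> j" "p \<noteq> i" "p \<noteq> j" by blast
    hence "q < p \<longleftrightarrow> t q < t p"
    proof cases
      case 4 thus ?thesis using True out[of p] t_else[of p] by (simp add: t_i)
    next
      case 5 thus ?thesis using True out[of p] t_else[of p] by (simp add: t_j)
    next
      case 6 thus ?thesis using True out[of q] t_else[of q] by (simp add: t_i)
    next
      case 7 thus ?thesis using True out[of q] t_else[of q] by (simp add: t_j)
    qed (use True ij t_else in \<open>simp_all add: t_i t_j\<close>)
    thus ?thesis using True by (simp add: before_def)
  qed (auto simp: before_def)
  have "rk n (\<eta> \<circ> t) p = rk n \<eta> (t p)" for p
  proof -
    have "{q. q < n \<and> before \<eta> q (t p)} = t ` {q. q < n \<and> before (\<eta> \<circ> t) q p}"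
      using t by (auto simp: bef symg_lt tt image_iff) (metis tt symg_lt)
    thus ?thesis unfolding rk_def by (simp add: card_image permutes_inj_on[OF symgD[OF t]])
  qed
  moreover have "inv (t \<circ> w) p = inv w (t p)" for p
  proof -
    have "(t \<circ> w) (inv w (t p)) = p" using w(1) by (simp add: tt)
    thus ?thesis by (metis symg_inv_apply(1) symg_comp t w(1))
  qed
  ultimately have "t \<circ> w = min_perm n (\<eta> \<circ> t)"
    using t w by (intro min_perm_props(3) mindex_comp m symg_comp) (auto simp: symg_lt)
  moreover have "t \<circ> w = w \<circ> transp_nat (inv w i) (inv w j)"
    unfolding t_def transp_nat_eq by (rule transpose_conj[OF w(1)])
  moreover have "bruhat_lt n w (w \<circ> transp_nat (inv w i) (inv w j))"
  proof (rule bruhat_edge[OF w(1)])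
    show "inv w i < inv w j" using w(2) ij rk_less[of \<eta> i j n] by (simp add: before_def)
    show "inv w j < n" using ij w(1) by (simp add: symg_lt[OF symg_inv])
    show "w (inv w i) < w (inv w j)" using ij w(1) by simp
  qed
  ultimately show ?thesis by (simp add: w_def swap_coords_eq t_def)
qed

text \<open>A swap across positions carrying the values A, B of the two exchanged entries is decomposed into
  gap-free swaps AB to BA.\<close>

lemma bruhat_swap:
  assumes "mindex n \<eta>" "i < j" "j < n" "\<eta> j < \<eta> i"
  shows "bruhat_lt n (min_perm n \<eta>) (min_perm n (swap_coords i j \<eta>))"
  using assms
proof (induction "j - i" arbitrary: i \<eta> rule: less_induct)
  case less
  show ?case
  proof (cases "\<exists>p. i < p \<and> p < j \<and> (\<eta> p = \<eta> i \<or> \<eta> p = \<eta> j)")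
    case False
    thus ?thesis using less.prems by (intro bruhat_swap_direct) auto
  next
    case True
    \<comment> \<open>The stretch from i to the first repetition p is free of both values, so a
      direct exchange applies there; the stretch from p to j is shorter and falls to the induction.
      If p repeats the value of j, the direct exchange comes first, otherwise last.\<close>
    define p where "p = (LEAST p. i < p \<and> p < j \<and> (\<eta> p = \<eta> i \<or> \<eta> p = \<eta> j))"
    have p: "i < p" "p < j" "\<eta> p = \<eta> i \<or> \<eta> p = \<eta> j"
      using LeastI_ex[OF True] by (auto simp: p_def)
    have gap: "\<eta> q \<noteq> \<eta> i \<and> \<eta> q \<noteq> \<eta> j" if "i < q" "q < p" for q
      using not_less_Least[of q "\<lambda>p. i < p \<and> p < j \<and> (\<eta> p = \<eta> i \<or> \<eta> p = \<eta> j)"] that p by (auto simp: p_def)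
    have m: "mindex n (swap_coords a b \<eta>)" if "a < n" "b < n" for a b
      unfolding swap_coords_eq using less.prems that by (intro mindex_comp swap_symg) auto
    show ?thesis
    proof (cases "\<eta> p = \<eta> j")
      case True
      let ?e = "swap_coords i p \<eta>"
      have "bruhat_lt n (min_perm n \<eta>) (min_perm n ?e)"
        using True p gap less.prems by (intro bruhat_swap_direct) auto
      moreover have "bruhat_lt n (min_perm n ?e) (min_perm n (swap_coords p j ?e))"
        using True p less.prems by (intro less.hyps m) (auto simp: swap_coords_def)
      moreover have "swap_coords p j ?e = swap_coords i j \<eta>"
        using True p by (auto simp: swap_coords_def fun_eq_iff)
      ultimately show ?thesis using bruhat_lt_trans by metis
    next
      case False
      hence pi: "\<eta> p = \<eta> i" using p by simp
      let ?e = "swap_coords p j \<eta>"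
      have "bruhat_lt n (min_perm n \<eta>) (min_perm n ?e)"
        using pi p less.prems by (intro less.hyps) auto
      moreover have "bruhat_lt n (min_perm n ?e) (min_perm n (swap_coords i p ?e))"
        using pi p less.prems gap by (intro bruhat_swap_direct m) (auto simp: swap_coords_def)
      moreover have "swap_coords i p ?e = swap_coords i j \<eta>"
        using pi p by (auto simp: swap_coords_def fun_eq_iff)
      ultimately show ?thesis using bruhat_lt_trans by metis
    qed
  qed
qed

section \<open>The order on exponents\<close>

lemma jack_prec_swap:
  assumes "mindex n \<eta>" "i < j" "j < n" "\<eta> j < \<eta> i"
  shows "jack_prec n (swap_coords i j \<eta>) \<eta>"
  using bruhat_swap[OF assms] eta_plus_comp[OF swap_symg, of i n j \<eta>] assms
  by (simp add: jack_prec_def swap_coords_eq)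

text \<open>The largest element of a set with c + 1 elements is at least c, so its entry is at most
  that of index c; the rest is the induction.\<close>

lemma sum_le_initial:
  fixes lam :: "nat => nat"
  assumes "\<And>i j. i \<le> j ==> j < n ==> lam j \<le> lam i" "T \<subseteq> {..<n}"
  shows "sum lam T \<le> (\<Sum>i<card T. lam i)"
  using assms(2)
proof (induction "card T" arbitrary: T)
  case 0
  hence "T = {}" using finite_subset[of T "{..<n}"] by auto
  thus ?case by simp
next
  case (Suc c)
  have fin: "finite T" using Suc.prems finite_subset by blast
  have ne: "T \<noteq> {}" using Suc.hyps(2) by auto
  define M where "M = Max T"
  have M: "M \<in> T" "\<And>x. x \<in> T ==> x \<le> M" using fin ne by (auto simp: M_def)
  have c: "card (T - {M}) = c" using Suc.hyps(2) M fin by simp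
  have "T \<subseteq> {..M}" using M by auto
  hence "card T \<le> Suc M" using card_mono[of "{..M}" T] by simp
  hence "c \<le> M" using Suc.hyps(2) by simp
  have "sum lam T = lam M + sum lam (T - {M})" using fin M(1) by (rule sum.remove)
  also have "sum lam (T - {M}) \<le> (\<Sum>i<c. lam i)" using Suc.hyps(1)[of "T - {M}"] c Suc.prems by auto
  also have "lam M \<le> lam c" using \<open>c \<le> M\<close> M Suc.prems by (intro assms(1)) auto
  finally show ?case using Suc.hyps(2) by (simp flip: Suc.hyps(2))
qed

lemma sum_le_eta_plus:
  assumes "mindex n \<eta>" "S \<subseteq> {..<n}"
  shows "sum \<eta> S \<le> (\<Sum>i<card S. eta_plus n \<eta> i)"
proof -
  obtain \<sigma> where \<sigma>: "\<sigma> \<in> symg n" "eta_plus n \<eta> = \<eta> \<circ> \<sigma>" using eta_plus_perm[OF assms(1)] by auto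
  have inj: "inj_on (inv \<sigma>) S" using permutes_inj_on[OF symgD[OF symg_inv[OF \<sigma>(1)]]] .
  have "sum (eta_plus n \<eta>) (inv \<sigma> ` S) = sum \<eta> S"
    using \<sigma> by (simp add: sum.reindex[OF inj])
  moreover have "sum (eta_plus n \<eta>) (inv \<sigma> ` S) \<le> (\<Sum>i<card (inv \<sigma> ` S). eta_plus n \<eta> i)"
    using assms(2) \<sigma>(1) by (intro sum_le_initial[where n = n] eta_plus_antimono) (auto simp: symg_lt[OF symg_inv])
  ultimately show ?thesis by (simp add: card_image[OF inj])
qed

lemma sum_eta_plus_gen:
  assumes "mindex n \<eta>"
  shows "(\<Sum>i<n. g (eta_plus n \<eta> i)) = (\<Sum>i<n. g (\<eta> i))"
proof -
  obtain \<sigma> where \<sigma>: "\<sigma> \<in> symg n" "eta_plus n \<eta> = \<eta> \<circ> \<sigma>" using eta_plus_perm[OF assms(1)] by auto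
  show ?thesis unfolding \<sigma>(2) comp_def
    by (rule sum.reindex_bij_betw[OF permutes_imp_bij[OF symgD[OF \<sigma>(1)]]])
qed

text \<open>Moving two entries towards each other lowers the exponent in the dominance order: the
  sum of the new entries over any index set is at most the larger of the old sums over that set and
  over its image under the transposition of i and j.\<close>

lemma jack_prec_interior:
  assumes m: "mindex n \<eta>" and ij: "i < n" "j < n" "i \<noteq> j" and ab: "a + b = \<eta> i + \<eta> j"
    and lt: "min (\<eta> i) (\<eta> j) < a" "a < max (\<eta> i) (\<eta> j)" 
  shows "jack_prec n (\<eta>(i := a, j := b)) \<eta>"
proof -
  let ?k = "\<eta>(i := a, j := b)"
  have mk: "mindex n ?k" using m ij by (auto simp: mindex_def)
  have split: "sum g S = (if i \<in> S then g i else 0) + (if j \<in> S then g j else 0) + sum g (S - {i, j})"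
    if "finite S" for S and g :: "nat => nat"
  proof -
    have "sum g S = sum g (S \<inter> {i, j}) + sum g (S - {i, j})" using that by (simp add: sum.Int_Diff)
    also have "sum g (S \<inter> {i, j}) = (if i \<in> S then g i else 0) + (if j \<in> S then g j else 0)"
      using ij by (auto simp: Int_insert_right)
    finally show ?thesis .
  qed
  have rest: "sum ?k (S - {i, j}) = sum \<eta> (S - {i, j})" for S by (intro sum.cong) auto
  have le: "sum ?k S \<le> (\<Sum>i<card S. eta_plus n \<eta> i)" if S: "S \<subseteq> {..<n}" for S
  proof -
    have fS: "finite S" using S finite_subset by blast
    let ?S' = "Transposition.transpose i j ` S"
    have S': "?S' \<subseteq> {..<n}" using S ij by (auto simp: Transposition.transpose_def)
    have cS': "card ?S' = card S" by (rule card_image) (metis inj_onI transpose_involutory)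
    have fS': "finite ?S'" using fS by simp
    have mem: "i \<in> ?S' \<longleftrightarrow> j \<in> S" "j \<in> ?S' \<longleftrightarrow> i \<in> S" "?S' - {i, j} = S - {i, j}"
      by (auto simp: image_iff Transposition.transpose_def split: if_splits)
    have "sum ?k S \<le> max (sum \<eta> S) (sum \<eta> ?S')"
      unfolding split[OF fS] split[OF fS'] mem rest using ij ab lt by (auto simp: min_def max_def split: if_splits)
    thus ?thesis using sum_le_eta_plus[OF m S] sum_le_eta_plus[OF m S'] cS' by (auto simp: max_def split: if_splits)
  qed
  obtain \<sigma> where \<sigma>: "\<sigma> \<in> symg n" "eta_plus n ?k = ?k \<circ> \<sigma>" using eta_plus_perm[OF mk] by auto
  have "(\<Sum>i<r. eta_plus n ?k i) \<le> (\<Sum>i<r. eta_plus n \<eta> i)" if "r \<le> n" for r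
  proof -
    have inj: "inj_on \<sigma> {..<r}" using permutes_inj_on[OF symgD[OF \<sigma>(1)]] .
    have "(\<Sum>i<r. eta_plus n ?k i) = sum ?k (\<sigma> ` {..<r})" unfolding \<sigma>(2) by (simp add: sum.reindex[OF inj])
    also have "\<dots> \<le> (\<Sum>i<card (\<sigma> ` {..<r}). eta_plus n \<eta> i)"
      using that \<sigma>(1) by (intro le) (auto simp: symg_lt)
    also have "card (\<sigma> ` {..<r}) = r" by (simp add: card_image[OF inj])
    finally show ?thesis .
  qed
  moreover have "(\<Sum>i<n. eta_plus n ?k i) = (\<Sum>i<n. eta_plus n \<eta> i)"
    using sum_eta_plus_gen[OF mk, of "\<lambda>x. x"] sum_eta_plus_gen[OF m, of "\<lambda>x. x"] split[of "{..<n}" ?k] split[of "{..<n}" \<eta>] rest ij ab by simp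
  ultimately have dom: "dom_le n (eta_plus n ?k) (eta_plus n \<eta>)" by (simp add: dom_le_def)
  \<comment> \<open>The sum of squares depends only on the rearrangement and strictly drops, which
    excludes equality in the dominance order.\<close>
  have "(\<Sum>q<n. (eta_plus n ?k q)\<^sup>2) < (\<Sum>q<n. (eta_plus n \<eta> q)\<^sup>2)"
  proof -
    have "(\<Sum>q\<in>{..<n}-{i,j}. (?k q)\<^sup>2) = (\<Sum>q\<in>{..<n}-{i,j}. (\<eta> q)\<^sup>2)" by (intro sum.cong) auto
    moreover have "a\<^sup>2 + b\<^sup>2 < (\<eta> i)\<^sup>2 + (\<eta> j)\<^sup>2"
    proof -
      have "(int (\<eta> i) - int a) * (int a - int (\<eta> j)) > 0"
        using lt by (auto simp: min_def max_def zero_less_mult_iff split: if_splits)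
      moreover have "int b = int (\<eta> i) + int (\<eta> j) - int a" using ab by linarith
      ultimately have "int a ^ 2 + int b ^ 2 < int (\<eta> i) ^ 2 + int (\<eta> j) ^ 2"
        by (simp only: \<open>int b = _\<close>) (simp add: algebra_simps power2_eq_square)
      thus ?thesis by (metis of_nat_add of_nat_less_iff of_nat_power)
    qed
    ultimately show ?thesis
      unfolding sum_eta_plus_gen[OF mk, of "\<lambda>x. x\<^sup>2"] sum_eta_plus_gen[OF m, of "\<lambda>x. x\<^sup>2"]
        split[of "{..<n}" "\<lambda>q. (?k q)\<^sup>2", OF finite_lessThan] split[of "{..<n}" "\<lambda>q. (\<eta> q)\<^sup>2", OF finite_lessThan]
      using ij by simp
  qed
  hence "eta_plus n ?k \<noteq> eta_plus n \<eta>" by (metis less_irrefl)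
  thus ?thesis using dom by (simp add: jack_prec_def)
qed

lemma dom_le_trans: "dom_le n a b ==> dom_le n b c ==> dom_le n a c"
  unfolding dom_le_def by (elim conjE, intro conjI allI impI) (simp, meson order_trans)

lemma dom_le_antisym:
  assumes "dom_le n a b" "dom_le n b a" "mindex n a" "mindex n b"
  shows "a = b"
proof
  fix i
  show "a i = b i"
  proof (cases "i < n")
    case True
    have "(\<Sum>q<r. a q) = (\<Sum>q<r. b q)" if "r \<le> n" for r
      using assms(1,2) that unfolding dom_le_def by (meson antisym)
    from this[of i] this[of "Suc i"] True show ?thesis by simp
  qed (use assms in \<open>simp add: mindex_def\<close>)
qed

lemma mindex_eta_plus: "mindex n (eta_plus n \<eta>)"
  by (simp add: mindex_def eta_plus_def)

lemma jack_prec_trans: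
  assumes "jack_prec n a b" "jack_prec n b c"
  shows "jack_prec n a c"
proof -
  let ?a = "eta_plus n a" and ?b = "eta_plus n b" and ?c = "eta_plus n c"
  have "dom_le n ?a ?c \<and> ?a \<noteq> ?c" if "dom_le n ?a ?b" "?a \<noteq> ?b" "dom_le n ?b ?c"
    using that dom_le_trans[of n ?a ?b ?c] dom_le_antisym[of n ?a ?b] mindex_eta_plus by metis
  moreover have "bruhat_lt n (min_perm n c) (min_perm n a)"
    if "bruhat_lt n (min_perm n b) (min_perm n a)" "bruhat_lt n (min_perm n c) (min_perm n b)"
    using that(2,1) by (rule bruhat_lt_trans)
  ultimately show ?thesis using assms unfolding jack_prec_def by (elim disjE conjE) simp_all
qed

lemma jack_prec_irrefl: "\<not> jack_prec n a a"
  unfolding jack_prec_def using bruhat_lt_inv_count by blast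

definition below :: "nat => (nat => nat) => (nat => nat) set" where
  "below n \<eta> = {\<kappa>. mindex n \<kappa> \<and> jack_prec n \<kappa> \<eta>}"

lemma finite_mindex_sum: "finite {\<kappa>. mindex n \<kappa> \<and> (\<Sum>i<n. \<kappa> i) = N}"
proof (rule finite_subset)
  show "{\<kappa>. mindex n \<kappa> \<and> (\<Sum>i<n. \<kappa> i) = N} \<subseteq> {\<kappa>. \<forall>i. (i \<in> {..<n} --> \<kappa> i \<in> {..N}) \<and> (i \<notin> {..<n} --> \<kappa> i = 0)}"
  proof (intro subsetI CollectI allI conjI impI)
    fix \<kappa> i assume k: "\<kappa> \<in> {\<kappa>. mindex n \<kappa> \<and> (\<Sum>i<n. \<kappa> i) = N}"
    show "\<kappa> i \<in> {..N}" if "i \<in> {..<n}" using member_le_sum[OF that, of \<kappa>] k by simp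
    show "\<kappa> i = 0" if "i \<notin> {..<n}" using k that by (simp add: mindex_def)
  qed
qed (intro finite_set_of_finite_funs; simp)

lemma finite_below:
  assumes "mindex n \<eta>"
  shows "finite (below n \<eta>)"
proof (rule finite_subset)
  show "below n \<eta> \<subseteq> {\<kappa>. mindex n \<kappa> \<and> (\<Sum>i<n. \<kappa> i) = (\<Sum>i<n. \<eta> i)}"
  proof
    fix \<kappa> assume "\<kappa> \<in> below n \<eta>"
    hence m: "mindex n \<kappa>" and "jack_prec n \<kappa> \<eta>" by (auto simp: below_def)
    hence "(\<Sum>i<n. eta_plus n \<kappa> i) = (\<Sum>i<n. eta_plus n \<eta> i)" by (auto simp: jack_prec_def dom_le_def)
    thus "\<kappa> \<in> {\<kappa>. mindex n \<kappa> \<and> (\<Sum>i<n. \<kappa> i) = (\<Sum>i<n. \<eta> i)}"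
      using sum_eta_plus_gen[OF m, of "\<lambda>x. x"] sum_eta_plus_gen[OF assms, of "\<lambda>x. x"] m by simp
  qed
qed (rule finite_mindex_sum)

lemma mono_comp:
  assumes "\<tau> \<in> symg n"
  shows "mono n \<eta> (x \<circ> \<tau>) = mono n (\<eta> \<circ> inv \<tau>) x"
  unfolding mono_def
  using prod.reindex_bij_betw[OF permutes_imp_bij[OF symgD[OF assms]], of "\<lambda>i. x i ^ \<eta> (inv \<tau> i)"] assms
  by (simp add: symg_inv_apply(1)[OF assms])

lemma mono_swap: "i < n ==> j < n ==> mono n \<eta> (swap_coords i j x) = mono n (swap_coords i j \<eta>) x"
  unfolding swap_coords_eq by (subst mono_comp[OF swap_symg]) auto

lemma mono_split1: "j < n ==> mono n \<eta> x = x j ^ \<eta> j * (\<Prod>q\<in>{..<n}-{j}. x q ^ \<eta> q)"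
  unfolding mono_def by (subst prod.remove[of _ j]) auto

lemma mono_split2:
  assumes "i < n" "j < n" "i \<noteq> j"
  shows "mono n \<eta> x = x i ^ \<eta> i * x j ^ \<eta> j * (\<Prod>q\<in>{..<n}-{i,j}. x q ^ \<eta> q)"
proof -
  have "{..<n} - {j} - {i} = {..<n} - {i, j}" by auto
  thus ?thesis unfolding mono_split1[OF assms(2)] using assms
    by (subst prod.remove[of _ i]) auto
qed

lemma mono_upd2:
  assumes "i < n" "j < n" "i \<noteq> j"
  shows "mono n (\<eta>(i := a, j := b)) x = x i ^ a * x j ^ b * (\<Prod>q\<in>{..<n}-{i,j}. x q ^ \<eta> q)"
  unfolding mono_split2[OF assms] using assms by (auto intro!: prod.cong)

lemma sep_holo_mono: "sep_holo n (mono n \<eta>)"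
  unfolding sep_holo_def
proof (intro allI impI)
  fix z i assume i: "i < n"
  have "(\<lambda>w. mono n \<eta> (z(i := w))) = (\<lambda>w. w ^ \<eta> i * (\<Prod>q\<in>{..<n}-{i}. z q ^ \<eta> q))"
    unfolding mono_split1[OF i] by (intro ext arg_cong2[of _ _ _ _ "(*)"] prod.cong) auto
  thus "(\<lambda>w. mono n \<eta> (z(i := w))) holomorphic_on UNIV" by (auto intro!: holomorphic_intros)
qed

lemma pderiv_n_mono:
  assumes j: "j < n"
  shows "x j * pderiv_n (mono n \<eta>) j x = of_nat (\<eta> j) * mono n \<eta> x"
proof -
  let ?R = "\<Prod>q\<in>{..<n}-{j}. x q ^ \<eta> q"
  have "(\<lambda>w. mono n \<eta> (x(j := w))) = (\<lambda>w. w ^ \<eta> j * ?R)"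
    unfolding mono_split1[OF j] by (intro ext arg_cong2[of _ _ _ _ "(*)"] prod.cong) auto
  moreover have "((\<lambda>w. w ^ \<eta> j * ?R) has_field_derivative of_nat (\<eta> j) * x j ^ (\<eta> j - 1) * ?R) (at (x j))"
    by (auto intro!: derivative_eq_intros)
  ultimately have "pderiv_n (mono n \<eta>) j x = of_nat (\<eta> j) * x j ^ (\<eta> j - 1) * ?R"
    by (simp add: pderiv_n_def DERIV_imp_deriv)
  thus ?thesis unfolding mono_split1[OF j] by (cases "\<eta> j") (auto simp: algebra_simps)
qed

lemma digits_inj:
  fixes a b :: "nat => nat"
  assumes "\<And>i. i < n ==> a i < B" "\<And>i. i < n ==> b i < B" "(\<Sum>i<n. a i * B ^ i) = (\<Sum>i<n. b i * B ^ i)" "i < n"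
  shows "a i = b i"
  using assms
proof (induction n arbitrary: a b i)
  case (Suc n)
  have s: "(\<Sum>i<Suc n. c i * B ^ i) = c 0 + B * (\<Sum>i<n. c (Suc i) * B ^ i)" for c
    by (subst sum.lessThan_Suc_shift) (simp add: sum_distrib_left algebra_simps)
  have B: "B > 0" using Suc.prems(1)[of 0] by simp
  have eq: "a 0 + B * (\<Sum>i<n. a (Suc i) * B ^ i) = b 0 + B * (\<Sum>i<n. b (Suc i) * B ^ i)"
    using Suc.prems(3) unfolding s .
  have "(a 0 + B * (\<Sum>i<n. a (Suc i) * B ^ i)) mod B = (b 0 + B * (\<Sum>i<n. b (Suc i) * B ^ i)) mod B"
    using eq by simp
  hence 0: "a 0 = b 0" using Suc.prems(1,2)[of 0] by simp
  hence "(\<Sum>i<n. a (Suc i) * B ^ i) = (\<Sum>i<n. b (Suc i) * B ^ i)" using eq B by simp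
  hence "a (Suc i) = b (Suc i)" if "i < n" for i
    using Suc.prems(1,2) that by (intro Suc.IH[of "\<lambda>i. a (Suc i)" "\<lambda>i. b (Suc i)"]) auto
  thus ?case using 0 Suc.prems(4) by (cases i) auto
qed simp

text \<open>Kronecker substitution: the points with coordinates t^(B^i), t > 1, have distinct coordinates
  and turn distinct monomials into distinct powers of t.\<close>

lemma mono_indep:
  assumes A: "finite A" "\<And>\<alpha>. \<alpha> \<in> A ==> mindex n \<alpha>"
    and z: "\<And>x. distinct_coords n x ==> (\<Sum>\<alpha>\<in>A. c \<alpha> * mono n \<alpha> x) = 0" and \<alpha>: "\<alpha> \<in> A"
  shows "c \<alpha> = 0"
proof -
  \<comment> \<open>B exceeds every occurring exponent, so the exponents are digits in base B; B >=
    2 also makes the powers B^i distinct.\<close>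
  define B where "B = 2 + (\<Sum>\<alpha>\<in>A. \<Sum>i<n. \<alpha> i)"
  define e where "e \<alpha> = (\<Sum>i<n. \<alpha> i * B ^ i)" for \<alpha> :: "nat => nat"
  have bnd: "\<alpha> i < B" if "\<alpha> \<in> A" "i < n" for \<alpha> i
  proof -
    have "\<alpha> i \<le> (\<Sum>i<n. \<alpha> i)" using that by (intro member_le_sum) auto
    also have "\<dots> \<le> (\<Sum>\<alpha>\<in>A. \<Sum>i<n. \<alpha> i)" using that A by (intro member_le_sum) auto
    finally show ?thesis by (simp add: B_def)
  qed
  have einj: "\<alpha> = \<beta>" if "\<alpha> \<in> A" "\<beta> \<in> A" "e \<alpha> = e \<beta>" for \<alpha> \<beta>
  proof
    fix i show "\<alpha> i = \<beta> i"
    proof (cases "i < n")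
      case True
      thus ?thesis using digits_inj[of n \<alpha> B \<beta> i] bnd that by (simp add: e_def)
    next
      case False
      thus ?thesis using A(2)[OF that(1)] A(2)[OF that(2)] by (simp add: mindex_def)
    qed
  qed
  define P where "P = (\<Sum>\<alpha>\<in>A. monom (c \<alpha>) (e \<alpha>))"
  have "poly P (of_real t) = 0" if "t > 1" for t :: real
  proof -
    define x where "x = (\<lambda>i. complex_of_real t ^ (B ^ i))"
    have "distinct_coords n x" unfolding distinct_coords_def
    proof (intro allI impI notI)
      fix i j assume "i < n" "j < n" "i \<noteq> j" "x i = x j"
      hence "complex_of_real (t ^ (B ^ i)) = of_real (t ^ (B ^ j))" by (simp add: x_def)
      hence "t ^ (B ^ i) = t ^ (B ^ j)" using of_real_eq_iff by blast
      hence "B ^ i = B ^ j" using that by (simp add: power_inject_exp)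
      hence "i = j" using power_inject_exp[of B i j] by (simp add: B_def)
      thus False using \<open>i \<noteq> j\<close> by simp
    qed
    moreover have "mono n \<alpha> x = of_real t ^ e \<alpha>" for \<alpha>
      by (simp add: mono_def x_def e_def power_sum flip: power_mult) (simp add: mult.commute)
    ultimately show ?thesis using z[of x] by (simp add: P_def poly_sum poly_monom)
  qed
  hence "of_real ` {1<..} \<subseteq> {w. poly P w = 0}" by auto
  moreover have "infinite (complex_of_real ` {1<..})"
    by (subst finite_image_iff) (auto simp: inj_on_def infinite_Ioi)
  ultimately have "P = 0" using poly_roots_finite[of P] finite_subset by blast
  hence "0 = coeff P (e \<alpha>)" by simp
  also have "\<dots> = (\<Sum>\<beta>\<in>A. if \<beta> = \<alpha> then c \<beta> else 0)"
    unfolding P_def coeff_sum coeff_monom using einj \<alpha> by (intro sum.cong) auto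
  also have "\<dots> = c \<alpha>" using A \<alpha> by simp
  finally show ?thesis by simp
qed

section \<open>Triangularity of the Cherednik operators\<close>

text \<open>The identity is demanded off the diagonals only, where the difference quotients in
  \<open>cher_op\<close> are literal. By \<open>mono_indep\<close> this still determines the
  coefficients.\<close>

definition lower :: "nat => (nat => nat) => ((nat => complex) => complex) => bool" where
  "lower n \<eta> f \<longleftrightarrow> (\<exists>c. \<forall>x. distinct_coords n x --> f x = (\<Sum>\<kappa>\<in>below n \<eta>. c \<kappa> * mono n \<kappa> x))"

lemma lower_add: "lower n \<eta> f ==> lower n \<eta> g ==> lower n \<eta> (\<lambda>x. f x + g x)"
  unfolding lower_def
proof (elim exE)
  fix c d assume "\<forall>x. distinct_coords n x --> f x = (\<Sum>\<kappa>\<in>below n \<eta>. c \<kappa> * mono n \<kappa> x)"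
    "\<forall>x. distinct_coords n x --> g x = (\<Sum>\<kappa>\<in>below n \<eta>. d \<kappa> * mono n \<kappa> x)"
  thus "\<exists>c. \<forall>x. distinct_coords n x --> f x + g x = (\<Sum>\<kappa>\<in>below n \<eta>. c \<kappa> * mono n \<kappa> x)"
    by (intro exI[of _ "\<lambda>\<kappa>. c \<kappa> + d \<kappa>"]) (simp add: sum.distrib distrib_right)
qed

lemma lower_cmult: "lower n \<eta> f ==> lower n \<eta> (\<lambda>x. a * f x)"
  unfolding lower_def
proof (elim exE)
  fix c assume "\<forall>x. distinct_coords n x --> f x = (\<Sum>\<kappa>\<in>below n \<eta>. c \<kappa> * mono n \<kappa> x)"
  thus "\<exists>c. \<forall>x. distinct_coords n x --> a * f x = (\<Sum>\<kappa>\<in>below n \<eta>. c \<kappa> * mono n \<kappa> x)"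
    by (intro exI[of _ "\<lambda>\<kappa>. a * c \<kappa>"]) (simp add: sum_distrib_left mult.assoc)
qed

lemma lower_0: "lower n \<eta> (\<lambda>_. 0)"
  unfolding lower_def by (intro exI[of _ "\<lambda>_. 0"]) simp

lemma lower_sum: "finite I ==> (\<And>i. i \<in> I ==> lower n \<eta> (f i)) ==> lower n \<eta> (\<lambda>x. \<Sum>i\<in>I. f i x)"
  by (induction I rule: finite_induct) (auto intro: lower_0 lower_add)

lemma lower_mono:
  assumes "mindex n \<eta>" "\<kappa> \<in> below n \<eta>"
  shows "lower n \<eta> (mono n \<kappa>)"
  unfolding lower_def
proof (intro exI[of _ "\<lambda>\<alpha>. if \<alpha> = \<kappa> then 1 else 0"] allI impI)
  fix x
  have "(\<Sum>\<alpha>\<in>below n \<eta>. (if \<alpha> = \<kappa> then 1 else 0) * mono n \<alpha> x) = (\<Sum>\<alpha>\<in>below n \<eta>. if \<alpha> = \<kappa> then mono n \<alpha> x else 0)"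
    by (intro sum.cong) auto
  thus "mono n \<kappa> x = (\<Sum>\<alpha>\<in>below n \<eta>. (if \<alpha> = \<kappa> then 1 else 0) * mono n \<alpha> x)"
    using assms finite_below[OF assms(1)] by simp
qed

lemma lower_cong: "lower n \<eta> f ==> (\<And>x. distinct_coords n x ==> g x = f x) ==> lower n \<eta> g"
  unfolding lower_def by metis

lemma dunkl_op_unit:
  assumes j: "j < n"
  shows "dunkl_op n k (unit_vec j) f x = pderiv_n f j x +
    of_real k * (\<Sum>i\<in>{..<n}-{j}. (f x - f (swap_coords i j x)) / (x j - x i))"
proof -
  let ?g = "\<lambda>p. complex_of_real (unit_vec j (fst p) - unit_vec j (snd p)) * (f x - f (x \<circ> tr p)) / (x (fst p) - x (snd p))"
  let ?h = "\<lambda>i. (min i j, max i j)"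
  have 1: "(\<Sum>i<n. complex_of_real (unit_vec j i) * pderiv_n f i x) = pderiv_n f j x"
  proof -
    have "(\<Sum>i<n. complex_of_real (unit_vec j i) * pderiv_n f i x) = (\<Sum>i<n. if i = j then pderiv_n f i x else 0)"
      by (intro sum.cong) (auto simp: unit_vec_def)
    thus ?thesis using j by simp
  qed
  have "(\<Sum>p\<in>pairs n. ?g p) = (\<Sum>p\<in>?h ` ({..<n}-{j}). ?g p)"
  proof (rule sum.mono_neutral_right)
    show "?h ` ({..<n} - {j}) \<subseteq> pairs n" using j by (auto simp: pairs_def)
    show "\<forall>p\<in>pairs n - ?h ` ({..<n} - {j}). ?g p = 0"
    proof
      fix p assume p: "p \<in> pairs n - ?h ` ({..<n} - {j})"
      obtain a b where ab: "p = (a, b)" "a < b" "b < n" using p by (auto simp: pairs_def)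
      have "a \<noteq> j"
      proof
        assume "a = j"
        hence "p = ?h b" "b \<in> {..<n}-{j}" using ab by auto
        thus False using p by blast
      qed
      moreover have "b \<noteq> j"
      proof
        assume "b = j"
        hence "p = ?h a" "a \<in> {..<n}-{j}" using ab by auto
        thus False using p by blast
      qed
      ultimately show "?g p = 0" by (simp add: ab unit_vec_def)
    qed
  qed auto
  also have "\<dots> = (\<Sum>i\<in>{..<n}-{j}. ?g (?h i))"
    by (subst sum.reindex) (auto simp: inj_on_def min_def max_def split: if_splits)
  also have "\<dots> = (\<Sum>i\<in>{..<n}-{j}. (f x - f (swap_coords i j x)) / (x j - x i))"
  proof (intro sum.cong refl)
    fix i assume i: "i \<in> {..<n} - {j}"
    have "x \<circ> tr (?h i) = swap_coords i j x"
      by (cases "i < j") (simp_all add: swap_coords_eq tr_def min_def max_def transpose_commute[of j i])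
    moreover have "(v - u) / (x i - x j) = (u - v) / (x j - x i)" for u v :: complex
      using minus_divide_divide[of "u - v" "x j - x i"] by simp
    ultimately show "?g (?h i) = (f x - f (swap_coords i j x)) / (x j - x i)"
      using i by (cases "i < j") (auto simp: unit_vec_def min_def max_def)
  qed
  finally show ?thesis unfolding dunkl_op_eq 1 by (simp del: of_real_diff)
qed

text \<open>The constant k (1 - n) is distributed as -f over the n - 1 indices i other than j, so
  that each index can be treated separately.\<close>

lemma cher_op_eq:
  assumes j: "j < n"
  shows "cher_op n k j f x = x j * pderiv_n f j x +
    of_real k * (\<Sum>i\<in>{..<n}-{j}. x j * ((f x - f (swap_coords i j x)) / (x j - x i)) - f x
       + (if j < i then f (swap_coords i j x) else 0))"
proof -
  have "(\<Sum>i\<in>{..<n}-{j}. if j < i then f (swap_coords i j x) else 0) = (\<Sum>i\<in>{j<..<n}. f (swap_coords i j x))"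
    by (rule sum.mono_neutral_cong_right) auto
  moreover have "card ({..<n} - {j}) = n - 1" using j by simp
  ultimately show ?thesis using j
    by (simp add: cher_op_def dunkl_op_unit[OF j] sum.distrib sum_subtractf sum_distrib_left algebra_simps of_nat_diff)
qed

text \<open>The divided difference is a geometric sum. Multiplied by x_j, its terms run through
  exponent pairs with constant sum: the inner ones are lower by \<open>jack_prec_interior\<close>,
  and the end term that remains is the monomial itself or minus its exchanged copy, depending on
  which entry is larger.\<close>

lemma lower_refl_mono:
  assumes m: "mindex n \<eta>" and ij: "i < n" "j < n" "i \<noteq> j"
  shows "lower n \<eta> (\<lambda>x. x j * ((mono n \<eta> x - mono n \<eta> (swap_coords i j x)) / (x j - x i)) -
     (if \<eta> i < \<eta> j then mono n \<eta> x else if \<eta> j < \<eta> i then - mono n (swap_coords i j \<eta>) x else 0))"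
proof -
  define R where "R x = (\<Prod>q\<in>{..<n}-{i,j}. x q ^ \<eta> q)" for x :: "nat => complex"
  define M where "M a b = mono n (\<eta>(i := a, j := b))" for a b
  have M: "M a b x = x i ^ a * x j ^ b * R x" for a b x
    unfolding M_def R_def by (rule mono_upd2[OF ij])
  have Mm: "mono n \<eta> x = M (\<eta> i) (\<eta> j) x" for x unfolding M_def by simp
  have Ms: "mono n (swap_coords i j \<eta>) x = M (\<eta> j) (\<eta> i) x" for x
    unfolding M_def swap_coords_def by simp
  have low: "lower n \<eta> (M a b)" if "a + b = \<eta> i + \<eta> j" "min (\<eta> i) (\<eta> j) < a" "a < max (\<eta> i) (\<eta> j)" for a b
    unfolding M_def using that m ij
    by (intro lower_mono m) (auto simp: below_def mindex_def intro!: jack_prec_interior)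
  have ne: "x j - x i \<noteq> 0" if "distinct_coords n x" for x :: "nat => complex"
    using that ij by (auto simp: distinct_coords_def)
  consider "\<eta> i = \<eta> j" | d where "\<eta> j = \<eta> i + Suc d" | d where "\<eta> i = \<eta> j + Suc d"
    by (metis less_iff_Suc_add linorder_neqE_nat add_Suc_right)
  thus ?thesis
  proof cases
    case 1
    have "swap_coords i j \<eta> = \<eta>" using 1 by (auto simp: swap_coords_def fun_eq_iff)
    thus ?thesis using 1 by (intro lower_cong[OF lower_0]) (simp add: mono_swap ij)
  next
    case (2 d)
    have "lower n \<eta> (\<lambda>x. \<Sum>p<d. M (\<eta> i + d - p) (\<eta> i + p + 1) x)"
      using 2 by (intro lower_sum low) auto
    thus ?thesis
    proof (rule lower_cong)
      fix x :: "nat => complex" assume x: "distinct_coords n x"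
      have "x j * (mono n \<eta> x - mono n \<eta> (swap_coords i j x)) =
         x i ^ \<eta> i * x j ^ \<eta> i * x j * R x * (x j ^ Suc d - x i ^ Suc d)"
        unfolding mono_swap[OF ij(1,2)] unfolding Ms Mm[of x] by (simp add: M 2 power_add algebra_simps)
      also have "\<dots> = (x j - x i) * (\<Sum>p<Suc d. x i ^ \<eta> i * x j ^ \<eta> i * x j * R x * (x j ^ p * x i ^ (d - p)))"
        by (simp only: diff_power_eq_sum sum_distrib_left ac_simps)
      also have "(\<Sum>p<Suc d. x i ^ \<eta> i * x j ^ \<eta> i * x j * R x * (x j ^ p * x i ^ (d - p))) =
         (\<Sum>p<Suc d. M (\<eta> i + d - p) (\<eta> i + p + 1) x)"
      proof (intro sum.cong refl)
        fix p assume "p \<in> {..<Suc d}"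
        hence "\<eta> i + d - p = \<eta> i + (d - p)" by auto
        thus "x i ^ \<eta> i * x j ^ \<eta> i * x j * R x * (x j ^ p * x i ^ (d - p)) = M (\<eta> i + d - p) (\<eta> i + p + 1) x"
          by (simp only: M power_add power_one_right ac_simps)
      qed
      also have "\<dots> = (\<Sum>p<d. M (\<eta> i + d - p) (\<eta> i + p + 1) x) + mono n \<eta> x"
        by (simp add: Mm 2)
      finally have "x j * (mono n \<eta> x - mono n \<eta> (swap_coords i j x)) =
        (x j - x i) * ((\<Sum>p<d. M (\<eta> i + d - p) (\<eta> i + p + 1) x) + mono n \<eta> x)" .
      thus "x j * ((mono n \<eta> x - mono n \<eta> (swap_coords i j x)) / (x j - x i)) -
          (if \<eta> i < \<eta> j then mono n \<eta> x else if \<eta> j < \<eta> i then - mono n (swap_coords i j \<eta>) x else 0) =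
         (\<Sum>p<d. M (\<eta> i + d - p) (\<eta> i + p + 1) x)"
        using ne[OF x] 2 by (simp only: times_divide_eq_right) simp
    qed
  next
    case (3 d)
    have "lower n \<eta> (\<lambda>x. - 1 * (\<Sum>p<d. M (\<eta> j + Suc p) (\<eta> j + d - p) x))"
      using 3 by (intro lower_cmult lower_sum low) auto
    thus ?thesis
    proof (rule lower_cong)
      fix x :: "nat => complex" assume x: "distinct_coords n x"
      have "x j * (mono n \<eta> x - mono n \<eta> (swap_coords i j x)) =
         - (x i ^ \<eta> j * x j ^ \<eta> j * x j * R x * (x j ^ Suc d - x i ^ Suc d))"
        unfolding mono_swap[OF ij(1,2)] unfolding Ms Mm[of x] by (simp add: M 3 power_add algebra_simps)
      also have "\<dots> = - ((x j - x i) * (\<Sum>p<Suc d. x i ^ \<eta> j * x j ^ \<eta> j * x j * R x * (x j ^ (d - p) * x i ^ p)))"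
      proof -
        have "x j ^ Suc d - x i ^ Suc d = - (x i ^ Suc d - x j ^ Suc d)" by simp
        also have "\<dots> = (x j - x i) * (\<Sum>p<Suc d. x j ^ (d - p) * x i ^ p)"
          unfolding diff_power_eq_sum minus_mult_left minus_diff_eq by (simp only: ac_simps)
        finally show ?thesis by (simp only: sum_distrib_left ac_simps)
      qed
      also have "(\<Sum>p<Suc d. x i ^ \<eta> j * x j ^ \<eta> j * x j * R x * (x j ^ (d - p) * x i ^ p)) =
         (\<Sum>p<Suc d. M (\<eta> j + p) (\<eta> j + (d - p) + 1) x)"
        by (intro sum.cong refl) (simp only: M power_add power_one_right ac_simps)
      also have "\<dots> = mono n (swap_coords i j \<eta>) x + (\<Sum>p<d. M (\<eta> j + Suc p) (\<eta> j + d - p) x)"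
        by (subst sum.lessThan_Suc_shift) (auto simp: Ms 3 Suc_diff_Suc intro!: sum.cong)
      finally have "x j * (mono n \<eta> x - mono n \<eta> (swap_coords i j x)) =
        - ((x j - x i) * (mono n (swap_coords i j \<eta>) x + (\<Sum>p<d. M (\<eta> j + Suc p) (\<eta> j + d - p) x)))" .
      thus "x j * ((mono n \<eta> x - mono n \<eta> (swap_coords i j x)) / (x j - x i)) -
          (if \<eta> i < \<eta> j then mono n \<eta> x else if \<eta> j < \<eta> i then - mono n (swap_coords i j \<eta>) x else 0) =
         - 1 * (\<Sum>p<d. M (\<eta> j + Suc p) (\<eta> j + d - p) x)"
        using ne[OF x] 3 by (simp only: times_divide_eq_right) simp
    qed
  qed
qed

text \<open>Each index i ranked before j contributes -k times the monomial, which accumulates to the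
  rank part of \<open>eta_bar\<close>; the derivative contributes the entry. All other terms are
  lower monomials.\<close>

lemma cher_op_mono_lower:
  assumes m: "mindex n \<eta>" and j: "j < n"
  shows "lower n \<eta> (\<lambda>x. cher_op n k j (mono n \<eta>) x - of_real (eta_bar n k \<eta> j) * mono n \<eta> x)"
proof -
  define T where "T i x = x j * ((mono n \<eta> x - mono n \<eta> (swap_coords i j x)) / (x j - x i)) - mono n \<eta> x
       + (if j < i then mono n \<eta> (swap_coords i j x) else 0)" for i and x :: "nat => complex"
  have T: "lower n \<eta> (\<lambda>x. T i x + (if before \<eta> i j then mono n \<eta> x else 0))" if i: "i \<in> {..<n} - {j}" for i
  proof -
    define D where "D x = x j * ((mono n \<eta> x - mono n \<eta> (swap_coords i j x)) / (x j - x i)) -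
       (if \<eta> i < \<eta> j then mono n \<eta> x else if \<eta> j < \<eta> i then - mono n (swap_coords i j \<eta>) x else 0)" for x :: "nat => complex"
    \<comment> \<open>The exchanged monomial that remains: for i < j it comes with a minus sign from
      the divided difference, for j < i with a plus sign from the transposition in
      \<open>cher_op\<close>. In both cases the larger entry moves to the right, so the monomial is
      lower.\<close>
    define s where "s x = (if (i < j \<and> \<eta> j < \<eta> i) \<or> (j < i \<and> \<eta> i < \<eta> j) then mono n (swap_coords i j \<eta>) x else 0)" for x :: "nat => complex"
    have D: "lower n \<eta> D" unfolding D_def[abs_def] using i j by (intro lower_refl_mono m) auto
    have sw: "swap_coords i j \<eta> = swap_coords j i \<eta>" by (auto simp: swap_coords_def fun_eq_iff)
    have mm: "mindex n (swap_coords i j \<eta>)" using m i j by (auto simp: mindex_def swap_coords_def)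
    have "lower n \<eta> s"
    proof (cases "(i < j \<and> \<eta> j < \<eta> i) \<or> (j < i \<and> \<eta> i < \<eta> j)")
      case True
      hence "jack_prec n (swap_coords i j \<eta>) \<eta>"
        using jack_prec_swap[OF m, of i j] jack_prec_swap[OF m, of j i] i j sw by auto
      thus ?thesis using True mm unfolding s_def[abs_def] by (auto intro!: lower_mono m simp: below_def)
    qed (auto simp: s_def[abs_def] lower_0)
    hence "lower n \<eta> (\<lambda>x. D x + (if i < j then - 1 else 1) * s x)"
      by (intro lower_add D lower_cmult)
    moreover have "T i x + (if before \<eta> i j then mono n \<eta> x else 0) = D x + (if i < j then - 1 else 1) * s x" for x
    proof -
      have "mono n (swap_coords i j \<eta>) x = mono n \<eta> x" if "\<eta> i = \<eta> j"
      proof -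
        have "swap_coords i j \<eta> = \<eta>" using that by (auto simp: swap_coords_def fun_eq_iff)
        thus ?thesis by simp
      qed
      moreover have "mono n \<eta> (swap_coords i j x) = mono n (swap_coords i j \<eta>) x" using i j by (intro mono_swap) auto
      ultimately show ?thesis using i unfolding T_def D_def s_def before_def
        by (cases "\<eta> i" "\<eta> j" rule: linorder_cases; cases "i < j") auto
    qed
    ultimately show ?thesis by simp
  qed
  have "lower n \<eta> (\<lambda>x. of_real k * (\<Sum>i\<in>{..<n}-{j}. T i x + (if before \<eta> i j then mono n \<eta> x else 0)))"
    by (intro lower_cmult lower_sum T) auto
  thus ?thesis
  proof (rule lower_cong)
    fix x :: "nat => complex" assume x: "distinct_coords n x"
    have "(\<Sum>i\<in>{..<n}-{j}. if before \<eta> i j then mono n \<eta> x else 0) = of_nat (rk n \<eta> j) * mono n \<eta> x"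
    proof -
      have "(\<Sum>i\<in>{..<n}-{j}. if before \<eta> i j then mono n \<eta> x else 0) = (\<Sum>i\<in>{q. q < n \<and> before \<eta> q j}. mono n \<eta> x)"
        by (rule sum.mono_neutral_cong_right) (auto simp: before_def)
      thus ?thesis by (simp add: rk_def)
    qed
    thus "cher_op n k j (mono n \<eta>) x - of_real (eta_bar n k \<eta> j) * mono n \<eta> x =
      of_real k * (\<Sum>i\<in>{..<n}-{j}. T i x + (if before \<eta> i j then mono n \<eta> x else 0))"
      unfolding cher_op_eq[OF j] pderiv_n_mono[OF j] eta_bar_rk[OF j] T_def[symmetric] sum.distrib[of "\<lambda>i. T i x"]
      by (simp add: algebra_simps)
  qed
qed

lemma cher_op_sum:
  assumes A: "finite A" and f: "\<And>\<alpha>. \<alpha> \<in> A ==> sep_holo n (f \<alpha>)" and j: "j < n"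
  shows "cher_op n k j (\<lambda>x. \<Sum>\<alpha>\<in>A. c \<alpha> * f \<alpha> x) x = (\<Sum>\<alpha>\<in>A. c \<alpha> * cher_op n k j (f \<alpha>) x)"
proof -
  have 1: "dunkl_op n k \<xi> (\<lambda>x. \<Sum>\<alpha>\<in>A. c \<alpha> * f \<alpha> x) x = (\<Sum>\<alpha>\<in>A. c \<alpha> * dunkl_op n k \<xi> (f \<alpha>) x)" for \<xi>
  proof -
    have "dunkl_op n k \<xi> (\<lambda>x. \<Sum>\<alpha>\<in>A. c \<alpha> * f \<alpha> x) x = (\<Sum>\<alpha>\<in>A. dunkl_op n k \<xi> (\<lambda>x. c \<alpha> * f \<alpha> x) x)"
      by (intro dunkl_op_sum A sep_holo_mult sep_holo_const f)
    also have "\<dots> = (\<Sum>\<alpha>\<in>A. c \<alpha> * dunkl_op n k \<xi> (f \<alpha>) x)"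
      by (intro sum.cong refl dunkl_op_cmult f)
    finally show ?thesis .
  qed
  have 2: "(\<Sum>i\<in>{j<..<n}. \<Sum>\<alpha>\<in>A. c \<alpha> * f \<alpha> (swap_coords i j x)) = (\<Sum>\<alpha>\<in>A. c \<alpha> * (\<Sum>i\<in>{j<..<n}. f \<alpha> (swap_coords i j x)))"
    by (subst sum.swap) (simp add: sum_distrib_left)
  show ?thesis unfolding cher_op_def 1 2 sum_distrib_left sum.distrib[symmetric]
    by (intro sum.cong refl) (simp add: algebra_simps sum_distrib_left)
qed

definition jack_eigen :: "nat => real => (nat => nat) => ((nat => complex) => complex) => bool" where
  "jack_eigen n k \<eta> p \<longleftrightarrow> (\<forall>j<n. \<forall>x. distinct_coords n x -->
     cher_op n k j p x = of_real (eta_bar n k \<eta> j) * p x)"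

text \<open>At a maximal exponent of the support no other monomial contributes, so its own
  eigenvalues must be those of \<eta>, and \<open>eta_bar_inj\<close> makes it equal to \<eta>.
  Every element of the finite support lies weakly below such a maximal one.\<close>

lemma jack_eigen_support:
  assumes k: "k \<ge> 0" and m: "mindex n \<eta>" and S: "finite S" "\<And>\<alpha>. \<alpha> \<in> S ==> mindex n \<alpha>" "\<And>\<alpha>. \<alpha> \<in> S ==> c \<alpha> \<noteq> 0"
    and p: "p = (\<lambda>x. \<Sum>\<alpha>\<in>S. c \<alpha> * mono n \<alpha> x)" and eig: "jack_eigen n k \<eta> p"
    and \<alpha>: "\<alpha> \<in> S"
  shows "\<eta> \<in> S \<and> (\<alpha> = \<eta> \<or> jack_prec n \<alpha> \<eta>)"
proof -
  have max: "\<beta> = \<eta>" if \<beta>: "\<beta> \<in> S" and mx: "\<And>\<gamma>. \<gamma> \<in> S ==> \<not> jack_prec n \<beta> \<gamma>" for \<beta>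
  proof -
    have "eta_bar n k \<beta> j = eta_bar n k \<eta> j" if j: "j < n" for j
    proof -
      have "\<forall>\<gamma>\<in>S. \<exists>r. \<forall>x. distinct_coords n x --> cher_op n k j (mono n \<gamma>) x - of_real (eta_bar n k \<gamma> j) * mono n \<gamma> x =
          (\<Sum>\<kappa>\<in>below n \<gamma>. r \<kappa> * mono n \<kappa> x)"
        using cher_op_mono_lower[OF S(2) j] unfolding lower_def by blast
      then obtain r where r: "\<And>\<gamma> x. \<gamma> \<in> S ==> distinct_coords n x ==>
          cher_op n k j (mono n \<gamma>) x - of_real (eta_bar n k \<gamma> j) * mono n \<gamma> x = (\<Sum>\<kappa>\<in>below n \<gamma>. r \<gamma> \<kappa> * mono n \<kappa> x)"
        by metis
      define U where "U = S \<union> (\<Union>\<gamma>\<in>S. below n \<gamma>)"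
      \<comment> \<open>The coefficient of the monomial \<kappa> in the operator applied to p minus
        the eigenvalue times p: diagonal part plus what higher monomials send down.\<close>
      define C where "C \<kappa> = (if \<kappa> \<in> S then c \<kappa> * of_real (eta_bar n k \<kappa> j - eta_bar n k \<eta> j) else 0)
         + (\<Sum>\<gamma>\<in>S. if \<kappa> \<in> below n \<gamma> then c \<gamma> * r \<gamma> \<kappa> else 0)" for \<kappa>
      have U: "finite U" "\<And>\<kappa>. \<kappa> \<in> U ==> mindex n \<kappa>"
        using S finite_below by (auto simp: U_def below_def)
      have "(\<Sum>\<kappa>\<in>U. C \<kappa> * mono n \<kappa> x) = 0" if x: "distinct_coords n x" for x
      proof -
        have 1: "(\<Sum>\<kappa>\<in>U. (if \<kappa> \<in> S then c \<kappa> * of_real (eta_bar n k \<kappa> j - eta_bar n k \<eta> j) else 0) * mono n \<kappa> x) =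
           (\<Sum>\<gamma>\<in>S. c \<gamma> * of_real (eta_bar n k \<gamma> j - eta_bar n k \<eta> j) * mono n \<gamma> x)"
          by (rule sum.mono_neutral_cong_right) (use U in \<open>auto simp: U_def\<close>)
        have "(\<Sum>\<kappa>\<in>U. (\<Sum>\<gamma>\<in>S. if \<kappa> \<in> below n \<gamma> then c \<gamma> * r \<gamma> \<kappa> else 0) * mono n \<kappa> x) =
           (\<Sum>\<gamma>\<in>S. \<Sum>\<kappa>\<in>U. (if \<kappa> \<in> below n \<gamma> then c \<gamma> * r \<gamma> \<kappa> else 0) * mono n \<kappa> x)"
          by (subst sum.swap) (simp add: sum_distrib_right)
        also have "\<dots> = (\<Sum>\<gamma>\<in>S. c \<gamma> * (\<Sum>\<kappa>\<in>below n \<gamma>. r \<gamma> \<kappa> * mono n \<kappa> x))"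
        proof (intro sum.cong refl)
          fix \<gamma> assume "\<gamma> \<in> S"
          hence "(\<Sum>\<kappa>\<in>U. (if \<kappa> \<in> below n \<gamma> then c \<gamma> * r \<gamma> \<kappa> else 0) * mono n \<kappa> x) = (\<Sum>\<kappa>\<in>below n \<gamma>. c \<gamma> * r \<gamma> \<kappa> * mono n \<kappa> x)"
            by (intro sum.mono_neutral_cong_right) (use U in \<open>auto simp: U_def\<close>)
          thus "(\<Sum>\<kappa>\<in>U. (if \<kappa> \<in> below n \<gamma> then c \<gamma> * r \<gamma> \<kappa> else 0) * mono n \<kappa> x) = c \<gamma> * (\<Sum>\<kappa>\<in>below n \<gamma>. r \<gamma> \<kappa> * mono n \<kappa> x)"
            by (simp add: sum_distrib_left mult.assoc)
        qed
        also have "\<dots> = (\<Sum>\<gamma>\<in>S. c \<gamma> * (cher_op n k j (mono n \<gamma>) x - of_real (eta_bar n k \<gamma> j) * mono n \<gamma> x))"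
          by (intro sum.cong refl) (simp add: r[OF _ x])
        finally have 2: "(\<Sum>\<kappa>\<in>U. (\<Sum>\<gamma>\<in>S. if \<kappa> \<in> below n \<gamma> then c \<gamma> * r \<gamma> \<kappa> else 0) * mono n \<kappa> x) =
           (\<Sum>\<gamma>\<in>S. c \<gamma> * (cher_op n k j (mono n \<gamma>) x - of_real (eta_bar n k \<gamma> j) * mono n \<gamma> x))" .
        have "(\<Sum>\<kappa>\<in>U. C \<kappa> * mono n \<kappa> x) = (\<Sum>\<gamma>\<in>S. c \<gamma> * of_real (eta_bar n k \<gamma> j - eta_bar n k \<eta> j) * mono n \<gamma> x) +
           (\<Sum>\<gamma>\<in>S. c \<gamma> * (cher_op n k j (mono n \<gamma>) x - of_real (eta_bar n k \<gamma> j) * mono n \<gamma> x))"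
          unfolding C_def distrib_right sum.distrib 1 2 ..
        also have "\<dots> = (\<Sum>\<gamma>\<in>S. c \<gamma> * cher_op n k j (mono n \<gamma>) x - of_real (eta_bar n k \<eta> j) * (c \<gamma> * mono n \<gamma> x))"
          unfolding sum.distrib[symmetric] by (intro sum.cong refl) (simp add: algebra_simps)
        also have "\<dots> = (\<Sum>\<gamma>\<in>S. c \<gamma> * cher_op n k j (mono n \<gamma>) x) - of_real (eta_bar n k \<eta> j) * (\<Sum>\<gamma>\<in>S. c \<gamma> * mono n \<gamma> x)"
          by (simp only: sum_subtractf sum_distrib_left)
        also have "(\<Sum>\<gamma>\<in>S. c \<gamma> * cher_op n k j (mono n \<gamma>) x) = cher_op n k j p x"
          unfolding p by (rule cher_op_sum[symmetric, OF S(1) sep_holo_mono j])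
        also have "\<dots> = of_real (eta_bar n k \<eta> j) * p x" using eig j x by (simp add: jack_eigen_def)
        finally show ?thesis by (simp add: p)
      qed
      note vanish = this
      have "\<beta> \<in> U" using \<beta> by (simp add: U_def)
      have "C \<beta> = 0" by (rule mono_indep[where c = C and A = U and n = n]) (fact U vanish \<open>\<beta> \<in> U\<close>)+
      moreover have "(\<Sum>\<gamma>\<in>S. if \<beta> \<in> below n \<gamma> then c \<gamma> * r \<gamma> \<beta> else 0) = 0"
        using mx by (intro sum.neutral) (auto simp: below_def)
      ultimately show ?thesis using \<beta> S(3)[OF \<beta>] by (simp add: C_def flip: of_real_diff)
    qed
    thus ?thesis using eta_bar_inj[OF k S(2)[OF \<beta>] m] by blast
  qed
  have "\<exists>\<beta>\<in>S. (\<alpha> = \<beta> \<or> jack_prec n \<alpha> \<beta>) \<and> (\<forall>\<gamma>\<in>S. \<not> jack_prec n \<beta> \<gamma>)"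
  proof -
    let ?Q = "{\<beta> \<in> S. \<alpha> = \<beta> \<or> jack_prec n \<alpha> \<beta>}"
    have "finite ?Q" "?Q \<noteq> {}" using S \<alpha> by auto
    moreover have "asymp_on ?Q (jack_prec n)"
    proof (rule asymp_onI)
      fix x y assume xy: "jack_prec n x y"
      show "\<not> jack_prec n y x" using jack_prec_trans[OF xy, of x] jack_prec_irrefl[of n x] by blast
    qed
    moreover have "transp_on ?Q (jack_prec n)" by (rule transp_onI) (rule jack_prec_trans)
    ultimately obtain \<beta> where \<beta>: "\<beta> \<in> ?Q" "\<forall>\<gamma>\<in>?Q. \<gamma> \<noteq> \<beta> --> \<not> jack_prec n \<beta> \<gamma>"
      using Finite_Set.bex_max_element[of ?Q "jack_prec n"] by meson
    hence \<beta>': "\<not> jack_prec n \<beta> \<gamma>" if "\<gamma> \<in> ?Q" for \<gamma> using that jack_prec_irrefl by (cases "\<gamma> = \<beta>") auto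
    have "\<not> jack_prec n \<beta> \<gamma>" if "\<gamma> \<in> S" for \<gamma>
    proof
      assume g: "jack_prec n \<beta> \<gamma>"
      hence "jack_prec n \<alpha> \<gamma>" using \<beta>(1) jack_prec_trans[OF _ g, of \<alpha>] by auto
      hence "\<gamma> \<in> ?Q" using that by simp
      thus False using \<beta>' g by blast
    qed
    thus ?thesis using \<beta> by auto
  qed
  thus ?thesis using max by auto
qed

section \<open>Identification of Jack polynomials by their eigenvalues\<close>

lemma poly_rep_sum:
  assumes "finite A" "\<And>\<alpha>. \<alpha> \<in> A ==> mindex n \<alpha>"
  shows "poly_rep n (\<lambda>x. \<Sum>\<alpha>\<in>A. c \<alpha> * mono n \<alpha> x) (\<lambda>\<alpha>. if \<alpha> \<in> A then c \<alpha> else 0)"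
  unfolding poly_rep_def
proof (intro conjI allI impI)
  show "finite {\<alpha>. (if \<alpha> \<in> A then c \<alpha> else 0) \<noteq> 0}"
    by (rule finite_subset[OF _ assms(1)]) (auto split: if_splits)
  fix x
  show "(\<Sum>\<alpha>\<in>A. c \<alpha> * mono n \<alpha> x) = (\<Sum>\<alpha>\<in>{\<alpha>. (if \<alpha> \<in> A then c \<alpha> else 0) \<noteq> 0}. (if \<alpha> \<in> A then c \<alpha> else 0) * mono n \<alpha> x)"
    by (rule sum.mono_neutral_cong_right) (use assms(1) in \<open>auto split: if_splits\<close>)
qed (use assms in \<open>auto split: if_splits\<close>)

lemma poly_rep_unique:
  assumes "poly_rep n p c" "poly_rep n p d"
  shows "c = d"
proof
  fix \<alpha>
  let ?A = "{\<alpha>. c \<alpha> \<noteq> 0} \<union> {\<alpha>. d \<alpha> \<noteq> 0}"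
  have A: "finite ?A" "\<And>\<alpha>. \<alpha> \<in> ?A ==> mindex n \<alpha>" using assms by (auto simp: poly_rep_def)
  have "(\<Sum>\<alpha>\<in>?A. (c \<alpha> - d \<alpha>) * mono n \<alpha> x) = 0" for x
  proof -
    have "p x = (\<Sum>\<alpha>\<in>?A. c \<alpha> * mono n \<alpha> x)"
      using assms(1) A(1) unfolding poly_rep_def by (simp, intro sum.mono_neutral_left) auto
    moreover have "p x = (\<Sum>\<alpha>\<in>?A. d \<alpha> * mono n \<alpha> x)"
      using assms(2) A(1) unfolding poly_rep_def by (simp, intro sum.mono_neutral_left) auto
    ultimately show ?thesis by (simp add: left_diff_distrib sum_subtractf)
  qed
  hence "\<alpha> \<in> ?A ==> c \<alpha> - d \<alpha> = 0" using mono_indep[OF A, of "\<lambda>\<alpha>. c \<alpha> - d \<alpha>"] by blast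
  thus "c \<alpha> = d \<alpha>" by (cases "\<alpha> \<in> ?A") auto
qed

lemma poly_coeff_eq: "poly_rep n p c ==> poly_coeff n p \<alpha> = c \<alpha>"
  unfolding poly_coeff_def by (rule the_equality) (auto dest: poly_rep_unique)

lemma cher_op_cmult:
  assumes "sep_holo n p" "j < n"
  shows "cher_op n k j (\<lambda>x. a * p x) x = a * cher_op n k j p x"
  using cher_op_sum[of "{()}" n "\<lambda>_. p" j k "\<lambda>_. a" x] assms by simp

lemma sep_holo_poly: "poly_rep n p c ==> sep_holo n p"
proof -
  assume "poly_rep n p c"
  hence "p = (\<lambda>x. \<Sum>\<alpha>\<in>{\<alpha>. c \<alpha> \<noteq> 0}. c \<alpha> * mono n \<alpha> x)" by (auto simp: poly_rep_def)
  note p = this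
  show ?thesis unfolding p by (intro sep_holo_sum sep_holo_mult sep_holo_const sep_holo_mono)
qed

text \<open>The triangular shape in the definition of the Jack polynomial is a consequence of the
  eigenvalues through \<open>jack_eigen_support\<close>. Any nonzero polynomial with the right
  eigenvalues is thus the Jack polynomial after division by its coefficient at \<eta>.\<close>

lemma nsjack_eq:
  assumes k: "k \<ge> 0" and m: "mindex n \<eta>" and rep: "poly_rep n p c" and nz: "c \<noteq> (\<lambda>_. 0)"
    and eig: "jack_eigen n k \<eta> p"
  shows "c \<eta> \<noteq> 0" "nsjack n k \<eta> = (\<lambda>x. p x / c \<eta>)"
proof -
  let ?S = "{\<alpha>. c \<alpha> \<noteq> 0}"
  have p: "p = (\<lambda>x. \<Sum>\<alpha>\<in>?S. c \<alpha> * mono n \<alpha> x)" and S: "finite ?S" "\<And>\<alpha>. \<alpha> \<in> ?S ==> mindex n \<alpha>"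
    using rep by (auto simp: poly_rep_def)
  have supp: "\<eta> \<in> ?S \<and> (\<alpha> = \<eta> \<or> jack_prec n \<alpha> \<eta>)" if "\<alpha> \<in> ?S" for \<alpha>
    using that by (intro jack_eigen_support[OF k m S _ p eig]) auto
  show c: "c \<eta> \<noteq> 0" using nz supp by auto
  have fb: "finite (below n \<eta>)" by (rule finite_below[OF m])
  have nb: "\<eta> \<notin> below n \<eta>" by (simp add: below_def jack_prec_irrefl)
  have px: "p x = c \<eta> * mono n \<eta> x + (\<Sum>\<kappa>\<in>below n \<eta>. c \<kappa> * mono n \<kappa> x)" for x
  proof -
    have "p x = (\<Sum>\<alpha>\<in>insert \<eta> (below n \<eta>). c \<alpha> * mono n \<alpha> x)"
      unfolding p by (rule sum.mono_neutral_left) (use fb supp S in \<open>auto simp: below_def\<close>)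
    thus ?thesis using fb nb by simp
  qed
  have sp: "sep_holo n p" using rep by (rule sep_holo_poly)
  show "nsjack n k \<eta> = (\<lambda>x. p x / c \<eta>)"
    unfolding nsjack_def below_def[symmetric] jack_eigen_def[symmetric]
  proof (rule the_equality, intro conjI)
    show "\<exists>d. \<forall>x. p x / c \<eta> = mono n \<eta> x + (\<Sum>\<kappa>\<in>below n \<eta>. d \<kappa> * mono n \<kappa> x)"
      using c by (intro exI[of _ "\<lambda>\<kappa>. c \<kappa> / c \<eta>"]) (simp add: px add_divide_distrib sum_divide_distrib)
    show "jack_eigen n k \<eta> (\<lambda>x. p x / c \<eta>)"
      using eig cher_op_cmult[OF sp, of _ k "1 / c \<eta>"] unfolding jack_eigen_def by simp
    fix q assume q: "(\<exists>d. \<forall>x. q x = mono n \<eta> x + (\<Sum>\<kappa>\<in>below n \<eta>. d \<kappa> * mono n \<kappa> x)) \<and> jack_eigen n k \<eta> q"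
    then obtain d where d: "\<And>x. q x = mono n \<eta> x + (\<Sum>\<kappa>\<in>below n \<eta>. d \<kappa> * mono n \<kappa> x)" by blast
    \<comment> \<open>The difference of two monic candidates is supported strictly below \<eta>.
      Were its support nonempty, \<open>jack_eigen_support\<close> would place \<eta> in it.\<close>
    define b where "b \<kappa> = d \<kappa> - c \<kappa> / c \<eta>" for \<kappa>
    define T where "T = {\<kappa> \<in> below n \<eta>. b \<kappa> \<noteq> 0}"
    have diff: "(\<lambda>x. q x - p x / c \<eta>) = (\<lambda>x. \<Sum>\<kappa>\<in>T. b \<kappa> * mono n \<kappa> x)"
    proof
      fix x
      have "q x - p x / c \<eta> = (\<Sum>\<kappa>\<in>below n \<eta>. b \<kappa> * mono n \<kappa> x)"
        using c by (simp add: d px b_def add_divide_distrib sum_divide_distrib left_diff_distrib sum_subtractf)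
      also have "\<dots> = (\<Sum>\<kappa>\<in>T. b \<kappa> * mono n \<kappa> x)"
        by (rule sum.mono_neutral_right) (use fb in \<open>auto simp: T_def\<close>)
      finally show "q x - p x / c \<eta> = (\<Sum>\<kappa>\<in>T. b \<kappa> * mono n \<kappa> x)" .
    qed
    have sq: "sep_holo n q"
    proof -
      have "q = (\<lambda>x. mono n \<eta> x + (\<Sum>\<kappa>\<in>below n \<eta>. d \<kappa> * mono n \<kappa> x))" using d by auto
      thus ?thesis by (simp add: sep_holo_add sep_holo_mono sep_holo_sum sep_holo_mult)
    qed
    have "jack_eigen n k \<eta> (\<lambda>x. q x - p x / c \<eta>)"
      unfolding jack_eigen_def
    proof (intro allI impI)
      fix j and x :: "nat => complex" assume j: "j < n" and x: "distinct_coords n x"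
      have "cher_op n k j (\<lambda>x. \<Sum>b\<in>{True, False}. (if b then 1 else - 1 / c \<eta>) * (if b then q else p) x) x =
         (\<Sum>b\<in>{True, False}. (if b then 1 else - 1 / c \<eta>) * cher_op n k j (if b then q else p) x)"
        by (rule cher_op_sum) (use sq sp j in auto)
      hence "cher_op n k j (\<lambda>x. q x - p x / c \<eta>) x = cher_op n k j q x - cher_op n k j p x / c \<eta>" by simp
      thus "cher_op n k j (\<lambda>x. q x - p x / c \<eta>) x = of_real (eta_bar n k \<eta> j) * (q x - p x / c \<eta>)"
        using q eig j x by (simp add: jack_eigen_def algebra_simps)
    qed
    note eigd = this
    have T1: "finite T" using fb by (simp add: T_def)
    have T2: "mindex n \<alpha>" "b \<alpha> \<noteq> 0" if "\<alpha> \<in> T" for \<alpha> using that by (simp_all add: T_def below_def)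
    have "\<eta> \<in> T \<and> (\<alpha> = \<eta> \<or> jack_prec n \<alpha> \<eta>)" if "\<alpha> \<in> T" for \<alpha>
      by (rule jack_eigen_support[where c = b, OF k m T1 _ _ diff eigd that]) (fact T2)+
    hence "T = {}" using nb by (auto simp: T_def)
    thus "q = (\<lambda>x. p x / c \<eta>)" using diff by (simp add: fun_eq_iff)
  qed
qed

lemma unit_vec_comp: "\<tau> \<in> symg n ==> unit_vec j \<circ> \<tau> = unit_vec (inv \<tau> j)"
  using symg_inv_apply[of \<tau> n] by (auto simp: unit_vec_def fun_eq_iff)

lemma swap_comp: "\<tau> \<in> symg n ==> swap_coords i j x \<circ> \<tau> = swap_coords (inv \<tau> i) (inv \<tau> j) (x \<circ> \<tau>)"
  unfolding swap_coords_eq comp_assoc by (subst transpose_conj) (auto simp: comp_assoc)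

lemma cher_op_permute:
  assumes \<tau>: "\<tau> \<in> symg n"
  shows "cher_op n k j (\<lambda>x. p (x \<circ> \<tau>)) x =
    (x \<circ> \<tau>) (inv \<tau> j) * dunkl_op n k (unit_vec (inv \<tau> j)) p (x \<circ> \<tau>)
     + of_real (k * (1 - real n)) * p (x \<circ> \<tau>)
     + of_real k * (\<Sum>i\<in>{j<..<n}. p (swap_coords (inv \<tau> i) (inv \<tau> j) (x \<circ> \<tau>)))"
  unfolding cher_op_def dunkl_op_permute[OF \<tau>] unit_vec_comp[OF \<tau>] swap_comp[OF \<tau>]
  using \<tau> by simp

section \<open>The raising operator and exchanges of adjacent coordinates\<close>

definition cyc :: "nat => nat => nat" where
  "cyc m i = (if i = 0 then m else if i \<le> m then i - 1 else i)"

definition icyc :: "nat => nat => nat" where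
  "icyc m i = (if i < m then Suc i else if i = m then 0 else i)"

lemma cyc_icyc [simp]: "cyc m (icyc m i) = i" "icyc m (cyc m i) = i"
  by (auto simp: cyc_def icyc_def)

lemma inv_cyc [simp]: "inv (cyc m) = icyc m"
  by (rule inv_equality) auto

lemma cyc_symg: "cyc m \<in> symg (Suc m)"
  unfolding symg_def
proof (intro CollectI bij_imp_permutes)
  show "bij_betw (cyc m) {..<Suc m} {..<Suc m}"
    by (rule bij_betw_byWitness[where f' = "icyc m"]) (auto simp: cyc_def icyc_def)
qed (auto simp: cyc_def)

definition Phi :: "nat => ((nat => complex) => complex) => (nat => complex) => complex" where
  "Phi m p x = x m * p (x \<circ> cyc m)"

text \<open>The exponent map induced by \<open>Phi\<close>: (eta_0, ..., eta_m) becomes (eta_1, ...,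
  eta_m, eta_0 + 1).\<close>

definition phi :: "nat => (nat => nat) => nat => nat" where
  "phi m \<eta> i = (if i = m then Suc (\<eta> 0) else \<eta> (icyc m i))"

lemma mindex_phi: "mindex (Suc m) \<eta> ==> mindex (Suc m) (phi m \<eta>)"
  by (auto simp: mindex_def phi_def icyc_def)

lemma Phi_mono: "Phi m (mono (Suc m) \<eta>) = mono (Suc m) (phi m \<eta>)"
proof
  fix x :: "nat => complex"
  have "(\<Prod>i<m. x i ^ \<eta> (icyc m i)) = (\<Prod>i<m. x i ^ phi m \<eta> i)"
    by (intro prod.cong) (auto simp: phi_def)
  moreover have "icyc m m = 0" by (simp add: icyc_def)
  ultimately show "Phi m (mono (Suc m) \<eta>) x = mono (Suc m) (phi m \<eta>) x"
    unfolding Phi_def mono_comp[OF cyc_symg] inv_cyc by (simp add: mono_def phi_def[of m \<eta> m])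
qed

lemma pderiv_n_coord: "pderiv_n (\<lambda>x. x i) j x = (if i = j then 1 else 0)"
  by (simp add: pderiv_n_def)

lemma dunkl_op_coord_mult_other:
  assumes h: "sep_holo n h" and x: "distinct_coords n x" and jm: "j < n" "m < n" "j \<noteq> m"
  shows "dunkl_op n k (unit_vec j) (\<lambda>x. x m * h x) x =
     x m * dunkl_op n k (unit_vec j) h x - of_real k * h (swap_coords m j x)"
proof -
  have 1: "(x m * h x - swap_coords i j x m * h (swap_coords i j x)) / (x j - x i) =
     x m * ((h x - h (swap_coords i j x)) / (x j - x i)) - (if i = m then h (swap_coords m j x) else 0)"
    if "i \<in> {..<n} - {j}" for i
  proof -
    have ne: "x j - x i \<noteq> 0" using x that jm by (auto simp: distinct_coords_def)
    show ?thesis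
    proof (cases "i = m")
      case True
      have "swap_coords m j x m = x j" using jm by (simp add: swap_coords_def)
      thus ?thesis using True ne by (simp add: field_simps)
    next
      case False
      hence "swap_coords i j x m = x m" using jm by (simp add: swap_coords_def)
      thus ?thesis using False by (simp add: right_diff_distrib)
    qed
  qed
  have 2: "pderiv_n (\<lambda>x. x m * h x) j x = x m * pderiv_n h j x"
    using jm by (subst pderiv_n_mult[OF sep_holo_coord h]) (auto simp: pderiv_n_coord)
  have "(\<Sum>i\<in>{..<n}-{j}. (x m * h x - swap_coords i j x m * h (swap_coords i j x)) / (x j - x i)) =
      (\<Sum>i\<in>{..<n}-{j}. x m * ((h x - h (swap_coords i j x)) / (x j - x i)) - (if i = m then h (swap_coords m j x) else 0))"
    by (intro sum.cong refl 1)
  also have "\<dots> = x m * (\<Sum>i\<in>{..<n}-{j}. (h x - h (swap_coords i j x)) / (x j - x i)) - h (swap_coords m j x)"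
    using jm by (simp add: sum_subtractf sum_distrib_left)
  finally have 3: "(\<Sum>i\<in>{..<n}-{j}. (x m * h x - swap_coords i j x m * h (swap_coords i j x)) / (x j - x i)) =
    x m * (\<Sum>i\<in>{..<n}-{j}. (h x - h (swap_coords i j x)) / (x j - x i)) - h (swap_coords m j x)" .
  show ?thesis unfolding dunkl_op_unit[OF jm(1)] 2 3 by (simp add: algebra_simps)
qed

lemma dunkl_op_coord_mult_same:
  assumes h: "sep_holo n h" and x: "distinct_coords n x" and m: "m < n"
  shows "dunkl_op n k (unit_vec m) (\<lambda>x. x m * h x) x =
     x m * dunkl_op n k (unit_vec m) h x + h x + of_real k * (\<Sum>i\<in>{..<n}-{m}. h (swap_coords i m x))"
proof -
  have 1: "(x m * h x - swap_coords i m x m * h (swap_coords i m x)) / (x m - x i) =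
     x m * ((h x - h (swap_coords i m x)) / (x m - x i)) + h (swap_coords i m x)"
    if "i \<in> {..<n} - {m}" for i
  proof -
    have ne: "x m - x i \<noteq> 0" using x that m by (auto simp: distinct_coords_def)
    have "swap_coords i m x m = x i" by (simp add: swap_coords_def)
    thus ?thesis using ne by (simp add: field_simps)
  qed
  have 2: "pderiv_n (\<lambda>x. x m * h x) m x = x m * pderiv_n h m x + h x"
    using m by (subst pderiv_n_mult[OF sep_holo_coord h]) (auto simp: pderiv_n_coord)
  have "(\<Sum>i\<in>{..<n}-{m}. (x m * h x - swap_coords i m x m * h (swap_coords i m x)) / (x m - x i)) =
      (\<Sum>i\<in>{..<n}-{m}. x m * ((h x - h (swap_coords i m x)) / (x m - x i)) + h (swap_coords i m x))"
    by (intro sum.cong refl 1)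
  also have "\<dots> = x m * (\<Sum>i\<in>{..<n}-{m}. (h x - h (swap_coords i m x)) / (x m - x i)) + (\<Sum>i\<in>{..<n}-{m}. h (swap_coords i m x))"
    by (simp add: sum.distrib sum_distrib_left)
  finally have 3: "(\<Sum>i\<in>{..<n}-{m}. (x m * h x - swap_coords i m x m * h (swap_coords i m x)) / (x m - x i)) =
    x m * (\<Sum>i\<in>{..<n}-{m}. (h x - h (swap_coords i m x)) / (x m - x i)) + (\<Sum>i\<in>{..<n}-{m}. h (swap_coords i m x))" .
  show ?thesis unfolding dunkl_op_unit[OF m] 2 3 by (simp add: algebra_simps)
qed

text \<open>The left side, with reflections for all i < m, is the operator that integration by parts
  in the last coordinate produces. The operator of index 0 carries the reflections for all i > 0,
  and the cyclic shift turns one into the other.\<close>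

lemma last_op_cyc:
  "x m * dunkl_op (Suc m) k (unit_vec m) (\<lambda>x. p (x \<circ> cyc m)) x
     + of_real (k * (1 - real (Suc m))) * p (x \<circ> cyc m)
     + of_real k * (\<Sum>i<m. p (swap_coords i m x \<circ> cyc m)) = cher_op (Suc m) k 0 p (x \<circ> cyc m)"
proof -
  have "(\<Sum>i<m. p (swap_coords i m x \<circ> cyc m)) = (\<Sum>i\<in>{0<..<Suc m}. p (swap_coords i 0 (x \<circ> cyc m)))"
    unfolding swap_comp[OF cyc_symg] inv_cyc
    by (rule sum.reindex_bij_witness[where i = "\<lambda>i. i - 1" and j = Suc]) (auto simp: icyc_def)
  thus ?thesis unfolding cher_op_def dunkl_op_permute[OF cyc_symg] unit_vec_comp[OF cyc_symg] inv_cyc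
    by (simp add: icyc_def cyc_def)
qed

lemma cher_op_Phi_last:
  assumes p: "sep_holo (Suc m) p" and x: "distinct_coords (Suc m) x"
  shows "cher_op (Suc m) k m (Phi m p) x = x m * (cher_op (Suc m) k 0 p (x \<circ> cyc m) + p (x \<circ> cyc m))"
proof -
  have s: "sep_holo (Suc m) (\<lambda>x. p (x \<circ> cyc m))" by (rule sep_holo_permute[OF p cyc_symg])
  have sets: "{..<Suc m} - {m} = {..<m}" "{m<..<Suc m} = {}" by auto
  show ?thesis unfolding Phi_def[abs_def] cher_op_def[of _ _ m] dunkl_op_coord_mult_same[OF s x lessI] sets last_op_cyc[symmetric]
    by (simp add: algebra_simps)
qed

text \<open>The commutator of T_j with x_m leaves -k x_j times a reflected value, which cancels the
  summand i = m of the reflection sum in \<open>cher_op\<close>. What remains is the operator of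
  index j + 1 after the cyclic shift.\<close>

lemma cher_op_Phi_other:
  assumes p: "sep_holo (Suc m) p" and x: "distinct_coords (Suc m) x" and j: "j < m"
  shows "cher_op (Suc m) k j (Phi m p) x = x m * cher_op (Suc m) k (Suc j) p (x \<circ> cyc m)"
proof -
  let ?h = "\<lambda>x. p (x \<circ> cyc m)"
  have s: "sep_holo (Suc m) ?h" by (rule sep_holo_permute[OF p cyc_symg])
  have ic: "icyc m j = Suc j" using j by (simp add: icyc_def)
  have sets: "{j<..<Suc m} = insert m {j<..<m}" using j by auto
  have 1: "(\<Sum>i\<in>{j<..<Suc m}. swap_coords i j x m * ?h (swap_coords i j x)) =
     x j * ?h (swap_coords m j x) + x m * (\<Sum>i\<in>{j<..<m}. ?h (swap_coords i j x))"
    unfolding sets using j by (auto simp: swap_coords_def sum_distrib_left intro!: sum.cong)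
  have 2: "(\<Sum>i\<in>{j<..<m}. ?h (swap_coords i j x)) = (\<Sum>i\<in>{Suc j<..<Suc m}. p (swap_coords i (Suc j) (x \<circ> cyc m)))"
    unfolding swap_comp[OF cyc_symg] inv_cyc ic
    by (rule sum.reindex_bij_witness[where i = "\<lambda>i. i - 1" and j = Suc]) (auto simp: icyc_def)
  have 3: "dunkl_op (Suc m) k (unit_vec j) ?h x = dunkl_op (Suc m) k (unit_vec (Suc j)) p (x \<circ> cyc m)"
    unfolding dunkl_op_permute[OF cyc_symg] unit_vec_comp[OF cyc_symg] inv_cyc ic ..
  have 4: "(x \<circ> cyc m) (Suc j) = x j" using j by (simp add: cyc_def)
  have jn: "j < Suc m" "j \<noteq> m" using j by auto
  show ?thesis
    unfolding Phi_def[abs_def] cher_op_def dunkl_op_coord_mult_other[OF s x jn(1) lessI jn(2)] 1 2 3 4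
    by (simp add: algebra_simps)
qed

text \<open>Moving the first entry to the end reverses the way its ties are decided, and adding 1
  compensates: eta_0 >= eta_q is equivalent to eta_0 + 1 > eta_q.\<close>

lemma rk_phi:
  assumes "p < Suc m"
  shows "rk (Suc m) (phi m \<eta>) p = rk (Suc m) \<eta> (icyc m p)"
proof -
  have bef: "before (phi m \<eta>) q p \<longleftrightarrow> before \<eta> (icyc m q) (icyc m p)" if "q < Suc m" for q
    using assms that by (auto simp: before_def phi_def icyc_def)
  have "{q. q < Suc m \<and> before \<eta> q (icyc m p)} = icyc m ` {q. q < Suc m \<and> before (phi m \<eta>) q p}"
  proof (intro set_eqI iffI)
    fix q assume q: "q \<in> {q. q < Suc m \<and> before \<eta> q (icyc m p)}"
    have "cyc m q < Suc m" using q by (auto simp: cyc_def)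
    moreover have "before (phi m \<eta>) (cyc m q) p" using q bef[of "cyc m q"] calculation by simp
    ultimately show "q \<in> icyc m ` {q. q < Suc m \<and> before (phi m \<eta>) q p}"
      by (intro image_eqI[of _ _ "cyc m q"]) auto
  next
    fix q assume "q \<in> icyc m ` {q. q < Suc m \<and> before (phi m \<eta>) q p}"
    then obtain r where "q = icyc m r" "r < Suc m" "before (phi m \<eta>) r p" by auto
    thus "q \<in> {q. q < Suc m \<and> before \<eta> q (icyc m p)}" using bef[of r] by (auto simp: icyc_def)
  qed
  moreover have "inj (icyc m)" by (metis injI cyc_icyc(1))
  ultimately show ?thesis unfolding rk_def by (simp add: card_image inj_on_subset[of _ UNIV])
qed

lemma eta_bar_phi:
  assumes "j < Suc m"
  shows "eta_bar (Suc m) k (phi m \<eta>) j = eta_bar (Suc m) k \<eta> (icyc m j) + (if j = m then 1 else 0)"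
proof -
  have "icyc m j < Suc m" using assms by (auto simp: icyc_def)
  thus ?thesis using assms by (simp add: eta_bar_rk rk_phi) (auto simp: phi_def icyc_def)
qed

lemma jack_eigen_Phi:
  assumes p: "sep_holo (Suc m) p" and e: "jack_eigen (Suc m) k \<eta> p"
  shows "jack_eigen (Suc m) k (phi m \<eta>) (Phi m p)"
  unfolding jack_eigen_def
proof (intro allI impI)
  fix j and x :: "nat => complex" assume j: "j < Suc m" and x: "distinct_coords (Suc m) x"
  have y: "distinct_coords (Suc m) (x \<circ> cyc m)" by (rule distinct_coords_permute[OF cyc_symg x])
  have E: "cher_op (Suc m) k i p (x \<circ> cyc m) = of_real (eta_bar (Suc m) k \<eta> i) * p (x \<circ> cyc m)" if "i < Suc m" for i
    using e y that by (simp add: jack_eigen_def)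
  show "cher_op (Suc m) k j (Phi m p) x = of_real (eta_bar (Suc m) k (phi m \<eta>) j) * Phi m p x"
  proof (cases "j = m")
    case True
    have "icyc m m = 0" by (simp add: icyc_def)
    thus ?thesis unfolding True cher_op_Phi_last[OF p x] eta_bar_phi[OF lessI] E[OF zero_less_Suc]
      by (simp add: Phi_def algebra_simps)
  next
    case False
    hence "j < m" "icyc m j = Suc j" using j by (auto simp: icyc_def)
    thus ?thesis using False by (simp add: cher_op_Phi_other[OF p x] eta_bar_phi[OF j] E Phi_def)
  qed
qed

lemma rk_swap_adj:
  assumes i: "Suc i < n" and ne: "\<eta> i \<noteq> \<eta> (Suc i)"
  shows "rk n (swap_coords i (Suc i) \<eta>) p = rk n \<eta> (Transposition.transpose i (Suc i) p)"
proof -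
  define t where "t = Transposition.transpose i (Suc i)"
  have t: "t \<in> symg n" unfolding t_def using i by (intro swap_symg) auto
  have tt: "t (t q) = q" for q by (simp add: t_def)
  have bef: "before (\<eta> \<circ> t) q p \<longleftrightarrow> before \<eta> (t q) (t p)" for q
  proof (cases "\<eta> (t q) = \<eta> (t p)")
    case True
    have "q < p \<longleftrightarrow> t q < t p"
      using True ne unfolding t_def Transposition.transpose_def by (auto split: if_splits)
    thus ?thesis using True by (simp add: before_def)
  qed (auto simp: before_def)
  have "{q. q < n \<and> before \<eta> q (t p)} = t ` {q. q < n \<and> before (\<eta> \<circ> t) q p}"
  proof (intro set_eqI iffI)
    fix q assume "q \<in> {q. q < n \<and> before \<eta> q (t p)}"
    hence "t q \<in> {q. q < n \<and> before (\<eta> \<circ> t) q p}" by (simp add: bef tt symg_lt[OF t])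
    thus "q \<in> t ` {q. q < n \<and> before (\<eta> \<circ> t) q p}" by (metis image_eqI tt)
  next
    fix q assume "q \<in> t ` {q. q < n \<and> before (\<eta> \<circ> t) q p}"
    thus "q \<in> {q. q < n \<and> before \<eta> q (t p)}" by (auto simp: bef symg_lt[OF t])
  qed
  thus ?thesis unfolding rk_def swap_coords_eq t_def[symmetric]
    by (simp add: card_image permutes_inj_on[OF symgD[OF t]])
qed

lemma eta_bar_swap_adj:
  assumes "Suc i < n" "\<eta> i \<noteq> \<eta> (Suc i)" "j < n"
  shows "eta_bar n k (swap_coords i (Suc i) \<eta>) j = eta_bar n k \<eta> (Transposition.transpose i (Suc i) j)"
proof -
  have "Transposition.transpose i (Suc i) j < n" using assms by (auto simp: Transposition.transpose_def)
  thus ?thesis using assms by (simp add: eta_bar_rk rk_swap_adj) (simp add: swap_coords_eq)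
qed

text \<open>Composition with the adjacent transposition exchanges the operators of index i and i + 1
  up to an error of k p and -k p respectively. The coefficient of p in the combination is the one
  for which these errors complete the exchanged eigenvalue.\<close>

lemma jack_eigen_swap:
  assumes p: "sep_holo n p" and e: "jack_eigen n k \<eta> p" and i: "Suc i < n" and ne: "\<eta> i \<noteq> \<eta> (Suc i)"
    and ab: "eta_bar n k \<eta> i \<noteq> eta_bar n k \<eta> (Suc i)"
  shows "jack_eigen n k (swap_coords i (Suc i) \<eta>)
     (\<lambda>x. p (swap_coords i (Suc i) x) + of_real (k / (eta_bar n k \<eta> (Suc i) - eta_bar n k \<eta> i)) * p x)"
  unfolding jack_eigen_def
proof (intro allI impI)
  fix j and x :: "nat => complex" assume j: "j < n" and x: "distinct_coords n x"
  define t where "t = Transposition.transpose i (Suc i)"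
  define a where "a = eta_bar n k \<eta>"
  define \<gamma> where "\<gamma> = k / (a (Suc i) - a i)"
  define y where "y = x \<circ> t"
  have t: "t \<in> symg n" unfolding t_def using i by (intro swap_symg) auto
  have tt: "t (t q) = q" for q by (simp add: t_def)
  have it: "inv t = t" by (simp add: inv_equality tt)
  have y: "distinct_coords n y" unfolding y_def by (rule distinct_coords_permute[OF t x])
  have E: "cher_op n k l p z = of_real (a l) * p z" if "l < n" "distinct_coords n z" for l z
    using e that by (simp add: jack_eigen_def a_def)
  have sp: "sep_holo n (\<lambda>x. p (x \<circ> t))" by (rule sep_holo_permute[OF p t])
  have "cher_op n k j (\<lambda>x. \<Sum>b\<in>{True, False}. (if b then 1 else of_real \<gamma>) * (if b then (\<lambda>x. p (x \<circ> t)) else p) x) x =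
     (\<Sum>b\<in>{True, False}. (if b then 1 else of_real \<gamma>) * cher_op n k j (if b then (\<lambda>x. p (x \<circ> t)) else p) x)"
    by (rule cher_op_sum) (use sp p j in auto)
  hence lin: "cher_op n k j (\<lambda>x. p (x \<circ> t) + of_real \<gamma> * p x) x = cher_op n k j (\<lambda>x. p (x \<circ> t)) x + of_real \<gamma> * (of_real (a j) * p x)"
    by (simp add: E[OF j x])
  have perm: "cher_op n k j (\<lambda>x. p (x \<circ> t)) x = y (t j) * dunkl_op n k (unit_vec (t j)) p y
     + of_real (k * (1 - real n)) * p y + of_real k * (\<Sum>l\<in>{j<..<n}. p (swap_coords (t l) (t j) y))"
    unfolding cher_op_permute[OF t] it y_def ..
  have yx: "swap_coords i (Suc i) y = x" "swap_coords (Suc i) i y = x"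
    unfolding y_def swap_coords_eq t_def by (auto simp: fun_eq_iff transpose_commute[of "Suc i" i])
  have ti: "t i = Suc i" "t (Suc i) = i" by (simp_all add: t_def)
  have tl: "t l = l" if "l \<noteq> i" "l \<noteq> Suc i" for l using that by (simp add: t_def)
  have key: "cher_op n k j (\<lambda>x. p (x \<circ> t)) x = of_real (a (t j)) * p y +
     (if j = i then of_real k * p x else if j = Suc i then - of_real k * p x else 0)"
  proof -
    consider "j = i" | "j = Suc i" | "j \<noteq> i" "j \<noteq> Suc i" by blast
    thus ?thesis
    proof cases
      case 1
      have s: "{i<..<n} = insert (Suc i) {Suc i<..<n}" using i by auto
      have "(\<Sum>l\<in>{i<..<n}. p (swap_coords (t l) (Suc i) y)) = p x + (\<Sum>l\<in>{Suc i<..<n}. p (swap_coords l (Suc i) y))"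
        unfolding s by (simp add: ti yx) (intro sum.cong, auto simp: tl)
      thus ?thesis using E[OF i y, unfolded cher_op_def] unfolding perm unfolding 1 ti by (simp add: algebra_simps)
    next
      case 2
      have s: "{i<..<n} = insert (Suc i) {Suc i<..<n}" using i by auto
      have "(\<Sum>l\<in>{i<..<n}. p (swap_coords l i y)) = p x + (\<Sum>l\<in>{Suc i<..<n}. p (swap_coords (t l) i y))"
        unfolding s by (simp add: yx) (intro sum.cong, auto simp: tl)
      thus ?thesis using E[of i y, unfolded cher_op_def] i y unfolding perm unfolding 2 ti by (simp add: algebra_simps)
    next
      case 3
      have "(\<Sum>l\<in>{j<..<n}. p (swap_coords (t l) j y)) = (\<Sum>l\<in>{j<..<n}. p (swap_coords l j y))"
      proof -
        have mem: "t l \<in> {j<..<n}" if "l \<in> {j<..<n}" for l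
          using that 3 i by (cases "l = i \<or> l = Suc i") (auto simp: ti tl)
        show ?thesis
          by (rule sum.reindex_bij_witness[where i = t and j = t]) (use mem tt in \<open>simp_all only:\<close>)
      qed
      thus ?thesis using E[OF j y, unfolded cher_op_def] 3 unfolding perm unfolding tl[OF 3] by simp
    qed
  qed
  have g: "of_real \<gamma> * of_real (a (Suc i)) - of_real \<gamma> * of_real (a i) = complex_of_real k"
  proof -
    have "\<gamma> * (a (Suc i) - a i) = k" using ab by (simp add: \<gamma>_def a_def)
    hence "\<gamma> * a (Suc i) - \<gamma> * a i = k" by (simp only: right_diff_distrib)
    thus ?thesis by (metis of_real_diff of_real_mult)
  qed
  have "cher_op n k j (\<lambda>x. p (x \<circ> t) + of_real \<gamma> * p x) x = of_real (a (t j)) * (p y + of_real \<gamma> * p x)"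
  proof -
    consider "j = i" | "j = Suc i" | "j \<noteq> i" "j \<noteq> Suc i" by blast
    thus ?thesis
    proof cases
      case 1
      have "(of_real \<gamma> * of_real (a (Suc i))) * p x = (of_real \<gamma> * of_real (a i) + of_real k) * p x"
        using g by (simp add: algebra_simps)
      thus ?thesis unfolding lin key by (simp add: 1 ti algebra_simps)
    next
      case 2
      have "(of_real \<gamma> * of_real (a (Suc i))) * p x = (of_real \<gamma> * of_real (a i) + of_real k) * p x"
        using g by (simp add: algebra_simps)
      thus ?thesis unfolding lin key by (simp add: 2 ti algebra_simps)
    next
      case 3
      thus ?thesis unfolding lin key by (simp add: tl algebra_simps)
    qed
  qed
  thus "cher_op n k j (\<lambda>x. p (swap_coords i (Suc i) x) + of_real (k / (eta_bar n k \<eta> (Suc i) - eta_bar n k \<eta> i)) * p x) x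
    = of_real (eta_bar n k (swap_coords i (Suc i) \<eta>) j) *
      (p (swap_coords i (Suc i) x) + of_real (k / (eta_bar n k \<eta> (Suc i) - eta_bar n k \<eta> i)) * p x)"
    unfolding eta_bar_swap_adj[OF i ne j] unfolding swap_coords_eq t_def[symmetric] a_def[symmetric] \<gamma>_def[symmetric] y_def .
qed

text \<open>At an adjacent ascent the denominator in \<open>jack_eigen_swap\<close> is positive, so
  the coefficient used there is nonnegative and positivity of coefficients is preserved.\<close>

lemma eta_bar_adj_less:
  assumes "k \<ge> 0" "Suc i < n" "\<eta> i < \<eta> (Suc i)"
  shows "eta_bar n k \<eta> i < eta_bar n k \<eta> (Suc i)"
proof -
  have "rk n \<eta> (Suc i) < rk n \<eta> i" using assms by (intro rk_less) (auto simp: before_def)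
  hence 1: "k * real (rk n \<eta> (Suc i)) \<le> k * real (rk n \<eta> i)" using assms(1) by (simp add: mult_left_mono)
  have 2: "real (\<eta> i) < real (\<eta> (Suc i))" using assms(3) by simp
  have "i < n" using assms(2) by simp
  have "real (\<eta> i) - k * real (rk n \<eta> i) < real (\<eta> (Suc i)) - k * real (rk n \<eta> (Suc i))"
    by (rule less_le_trans[OF diff_strict_right_mono[OF 2] diff_left_mono[OF 1]])
  thus ?thesis using eta_bar_rk[OF assms(2), of k \<eta>] eta_bar_rk[OF \<open>i < n\<close>, of k \<eta>] by simp
qed

section \<open>Polynomials with positive coefficients\<close>

text \<open>Exponents may be repeated in the list. Sums are then concatenations and substitutions
  are maps, and since all weights of a \<open>pos_list\<close> are positive, the exponents with
  nonzero coefficient are exactly those listed.\<close>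

definition lpoly :: "nat => (real \<times> (nat => nat)) list => (nat => complex) => complex" where
  "lpoly n L x = (\<Sum>(r, \<alpha>)\<leftarrow>L. of_real r * mono n \<alpha> x)"

definition pos_list :: "nat => (real \<times> (nat => nat)) list => bool" where
  "pos_list n L \<longleftrightarrow> L \<noteq> [] \<and> (\<forall>(r, \<alpha>)\<in>set L. r > 0 \<and> mindex n \<alpha>)"

definition lcoeff :: "(real \<times> (nat => nat)) list => (nat => nat) => real" where
  "lcoeff L \<alpha> = (\<Sum>(r, \<beta>)\<leftarrow>L. if \<beta> = \<alpha> then r else 0)"

lemma lcoeff_nonneg: "(\<forall>(r, \<alpha>)\<in>set L. r > 0) ==> lcoeff L \<alpha> \<ge> 0"
  by (induction L) (auto simp: lcoeff_def)

lemma lcoeff_pos_iff: "(\<forall>(r, \<alpha>)\<in>set L. r > 0) ==> lcoeff L \<alpha> > 0 \<longleftrightarrow> \<alpha> \<in> snd ` set L"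
proof (induction L)
  case Nil
  show ?case by (simp add: lcoeff_def)
next
  case (Cons a L)
  have "lcoeff L \<alpha> \<ge> 0" using Cons.prems by (intro lcoeff_nonneg) auto
  moreover have "lcoeff (a # L) \<alpha> = (if snd a = \<alpha> then fst a else 0) + lcoeff L \<alpha>"
    by (simp add: lcoeff_def case_prod_unfold)
  ultimately show ?case using Cons by (cases a) auto
qed

lemma lpoly_sum:
  assumes "finite A" "snd ` set L \<subseteq> A"
  shows "lpoly n L x = (\<Sum>\<alpha>\<in>A. of_real (lcoeff L \<alpha>) * mono n \<alpha> x)"
  using assms(2)
proof (induction L)
  case Nil
  show ?case by (simp add: lpoly_def lcoeff_def)
next
  case (Cons a L)
  obtain r \<beta> where a: "a = (r, \<beta>)" by (cases a)
  have "\<beta> \<in> A" using Cons.prems a by auto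
  have "(\<Sum>\<alpha>\<in>A. of_real (lcoeff (a # L) \<alpha>) * mono n \<alpha> x) =
     (\<Sum>\<alpha>\<in>A. (if \<alpha> = \<beta> then of_real r * mono n \<alpha> x else 0) + of_real (lcoeff L \<alpha>) * mono n \<alpha> x)"
    by (intro sum.cong) (auto simp: a lcoeff_def distrib_right)
  also have "\<dots> = of_real r * mono n \<beta> x + lpoly n L x"
    using Cons \<open>\<beta> \<in> A\<close> assms(1) by (simp add: sum.distrib)
  finally show ?case by (simp add: a lpoly_def)
qed

lemma lpoly_rep:
  assumes "pos_list n L"
  shows "poly_rep n (lpoly n L) (\<lambda>\<alpha>. of_real (lcoeff L \<alpha>))" "(\<lambda>\<alpha>. complex_of_real (lcoeff L \<alpha>)) \<noteq> (\<lambda>_. 0)"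
proof -
  have pos: "\<forall>(r, \<alpha>)\<in>set L. r > 0" using assms by (auto simp: pos_list_def)
  have ne: "lcoeff L \<alpha> \<noteq> 0 \<longleftrightarrow> \<alpha> \<in> snd ` set L" for \<alpha>
    using lcoeff_pos_iff[OF pos, of \<alpha>] lcoeff_nonneg[OF pos, of \<alpha>] by linarith
  hence A: "{\<alpha>. complex_of_real (lcoeff L \<alpha>) \<noteq> 0} = snd ` set L" by auto
  show "poly_rep n (lpoly n L) (\<lambda>\<alpha>. of_real (lcoeff L \<alpha>))"
    unfolding poly_rep_def A
  proof (intro conjI allI impI)
    show "mindex n \<alpha>" if "complex_of_real (lcoeff L \<alpha>) \<noteq> 0" for \<alpha>
      using that ne[of \<alpha>] assms by (auto simp: pos_list_def)
    show "lpoly n L x = (\<Sum>\<alpha>\<in>snd ` set L. of_real (lcoeff L \<alpha>) * mono n \<alpha> x)" for x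
      by (rule lpoly_sum) auto
  qed auto
  obtain r \<alpha> where "(r, \<alpha>) \<in> set L" using assms by (cases L) (auto simp: pos_list_def)
  hence "\<alpha> \<in> snd ` set L" by force
  hence "complex_of_real (lcoeff L \<alpha>) \<noteq> 0" using ne by auto
  thus "(\<lambda>\<alpha>. complex_of_real (lcoeff L \<alpha>)) \<noteq> (\<lambda>_. 0)" by metis
qed

lemma lpoly_permute:
  assumes "\<tau> \<in> symg n"
  shows "lpoly n L (x \<circ> \<tau>) = lpoly n (map (\<lambda>(r, \<alpha>). (r, \<alpha> \<circ> inv \<tau>)) L) x"
proof (induction L)
  case (Cons a L)
  obtain r \<alpha> where a: "a = (r, \<alpha>)" by (cases a)
  show ?case using Cons.IH unfolding lpoly_def a list.map sum_list.Cons case_prod_conv mono_comp[OF assms] by simp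
qed (simp add: lpoly_def)

lemma pos_list_permute: "\<tau> \<in> symg n ==> pos_list n L ==> pos_list n (map (\<lambda>(r, \<alpha>). (r, \<alpha> \<circ> inv \<tau>)) L)"
  by (auto simp: pos_list_def intro!: mindex_comp symg_inv)

lemma lpoly_append: "lpoly n (L @ L') x = lpoly n L x + lpoly n L' x"
  by (simp add: lpoly_def)

lemma lpoly_scale: "lpoly n (map (\<lambda>(r, \<alpha>). (c * r, \<alpha>)) L) x = of_real c * lpoly n L x"
  by (induction L) (auto simp: lpoly_def algebra_simps)

lemma lpoly_Phi: "Phi m (lpoly (Suc m) L) = lpoly (Suc m) (map (\<lambda>(r, \<alpha>). (r, phi m \<alpha>)) L)"
proof
  fix x :: "nat => complex"
  have "x m * mono (Suc m) \<alpha> (x \<circ> cyc m) = mono (Suc m) (phi m \<alpha>) x" for \<alpha>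
    using Phi_mono[of m \<alpha>] by (metis Phi_def)
  thus "Phi m (lpoly (Suc m) L) x = lpoly (Suc m) (map (\<lambda>(r, \<alpha>). (r, phi m \<alpha>)) L) x"
    by (induction L) (auto simp: Phi_def lpoly_def algebra_simps)
qed

definition pos_poly :: "nat => ((nat => complex) => complex) => bool" where
  "pos_poly n p \<longleftrightarrow> (\<exists>L. pos_list n L \<and> p = lpoly n L)"

lemma sep_holo_pos_poly: "pos_poly n p ==> sep_holo n p"
  by (auto simp: pos_poly_def intro: sep_holo_poly lpoly_rep)

lemma pos_poly_1: "pos_poly n (\<lambda>_. 1)"
  unfolding pos_poly_def
  by (intro exI[of _ "[(1, \<lambda>_. 0)]"]) (auto simp: pos_list_def mindex_def lpoly_def mono_def)

lemma pos_poly_Phi: "pos_poly (Suc m) p ==> pos_poly (Suc m) (Phi m p)"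
  unfolding pos_poly_def
proof (elim exE conjE)
  fix L assume "pos_list (Suc m) L" "p = lpoly (Suc m) L"
  thus "\<exists>L. pos_list (Suc m) L \<and> Phi m p = lpoly (Suc m) L"
    by (intro exI[of _ "map (\<lambda>(r, \<alpha>). (r, phi m \<alpha>)) L"]) (auto simp: lpoly_Phi pos_list_def intro!: mindex_phi)
qed

lemma pos_poly_permute: "pos_poly n p ==> \<tau> \<in> symg n ==> pos_poly n (\<lambda>x. p (x \<circ> \<tau>))"
  unfolding pos_poly_def
  by (elim exE conjE, rule exI, rule conjI[OF pos_list_permute]) (auto simp: lpoly_permute)

lemma pos_poly_add: "pos_poly n p ==> pos_poly n q ==> pos_poly n (\<lambda>x. p x + q x)"
  unfolding pos_poly_def
proof (elim exE conjE)
  fix L L' assume "pos_list n L" "p = lpoly n L" "pos_list n L'" "q = lpoly n L'"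
  thus "\<exists>L. pos_list n L \<and> (\<lambda>x. p x + q x) = lpoly n L"
    by (intro exI[of _ "L @ L'"]) (auto simp: lpoly_append pos_list_def)
qed

lemma pos_poly_cmult: "pos_poly n p ==> c > 0 ==> pos_poly n (\<lambda>x. of_real c * p x)"
  unfolding pos_poly_def
proof (elim exE conjE)
  fix L assume "pos_list n L" "p = lpoly n L" "c > 0"
  thus "\<exists>L. pos_list n L \<and> (\<lambda>x. of_real c * p x) = lpoly n L"
    by (intro exI[of _ "map (\<lambda>(r, \<alpha>). (c * r, \<alpha>)) L"]) (auto simp: lpoly_scale pos_list_def)
qed

lemma jack_eigen_1: "jack_eigen n k (\<lambda>_. 0) (\<lambda>_. 1)"
  unfolding jack_eigen_def
proof (intro allI impI)
  fix j and x :: "nat => complex" assume j: "j < n"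
  have "{q. q < n \<and> before (\<lambda>_. 0) q j} = {..<j}" using j by (auto simp: before_def)
  hence "rk n (\<lambda>_. 0) j = j" by (simp add: rk_def)
  moreover have "card {j<..<n} = n - Suc j" by simp
  ultimately show "cher_op n k j (\<lambda>_. 1) x = complex_of_real (eta_bar n k (\<lambda>_. 0) j) * 1"
    using j by (simp add: cher_op_def eta_bar_rk of_nat_diff algebra_simps)
qed

text \<open>Every composition is reached from zero by raising (Phi) and by exchanging an adjacent ascent.\<close>

lemma jack_induct:
  assumes k: "k \<ge> 0" and m: "mindex (Suc m) \<eta>"
    and base: "P (\<lambda>_. 0) (\<lambda>_. 1)"
    and Phi: "\<And>\<eta> p. mindex (Suc m) \<eta> ==> pos_poly (Suc m) p ==> jack_eigen (Suc m) k \<eta> p ==> P \<eta> p ==> P (phi m \<eta>) (Phi m p)"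
    and swap: "\<And>\<eta> p i c. mindex (Suc m) \<eta> ==> i < m ==> pos_poly (Suc m) p ==> P \<eta> p ==>
       P (swap_coords i (Suc i) \<eta>) (\<lambda>x. p (swap_coords i (Suc i) x) + of_real c * p x)"
  shows "\<exists>p. pos_poly (Suc m) p \<and> jack_eigen (Suc m) k \<eta> p \<and> P \<eta> p"
  using m
\<comment> \<open>Undoing a raising lowers the degree; otherwise the degree is kept and moving a
  positive entry to the right lowers the sum weighted by m - i.\<close>
proof (induction \<eta> rule: wf_induct_rule[OF wf_measures[of "[\<lambda>\<eta>. \<Sum>i<Suc m. \<eta> i, \<lambda>\<eta>. \<Sum>i<Suc m. (m - i) * \<eta> i]"]])
  case (1 \<eta>)
  show ?case
  proof (cases "\<eta> m > 0")
    case True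
    \<comment> \<open>The preimage under \<open>phi\<close>: the last entry, lowered by one, returns
      to the front.\<close>
    define \<kappa> where "\<kappa> = (\<lambda>i. if i = 0 then \<eta> m - 1 else if i \<le> m then \<eta> (i - 1) else 0)"
    have mk: "mindex (Suc m) \<kappa>" by (auto simp: \<kappa>_def mindex_def)
    have phk: "phi m \<kappa> = \<eta>"
      using True 1(2) by (auto simp: phi_def \<kappa>_def icyc_def fun_eq_iff mindex_def)
    have "(\<Sum>i<Suc m. \<kappa> i) = \<kappa> 0 + (\<Sum>i<m. \<kappa> (Suc i))" by (rule sum.lessThan_Suc_shift)
    also have "(\<Sum>i<m. \<kappa> (Suc i)) = (\<Sum>i<m. \<eta> i)" by (intro sum.cong) (auto simp: \<kappa>_def)
    finally have "(\<Sum>i<Suc m. \<kappa> i) < (\<Sum>i<Suc m. \<eta> i)" using True by (simp add: \<kappa>_def)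
    hence "(\<kappa>, \<eta>) \<in> measures [\<lambda>\<eta>. \<Sum>i<Suc m. \<eta> i, \<lambda>\<eta>. \<Sum>i<Suc m. (m - i) * \<eta> i]" by simp
    from 1(1)[OF this mk] obtain p where p: "pos_poly (Suc m) p" "jack_eigen (Suc m) k \<kappa> p" "P \<kappa> p" by blast
    have "pos_poly (Suc m) (Phi m p)" "jack_eigen (Suc m) k \<eta> (Phi m p)" "P \<eta> (Phi m p)"
      using pos_poly_Phi[OF p(1)] jack_eigen_Phi[OF sep_holo_pos_poly[OF p(1)] p(2)] Phi[OF mk p] by (simp_all add: phk)
    thus ?thesis by blast
  next
    case False
    show ?thesis
    proof (cases "\<eta> = (\<lambda>_. 0)")
      case True
      thus ?thesis using base pos_poly_1 jack_eigen_1 by blast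
    next
      case nz: False
      then obtain q where q: "\<eta> q > 0" by (auto simp: fun_eq_iff)
      \<comment> \<open>The last nonzero position; it lies before m in this case, and its right
        neighbour is 0. After the exchange the pair is an ascent, as the sign of the coefficient
        requires.\<close>
      define i where "i = Max {i. i < Suc m \<and> \<eta> i > 0}"
      have "q < Suc m" using q 1(2) by (metis mindex_def not_less less_irrefl)
      hence ne: "{i. i < Suc m \<and> \<eta> i > 0} \<noteq> {}" using q by auto
      have fin: "finite {i. i < Suc m \<and> \<eta> i > 0}" by simp
      have i: "i < Suc m" "\<eta> i > 0" using Max_in[OF fin ne] by (auto simp: i_def)
      have im: "i < m" using i False by (cases "i = m") auto
      have z: "\<eta> (Suc i) = 0"
      proof (rule ccontr)
        assume "\<eta> (Suc i) \<noteq> 0"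
        hence "Suc i \<le> i" unfolding i_def using fin im by (intro Max_ge) (auto simp: i_def)
        thus False by simp
      qed
      define \<kappa> where "\<kappa> = swap_coords i (Suc i) \<eta>"
      have \<kappa>i: "\<kappa> i = 0" "\<kappa> (Suc i) = \<eta> i" by (auto simp: \<kappa>_def swap_coords_def z)
      have mk: "mindex (Suc m) \<kappa>" using 1(2) im by (auto simp: \<kappa>_def mindex_def swap_coords_def)
      have swk: "swap_coords i (Suc i) \<kappa> = \<eta>" by (auto simp: \<kappa>_def swap_coords_def fun_eq_iff)
      have split: "(\<Sum>l<Suc m. g l) = g i + g (Suc i) + (\<Sum>l\<in>{..<Suc m}-{i, Suc i}. g l)" for g :: "nat => nat"
      proof -
        have "{..<Suc m} = insert i (insert (Suc i) ({..<Suc m}-{i, Suc i}))" using im by auto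
        hence "(\<Sum>l<Suc m. g l) = (\<Sum>l\<in>insert i (insert (Suc i) ({..<Suc m}-{i, Suc i})). g l)" by simp
        also have "\<dots> = g i + g (Suc i) + (\<Sum>l\<in>{..<Suc m}-{i, Suc i}. g l)" by (subst sum.insert) auto
        finally show ?thesis .
      qed
      have rest: "(\<Sum>l\<in>{..<Suc m}-{i, Suc i}. g l (\<kappa> l)) = (\<Sum>l\<in>{..<Suc m}-{i, Suc i}. g l (\<eta> l))" for g :: "nat => nat => nat"
        by (intro sum.cong) (auto simp: \<kappa>_def swap_coords_def)
      have "(\<Sum>l<Suc m. \<kappa> l) = (\<Sum>l<Suc m. \<eta> l)"
        unfolding split[of \<kappa>] split[of \<eta>] using rest[of "\<lambda>l y. y"] by (simp add: \<kappa>i z)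
      moreover have "(\<Sum>l<Suc m. (m - l) * \<kappa> l) < (\<Sum>l<Suc m. (m - l) * \<eta> l)"
      proof -
        have "(m - Suc i) * \<eta> i < (m - i) * \<eta> i" using im i by (intro mult_strict_right_mono) auto
        thus ?thesis unfolding split[of "\<lambda>l. (m - l) * \<kappa> l"] split[of "\<lambda>l. (m - l) * \<eta> l"]
          using rest[of "\<lambda>l y. (m - l) * y"] by (simp add: \<kappa>i z)
      qed
      ultimately have "(\<kappa>, \<eta>) \<in> measures [\<lambda>\<eta>. \<Sum>i<Suc m. \<eta> i, \<lambda>\<eta>. \<Sum>i<Suc m. (m - i) * \<eta> i]" by simp
      from 1(1)[OF this mk] obtain p where p: "pos_poly (Suc m) p" "jack_eigen (Suc m) k \<kappa> p" "P \<kappa> p" by blast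
      have si: "Suc i < Suc m" using im by simp
      have less: "eta_bar (Suc m) k \<kappa> i < eta_bar (Suc m) k \<kappa> (Suc i)"
        using si i by (intro eta_bar_adj_less k) (auto simp: \<kappa>i)
      define c where "c = k / (eta_bar (Suc m) k \<kappa> (Suc i) - eta_bar (Suc m) k \<kappa> i)"
      have c: "c \<ge> 0" using k less by (simp add: c_def)
      define r where "r = (\<lambda>x. p (swap_coords i (Suc i) x) + complex_of_real c * p x)"
      have pp: "pos_poly (Suc m) (\<lambda>x. p (swap_coords i (Suc i) x))"
        unfolding swap_coords_eq using im by (intro pos_poly_permute p swap_symg) auto
      have "pos_poly (Suc m) r"
      proof (cases "c = 0")
        case True thus ?thesis using pp by (simp add: r_def)
      next
        case False thus ?thesis using c unfolding r_def by (intro pos_poly_add pp pos_poly_cmult p) auto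
      qed
      moreover have "jack_eigen (Suc m) k \<eta> r"
        using jack_eigen_swap[OF sep_holo_pos_poly[OF p(1)] p(2) si] less i
        by (simp add: swk r_def c_def \<kappa>i)
      moreover have "P \<eta> r" using swap[OF mk im p(1) p(3), of c] by (simp add: swk r_def)
      ultimately show ?thesis by blast
    qed
  qed
qed

lemma nsjack_pos:
  assumes k: "k \<ge> 0" and m: "mindex n \<eta>" and p: "pos_poly n p" and e: "jack_eigen n k \<eta> p"
  shows "\<exists>a L. a > 0 \<and> pos_list n L \<and> p = lpoly n L \<and> \<eta> \<in> snd ` set L \<and> nsjack n k \<eta> = (\<lambda>x. of_real a * p x)"
proof -
  obtain L where L: "pos_list n L" "p = lpoly n L" using p by (auto simp: pos_poly_def)
  have pos: "\<forall>(r, \<alpha>)\<in>set L. r > 0" using L by (auto simp: pos_list_def)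
  have c: "complex_of_real (lcoeff L \<eta>) \<noteq> 0" and ns: "nsjack n k \<eta> = (\<lambda>x. p x / of_real (lcoeff L \<eta>))"
    using nsjack_eq[OF k m lpoly_rep[OF L(1)] e[unfolded L(2)]] L(2) by auto
  have c': "lcoeff L \<eta> > 0" using c lcoeff_nonneg[OF pos, of \<eta>] by simp
  hence "\<eta> \<in> snd ` set L" using lcoeff_pos_iff[OF pos] by blast
  thus ?thesis using L ns c' by (intro exI[of _ "1 / lcoeff L \<eta>"] exI[of _ L]) simp
qed

text \<open>Positive coefficients cannot cancel under symmetrisation, and the identity permutation
  contributes the exponent \<open>lam\<close>. The coefficient to be normalised is therefore
  nonzero, which gives existence and uniqueness in the definite description.\<close>

lemma symjack_eq:
  assumes k: "k \<ge> 0" and m: "mindex n lam" and p: "pos_poly n p" and e: "jack_eigen n k lam p"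
  shows "\<exists>a. symjack n k lam = (\<lambda>x. a * (\<Sum>\<sigma>\<in>symg n. nsjack n k lam (x \<circ> \<sigma>)))"
proof -
  obtain a L where aL: "a > 0" "pos_list n L" "p = lpoly n L" "lam \<in> snd ` set L" "nsjack n k lam = (\<lambda>x. of_real a * p x)"
    using nsjack_pos[OF assms] by blast
  define S where "S x = (\<Sum>\<sigma>\<in>symg n. nsjack n k lam (x \<circ> \<sigma>))" for x
  obtain ss where ss: "set ss = symg n" "distinct ss" using finite_distinct_list[OF finite_symg] by blast
  define M where "M = concat (map (\<lambda>\<sigma>. map (\<lambda>(r, \<alpha>). (a * r, \<alpha> \<circ> inv \<sigma>)) L) ss)"
  have S: "S = lpoly n M"
  proof
    fix x :: "nat => complex"
    have "nsjack n k lam (x \<circ> \<sigma>) = lpoly n (map (\<lambda>(r, \<alpha>). (a * r, \<alpha> \<circ> inv \<sigma>)) L) x" if "\<sigma> \<in> symg n" for \<sigma>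
    proof -
      have "map (\<lambda>(r, \<alpha>). (a * r, \<alpha> \<circ> inv \<sigma>)) L = map (\<lambda>(r, \<alpha>). (a * r, \<alpha>)) (map (\<lambda>(r, \<alpha>). (r, \<alpha> \<circ> inv \<sigma>)) L)" by auto
      thus ?thesis using that by (simp only: lpoly_scale aL(5) aL(3) lpoly_permute)
    qed
    hence "S x = (\<Sum>\<sigma>\<leftarrow>ss. lpoly n (map (\<lambda>(r, \<alpha>). (a * r, \<alpha> \<circ> inv \<sigma>)) L) x)"
      unfolding S_def sum_list_distinct_conv_sum_set[OF ss(2)] ss(1) by simp
    also have "\<dots> = lpoly n M x" unfolding M_def
      by (induction ss) (simp_all add: lpoly_append, simp add: lpoly_def)
    finally show "S x = lpoly n M x" .
  qed
  have posM: "\<forall>(r, \<alpha>)\<in>set M. r > 0 \<and> mindex n \<alpha>"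
    using aL(1,2) ss(1) by (auto simp: M_def pos_list_def intro!: mindex_comp symg_inv)
  have "lam \<in> snd ` set M"
  proof -
    obtain r where r: "(r, lam) \<in> set L" using aL(4) by auto
    have "(a * r, lam) \<in> set (map (\<lambda>(r, \<alpha>). (a * r, \<alpha> \<circ> inv id)) L)" using r by force
    moreover have "set M = (\<Union>\<sigma>\<in>symg n. set (map (\<lambda>(r, \<alpha>). (a * r, \<alpha> \<circ> inv \<sigma>)) L))"
      by (simp add: M_def ss(1))
    ultimately have "(a * r, lam) \<in> set M" by (simp only:) (rule UN_I[OF id_symg])
    thus ?thesis by (rule rev_image_eqI) simp
  qed
  moreover have "\<forall>(r, \<alpha>)\<in>set M. r > 0" using posM by auto
  ultimately have b: "lcoeff M lam > 0" using lcoeff_pos_iff by blast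
  have "M \<noteq> []" using \<open>lam \<in> snd ` set M\<close> by auto
  hence plM: "pos_list n M" using posM by (auto simp: pos_list_def)
  have sumS: "(\<Sum>\<sigma>\<in>{\<sigma>. \<sigma> permutes {..<n}}. nsjack n k lam (perm_act \<sigma> x)) = S x" for x
  proof -
    have "(\<Sum>\<sigma>\<in>symg n. nsjack n k lam (x \<circ> inv \<sigma>)) = S x"
      unfolding S_def by (rule sum.reindex_bij_betw[OF bij_symg_inv])
    thus ?thesis by (simp add: symg_def perm_act_def comp_def)
  qed
  have co: "poly_coeff n (\<lambda>x. c * S x) lam = c * of_real (lcoeff M lam)" for c
  proof -
    have R: "poly_rep n (lpoly n M) (\<lambda>\<alpha>. of_real (lcoeff M \<alpha>))" by (rule lpoly_rep[OF plM])
    let ?A = "{\<alpha>. complex_of_real (lcoeff M \<alpha>) \<noteq> 0}"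
    have A: "finite ?A" "\<And>\<alpha>. \<alpha> \<in> ?A ==> mindex n \<alpha>" using R by (auto simp: poly_rep_def)
    have "(\<lambda>x. c * S x) = (\<lambda>x. \<Sum>\<alpha>\<in>?A. (c * of_real (lcoeff M \<alpha>)) * mono n \<alpha> x)"
      using R unfolding S poly_rep_def by (simp add: sum_distrib_left mult.assoc fun_eq_iff)
    moreover have "lam \<in> ?A" using b by simp
    ultimately show ?thesis using poly_coeff_eq[OF poly_rep_sum[OF A, of "\<lambda>\<alpha>. c * of_real (lcoeff M \<alpha>)"], of lam] by simp
  qed
  have "symjack n k lam = (\<lambda>x. (1 / of_real (lcoeff M lam)) * S x)"
    unfolding symjack_def sumS
  proof (rule the_equality, intro conjI)
    show "poly_coeff n (\<lambda>x. (1 / of_real (lcoeff M lam)) * S x) lam = 1" unfolding co using b by simp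
    fix q assume q: "(\<exists>c::complex. \<forall>x. q x = c * S x) \<and> poly_coeff n q lam = 1"
    then obtain c where c: "q = (\<lambda>x. c * S x)" by blast
    have "c * of_real (lcoeff M lam) = 1" using q unfolding c co by simp
    hence "c = 1 / of_real (lcoeff M lam)" using b by (simp add: field_simps)
    thus "q = (\<lambda>x. (1 / of_real (lcoeff M lam)) * S x)" using c by simp
  qed blast
  thus ?thesis unfolding S_def by blast
qed

section \<open>Integration over the orthant\<close>

lemma integrable_cong_imp:
  assumes "\<And>x. x \<in> space M ==> f x = g x" "integrable M f"
  shows "integrable M g"
  using Bochner_Integration.integrable_cong[of M M f g] assms by blast

lemma psf: "product_sigma_finite (\<lambda>_::nat. lborel :: real measure)"
  by unfold_locales

lemma space_lebesgue_n: "space (lebesgue_n n) = PiE {..<n} (\<lambda>_. UNIV)"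
  by (simp add: lebesgue_n_def space_PiM)

lemma pos_orthant_eq: "pos_orthant n = PiE {..<n} (\<lambda>_. {0<..})"
  by (auto simp: pos_orthant_def space_lebesgue_n PiE_def)

lemma pos_orthant_sets [measurable]: "pos_orthant n \<in> sets (lebesgue_n n)"
  unfolding pos_orthant_eq lebesgue_n_def by (rule sets_PiM_I_finite) auto

lemma coord_measurable [measurable]: "i < n ==> (\<lambda>x. x i) \<in> borel_measurable (lebesgue_n n)"
  unfolding lebesgue_n_def using measurable_component_singleton[of i "{..<n}" "\<lambda>_. lborel"] by simp

lemma permute_measurable:
  assumes "\<sigma> \<in> symg n"
  shows "(\<lambda>x. x \<circ> \<sigma>) \<in> measurable (lebesgue_n n) (lebesgue_n n)"
  unfolding lebesgue_n_def
proof (rule measurable_PiM_single')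
  fix i assume "i \<in> {..<n}"
  hence "\<sigma> i \<in> {..<n}" using assms by (simp add: symg_lt)
  thus "(\<lambda>x. (x \<circ> \<sigma>) i) \<in> measurable (PiM {..<n} (\<lambda>_. lborel)) lborel"
    by simp
qed (use assms in \<open>auto simp: space_PiM PiE_def extensional_def symg_lt\<close>)

lemma distr_permute:
  assumes \<sigma>: "\<sigma> \<in> symg n"
  shows "distr (lebesgue_n n) (lebesgue_n n) (\<lambda>x. x \<circ> \<sigma>) = lebesgue_n n"
  unfolding lebesgue_n_def
proof (rule product_sigma_finite.PiM_eqI[OF psf])
  fix A :: "nat => real set" assume A: "\<And>i. i \<in> {..<n} ==> A i \<in> sets lborel"
  let ?M = "PiM {..<n} (\<lambda>_. lborel :: real measure)"
  have "(\<lambda>x. x \<circ> \<sigma>) -` PiE {..<n} A \<inter> space ?M = PiE {..<n} (A \<circ> inv \<sigma>)"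
  proof (intro set_eqI iffI)
    fix x assume x: "x \<in> (\<lambda>x. x \<circ> \<sigma>) -` PiE {..<n} A \<inter> space ?M"
    show "x \<in> PiE {..<n} (A \<circ> inv \<sigma>)"
    proof (rule PiE_I)
      fix i assume "i \<in> {..<n}"
      hence "inv \<sigma> i \<in> {..<n}" using \<sigma> by (simp add: symg_lt[OF symg_inv])
      hence "(x \<circ> \<sigma>) (inv \<sigma> i) \<in> A (inv \<sigma> i)" using x by (auto simp: PiE_def Pi_def)
      thus "x i \<in> (A \<circ> inv \<sigma>) i" using \<sigma> by simp
    qed (use x in \<open>auto simp: space_PiM PiE_def extensional_def\<close>)
  next
    fix x assume x: "x \<in> PiE {..<n} (A \<circ> inv \<sigma>)"
    have "(x \<circ> \<sigma>) i \<in> A i" if "i < n" for i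
      using PiE_mem[OF x, of "\<sigma> i"] that \<sigma> by (simp add: symg_lt)
    moreover have "(x \<circ> \<sigma>) i = undefined" if "\<not> i < n" for i
      using x that \<sigma> by (auto simp: PiE_def extensional_def symg_lt)
    ultimately show "x \<in> (\<lambda>x. x \<circ> \<sigma>) -` PiE {..<n} A \<inter> space ?M"
      using x by (auto simp: space_PiM PiE_def extensional_def)
  qed
  hence "emeasure (distr ?M ?M (\<lambda>x. x \<circ> \<sigma>)) (PiE {..<n} A) = emeasure ?M (PiE {..<n} (A \<circ> inv \<sigma>))"
    using A permute_measurable[OF \<sigma>] by (subst emeasure_distr) (auto simp: lebesgue_n_def intro!: sets_PiM_I_finite)
  also have "\<dots> = (\<Prod>i<n. emeasure lborel ((A \<circ> inv \<sigma>) i))"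
    using A \<sigma> by (intro product_sigma_finite.emeasure_PiM[OF psf]) (auto simp: symg_lt[OF symg_inv])
  also have "\<dots> = (\<Prod>i<n. emeasure lborel (A i))"
    using prod.reindex_bij_betw[OF permutes_imp_bij[OF symgD[OF symg_inv[OF \<sigma>]]], of "\<lambda>i. emeasure lborel (A i)"] by simp
  finally show "emeasure (distr ?M ?M (\<lambda>x. x \<circ> \<sigma>)) (PiE {..<n} A) = (\<Prod>i\<in>{..<n}. emeasure lborel (A i))" .
qed auto

abbreviation (input) oint :: "nat => ((nat => real) => 'a :: {banach, second_countable_topology}) => bool" where
  "oint n F \<equiv> set_integrable (lebesgue_n n) (pos_orthant n) F"

abbreviation (input) OI :: "nat => ((nat => real) => 'a :: {banach, second_countable_topology}) => 'a" where
  "OI n F \<equiv> set_lebesgue_integral (lebesgue_n n) (pos_orthant n) F"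

lemma pos_orthant_permute:
  assumes "\<sigma> \<in> symg n" "x \<in> space (lebesgue_n n)"
  shows "x \<circ> \<sigma> \<in> pos_orthant n \<longleftrightarrow> x \<in> pos_orthant n"
proof -
  have "x \<circ> \<sigma> \<in> space (lebesgue_n n)" using permute_measurable[OF assms(1)] assms(2) by (rule measurable_space)
  moreover have "(\<forall>i<n. 0 < x (\<sigma> i)) \<longleftrightarrow> (\<forall>i<n. 0 < x i)"
    using assms(1) by (metis symg_inv_apply(2) symg_lt symg_inv)
  ultimately show ?thesis using assms(2) by (simp add: pos_orthant_def)
qed

lemma oint_permute:
  fixes F :: "(nat => real) => 'a :: {banach, second_countable_topology}"
  assumes \<sigma>: "\<sigma> \<in> symg n" and F: "oint n F"
  shows "oint n (\<lambda>x. F (x \<circ> \<sigma>))" "OI n (\<lambda>x. F (x \<circ> \<sigma>)) = OI n F"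
proof -
  let ?M = "lebesgue_n n" and ?G = "\<lambda>x. indicator (pos_orthant n) x *\<^sub>R F x"
  have G: "integrable ?M ?G" using F by (simp add: set_integrable_def)
  have ind: "?G (x \<circ> \<sigma>) = indicator (pos_orthant n) x *\<^sub>R F (x \<circ> \<sigma>)" if "x \<in> space ?M" for x
    using pos_orthant_permute[OF \<sigma> that] by (auto simp: indicator_def)
  have "integrable (distr ?M ?M (\<lambda>x. x \<circ> \<sigma>)) ?G" using G by (simp add: distr_permute[OF \<sigma>])
  hence "integrable ?M (\<lambda>x. ?G (x \<circ> \<sigma>))" by (rule integrable_distr[OF permute_measurable[OF \<sigma>]])
  thus "oint n (\<lambda>x. F (x \<circ> \<sigma>))" unfolding set_integrable_def
    by (rule integrable_cong_imp[rotated]) (rule ind)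
  have "integral\<^sup>L ?M ?G = integral\<^sup>L (distr ?M ?M (\<lambda>x. x \<circ> \<sigma>)) ?G" by (simp add: distr_permute[OF \<sigma>])
  also have "\<dots> = integral\<^sup>L ?M (\<lambda>x. ?G (x \<circ> \<sigma>))"
    using G by (intro integral_distr permute_measurable[OF \<sigma>]) auto
  also have "\<dots> = integral\<^sup>L ?M (\<lambda>x. indicator (pos_orthant n) x *\<^sub>R F (x \<circ> \<sigma>))"
    by (intro Bochner_Integration.integral_cong ind refl)
  finally show "OI n (\<lambda>x. F (x \<circ> \<sigma>)) = OI n F" by (simp add: set_lebesgue_integral_def)
qed

lemma lebesgue_Suc: "lebesgue_n (Suc m) = PiM (insert m {..<m}) (\<lambda>_. lborel)"
  by (simp add: lebesgue_n_def lessThan_Suc)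

text \<open>Each hyperplane x_i = x_j meets the lines in direction j in at most one point, so it is
  null by Fubini.\<close>

lemma AE_distinct: "AE x in lebesgue_n n. distinct_coords n x"
proof (rule AE_I')
  define N where "N i j = {x \<in> space (lebesgue_n n). x i = x j}" for i j :: nat
  have sets: "N i j \<in> sets (lebesgue_n n)" if "i < n" "j < n" for i j
    unfolding N_def using that by measurable
  have null: "N i j \<in> null_sets (lebesgue_n n)" if ij: "i < n" "j < n" "i \<noteq> j" for i j
  proof -
    let ?I = "{..<n} - {j}"
    have ins: "insert j ?I = {..<n}" using ij by auto
    have "emeasure (lebesgue_n n) (N i j) = (\<integral>\<^sup>+x. indicator (N i j) x \<partial>PiM (insert j ?I) (\<lambda>_. lborel))"
      unfolding ins lebesgue_n_def[symmetric] using sets[OF ij(1,2)] by simp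
    also have "\<dots> = (\<integral>\<^sup>+x. (\<integral>\<^sup>+y. indicator (N i j) (x(j := y)) \<partial>lborel) \<partial>PiM ?I (\<lambda>_. lborel))"
    proof (rule product_sigma_finite.product_nn_integral_insert[OF psf])
      show "indicator (N i j) \<in> borel_measurable (PiM (insert j ?I) (\<lambda>_. lborel))"
        unfolding ins lebesgue_n_def[symmetric] using sets[OF ij(1,2)] by simp
    qed auto
    also have "\<dots> = (\<integral>\<^sup>+x. 0 \<partial>PiM ?I (\<lambda>_. lborel :: real measure))"
    proof (rule nn_integral_cong)
      fix x
      have "(\<integral>\<^sup>+y. indicator (N i j) (x(j := y)) \<partial>lborel) \<le> (\<integral>\<^sup>+y. indicator {x i} y \<partial>lborel)"
        using ij by (intro nn_integral_mono) (auto simp: N_def indicator_def)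
      thus "(\<integral>\<^sup>+y. indicator (N i j) (x(j := y)) \<partial>lborel) = 0" by simp
    qed
    finally show ?thesis using sets[OF ij(1,2)] by (simp add: null_sets_def)
  qed
  show "(\<Union>i\<in>{..<n}. \<Union>j\<in>{..<n}-{i}. N i j) \<in> null_sets (lebesgue_n n)"
    by (intro null_sets_UN' countable_finite) (auto intro!: null)
  show "{x \<in> space (lebesgue_n n). \<not> distinct_coords n x} \<subseteq> (\<Union>i\<in>{..<n}. \<Union>j\<in>{..<n}-{i}. N i j)"
    by (auto simp: distinct_coords_def N_def)
qed

section \<open>Integrability of densities with a diagonal singularity\<close>

definition gdens :: "real => real => real => real" where
  "gdens b d t = indicator {0<..} t * (t powr b * exp (- d * t))"

lemma gdens_nonneg [simp]: "gdens b d t \<ge> 0" by (simp add: gdens_def)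

lemma gdens_measurable [measurable]: "gdens b d \<in> borel_measurable borel"
  unfolding gdens_def[abs_def] by measurable

lemma gdens_integrable:
  assumes "b > -1" "d > 0"
  shows "integrable lborel (gdens b d)"
proof -
  have "(\<lambda>t. complex_of_real t powr (of_real (b + 1) - 1) / of_real (exp (d * t))) absolutely_integrable_on {0<..}"
    using assms by (intro absolutely_integrable_Gamma_integral) auto
  hence "integrable lebesgue (\<lambda>t. norm (indicator {0<..} t *\<^sub>R (complex_of_real t powr (of_real (b + 1) - 1) / of_real (exp (d * t)))))"
    unfolding set_integrable_def by (rule integrable_norm)
  moreover have "norm (indicator {0<..} t *\<^sub>R (complex_of_real t powr (of_real (b + 1) - 1) / of_real (exp (d * t)))) = gdens b d t" for t
  proof (cases "t > 0")
    case True
    have "norm (complex_of_real t powr (of_real (b + 1) - 1)) = t powr b"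
      using True by (subst norm_powr_real_powr) auto
    thus ?thesis using True by (simp add: gdens_def norm_divide exp_minus field_simps)
  qed (simp add: gdens_def)
  ultimately have "integrable lebesgue (gdens b d)" by (simp only:)
  thus ?thesis by (subst (asm) integrable_completion) auto
qed

lemma gdens_nn_finite: "b > -1 ==> d > 0 ==> (\<integral>\<^sup>+t. ennreal (gdens b d t) \<partial>lborel) < \<infinity>"
  using gdens_integrable[of b d] by (simp add: integrable_iff_bounded)

lemma prod_indicator: "x \<in> space (lebesgue_n n) ==>
   (\<Prod>i<n. indicator {0<..} (x i) :: real) = indicator (pos_orthant n) x"
  by (auto simp: pos_orthant_def indicator_def)

lemma oint_prod:
  assumes "d > 0" "\<And>i. i < n ==> b i > -1"
  shows "oint n (\<lambda>x. (\<Prod>i<n. x i powr b i) * exp (- d * (\<Sum>i<n. x i)))"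
proof -
  have "integrable (lebesgue_n n) (\<lambda>x. \<Prod>i<n. gdens (b i) d (x i))"
    unfolding lebesgue_n_def using assms
    by (intro product_sigma_finite.product_integrable_prod[OF psf] gdens_integrable) auto
  moreover have "(\<Prod>i<n. gdens (b i) d (x i)) = indicator (pos_orthant n) x *\<^sub>R ((\<Prod>i<n. x i powr b i) * exp (- d * (\<Sum>i<n. x i)))"
    if "x \<in> space (lebesgue_n n)" for x
    using prod_indicator[OF that] by (simp add: gdens_def prod.distrib sum_distrib_left exp_sum flip: sum_negf)
  ultimately show ?thesis unfolding set_integrable_def
    by (rule integrable_cong_imp[rotated])
qed

text \<open>The bound has to be uniform in the location c of the singularity. |u|^(q-1) is at most
  an integrable spike at 0 plus 1; the spike has a translation invariant integral and the constant 1
  is absorbed by the exponential.\<close>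

lemma sing_nn_bound:
  assumes q: "0 < q" "q \<le> 1" and d: "d > 0"
  shows "\<exists>K<\<infinity>. \<forall>c. (\<integral>\<^sup>+y. ennreal (\<bar>c - y\<bar> powr (q - 1) * gdens 0 d y) \<partial>lborel) \<le> K"
proof -
  \<comment> \<open>The factor e makes this dominate t^(q-1) on (0, 1), since exp(1 - t) >= 1
    there.\<close>
  let ?g = "\<lambda>t. exp 1 * gdens (q - 1) 1 t"
  define G where "G = (\<integral>\<^sup>+t. ennreal (?g t) \<partial>lborel)"
  define K where "K = G + G + (\<integral>\<^sup>+t. ennreal (gdens 0 d t) \<partial>lborel)"
  have G: "G < \<infinity>"
  proof -
    have "G = ennreal (exp 1) * (\<integral>\<^sup>+t. ennreal (gdens (q - 1) 1 t) \<partial>lborel)"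
      unfolding G_def by (subst nn_integral_cmult[symmetric]) (auto simp: ennreal_mult')
    thus ?thesis using gdens_nn_finite[of "q - 1" 1] q by (simp add: ennreal_mult_less_top)
  qed
  have K: "K < \<infinity>" unfolding K_def using G gdens_nn_finite[of 0 d] d by simp
  have pw: "\<bar>u\<bar> powr (q - 1) \<le> ?g u + ?g (- u) + 1" for u :: real
  proof (cases "\<bar>u\<bar> \<ge> 1")
    case True
    have "\<bar>u\<bar> powr (q - 1) \<le> \<bar>u\<bar> powr 0" using True q by (intro powr_mono) auto
    moreover have "\<bar>u\<bar> powr 0 = 1" using True by auto
    moreover have "?g u \<ge> 0" "?g (-u) \<ge> 0" by auto
    ultimately show ?thesis by linarith
  next
    case False
    have *: "t powr (q - 1) \<le> ?g t" if "0 < t" "t < 1" for t :: real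
    proof -
      have "1 \<le> exp (1 - t)" using that by simp
      hence "t powr (q - 1) * 1 \<le> t powr (q - 1) * exp (1 - t)" by (intro mult_left_mono) auto
      thus ?thesis using that by (simp add: gdens_def exp_diff exp_minus field_simps)
    qed
    have nn: "?g u \<ge> 0" "?g (-u) \<ge> 0" by auto
    consider "u = 0" | "u > 0" | "u < 0" by linarith
    thus ?thesis
    proof cases
      case 2 
      hence "u powr (q - 1) \<le> ?g u" "\<bar>u\<bar> = u" using *[of u] False by auto
      thus ?thesis using nn by (simp only:)
    next
      case 3
      hence "(- u) powr (q - 1) \<le> ?g (- u)" "\<bar>u\<bar> = - u" using *[of "- u"] False by auto
      thus ?thesis using nn by (simp only:)
    qed (use nn in auto)
  qed
  have "(\<integral>\<^sup>+y. ennreal (\<bar>c - y\<bar> powr (q - 1) * gdens 0 d y) \<partial>lborel) \<le> K" for c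
  proof -
    have g1: "gdens 0 d y \<le> 1" for y using d by (auto simp: gdens_def indicator_def)
    have "(\<integral>\<^sup>+y. ennreal (\<bar>c - y\<bar> powr (q - 1) * gdens 0 d y) \<partial>lborel) \<le>
       (\<integral>\<^sup>+y. ennreal (?g (c - y)) + ennreal (?g (y - c)) + ennreal (gdens 0 d y) \<partial>lborel)"
    proof (rule nn_integral_mono)
      fix y
      have "\<bar>c - y\<bar> powr (q - 1) * gdens 0 d y \<le> (?g (c - y) + ?g (y - c) + 1) * gdens 0 d y"
        using pw[of "c - y"] by (intro mult_right_mono) auto
      also have "\<dots> \<le> ?g (c - y) * 1 + ?g (y - c) * 1 + gdens 0 d y"
        unfolding distrib_right using g1[of y] by (intro add_mono mult_left_mono) auto
      finally show "ennreal (\<bar>c - y\<bar> powr (q - 1) * gdens 0 d y) \<le> ennreal (?g (c - y)) + ennreal (?g (y - c)) + ennreal (gdens 0 d y)"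
        by (simp flip: ennreal_plus add: ennreal_leI)
    qed
    also have "\<dots> = (\<integral>\<^sup>+y. ennreal (?g (c - y)) \<partial>lborel) + (\<integral>\<^sup>+y. ennreal (?g (y - c)) \<partial>lborel) + (\<integral>\<^sup>+t. ennreal (gdens 0 d t) \<partial>lborel)"
      by (simp add: nn_integral_add)
    also have "(\<integral>\<^sup>+y. ennreal (?g (c - y)) \<partial>lborel) = G"
      unfolding G_def using nn_integral_real_affine[of "\<lambda>t. ennreal (?g t)" "-1" c] by simp
    also have "(\<integral>\<^sup>+y. ennreal (?g (y - c)) \<partial>lborel) = G"
      unfolding G_def using nn_integral_real_affine[of "\<lambda>t. ennreal (?g t)" 1 "- c"] by simp
    finally show ?thesis by (simp add: K_def)
  qed
  thus ?thesis using K by blast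
qed

lemma ennreal_prod_less_top: "finite I ==> (\<And>i. i \<in> I ==> f i < (\<infinity>::ennreal)) ==> prod f I < \<infinity>"
  by (induction I rule: finite_induct) (auto simp: ennreal_mult_less_top)

text \<open>Coordinate j is integrated first, carrying only the singularity and its exponential. The
  uniform constant of \<open>sing_nn_bound\<close> leaves a product of one-dimensional Gamma
  integrals.\<close>

lemma oint_sing:
  assumes q: "0 < q" "q \<le> 1" and d: "d > 0" and ij: "i < n" "j < n" "i \<noteq> j" and b: "\<And>l. l < n ==> b l > -1"
  shows "oint n (\<lambda>x. \<bar>x i - x j\<bar> powr (q - 1) * (\<Prod>l\<in>{..<n}-{j}. x l powr b l) * exp (- d * (\<Sum>l<n. x l)))"
proof -
  let ?I = "{..<n} - {j}"
  let ?F = "\<lambda>x. \<bar>x i - x j\<bar> powr (q - 1) * (\<Prod>l\<in>?I. gdens (b l) d (x l)) * gdens 0 d (x j)"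
  have ins: "insert j ?I = {..<n}" using ij by auto
  obtain K where K: "K < \<infinity>" "\<And>c. (\<integral>\<^sup>+y. ennreal (\<bar>c - y\<bar> powr (q - 1) * gdens 0 d y) \<partial>lborel) \<le> K"
    using sing_nn_bound[OF q d] by blast
  have meas: "?F \<in> borel_measurable (lebesgue_n n)" using ij by measurable
  have "(\<integral>\<^sup>+x. ennreal (?F x) \<partial>lebesgue_n n) = (\<integral>\<^sup>+x. ennreal (?F x) \<partial>PiM (insert j ?I) (\<lambda>_. lborel))"
    unfolding ins lebesgue_n_def ..
  also have "\<dots> = (\<integral>\<^sup>+x. (\<integral>\<^sup>+y. ennreal (?F (x(j := y))) \<partial>lborel) \<partial>PiM ?I (\<lambda>_. lborel))"
  proof (rule product_sigma_finite.product_nn_integral_insert[OF psf])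
    show "(\<lambda>x. ennreal (?F x)) \<in> borel_measurable (PiM (insert j ?I) (\<lambda>_. lborel))"
      unfolding ins lebesgue_n_def[symmetric] using meas by simp
  qed auto
  also have "\<dots> \<le> (\<integral>\<^sup>+x. (\<Prod>l\<in>?I. ennreal (gdens (b l) d (x l))) * K \<partial>PiM ?I (\<lambda>_. lborel))"
  proof (rule nn_integral_mono)
    fix x
    have p: "(\<Prod>l\<in>?I. gdens (b l) d ((x(j := y)) l)) = (\<Prod>l\<in>?I. gdens (b l) d (x l))" for y
      by (intro prod.cong) auto
    have "(\<integral>\<^sup>+y. ennreal (?F (x(j := y))) \<partial>lborel) =
       (\<integral>\<^sup>+y. ennreal (\<Prod>l\<in>?I. gdens (b l) d (x l)) * ennreal (\<bar>x i - y\<bar> powr (q - 1) * gdens 0 d y) \<partial>lborel)"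
      unfolding p using ij by (intro nn_integral_cong) (simp add: prod_nonneg flip: ennreal_mult' add: mult_ac)
    also have "\<dots> = ennreal (\<Prod>l\<in>?I. gdens (b l) d (x l)) * (\<integral>\<^sup>+y. ennreal (\<bar>x i - y\<bar> powr (q - 1) * gdens 0 d y) \<partial>lborel)"
      by (rule nn_integral_cmult) simp
    also have "\<dots> \<le> ennreal (\<Prod>l\<in>?I. gdens (b l) d (x l)) * K"
      by (intro mult_left_mono K) auto
    finally show "(\<integral>\<^sup>+y. ennreal (?F (x(j := y))) \<partial>lborel) \<le> (\<Prod>l\<in>?I. ennreal (gdens (b l) d (x l))) * K"
      by (simp add: prod_ennreal)
  qed
  also have "\<dots> = (\<integral>\<^sup>+x. (\<Prod>l\<in>?I. ennreal (gdens (b l) d (x l))) \<partial>PiM ?I (\<lambda>_. lborel)) * K"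
  proof (rule nn_integral_multc)
    have "(\<lambda>x. gdens (b l) d (x l)) \<in> borel_measurable (PiM ?I (\<lambda>_. lborel))" if "l \<in> ?I" for l
      by (rule measurable_compose[OF measurable_component_singleton[OF that]]) simp
    hence "(\<lambda>x. \<Prod>l\<in>?I. gdens (b l) d (x l)) \<in> borel_measurable (PiM ?I (\<lambda>_. lborel))"
      by (rule borel_measurable_prod)
    hence "(\<lambda>x. ennreal (\<Prod>l\<in>?I. gdens (b l) d (x l))) \<in> borel_measurable (PiM ?I (\<lambda>_. lborel))"
      by (rule measurable_compose[OF _ measurable_ennreal])
    thus "(\<lambda>x. \<Prod>l\<in>?I. ennreal (gdens (b l) d (x l))) \<in> borel_measurable (PiM ?I (\<lambda>_. lborel))"
      by (simp add: prod_ennreal)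
  qed
  also have "\<dots> = (\<Prod>l\<in>?I. \<integral>\<^sup>+t. ennreal (gdens (b l) d t) \<partial>lborel) * K"
    by (subst product_sigma_finite.product_nn_integral_prod[OF psf]) auto
  also have "\<dots> < \<infinity>"
  proof -
    have "(\<Prod>l\<in>?I. \<integral>\<^sup>+t. ennreal (gdens (b l) d t) \<partial>lborel) < \<infinity>"
      using gdens_nn_finite[OF b d] by (intro ennreal_prod_less_top) auto
    thus ?thesis using K(1) by (simp add: ennreal_mult_less_top)
  qed
  finally have fin: "(\<integral>\<^sup>+x. ennreal (?F x) \<partial>lebesgue_n n) < \<infinity>" .
  have "integrable (lebesgue_n n) ?F"
    by (rule integrableI_nonneg[OF meas _ fin]) (simp add: prod_nonneg)
  moreover have "?F x = indicator (pos_orthant n) x *\<^sub>R (\<bar>x i - x j\<bar> powr (q - 1) * (\<Prod>l\<in>?I. x l powr b l) * exp (- d * (\<Sum>l<n. x l)))"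
    if x: "x \<in> space (lebesgue_n n)" for x
  proof -
    have 1: "(\<Prod>l\<in>?I. indicator {0<..} (x l)) * indicator {0<..} (x j) = (indicator (pos_orthant n) x :: real)"
      unfolding prod_indicator[OF x, symmetric] using ij by (subst (2) prod.remove[of _ j]) auto
    have 2: "(\<Prod>l\<in>?I. exp (- d * x l)) * exp (- d * x j) = exp (- d * (\<Sum>l<n. x l))"
    proof -
      have "(\<Sum>l<n. x l) = x j + (\<Sum>l\<in>?I. x l)" using ij by (intro sum.remove) auto
      hence "exp (- d * (\<Sum>l<n. x l)) = exp ((\<Sum>l\<in>?I. - d * x l) + - d * x j)"
        unfolding sum_distrib_left[symmetric] by (simp only: distrib_left add.commute)
      thus ?thesis by (simp only: exp_add exp_sum finite_Diff finite_lessThan)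
    qed
    have "?F x = \<bar>x i - x j\<bar> powr (q - 1) * (\<Prod>l\<in>?I. x l powr b l) * ((\<Prod>l\<in>?I. indicator {0<..} (x l)) * (indicator {0<..} (x j) * x j powr 0)) *
      ((\<Prod>l\<in>?I. exp (- d * x l)) * exp (- d * x j))"
      by (simp only: gdens_def prod.distrib mult_ac)
    also have "indicator {0<..} (x j) * x j powr 0 = (indicator {0<..} (x j) :: real)" by (auto simp: indicator_def)
    finally show ?thesis unfolding 1 2 real_scaleR_def by (simp only: mult_ac)
  qed
  ultimately show ?thesis unfolding set_integrable_def
    by (rule integrable_cong_imp[rotated])
qed

text \<open>The half-line is exhausted by the intervals from 1/(i+1) to i+1. Integrability of the
  derivative gives convergence of the integrals, and continuity bridges the finitely many points
  where the derivative is not given.\<close>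

lemma ftc_halfline:
  fixes \<phi> \<phi>' :: "real => complex"
  assumes int: "set_integrable lborel {0<..} \<phi>'" and S: "finite S"
    and cont: "continuous_on {0<..} \<phi>"
    and der: "\<And>t. t > 0 ==> t \<notin> S ==> (\<phi> has_vector_derivative \<phi>' t) (at t)"
    and L: "(\<phi> \<longlongrightarrow> L) (at_right 0)" and top: "(\<phi> \<longlongrightarrow> 0) at_top"
  shows "(LINT t:{0<..}|lborel. \<phi>' t) = - L"
proof -
  define A where "A i = {1 / real (Suc i)..real (Suc i)}" for i :: nat
  have Un: "(\<Union>i. A i) = {0<..}"
  proof (intro set_eqI iffI)
    fix t :: real assume "t \<in> {0<..}"
    hence t: "t > 0" by simp
    obtain i :: nat where i: "max t (1 / t) < real i" using reals_Archimedean2 by blast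
    have "1 / real (Suc i) \<le> t"
    proof -
      have "1 / t < real (Suc i)" using i by simp
      thus ?thesis using t by (simp add: field_simps)
    qed
    thus "t \<in> (\<Union>i. A i)" using i by (intro UN_I[of i]) (auto simp: A_def)
  qed (auto simp: A_def intro: less_le_trans[rotated])
  have inc: "incseq A"
    unfolding incseq_def A_def by (auto simp: frac_le intro: order_trans[rotated])
  have sub: "A i \<subseteq> {0<..}" for i using Un by blast
  have "(\<lambda>i. LINT t:A i|lborel. \<phi>' t) \<longlonglongrightarrow> (LINT t:(\<Union>i. A i)|lborel. \<phi>' t)"
    by (rule set_integral_cont_up[OF _ inc]) (simp add: A_def, simp only: Un int)
  moreover have "(LINT t:A i|lborel. \<phi>' t) = \<phi> (real (Suc i)) - \<phi> (1 / real (Suc i))" for i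
  proof -
    have si: "set_integrable lborel (A i) \<phi>'"
      by (rule set_integrable_subset[OF int _ sub]) (auto simp: A_def)
    have "(\<phi>' has_integral (\<phi> (real (Suc i)) - \<phi> (1 / real (Suc i)))) (A i)"
      unfolding A_def
    proof (rule fundamental_theorem_of_calculus_interior_strong[OF S])
      show "continuous_on {1 / real (Suc i)..real (Suc i)} \<phi>"
        using sub[of i] by (intro continuous_on_subset[OF cont]) (auto simp: A_def)
      fix t assume t: "t \<in> {1 / real (Suc i)<..<real (Suc i)} - S"
      have "0 < 1 / real (Suc i)" by simp
      also have "\<dots> < t" using t by simp
      finally show "(\<phi> has_vector_derivative \<phi>' t) (at t)" using t by (intro der) auto
    qed (simp add: field_simps)
    thus ?thesis using set_borel_integral_eq_integral(2)[OF si] by (simp add: integral_unique)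
  qed
  moreover have "(\<lambda>i. \<phi> (real (Suc i)) - \<phi> (1 / real (Suc i))) \<longlonglongrightarrow> 0 - L"
  proof (rule tendsto_diff)
    show "(\<lambda>i. \<phi> (real (Suc i))) \<longlonglongrightarrow> 0"
      by (rule filterlim_compose[OF top]) (rule filterlim_compose[OF filterlim_real_sequentially filterlim_Suc])
    show "(\<lambda>i. \<phi> (1 / real (Suc i))) \<longlonglongrightarrow> L"
    proof (rule filterlim_compose[OF L])
      have "(\<lambda>i. inverse (real (Suc i))) \<longlonglongrightarrow> 0" by (rule LIMSEQ_inverse_real_of_nat)
      thus "filterlim (\<lambda>i. 1 / real (Suc i)) (at_right 0) sequentially"
        unfolding filterlim_at by (auto simp: inverse_eq_divide)
    qed
  qed
  ultimately show ?thesis unfolding Un using LIMSEQ_unique by fastforce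
qed

lemma dkp_measurable:
  fixes g :: "'b => nat => complex"
  assumes "\<And>i. i < n ==> (\<lambda>x. g x i) \<in> borel_measurable M"
  shows "(\<lambda>x. dkp n k m l (g x)) \<in> borel_measurable M"
  using assms
proof (induction m arbitrary: g)
  case (Suc m)
  have "(\<lambda>x. of_real (green n k (real (Suc m)) \<sigma>) * (pairing n l (g x \<circ> \<sigma>) * dkp n k m l (g x \<circ> \<sigma>))) \<in> borel_measurable M"
    if \<sigma>: "\<sigma> \<in> symg n" for \<sigma>
  proof -
    have c: "(\<lambda>x. (g x \<circ> \<sigma>) i) \<in> borel_measurable M" if "i < n" for i
      using Suc.prems[of "\<sigma> i"] that \<sigma> by (simp add: symg_lt)
    hence "(\<lambda>x. dkp n k m l (g x \<circ> \<sigma>)) \<in> borel_measurable M" by (intro Suc.IH)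
    moreover have "(\<lambda>x. pairing n l (g x \<circ> \<sigma>)) \<in> borel_measurable M"
      unfolding pairing_def using c by (intro borel_measurable_sum borel_measurable_times borel_measurable_const) auto
    ultimately show ?thesis by (intro borel_measurable_times borel_measurable_const)
  qed
  thus ?case unfolding dkp.simps by (intro borel_measurable_sum)
qed simp

lemma dk_measurable:
  fixes g :: "'b => nat => complex"
  assumes "k \<ge> 0" "\<And>i. i < n ==> (\<lambda>x. g x i) \<in> borel_measurable M"
  shows "(\<lambda>x. dk n k l (g x)) \<in> borel_measurable M"
proof (rule borel_measurable_LIMSEQ_metric)
  fix N show "(\<lambda>x. \<Sum>m<N. dkp n k m l (g x)) \<in> borel_measurable M"
    by (intro borel_measurable_sum dkp_measurable assms(2))
next
  fix x show "(\<lambda>N. \<Sum>m<N. dkp n k m l (g x)) \<longlonglongrightarrow> dk n k l (g x)"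
    using dkp_sums(1)[OF assms(1)] by (simp add: sums_def)
qed

lemma powr_le_exp:
  assumes "a \<ge> 0" "d > 0"
  shows "\<exists>C\<ge>0. \<forall>t\<ge>0. t powr a \<le> C * exp (d * t :: real)"
proof (cases "a = 0")
  case True
  show ?thesis
  proof (intro exI[of _ 1] conjI allI impI)
    fix t :: real assume "t \<ge> 0"
    have "t powr a \<le> 1" using True by simp
    also have "\<dots> \<le> exp (d * t)" using \<open>t \<ge> 0\<close> assms by simp
    finally show "t powr a \<le> 1 * exp (d * t)" by simp
  qed simp
next
  case False
  hence a: "a > 0" using assms by simp
  show ?thesis
  proof (intro exI[of _ "(a / d) powr a"] conjI allI impI)
    fix t :: real assume t: "t \<ge> 0"
    define y where "y = d * t / a"
    have y: "y \<ge> 0" "t = a / d * y" using t a assms by (auto simp: y_def)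
    have "y \<le> exp y" using exp_ge_add_one_self[of y] by linarith
    hence "y powr a \<le> exp y powr a" using y a by (intro powr_mono2) auto
    also have "\<dots> = exp (d * t)" using a by (simp add: powr_def y_def)
    finally have "(a / d) powr a * y powr a \<le> (a / d) powr a * exp (d * t)" by (intro mult_left_mono) auto
    moreover have "(a / d * y) powr a = (a / d) powr a * y powr a"
      using y a assms by (subst powr_mult) auto
    ultimately show "t powr a \<le> (a / d) powr a * exp (d * t)" using y(2) by metis
  qed simp
qed

section \<open>Growth and decay classes\<close>

text \<open>Subexponential growth: for every rate, however small, a constant exists. This form makes
  the class closed under products and lets it be multiplied onto a function that decays
  exponentially at some rate (\<open>decays_mult\<close>).\<close>

definition expbd :: "nat => ((nat => real) => 'a :: real_normed_vector) => bool" where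
  "expbd n F \<longleftrightarrow> (\<forall>\<epsilon>>0. \<exists>C\<ge>0. \<forall>x. (\<forall>i<n. 0 < x i) --> norm (F x) \<le> C * exp (\<epsilon> * (\<Sum>i<n. x i)))"

lemma expbdD: "expbd n F ==> \<epsilon> > 0 ==> \<exists>C\<ge>0. \<forall>x. (\<forall>i<n. 0 < x i) --> norm (F x) \<le> C * exp (\<epsilon> * (\<Sum>i<n. x i))"
  by (simp add: expbd_def)

lemma sum_coords_nonneg: "(\<And>i. i < n ==> 0 < (x i :: real)) ==> 0 \<le> (\<Sum>i<n. x i)"
  by (intro sum_nonneg) (auto intro: less_imp_le)

lemma expbd_const: "expbd n (\<lambda>_. c)"
  unfolding expbd_def
proof (intro allI impI exI[of _ "norm c"] conjI)
  fix e :: real and x :: "nat => real" assume e: "e > 0" "\<forall>i<n. 0 < x i"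
  have "1 \<le> exp (e * (\<Sum>i<n. x i))" using e sum_coords_nonneg[of n x] by simp
  thus "norm c \<le> norm c * exp (e * (\<Sum>i<n. x i))" using mult_left_mono[of 1 _ "norm c"] by simp
qed simp

lemma expbd_mono:
  assumes "expbd n F" "\<And>x. (\<And>i. i < n ==> 0 < x i) ==> norm (G x) \<le> norm (F x)"
  shows "expbd n G"
  unfolding expbd_def
proof (intro allI impI)
  fix e :: real assume "e > 0"
  then obtain C where "C \<ge> 0" "\<forall>x. (\<forall>i<n. 0 < x i) --> norm (F x) \<le> C * exp (e * (\<Sum>i<n. x i))"
    using assms(1) by (auto simp: expbd_def)
  thus "\<exists>C\<ge>0. \<forall>x. (\<forall>i<n. 0 < x i) --> norm (G x) \<le> C * exp (e * (\<Sum>i<n. x i))"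
    using assms(2) by (intro exI[of _ C]) (meson order_trans)
qed

lemma expbd_mult:
  fixes F G :: "(nat => real) => 'a :: real_normed_algebra"
  assumes "expbd n F" "expbd n G"
  shows "expbd n (\<lambda>x. F x * G x)"
  unfolding expbd_def
proof (intro allI impI)
  fix e :: real assume "e > 0"
  hence e: "e / 2 > 0" by simp
  obtain C where C: "C \<ge> 0" "\<And>x. (\<forall>i<n. 0 < x i) ==> norm (F x) \<le> C * exp (e / 2 * (\<Sum>i<n. x i))"
    using expbdD[OF assms(1) e] by blast
  obtain D where D: "D \<ge> 0" "\<And>x. (\<forall>i<n. 0 < x i) ==> norm (G x) \<le> D * exp (e / 2 * (\<Sum>i<n. x i))"
    using expbdD[OF assms(2) e] by blast
  show "\<exists>C\<ge>0. \<forall>x. (\<forall>i<n. 0 < x i) --> norm (F x * G x) \<le> C * exp (e * (\<Sum>i<n. x i))"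
  proof (intro exI[of _ "C * D"] conjI allI impI)
    fix x assume x: "\<forall>i<n. 0 < (x i :: real)"
    have "norm (F x * G x) \<le> norm (F x) * norm (G x)" by (rule norm_mult_ineq)
    also have "\<dots> \<le> (C * exp (e / 2 * (\<Sum>i<n. x i))) * (D * exp (e / 2 * (\<Sum>i<n. x i)))"
      by (intro mult_mono C D x) (use C in auto)
    also have "\<dots> = C * D * exp (e * (\<Sum>i<n. x i))" by (simp flip: exp_add)
    finally show "norm (F x * G x) \<le> C * D * exp (e * (\<Sum>i<n. x i))" .
  qed (use C D in simp)
qed

lemma expbd_add:
  assumes "expbd n F" "expbd n G"
  shows "expbd n (\<lambda>x. F x + G x)"
  unfolding expbd_def
proof (intro allI impI)
  fix e :: real assume e: "e > 0"
  obtain C where C: "C \<ge> 0" "\<And>x. (\<forall>i<n. 0 < x i) ==> norm (F x) \<le> C * exp (e * (\<Sum>i<n. x i))"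
    using expbdD[OF assms(1) e] by blast
  obtain D where D: "D \<ge> 0" "\<And>x. (\<forall>i<n. 0 < x i) ==> norm (G x) \<le> D * exp (e * (\<Sum>i<n. x i))"
    using expbdD[OF assms(2) e] by blast
  show "\<exists>C\<ge>0. \<forall>x. (\<forall>i<n. 0 < x i) --> norm (F x + G x) \<le> C * exp (e * (\<Sum>i<n. x i))"
  proof (intro exI[of _ "C + D"] conjI allI impI)
    fix x assume x: "\<forall>i<n. 0 < (x i :: real)"
    show "norm (F x + G x) \<le> (C + D) * exp (e * (\<Sum>i<n. x i))"
      using norm_triangle_ineq[of "F x" "G x"] C(2)[OF x] D(2)[OF x] by (simp add: distrib_right)
  qed (use C D in simp)
qed

lemma expbd_sum: "finite S ==> (\<And>i. i \<in> S ==> expbd n (F i)) ==> expbd n (\<lambda>x. \<Sum>i\<in>S. F i x)"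
  by (induction S rule: finite_induct) (auto intro: expbd_const expbd_add)

lemma expbd_prod:
  fixes F :: "'i => (nat => real) => 'a :: real_normed_field"
  shows "finite S ==> (\<And>i. i \<in> S ==> expbd n (F i)) ==> expbd n (\<lambda>x. \<Prod>i\<in>S. F i x)"
  by (induction S rule: finite_induct) (auto intro: expbd_const expbd_mult)

lemma expbd_powr_gen:
  assumes "a \<ge> 0" and u: "\<And>x. (\<And>i. i < n ==> 0 < x i) ==> \<bar>u x\<bar> \<le> (\<Sum>i<n. x i)"
  shows "expbd n (\<lambda>x. \<bar>u x\<bar> powr a)"
  unfolding expbd_def
proof (intro allI impI)
  fix e :: real assume e: "e > 0"
  obtain C where C: "C \<ge> 0" "\<And>t. t \<ge> 0 ==> t powr a \<le> C * exp (e * t)" using powr_le_exp[OF assms(1) e] by blast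
  show "\<exists>C\<ge>0. \<forall>x. (\<forall>i<n. 0 < x i) --> norm (\<bar>u x\<bar> powr a) \<le> C * exp (e * (\<Sum>i<n. x i))"
  proof (intro exI[of _ C] conjI allI impI)
    fix x assume x: "\<forall>i<n. 0 < (x i :: real)"
    have "\<bar>u x\<bar> powr a \<le> (\<Sum>i<n. x i) powr a" using u[of x] x assms(1) by (intro powr_mono2) auto
    also have "\<dots> \<le> C * exp (e * (\<Sum>i<n. x i))" using x by (intro C sum_coords_nonneg) auto
    finally show "norm (\<bar>u x\<bar> powr a) \<le> C * exp (e * (\<Sum>i<n. x i))" by simp
  qed (use C in simp)
qed

lemma coord_le_sum: "(i::nat) < n ==> (\<And>i. i < n ==> 0 < (x i :: real)) ==> x i \<le> (\<Sum>i<n. x i)"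
  by (rule member_le_sum) (auto intro: less_imp_le)

lemma expbd_powr_diff:
  assumes "a \<ge> 0" "i < n" "j < n"
  shows "expbd n (\<lambda>x. \<bar>x i - x j\<bar> powr a)"
proof (rule expbd_powr_gen[OF assms(1)])
  fix x :: "nat => real" assume x: "\<And>i. i < n ==> 0 < x i"
  have "\<bar>x i - x j\<bar> \<le> max (x i) (x j)" using x[OF assms(2)] x[OF assms(3)] by auto
  thus "\<bar>x i - x j\<bar> \<le> (\<Sum>i<n. x i)" using coord_le_sum[of i n x] coord_le_sum[of j n x] x assms by auto
qed

lemma expbd_coord:
  assumes "i < n"
  shows "expbd n (\<lambda>x. of_real (x i) :: 'a :: real_normed_field)"
proof (rule expbd_mono[OF expbd_powr_gen[of 1 n "\<lambda>x. x i"]])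
  fix x :: "nat => real" assume x: "\<And>i. i < n ==> 0 < x i"
  show "\<bar>x i\<bar> \<le> (\<Sum>i<n. x i)" using coord_le_sum[of i n x] x x[OF assms] assms by (simp add: abs_of_pos)
  show "norm (of_real (x i) :: 'a) \<le> norm (\<bar>x i\<bar> powr 1)" using x[OF assms] by simp
qed simp

lemma expbd_mono_cvec: "expbd n (\<lambda>x. mono n \<alpha> (cvec x))"
  unfolding mono_def cvec_def
proof (intro expbd_prod)
  fix i assume i: "i \<in> {..<n}"
  have "expbd n (\<lambda>x. (of_real (x i) :: complex) ^ a)" for a
    using i by (induction a) (auto intro!: expbd_const expbd_mult expbd_coord)
  thus "expbd n (\<lambda>x. (complex_of_real (x i)) ^ \<alpha> i)" .
qed simp

text \<open>The case k = 0 is separate because \<open>0 powr 0\<close> is 0, while the weight must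
  be 1 also on the diagonals.\<close>

definition ww :: "real => real => real" where
  "ww k u = (if k = 0 then 1 else \<bar>u\<bar> powr (2 * k))"

lemma omega_ww: "omega n k x = (\<Prod>p\<in>pairs n. ww k (x (fst p) - x (snd p)))"
  unfolding omega_def ww_def by (rule prod_pairs)

lemma omega_Suc: "omega (Suc m) k x = omega m k x * (\<Prod>i<m. ww k (x i - x m))"
  by (simp add: omega_def ww_def)

lemma expbd_ww: "k \<ge> 0 ==> i < n ==> j < n ==> expbd n (\<lambda>x. ww k (x i - x j))"
  by (cases "k = 0") (auto simp: ww_def intro!: expbd_const expbd_powr_diff)

lemma expbd_omega: "k \<ge> 0 ==> n \<le> N ==> expbd N (omega n k)"
  unfolding omega_ww[abs_def] by (intro expbd_prod expbd_ww finite_pairs) (auto simp: pairs_def)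

lemma omega_nonneg: "omega n k x \<ge> 0"
  unfolding omega_ww by (intro prod_nonneg) (auto simp: ww_def)

lemma ww_minus: "ww k (- u) = ww k u" by (simp add: ww_def)

lemma omega_permute:
  assumes "\<tau> \<in> symg n"
  shows "omega n k (x \<circ> \<tau>) = omega n k x"
  unfolding omega_ww comp_def
  by (rule prod_pairs_permute[OF assms, where g = "\<lambda>i j. ww k (x i - x j)"]) (metis ww_minus minus_diff_eq)

lemma omega_cong: "(\<And>i. i < n ==> x i = y i) ==> omega n k x = omega n k y"
  unfolding omega_ww by (intro prod.cong) (auto simp: pairs_def)

lemma ww_measurable [measurable]: "ww k \<in> borel_measurable borel"
  unfolding ww_def[abs_def] by measurable

lemma omega_measurable:
  assumes "\<And>i. i < n ==> (\<lambda>x. g x i) \<in> borel_measurable M"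
  shows "(\<lambda>x. omega n k (g x)) \<in> borel_measurable M"
  unfolding omega_ww
  by (intro borel_measurable_prod measurable_compose[OF _ ww_measurable] borel_measurable_diff assms) (auto simp: pairs_def)

definition Dp :: "nat => complex => (nat => real) => complex" where
  "Dp n s x = exp (s * of_real (\<Sum>i<n. ln (x i)))"

lemma Delta_pow_Dp: "(\<And>i. i < n ==> 0 < x i) ==> Delta_pow n (cvec x) s = Dp n s x"
  unfolding Delta_pow_def Dp_def cvec_def by (simp add: Ln_of_real)

lemma norm_Dp:
  assumes "\<And>i. i < n ==> 0 < x i"
  shows "norm (Dp n s x) = (\<Prod>i<n. x i powr Re s)"
proof -
  have "norm (Dp n s x) = exp (\<Sum>i<n. Re s * ln (x i))"
    by (simp add: Dp_def sum_distrib_left)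
  also have "\<dots> = (\<Prod>i<n. exp (Re s * ln (x i)))" by (simp add: exp_sum)
  also have "\<dots> = (\<Prod>i<n. x i powr Re s)"
    by (intro prod.cong refl) (use assms in \<open>force simp: powr_def\<close>)
  finally show ?thesis .
qed

lemma Dp_measurable [measurable]: "Dp n s \<in> borel_measurable (lebesgue_n n)"
  unfolding Dp_def[abs_def]
  by (intro borel_measurable_exp measurable_compose[OF _ borel_measurable_exp] borel_measurable_times borel_measurable_const
      borel_measurable_of_real borel_measurable_sum borel_measurable_ln) auto

lemma Dp_permute: "\<tau> \<in> symg n ==> Dp n s (x \<circ> \<tau>) = Dp n s x"
  using sum_coords_symg[of \<tau> n "\<lambda>i. ln (x i)"] by (simp add: Dp_def comp_def)

definition decays :: "nat => ((nat => real) => complex) => bool" where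
  "decays n G \<longleftrightarrow> G \<in> borel_measurable (lebesgue_n n) \<and>
     (\<exists>d>0. \<exists>C\<ge>0. \<forall>x. (\<forall>i<n. 0 < x i) --> norm (G x) \<le> C * exp (- d * (\<Sum>i<n. x i)))"

lemma decays_mult:
  assumes G: "decays n G" and F: "expbd n F" "F \<in> borel_measurable (lebesgue_n n)"
  shows "decays n (\<lambda>x. G x * F x)"
proof -
  obtain d C where d: "d > 0" "C \<ge> 0" and G': "\<And>x. \<forall>i<n. 0 < x i ==> norm (G x) \<le> C * exp (- d * (\<Sum>i<n. x i))"
    using G by (auto simp: decays_def)
  obtain D where D: "D \<ge> 0" "\<And>x. (\<forall>i<n. 0 < x i) ==> norm (F x) \<le> D * exp (d / 2 * (\<Sum>i<n. x i))"
    using expbdD[OF F(1), of "d / 2"] d by auto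
  have "norm (G x * F x) \<le> C * D * exp (- (d / 2) * (\<Sum>i<n. x i))" if x: "\<forall>i<n. 0 < x i" for x
  proof -
    have "norm (G x * F x) \<le> (C * exp (- d * (\<Sum>i<n. x i))) * (D * exp (d / 2 * (\<Sum>i<n. x i)))"
      unfolding norm_mult by (intro mult_mono G' D x) (use d in auto)
    also have "\<dots> = C * D * exp (- (d / 2) * (\<Sum>i<n. x i))" by (simp add: algebra_simps flip: exp_add)
    finally show ?thesis .
  qed
  thus ?thesis unfolding decays_def using d D F(2) G
    by (intro conjI exI[of _ "d / 2"] exI[of _ "C * D"]) (auto simp: decays_def)
qed

lemma set_meas:
  fixes f :: "(nat => real) => 'a :: {banach, second_countable_topology}"
  shows "f \<in> borel_measurable (lebesgue_n n) ==> set_borel_measurable (lebesgue_n n) (pos_orthant n) f"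
  unfolding set_borel_measurable_def by (intro borel_measurable_scaleR borel_measurable_indicator pos_orthant_sets)

lemma pos_orthantD: "x \<in> pos_orthant n ==> i < n ==> 0 < x i"
  by (simp add: pos_orthant_def)

lemma oint_dom:
  assumes G: "decays n G" and s: "Re s > -1"
  shows "oint n (\<lambda>x. G x * Dp n s x)"
proof -
  obtain d C where d: "d > 0" "C \<ge> 0" and G': "\<And>x. \<forall>i<n. 0 < x i ==> norm (G x) \<le> C * exp (- d * (\<Sum>i<n. x i))"
    using G by (auto simp: decays_def)
  have Gm: "G \<in> borel_measurable (lebesgue_n n)" using G by (simp add: decays_def)
  have "oint n (\<lambda>x. C * ((\<Prod>i<n. x i powr Re s) * exp (- d * (\<Sum>i<n. x i))))"
    using s d by (intro set_integrable_mult_right oint_prod) auto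
  thus ?thesis
  proof (rule set_integrable_bound)
    show "set_borel_measurable (lebesgue_n n) (pos_orthant n) (\<lambda>x. G x * Dp n s x)"
      using Gm by (intro set_meas borel_measurable_times Dp_measurable)
    show "AE x in lebesgue_n n. x \<in> pos_orthant n --> norm (G x * Dp n s x) \<le> norm (C * ((\<Prod>i<n. x i powr Re s) * exp (- d * (\<Sum>i<n. x i))))"
    proof (intro AE_I2 impI)
      fix x assume x: "x \<in> pos_orthant n"
      have nD: "norm (Dp n s x) = (\<Prod>i<n. x i powr Re s)" by (rule norm_Dp) (use pos_orthantD[OF x] in auto)
      have "norm (G x * Dp n s x) \<le> C * exp (- d * (\<Sum>i<n. x i)) * (\<Prod>i<n. x i powr Re s)"
        unfolding norm_mult nD using pos_orthantD[OF x]
        by (intro mult_right_mono G') (auto intro: prod_nonneg)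
      also have "\<dots> = norm (C * ((\<Prod>i<n. x i powr Re s) * exp (- d * (\<Sum>i<n. x i))))"
        using d by (simp add: abs_mult prod_nonneg)
      finally show "norm (G x * Dp n s x) \<le> norm (C * ((\<Prod>i<n. x i powr Re s) * exp (- d * (\<Sum>i<n. x i))))" .
    qed
  qed
qed

lemma prod_split2:
  fixes f :: "nat => real"
  assumes "i < n" "j < n" "i \<noteq> j"
  shows "(\<Prod>l<n. f l) = f i * f j * (\<Prod>l\<in>{..<n}-{i,j}. f l)" "(\<Prod>l\<in>{..<n}-{j}. f l) = f i * (\<Prod>l\<in>{..<n}-{i,j}. f l)"
proof -
  have e: "{..<n} - {j} - {i} = {..<n} - {i, j}" by auto
  show 2: "(\<Prod>l\<in>{..<n}-{j}. f l) = f i * (\<Prod>l\<in>{..<n}-{i,j}. f l)"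
    using assms by (subst prod.remove[of _ i]) (auto simp: e)
  show "(\<Prod>l<n. f l) = f i * f j * (\<Prod>l\<in>{..<n}-{i,j}. f l)"
    using assms by (subst prod.remove[of _ j]) (auto simp: 2)
qed

text \<open>The pole of order one on the diagonal is integrable against the weight; the factor x j makes up for
  a possible singularity at the origin, via min(u,v) <= sqrt(uv) and (uv)^c <= u^(2c) + v^(2c).\<close>

lemma oint_sing_weighted:
  assumes q: "0 < q" "q \<le> 1" and d: "d > 0" and ij: "i < n" "j < n" "i \<noteq> j" and a: "a > 0"
  shows "oint n (\<lambda>x. x j * \<bar>x i - x j\<bar> powr (q - 1) * (\<Prod>l<n. x l powr (a - 1)) * exp (- d * (\<Sum>l<n. x l)))"
proof -
  define E where "E c x = exp (- c * (\<Sum>l<n. x l))" for c and x :: "nat => real"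
  define R where "R x = (\<Prod>l\<in>{..<n}-{i,j}. x l powr (a - 1))" for x :: "nat => real"
  obtain C where C: "C \<ge> 0" "\<And>x. (\<forall>l<n. 0 < x l) ==> norm (\<bar>x i - x j\<bar> powr q) \<le> C * exp (d / 2 * (\<Sum>i<n. x i))"
    using expbdD[OF expbd_powr_diff[of q i n j], of "d / 2"] q ij d by auto
  \<comment> \<open>F1 will absorb the part in which the singularity is cancelled by |u - v|. F2 and
    F3 put the exponent 2a - 1, which exceeds -1, on one of the two coordinates and none on the
    other, as \<open>oint_sing\<close> requires.\<close>
  define F1 where "F1 x = C * ((\<Prod>l<n. x l powr (a - 1)) * E (d / 2) x)" for x
  define F2 where "F2 x = \<bar>x i - x j\<bar> powr (q - 1) * (\<Prod>l\<in>{..<n}-{j}. x l powr (if l = i then 2 * a - 1 else a - 1)) * E d x" for x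
  define F3 where "F3 x = \<bar>x j - x i\<bar> powr (q - 1) * (\<Prod>l\<in>{..<n}-{i}. x l powr (if l = j then 2 * a - 1 else a - 1)) * E d x" for x
  have "oint n (\<lambda>x. F1 x + F2 x + F3 x)"
  proof (intro set_integral_add)
    show "oint n F1" unfolding F1_def[abs_def] E_def using a d by (intro set_integrable_mult_right oint_prod) auto
    show "oint n F2" unfolding F2_def[abs_def] E_def using a d q ij by (intro oint_sing) auto
    show "oint n F3" unfolding F3_def[abs_def] E_def using a d q ij by (intro oint_sing) auto
  qed
  thus ?thesis
  proof (rule set_integrable_bound)
    have "(\<lambda>x. x j * \<bar>x i - x j\<bar> powr (q - 1) * (\<Prod>l<n. x l powr (a - 1)) * exp (- d * (\<Sum>l<n. x l))) \<in> borel_measurable (lebesgue_n n)"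
      using ij by measurable
    thus "set_borel_measurable (lebesgue_n n) (pos_orthant n)
       (\<lambda>x. x j * \<bar>x i - x j\<bar> powr (q - 1) * (\<Prod>l<n. x l powr (a - 1)) * exp (- d * (\<Sum>l<n. x l)))"
      by (rule set_meas)
    show "AE x in lebesgue_n n. x \<in> pos_orthant n -->
       norm (x j * \<bar>x i - x j\<bar> powr (q - 1) * (\<Prod>l<n. x l powr (a - 1)) * exp (- d * (\<Sum>l<n. x l))) \<le> norm (F1 x + F2 x + F3 x)"
    proof (intro AE_I2 impI)
      fix x assume x: "x \<in> pos_orthant n"
      define u v where "u = x i" and "v = x j"
      have uv: "u > 0" "v > 0" using pos_orthantD[OF x] ij by (auto simp: u_def v_def)
      have P: "(\<Prod>l<n. x l powr (a - 1)) = u powr (a - 1) * v powr (a - 1) * R x"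
        unfolding prod_split2(1)[OF ij] R_def u_def v_def ..
      have R: "R x \<ge> 0" unfolding R_def by (intro prod_nonneg) auto
      have E: "E c x \<ge> 0" for c by (simp add: E_def)
      have f2: "F2 x = \<bar>u - v\<bar> powr (q - 1) * (u powr (2 * a - 1) * R x) * E d x"
      proof -
        have "(\<Prod>l\<in>{..<n}-{i,j}. x l powr (if l = i then 2 * a - 1 else a - 1)) = R x"
          unfolding R_def by (intro prod.cong) auto
        thus ?thesis unfolding F2_def prod_split2(2)[OF ij] by (simp add: u_def v_def)
      qed
      have f3: "F3 x = \<bar>u - v\<bar> powr (q - 1) * (v powr (2 * a - 1) * R x) * E d x"
      proof -
        have "(\<Prod>l\<in>{..<n}-{j,i}. x l powr (if l = j then 2 * a - 1 else a - 1)) = R x"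
          unfolding R_def by (intro prod.cong) auto
        thus ?thesis unfolding F3_def prod_split2(2)[OF ij(2,1) ij(3)[symmetric]] by (simp add: u_def v_def abs_minus_commute)
      qed
      have f1: "\<bar>u - v\<bar> powr q * (\<Prod>l<n. x l powr (a - 1)) * E d x \<le> F1 x"
      proof -
        have "\<bar>u - v\<bar> powr q \<le> C * exp (d / 2 * (\<Sum>i<n. x i))" using C(2)[of x] pos_orthantD[OF x] by (simp add: u_def v_def)
        hence "\<bar>u - v\<bar> powr q * E d x \<le> C * exp (d / 2 * (\<Sum>i<n. x i)) * E d x" using E by (rule mult_right_mono)
        also have "\<dots> = C * E (d / 2) x" by (simp add: E_def field_simps flip: exp_add)
        finally have "\<bar>u - v\<bar> powr q * E d x * (\<Prod>l<n. x l powr (a - 1)) \<le> C * E (d / 2) x * (\<Prod>l<n. x l powr (a - 1))"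
          by (rule mult_right_mono) (auto intro: prod_nonneg)
        thus ?thesis by (simp add: F1_def mult_ac)
      qed
      \<comment> \<open>The factor v is split in two: |u - v| raises the exponent of the singularity
        to q, and the minimum repairs the powers at the origin.\<close>
      have m: "v \<le> \<bar>u - v\<bar> + min u v" by auto
      have abs_q: "\<bar>u - v\<bar> * \<bar>u - v\<bar> powr (q - 1) = \<bar>u - v\<bar> powr q"
        using powr_add[of "\<bar>u - v\<bar>" 1 "q - 1"] by (cases "u = v") (auto simp: powr_one)
      have min_le: "min u v * (u powr (a - 1) * v powr (a - 1)) \<le> u powr (2 * a - 1) + v powr (2 * a - 1)"
      proof -
        have "min u v = sqrt (min u v * min u v)" using uv by simp
        also have "\<dots> \<le> sqrt (u * v)" using uv by (intro real_sqrt_le_mono mult_mono) auto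
        also have "\<dots> = (u * v) powr (1 / 2)" using uv by (simp add: powr_half_sqrt)
        finally have "min u v * (u powr (a - 1) * v powr (a - 1)) \<le> (u * v) powr (1 / 2) * (u * v) powr (a - 1)"
          using uv by (simp add: powr_mult mult_right_mono)
        also have "\<dots> = u powr (a - 1 / 2) * v powr (a - 1 / 2)"
        proof -
          have e: "r powr (1 / 2) * r powr (a - 1) = r powr (a - 1 / 2)" for r :: real
            by (simp add: field_simps flip: powr_add)
          have "(u * v) powr b = u powr b * v powr b" for b using uv by (subst powr_mult) auto
          thus ?thesis by (simp only: e[symmetric] mult_ac)
        qed
        also have "\<dots> \<le> (u powr (a - 1 / 2))\<^sup>2 + (v powr (a - 1 / 2))\<^sup>2"
        proof -
          have "p * r \<le> p\<^sup>2 + r\<^sup>2" for p r :: real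
            using sum_squares_bound[of p r] zero_le_power2[of p] zero_le_power2[of r] by linarith
          thus ?thesis .
        qed
        also have "\<dots> = u powr (2 * a - 1) + v powr (2 * a - 1)"
          by (simp add: power2_eq_square algebra_simps flip: powr_add)
        finally show ?thesis .
      qed
      have "v * \<bar>u - v\<bar> powr (q - 1) * (\<Prod>l<n. x l powr (a - 1)) * E d x \<le>
         (\<bar>u - v\<bar> + min u v) * \<bar>u - v\<bar> powr (q - 1) * (\<Prod>l<n. x l powr (a - 1)) * E d x"
        using m E by (intro mult_right_mono) (auto intro: prod_nonneg)
      also have "\<dots> = \<bar>u - v\<bar> powr q * (\<Prod>l<n. x l powr (a - 1)) * E d x +
         \<bar>u - v\<bar> powr (q - 1) * ((min u v * (u powr (a - 1) * v powr (a - 1))) * R x) * E d x"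
        unfolding abs_q[symmetric] P by (simp only: distrib_right distrib_left mult_ac)
      also have "\<dots> \<le> F1 x + \<bar>u - v\<bar> powr (q - 1) * ((u powr (2 * a - 1) + v powr (2 * a - 1)) * R x) * E d x"
        using f1 min_le R E by (intro add_mono mult_right_mono mult_left_mono) auto
      also have "\<dots> = F1 x + F2 x + F3 x" unfolding f2 f3 by (simp only: distrib_right distrib_left mult_ac add.assoc)
      finally have le: "v * \<bar>u - v\<bar> powr (q - 1) * (\<Prod>l<n. x l powr (a - 1)) * E d x \<le> F1 x + F2 x + F3 x" .
      have "0 \<le> v * \<bar>u - v\<bar> powr (q - 1) * (\<Prod>l<n. x l powr (a - 1)) * E d x"
        using uv E by (intro mult_nonneg_nonneg prod_nonneg) auto
      thus "norm (x j * \<bar>x i - x j\<bar> powr (q - 1) * (\<Prod>l<n. x l powr (a - 1)) * exp (- d * (\<Sum>l<n. x l))) \<le> norm (F1 x + F2 x + F3 x)"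
        using le unfolding u_def v_def E_def by (simp only: real_norm_def)
    qed
  qed
qed

text \<open>The exponent 2k - 1 is split into q - 1 in (-1, 0], an admissible singularity, and the
  nonnegative remainder 2k - q, which only contributes growth.\<close>

lemma norm_ww_div:
  assumes "k > 0"
  shows "\<bar>ww k u / u\<bar> = \<bar>u\<bar> powr (min 1 (2 * k) - 1) * \<bar>u\<bar> powr (2 * k - min 1 (2 * k))"
proof (cases "u = 0")
  case False
  have "\<bar>u\<bar> powr (min 1 (2 * k) - 1) * \<bar>u\<bar> powr (2 * k - min 1 (2 * k)) = \<bar>u\<bar> powr (2 * k - 1)"
    by (simp flip: powr_add)
  also have "\<dots> = \<bar>u\<bar> powr (2 * k) / \<bar>u\<bar>" using False by (simp add: powr_diff)
  finally show ?thesis using assms by (simp add: ww_def)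
qed simp

lemma oint_dom_sing:
  assumes G: "decays n G" and s: "Re s > -1" and ij: "i < n" "j < n" "i \<noteq> j" and k: "k > 0"
  shows "oint n (\<lambda>x. G x * of_real (x j * (ww k (x i - x j) / (x j - x i))) * Dp n s x)"
proof -
  define q where "q = min 1 (2 * k)"
  have q: "0 < q" "q \<le> 1" "2 * k - q \<ge> 0" using k by (auto simp: q_def)
  have "decays n (\<lambda>x. G x * of_real (\<bar>x i - x j\<bar> powr (2 * k - q)))"
  proof (rule decays_mult[OF G])
    show "expbd n (\<lambda>x. complex_of_real (\<bar>x i - x j\<bar> powr (2 * k - q)))"
      by (rule expbd_mono[OF expbd_powr_diff[OF q(3) ij(1,2)]]) simp
    show "(\<lambda>x. complex_of_real (\<bar>x i - x j\<bar> powr (2 * k - q))) \<in> borel_measurable (lebesgue_n n)"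
      using ij by measurable
  qed
  then obtain d C where d: "d > 0" "C \<ge> 0" and G': "\<And>x. \<forall>i<n. 0 < x i ==>
       norm (G x * of_real (\<bar>x i - x j\<bar> powr (2 * k - q))) \<le> C * exp (- d * (\<Sum>i<n. x i))"
    by (auto simp: decays_def)
  have Gm: "G \<in> borel_measurable (lebesgue_n n)" using G by (simp add: decays_def)
  let ?F = "\<lambda>x. C * (x j * \<bar>x i - x j\<bar> powr (q - 1) * (\<Prod>l<n. x l powr (Re s + 1 - 1)) * exp (- d * (\<Sum>l<n. x l)))"
  have "oint n ?F" using s d q ij by (intro set_integrable_mult_right oint_sing_weighted) auto
  thus ?thesis
  proof (rule set_integrable_bound)
    have "(\<lambda>x. complex_of_real (x j * (ww k (x i - x j) / (x j - x i)))) \<in> borel_measurable (lebesgue_n n)"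
      using ij by measurable
    thus "set_borel_measurable (lebesgue_n n) (pos_orthant n) (\<lambda>x. G x * of_real (x j * (ww k (x i - x j) / (x j - x i))) * Dp n s x)"
      using Gm by (intro set_meas borel_measurable_times Dp_measurable)
    show "AE x in lebesgue_n n. x \<in> pos_orthant n --> norm (G x * of_real (x j * (ww k (x i - x j) / (x j - x i))) * Dp n s x) \<le> norm (?F x)"
    proof (intro AE_I2 impI)
      fix x assume x: "x \<in> pos_orthant n"
      have nD: "norm (Dp n s x) = (\<Prod>i<n. x i powr Re s)" by (rule norm_Dp) (use pos_orthantD[OF x] in auto)
      have xj: "x j > 0" using pos_orthantD[OF x] ij by auto
      have "\<bar>ww k (x i - x j) / (x j - x i)\<bar> = \<bar>x i - x j\<bar> powr (q - 1) * \<bar>x i - x j\<bar> powr (2 * k - q)"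
        using norm_ww_div[OF k, of "x i - x j"] by (simp add: q_def abs_minus_commute[of "x j"])
      hence "norm (G x * of_real (x j * (ww k (x i - x j) / (x j - x i))) * Dp n s x) =
         norm (G x * of_real (\<bar>x i - x j\<bar> powr (2 * k - q))) * (x j * \<bar>x i - x j\<bar> powr (q - 1) * (\<Prod>l<n. x l powr Re s))"
        using xj by (simp only: norm_mult norm_of_real abs_mult nD) (simp add: mult_ac)
      also have "\<dots> \<le> (C * exp (- d * (\<Sum>i<n. x i))) * (x j * \<bar>x i - x j\<bar> powr (q - 1) * (\<Prod>l<n. x l powr Re s))"
        using pos_orthantD[OF x] xj by (intro mult_right_mono G') (auto intro!: mult_nonneg_nonneg prod_nonneg)
      also have "\<dots> = ?F x" by (simp add: mult_ac)
      also have "\<dots> \<le> norm (?F x)" by simp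
      finally show "norm (G x * of_real (x j * (ww k (x i - x j) / (x j - x i))) * Dp n s x) \<le> norm (?F x)" .
    qed
  qed
qed

text \<open>The variant for exponent s = 0, without powers of the coordinates and without the factor
  x_j. It serves the boundary computation that lowers the number of variables.\<close>

lemma oint_dom_sing0:
  assumes G: "decays n G" and ij: "i < n" "j < n" "i \<noteq> j" and k: "k > 0"
  shows "oint n (\<lambda>x. G x * of_real (ww k (x i - x j) / (x j - x i)))"
proof -
  define q where "q = min 1 (2 * k)"
  have q: "0 < q" "q \<le> 1" "2 * k - q \<ge> 0" using k by (auto simp: q_def)
  have "decays n (\<lambda>x. G x * of_real (\<bar>x i - x j\<bar> powr (2 * k - q)))"
  proof (rule decays_mult[OF G])
    show "expbd n (\<lambda>x. complex_of_real (\<bar>x i - x j\<bar> powr (2 * k - q)))"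
      by (rule expbd_mono[OF expbd_powr_diff[OF q(3) ij(1,2)]]) simp
    show "(\<lambda>x. complex_of_real (\<bar>x i - x j\<bar> powr (2 * k - q))) \<in> borel_measurable (lebesgue_n n)"
      using ij by measurable
  qed
  then obtain d C where d: "d > 0" "C \<ge> 0" and G': "\<And>x. \<forall>i<n. 0 < x i ==>
       norm (G x * of_real (\<bar>x i - x j\<bar> powr (2 * k - q))) \<le> C * exp (- d * (\<Sum>i<n. x i))"
    by (auto simp: decays_def)
  have Gm: "G \<in> borel_measurable (lebesgue_n n)" using G by (simp add: decays_def)
  let ?F = "\<lambda>x. C * (\<bar>x i - x j\<bar> powr (q - 1) * (\<Prod>l\<in>{..<n}-{j}. x l powr 0) * exp (- d * (\<Sum>l<n. x l)))"
  have "oint n ?F" using d q ij by (intro set_integrable_mult_right oint_sing) auto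
  thus ?thesis
  proof (rule set_integrable_bound)
    have "(\<lambda>x. complex_of_real (ww k (x i - x j) / (x j - x i))) \<in> borel_measurable (lebesgue_n n)"
      using ij by measurable
    thus "set_borel_measurable (lebesgue_n n) (pos_orthant n) (\<lambda>x. G x * of_real (ww k (x i - x j) / (x j - x i)))"
      using Gm by (intro set_meas borel_measurable_times)
    show "AE x in lebesgue_n n. x \<in> pos_orthant n --> norm (G x * of_real (ww k (x i - x j) / (x j - x i))) \<le> norm (?F x)"
    proof (intro AE_I2 impI)
      fix x assume x: "x \<in> pos_orthant n"
      have p1: "(\<Prod>l\<in>{..<n}-{j}. x l powr 0) = 1"
        by (intro prod.neutral) (use pos_orthantD[OF x] in force)
      have "\<bar>ww k (x i - x j) / (x j - x i)\<bar> = \<bar>x i - x j\<bar> powr (q - 1) * \<bar>x i - x j\<bar> powr (2 * k - q)"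
        using norm_ww_div[OF k, of "x i - x j"] by (simp add: q_def abs_minus_commute[of "x j"])
      hence "norm (G x * of_real (ww k (x i - x j) / (x j - x i))) =
         norm (G x * of_real (\<bar>x i - x j\<bar> powr (2 * k - q))) * \<bar>x i - x j\<bar> powr (q - 1)"
        by (simp only: norm_mult norm_of_real) (simp add: mult_ac)
      also have "\<dots> \<le> (C * exp (- d * (\<Sum>i<n. x i))) * \<bar>x i - x j\<bar> powr (q - 1)"
        using pos_orthantD[OF x] by (intro mult_right_mono G') auto
      also have "\<dots> = ?F x" unfolding p1 by (simp add: mult_ac)
      also have "\<dots> \<le> norm (?F x)" by simp
      finally show "norm (G x * of_real (ww k (x i - x j) / (x j - x i))) \<le> norm (?F x)" .
    qed
  qed
qed

text \<open>The right half-plane is exhausted by discs about M of radius M - epsilon: expanding the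
  square, z lies in such a disc as soon as |z|^2 <= 2 (Re z - epsilon)(M - epsilon).\<close>

lemma halfplane_disc:
  assumes "\<And>i. i < n ==> Re (z i) > 0"
  shows "\<exists>M \<epsilon>. \<epsilon> > 0 \<and> (\<forall>i<(n::nat). norm (of_real M - z i) \<le> M - \<epsilon>)"
proof -
  define \<epsilon> where "\<epsilon> = Min (insert 1 ((\<lambda>i. Re (z i)) ` {..<n})) / 2"
  have fin: "finite (insert 1 ((\<lambda>i. Re (z i)) ` {..<n}))" by simp
  have e: "\<epsilon> > 0" unfolding \<epsilon>_def using assms by (simp add: Min_gr_iff)
  have le: "\<epsilon> < Re (z i)" if "i < n" for i
  proof -
    have "Min (insert 1 ((\<lambda>i. Re (z i)) ` {..<n})) \<le> Re (z i)" using that by (intro Min_le) auto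
    thus ?thesis using assms[OF that] by (simp add: \<epsilon>_def)
  qed
  \<comment> \<open>The value that M - epsilon must reach for z_i; taking M as epsilon plus the sum
    of these serves all coordinates at once.\<close>
  define t where "t i = (norm (z i))\<^sup>2 / (2 * (Re (z i) - \<epsilon>))" for i
  define M where "M = \<epsilon> + (\<Sum>i<n. t i)"
  have "norm (of_real M - z i) \<le> M - \<epsilon>" if i: "i < n" for i
  proof -
    have t0: "t j \<ge> 0" if "j < n" for j using le[OF that] by (simp add: t_def)
    have "t i \<le> (\<Sum>i<n. t i)" using i t0 by (intro member_le_sum) auto
    hence M: "t i \<le> M - \<epsilon>" "M - \<epsilon> \<ge> 0" using t0[OF i] by (auto simp: M_def)
    have d: "Re (z i) - \<epsilon> > 0" using le[OF i] by simp
    have "(norm (z i))\<^sup>2 \<le> 2 * (Re (z i) - \<epsilon>) * (M - \<epsilon>)"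
      using M(1) d by (simp add: t_def field_simps)
    note nz = this
    have e2: "\<epsilon> * \<epsilon> \<le> \<epsilon> * Re (z i)" using e d by (intro mult_left_mono) auto
    have "(norm (of_real M - z i))\<^sup>2 = M * M - 2 * M * Re (z i) + (norm (z i))\<^sup>2"
      unfolding cmod_power2 by (simp add: power2_eq_square algebra_simps)
    also have "\<dots> \<le> M * M - 2 * M * Re (z i) + 2 * (Re (z i) - \<epsilon>) * (M - \<epsilon>)" using nz by simp
    also have "\<dots> = M * M - 2 * (M * \<epsilon>) - 2 * (\<epsilon> * Re (z i)) + 2 * (\<epsilon> * \<epsilon>)" by (simp add: algebra_simps)
    also have "\<dots> \<le> M * M - 2 * (M * \<epsilon>) + \<epsilon> * \<epsilon>" using e2 mult_nonneg_nonneg[of \<epsilon> \<epsilon>] e by linarith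
    also have "\<dots> = (M - \<epsilon>)\<^sup>2" by (simp add: power2_eq_square algebra_simps)
    finally have "(norm (of_real M - z i))\<^sup>2 \<le> (M - \<epsilon>)\<^sup>2" .
    thus ?thesis using M(2) by (rule power2_le_imp_le)
  qed
  thus ?thesis using e by blast
qed

lemma cvec_coord_measurable: "i < n ==> (\<lambda>x. cvec x i) \<in> borel_measurable (lebesgue_n n)"
  unfolding cvec_def by measurable

lemma norm_dk_pos:
  assumes "k \<ge> 0" "\<And>i. i < n ==> norm (of_real M - z i) \<le> M - \<epsilon>" "\<And>i. i < n ==> 0 < x i"
  shows "norm (dk n k (\<lambda>i. - z i) (cvec x)) \<le> exp (- \<epsilon> * (\<Sum>i<n. x i))"
proof -
  have "(\<Sum>i<n. norm (cvec x i)) = (\<Sum>i<n. x i)" "(\<Sum>i<n. Re (cvec x i)) = (\<Sum>i<n. x i)"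
    by (auto simp: cvec_def abs_of_pos assms(3) intro!: sum.cong)
  thus ?thesis using norm_dk_decay[OF assms(1), of n M z \<epsilon> "cvec x"] assms(2) by (simp add: algebra_simps)
qed

lemma decays_dk:
  assumes k: "k \<ge> 0" and z: "\<And>i. i < n ==> Re (z i) > 0" and \<tau>: "\<tau> \<in> symg n"
  shows "decays n (\<lambda>x. dk n k (\<lambda>i. - z i) (cvec x \<circ> \<tau>))"
  unfolding decays_def
proof
  have "\<exists>M \<epsilon>. \<epsilon> > 0 \<and> (\<forall>i<n. norm (of_real M - z i) \<le> M - \<epsilon>)" by (rule halfplane_disc) (rule z)
  then obtain M \<epsilon> where M0: "\<epsilon> > 0" "\<forall>i<n. norm (of_real M - z i) \<le> M - \<epsilon>" by (elim exE conjE)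
  have M: "norm (of_real M - z i) \<le> M - \<epsilon>" if "i < n" for i using M0(2) that by simp
  show "(\<lambda>x. dk n k (\<lambda>i. - z i) (cvec x \<circ> \<tau>)) \<in> borel_measurable (lebesgue_n n)"
  proof (rule dk_measurable[OF k])
    fix i assume "i < n"
    hence "\<tau> i < n" using \<tau> by (simp add: symg_lt)
    thus "(\<lambda>x. (cvec x \<circ> \<tau>) i) \<in> borel_measurable (lebesgue_n n)"
      unfolding comp_def by (rule cvec_coord_measurable)
  qed
  show "\<exists>d>0. \<exists>C\<ge>0. \<forall>x. (\<forall>i<n. 0 < x i) --> norm (dk n k (\<lambda>i. - z i) (cvec x \<circ> \<tau>)) \<le> C * exp (- d * (\<Sum>i<n. x i))"
  proof (rule exI[of _ \<epsilon>], rule conjI[OF M0(1)], rule exI[of _ 1], intro conjI allI impI)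
    fix x :: "nat => real" assume x: "\<forall>i<n. 0 < x i"
    have "norm (dk n k (\<lambda>i. - z i) (cvec (x \<circ> \<tau>))) \<le> exp (- \<epsilon> * (\<Sum>i<n. (x \<circ> \<tau>) i))"
    proof (rule norm_dk_pos[where M = M and z = z and \<epsilon> = \<epsilon> and x = "x \<circ> \<tau>", OF k])
      fix i assume "i < n" thus "norm (of_real M - z i) \<le> M - \<epsilon>" by (rule M)
    next
      fix i assume "i < n" thus "0 < (x \<circ> \<tau>) i" using x \<tau> by (simp add: symg_lt)
    qed
    thus "norm (dk n k (\<lambda>i. - z i) (cvec x \<circ> \<tau>)) \<le> 1 * exp (- \<epsilon> * (\<Sum>i<n. x i))"
      unfolding sum_coords_symg[OF \<tau>] cvec_comp by simp
  qed simp
qed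

lemma decays_dk': "k \<ge> 0 ==> (\<And>i. i < n ==> Re (z i) > 0) ==> decays n (\<lambda>x. dk n k (\<lambda>i. - z i) (cvec x))"
  using decays_dk[of k n z id] by simp

lemma expbd_of_real: "expbd n F ==> expbd n (\<lambda>x. of_real (F x) :: 'a :: real_normed_field)"
  by (rule expbd_mono[of n F]) auto

lemma omega_meas [measurable]: "n \<le> N ==> omega n k \<in> borel_measurable (lebesgue_n N)"
  using omega_measurable[of n "\<lambda>x. x" "lebesgue_n N" k] by (simp add: coord_measurable)

lemma decays_omega: "decays n G ==> k \<ge> 0 ==> decays n (\<lambda>x. G x * of_real (omega n k x))"
  by (rule decays_mult) (auto intro!: expbd_of_real expbd_omega borel_measurable_of_real omega_meas)

section \<open>The integrand and its derivative in the last coordinate\<close>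

definition mpoly :: "nat => (nat => nat) set => ((nat => nat) => complex) => (nat => complex) => complex" where
  "mpoly n S c x = (\<Sum>\<alpha>\<in>S. c \<alpha> * mono n \<alpha> x)"

lemma mono_measurable: "(\<lambda>x. mono n \<alpha> (cvec x)) \<in> borel_measurable (lebesgue_n n)"
  unfolding mono_def by (intro borel_measurable_prod borel_measurable_power cvec_coord_measurable) auto

lemma mpoly_measurable: "(\<lambda>x. mpoly n S c (cvec x)) \<in> borel_measurable (lebesgue_n n)"
  unfolding mpoly_def by (intro borel_measurable_sum borel_measurable_times borel_measurable_const mono_measurable)

lemma expbd_mpoly: "finite S ==> expbd n (\<lambda>x. mpoly n S c (cvec x))"
  unfolding mpoly_def by (intro expbd_sum expbd_mult expbd_const expbd_mono_cvec)

lemma sep_holo_mpoly: "sep_holo n (mpoly n S c)"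
  unfolding mpoly_def[abs_def] by (intro sep_holo_sum sep_holo_mult sep_holo_const sep_holo_mono)

text \<open>The integrand of formula (1) with a general polynomial g; s stands for the exponent mu -
  mu_0 - 1.\<close>

definition hint :: "nat => real => complex => (nat => complex) => ((nat => complex) => complex) => (nat => real) => complex" where
  "hint n k s z g x = dk n k (\<lambda>i. - z i) (cvec x) * g (cvec x) * of_real (omega n k x) * Dp n s x"

lemma oint_hint:
  assumes "k \<ge> 0" "\<And>i. i < n ==> Re (z i) > 0" "Re s > -1" "finite S"
  shows "oint n (hint n k s z (mpoly n S c))"
  unfolding hint_def[abs_def] using assms
  by (intro oint_dom decays_omega decays_mult decays_dk' expbd_mpoly mpoly_measurable) auto

lemma log_deriv_prod:
  fixes f :: "'i => real => real"
  assumes "finite S" "\<And>i. i \<in> S ==> (f i has_real_derivative f i y * r i) (at y)"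
  shows "((\<lambda>y. \<Prod>i\<in>S. f i y) has_real_derivative (\<Prod>i\<in>S. f i y) * (\<Sum>i\<in>S. r i)) (at y)"
  using assms
proof (induction S rule: finite_induct)
  case (insert i S)
  have "((\<lambda>y. f i y * (\<Prod>i\<in>S. f i y)) has_real_derivative f i y * r i * (\<Prod>i\<in>S. f i y) + (\<Prod>i\<in>S. f i y) * (\<Sum>i\<in>S. r i) * f i y) (at y)"
    using insert by (intro DERIV_mult) auto
  thus ?case using insert by (simp add: algebra_simps)
qed simp

text \<open>The logarithmic derivative 2k / (y - u) is the same on both sides of the singularity,
  although the power is differentiated separately on each side.\<close>

lemma ww_deriv:
  assumes "u \<noteq> y" "k \<ge> 0"
  shows "((\<lambda>y. ww k (u - y)) has_real_derivative ww k (u - y) * (2 * k / (y - u))) (at y)"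
proof (cases "k = 0")
  case True
  thus ?thesis by (simp add: ww_def)
next
  case False
  consider "u < y" | "y < u" using assms by linarith
  thus ?thesis
  proof cases
    case 1
    have "((\<lambda>y. (y - u) powr (2 * k)) has_real_derivative (2 * k) * (y - u) powr (2 * k - 1)) (at y)"
      using 1 by (auto intro!: derivative_eq_intros simp: powr_diff)
    note der = this
    have "eventually (\<lambda>t. t \<in> {u<..}) (nhds y)" using 1 by (intro eventually_nhds_in_open) auto
    hence "eventually (\<lambda>t. (t - u) powr (2 * k) = ww k (u - t)) (nhds y)"
      by eventually_elim (use False in \<open>simp add: ww_def\<close>)
    note ev = this
    have "((\<lambda>y. ww k (u - y)) has_real_derivative (2 * k) * (y - u) powr (2 * k - 1)) (at y)"
      using der DERIV_cong_ev[OF refl ev refl] by simp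
    thus ?thesis using 1 False by (simp add: ww_def powr_diff mult_ac)
  next
    case 2
    have "((\<lambda>y. (u - y) powr (2 * k)) has_real_derivative - ((2 * k) * (u - y) powr (2 * k - 1))) (at y)"
      using 2 by (auto intro!: derivative_eq_intros simp: powr_diff)
    note der = this
    have "eventually (\<lambda>t. t \<in> {..<u}) (nhds y)" using 2 by (intro eventually_nhds_in_open) auto
    hence "eventually (\<lambda>t. (u - t) powr (2 * k) = ww k (u - t)) (nhds y)"
      by eventually_elim (use False in \<open>simp add: ww_def\<close>)
    note ev = this
    have "((\<lambda>y. ww k (u - y)) has_real_derivative - ((2 * k) * (u - y) powr (2 * k - 1))) (at y)"
      using der DERIV_cong_ev[OF refl ev refl] by simp
    moreover have "- ((2 * k) * (u - y) powr (2 * k - 1)) = ww k (u - y) * (2 * k / (y - u))"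
      using 2 False minus_divide_right[of "(u - y) powr (2 * k) * (2 * k)" "u - y"] by (simp add: ww_def powr_diff mult_ac)
    ultimately show ?thesis by simp
  qed
qed

lemma omega_deriv:
  assumes "\<And>i. i < m ==> x i \<noteq> y" "k \<ge> 0"
  shows "((\<lambda>y. omega (Suc m) k (x(m := y))) has_real_derivative
    omega (Suc m) k (x(m := y)) * (\<Sum>i<m. 2 * k / (y - x i))) (at y)"
proof -
  have o: "omega (Suc m) k (x(m := y)) = omega m k x * (\<Prod>i<m. ww k (x i - y))" for y
    unfolding omega_Suc using omega_cong[of m "x(m := y)" x k] by simp
  have "((\<lambda>y. \<Prod>i<m. ww k (x i - y)) has_real_derivative (\<Prod>i<m. ww k (x i - y)) * (\<Sum>i<m. 2 * k / (y - x i))) (at y)"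
    using assms by (intro log_deriv_prod ww_deriv) auto
  thus ?thesis unfolding o using DERIV_cmult by (simp add: mult.assoc)
qed

lemma continuous_ww: "k \<ge> 0 ==> continuous_on UNIV (\<lambda>y. ww k (u - y))"
  by (cases "k = 0") (auto simp: ww_def intro!: continuous_intros continuous_on_powr')

lemma continuous_omega:
  assumes "k \<ge> 0"
  shows "continuous_on UNIV (\<lambda>y. omega (Suc m) k (x(m := y)))"
proof -
  have o: "omega (Suc m) k (x(m := y)) = omega m k x * (\<Prod>i<m. ww k (x i - y))" for y
    unfolding omega_Suc using omega_cong[of m "x(m := y)" x k] by simp
  show ?thesis unfolding o using assms by (intro continuous_intros continuous_ww)
qed

lemma cvec_upd: "cvec (x(m := y)) = (cvec x)(m := of_real y)" by (auto simp: cvec_def)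

lemma sep_holo_real_deriv:
  assumes "sep_holo n f" "m < n"
  shows "((\<lambda>y. f (cvec (x(m := y)))) has_vector_derivative pderiv_n f m (cvec (x(m := y)))) (at y)"
proof -
  have "((\<lambda>w. f ((cvec x)(m := w))) has_field_derivative pderiv_n f m ((cvec x)(m := of_real y))) (at (of_real y))"
    unfolding pderiv_n_def using sep_holo_diff[OF assms, of "cvec x" "of_real y"] by (simp add: field_differentiable_derivI)
  from has_vector_derivative_real_field[OF this] show ?thesis by (simp add: cvec_upd)
qed

lemma Dp_upd: "y > 0 ==> Dp (Suc m) s (x(m := y)) = Dp m s x * exp (s * of_real (ln y))"
proof -
  have "(\<Sum>i<m. ln ((x(m := y)) i)) = (\<Sum>i<m. ln (x i))" by (intro sum.cong) auto
  thus ?thesis by (simp add: Dp_def exp_add distrib_left)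
qed

lemma Dp_deriv:
  assumes "y > 0"
  shows "((\<lambda>y. Dp (Suc m) s (x(m := y))) has_vector_derivative s / of_real y * Dp (Suc m) s (x(m := y))) (at y)"
proof -
  have "((\<lambda>w. Dp m s x * exp (s * Ln w)) has_field_derivative Dp m s x * (exp (s * Ln (of_real y)) * (s * (1 / of_real y)))) (at (of_real y))"
    using assms by (auto intro!: derivative_eq_intros simp: complex_nonpos_Reals_iff divide_inverse mult_ac)
  from has_vector_derivative_real_field[OF this]
  have 1: "((\<lambda>y. Dp m s x * exp (s * Ln (of_real y))) has_vector_derivative Dp m s x * (exp (s * Ln (of_real y)) * (s * (1 / of_real y)))) (at y)" .
  have "((\<lambda>y. Dp (Suc m) s (x(m := y))) has_vector_derivative Dp m s x * (exp (s * Ln (of_real y)) * (s * (1 / of_real y)))) (at y)"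
    by (rule has_vector_derivative_transform_within_open[OF 1, of "{0<..}"])
       (use assms in \<open>auto simp: Dp_upd Ln_of_real\<close>)
  thus ?thesis using assms by (simp add: Dp_upd Ln_of_real mult_ac)
qed

lemma halfline_limits:
  fixes \<phi> :: "real => complex"
  assumes "\<And>y. y > 0 ==> norm (\<phi> y) \<le> K * (y powr a * exp (- d * y))" "a > 0" "d > 0" "K \<ge> 0"
  shows "(\<phi> \<longlongrightarrow> 0) (at_right 0)" "(\<phi> \<longlongrightarrow> 0) at_top"
proof -
  have "((\<lambda>y. y powr a) \<longlongrightarrow> 0) (at_right (0::real))"
    by (rule tendsto_zero_powrI[OF tendsto_ident_at tendsto_const _ assms(2)]) (auto simp: eventually_at_filter)
  hence t: "((\<lambda>y. K * y powr a) \<longlongrightarrow> 0) (at_right 0)" by (rule tendsto_mult_right_zero)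
  show "(\<phi> \<longlongrightarrow> 0) (at_right 0)"
  proof (rule Lim_null_comparison[OF _ t])
    have "norm (\<phi> y) \<le> K * y powr a" if "y > 0" for y
    proof -
      have "exp (- d * y) \<le> 1" using that assms(3) by simp
      hence "y powr a * exp (- d * y) \<le> y powr a * 1" by (intro mult_left_mono) auto
      hence "K * (y powr a * exp (- d * y)) \<le> K * y powr a" using assms(4) by (intro mult_left_mono) auto
      thus ?thesis using assms(1)[OF that] by linarith
    qed
    thus "\<forall>\<^sub>F y in at_right 0. norm (\<phi> y) \<le> K * y powr a"
      by (auto simp: eventually_at_filter)
  qed
  obtain C where C: "C \<ge> 0" "\<And>t. t \<ge> 0 ==> t powr a \<le> C * exp (d / 2 * t)"
    using powr_le_exp[of a "d / 2"] assms by auto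
  have "filterlim (\<lambda>y. - (d / 2) * y) at_bot at_top"
    using assms(3) by (intro filterlim_tendsto_neg_mult_at_bot[OF tendsto_const _ filterlim_ident]) auto
  hence "((\<lambda>y. exp (- (d / 2) * y)) \<longlongrightarrow> 0) at_top" by (rule filterlim_compose[OF exp_at_bot])
  hence t: "((\<lambda>y. K * C * exp (- (d / 2) * y)) \<longlongrightarrow> 0) at_top" by (rule tendsto_mult_right_zero)
  show "(\<phi> \<longlongrightarrow> 0) at_top"
  proof (rule Lim_null_comparison[OF _ t])
    have "norm (\<phi> y) \<le> K * C * exp (- (d / 2) * y)" if "y > 0" for y
    proof -
      have "y powr a * exp (- d * y) \<le> C * exp (d / 2 * y) * exp (- d * y)"
        using that by (intro mult_right_mono C) auto
      also have "\<dots> = C * exp (- (d / 2) * y)" by (simp add: field_simps flip: exp_add)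
      finally have "K * (y powr a * exp (- d * y)) \<le> K * (C * exp (- (d / 2) * y))" using assms(4) by (rule mult_left_mono)
      thus ?thesis using assms(1)[OF that] by (simp add: mult.assoc)
    qed
    note b = this
    show "\<forall>\<^sub>F y in at_top. norm (\<phi> y) \<le> K * C * exp (- (d / 2) * y)"
      by (rule eventually_mono[OF eventually_gt_at_top[of "0::real"]]) (rule b)
  qed
qed

lemma has_vector_derivative_of_real':
  "(f has_real_derivative f') (at y) ==> ((\<lambda>y. complex_of_real (f y)) has_vector_derivative of_real f') (at y)"
  by (auto intro!: has_vector_derivative_of_real simp: has_real_derivative_iff_has_vector_derivative)

lemma last_deriv_dk:
  assumes k: "k \<ge> 0" and d: "distinct_coords (Suc m) x"
  shows "pderiv_n (dk (Suc m) k l) m x = l m * dk (Suc m) k l x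
    - (\<Sum>i<m. of_real k * (dk (Suc m) k l x - dk (Suc m) k l (swap_coords i m x)) / (x m - x i))"
proof -
  have "pairing (Suc m) l (cvec (unit_vec m)) = l m"
    by (simp add: pairing_def cvec_def unit_vec_def)
  moreover have "{..<Suc m} - {m} = {..<m}" by auto
  ultimately have "pderiv_n (dk (Suc m) k l) m x + of_real k * (\<Sum>i<m. (dk (Suc m) k l x - dk (Suc m) k l (swap_coords i m x)) / (x m - x i)) = l m * dk (Suc m) k l x"
    using dunkl_op_dk[OF k d, of "unit_vec m" l] dunkl_op_unit[of m "Suc m" k "dk (Suc m) k l" x] by simp
  thus ?thesis by (simp add: sum_distrib_left algebra_simps)
qed

section \<open>Integration by parts\<close>

lemma upd_space:
  "x \<in> space (PiM {..<m} (\<lambda>_. lborel :: real measure)) ==> x(m := y) \<in> space (lebesgue_n (Suc m))"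
  by (auto simp: space_lebesgue_n space_PiM PiE_def extensional_def)

lemma indicator_upd:
  assumes "x \<in> space (PiM {..<m} (\<lambda>_. lborel :: real measure))"
  shows "x(m := y) \<in> pos_orthant (Suc m) \<longleftrightarrow> (\<forall>i<m. 0 < x i) \<and> 0 < y"
  using upd_space[OF assms, of y] by (auto simp: pos_orthant_def less_Suc_eq)

lemma set_sum:
  fixes f :: "'i => 'b => 'a :: {banach, second_countable_topology}"
  assumes "\<And>i. i \<in> I ==> set_integrable M A (f i)"
  shows "set_integrable M A (\<lambda>x. \<Sum>i\<in>I. f i x)"
    "(LINT x:A|M. \<Sum>i\<in>I. f i x) = (\<Sum>i\<in>I. LINT x:A|M. f i x)"
  using assms unfolding set_integrable_def set_lebesgue_integral_def scaleR_sum_right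
  by (auto intro!: Bochner_Integration.integral_sum)

text \<open>Fubini with the last coordinate innermost, then \<open>ftc_halfline\<close> on almost
  every line; L is the boundary value at x_m = 0. For almost every line the other coordinates are
  distinct, and the derivative is missing only where the last one meets one of them.\<close>

lemma oint_last_deriv:
  fixes D \<Psi> :: "(nat => real) => complex"
  assumes D: "oint (Suc m) D"
    and der: "\<And>x y. (\<And>i. i < m ==> 0 < x i) ==> y > 0 ==> distinct_coords (Suc m) (x(m := y)) ==>
       ((\<lambda>y. \<Psi> (x(m := y))) has_vector_derivative D (x(m := y))) (at y)"
    and cont: "\<And>x. (\<And>i. i < m ==> 0 < x i) ==> continuous_on {0<..} (\<lambda>y. \<Psi> (x(m := y)))"
    and lim: "\<And>x. (\<And>i. i < m ==> 0 < x i) ==> ((\<lambda>y. \<Psi> (x(m := y))) \<longlongrightarrow> L x) (at_right 0) \<and> ((\<lambda>y. \<Psi> (x(m := y))) \<longlongrightarrow> 0) at_top"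
    and L: "L \<in> borel_measurable (lebesgue_n m)"
  shows "OI (Suc m) D = - OI m L"
proof -
  let ?M = "PiM {..<m} (\<lambda>_. lborel :: real measure)"
  let ?F = "\<lambda>x. indicator (pos_orthant (Suc m)) x *\<^sub>R D x"
  have F: "integrable (PiM (insert m {..<m}) (\<lambda>_. lborel)) ?F"
    using D by (simp add: set_integrable_def lebesgue_Suc)
  have Fm: "?F \<in> borel_measurable (PiM (insert m {..<m}) (\<lambda>_. lborel))" using F by (rule borel_measurable_integrable)
  have Fp: "(\<lambda>(x, y). ?F (x(m := y))) \<in> borel_measurable (?M \<Otimes>\<^sub>M lborel)"
    using measurable_comp[OF measurable_add_dim[of m "{..<m}" "\<lambda>_. lborel"] Fm] by (simp add: comp_def split_beta')
  have nb: "(\<lambda>v::complex. ennreal (norm v)) \<in> borel_measurable borel" by measurable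
  have Fpn: "(\<lambda>(x, y). ennreal (norm (?F (x(m := y))))) \<in> borel_measurable (?M \<Otimes>\<^sub>M lborel)"
    using measurable_compose[OF Fp nb] by (simp only: split_beta')
  have "(\<integral>\<^sup>+x. \<integral>\<^sup>+y. ennreal (norm (?F (x(m := y)))) \<partial>lborel \<partial>?M) = (\<integral>\<^sup>+x. ennreal (norm (?F x)) \<partial>PiM (insert m {..<m}) (\<lambda>_. lborel))"
    by (rule product_sigma_finite.product_nn_integral_insert[OF psf _ _ measurable_compose[OF Fm nb], symmetric]) auto
  also have "\<dots> < \<infinity>" using F by (simp add: integrable_iff_bounded)
  \<comment> \<open>Joint integrability of D makes it integrable along almost every line, which the
    fundamental theorem on the half-line presupposes.\<close>
  finally have "AE x in ?M. (\<integral>\<^sup>+y. ennreal (norm (?F (x(m := y)))) \<partial>lborel) \<noteq> \<infinity>"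
    by (intro nn_integral_PInf_AE lborel.borel_measurable_nn_integral Fpn) auto
  hence sec: "AE x in ?M. integrable lborel (\<lambda>y. ?F (x(m := y)))"
    using AE_space
  proof eventually_elim
    fix x assume fin: "(\<integral>\<^sup>+y. ennreal (norm (?F (x(m := y)))) \<partial>lborel) \<noteq> \<infinity>" and xs: "x \<in> space ?M"
    have "(\<lambda>y. ?F (x(m := y))) \<in> borel_measurable lborel"
      using measurable_Pair2[OF Fp xs] by simp
    thus "integrable lborel (\<lambda>y. ?F (x(m := y)))" using fin by (simp add: integrable_iff_bounded less_top)
  qed
  have "OI (Suc m) D = (\<integral>x. ?F x \<partial>PiM (insert m {..<m}) (\<lambda>_. lborel))"
    by (simp add: set_lebesgue_integral_def lebesgue_Suc)
  also have "\<dots> = (\<integral>x. (\<integral>y. ?F (x(m := y)) \<partial>lborel) \<partial>?M)"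
    by (rule product_sigma_finite.product_integral_insert[OF psf _ _ F]) auto
  also have "\<dots> = (\<integral>x. - (indicator (pos_orthant m) x *\<^sub>R L x) \<partial>?M)"
  proof (rule integral_cong_AE)
    show "(\<lambda>x. \<integral>y. ?F (x(m := y)) \<partial>lborel) \<in> borel_measurable ?M"
      by (rule lborel.borel_measurable_lebesgue_integral[OF Fp])
    show "(\<lambda>x. - (indicator (pos_orthant m) x *\<^sub>R L x)) \<in> borel_measurable ?M"
      using L pos_orthant_sets[of m] unfolding lebesgue_n_def by (intro borel_measurable_uminus borel_measurable_scaleR borel_measurable_indicator)
    have "AE x in ?M. distinct_coords m x" using AE_distinct[of m] unfolding lebesgue_n_def .
    moreover have "AE x in ?M. x \<in> space ?M" by (rule AE_space)
    ultimately show "AE x in ?M. (\<integral>y. ?F (x(m := y)) \<partial>lborel) = - (indicator (pos_orthant m) x *\<^sub>R L x)"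
      using sec
    proof eventually_elim
      fix x assume dx: "distinct_coords m x" and xs: "x \<in> space ?M" and int: "integrable lborel (\<lambda>y. ?F (x(m := y)))"
      have pos: "x \<in> pos_orthant m \<longleftrightarrow> (\<forall>i<m. 0 < x i)" using xs by (simp add: pos_orthant_def lebesgue_n_def)
      show "(\<integral>y. ?F (x(m := y)) \<partial>lborel) = - (indicator (pos_orthant m) x *\<^sub>R L x)"
      proof (cases "\<forall>i<m. 0 < x i")
        case False
        hence "(\<lambda>y. ?F (x(m := y))) = (\<lambda>y. 0)" using indicator_upd[OF xs] by (intro ext) (simp add: indicator_def)
        thus ?thesis using False pos by (simp only: Bochner_Integration.integral_zero) (simp add: indicator_def)
      next
        case True
        have e: "?F (x(m := y)) = indicator {0<..} y *\<^sub>R D (x(m := y))" for y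
          using indicator_upd[OF xs, of y] True by (simp add: indicator_def)
        have int': "set_integrable lborel {0<..} (\<lambda>y. D (x(m := y)))" using int unfolding e set_integrable_def .
        have "(LINT y:{0<..}|lborel. D (x(m := y))) = - L x"
        proof (rule ftc_halfline[where S = "x ` {..<m}", OF int'])
          show "continuous_on {0<..} (\<lambda>y. \<Psi> (x(m := y)))" using True by (intro cont) auto
          show "((\<lambda>y. \<Psi> (x(m := y))) \<longlongrightarrow> L x) (at_right 0)" "((\<lambda>y. \<Psi> (x(m := y))) \<longlongrightarrow> 0) at_top"
            using lim[of x] True by auto
          fix t :: real assume t: "t > 0" "t \<notin> x ` {..<m}"
          have "distinct_coords (Suc m) (x(m := t))"
            using dx t by (auto simp: distinct_coords_def less_Suc_eq)
          thus "((\<lambda>y. \<Psi> (x(m := y))) has_vector_derivative D (x(m := t))) (at t)"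
            using True t by (intro der) auto
        qed simp
        thus ?thesis using True pos by (simp add: e set_lebesgue_integral_def)
      qed
    qed
  qed
  also have "\<dots> = - OI m L" by (simp add: set_lebesgue_integral_def lebesgue_n_def)
  finally show ?thesis .
qed

lemma OI_cong_distinct:
  fixes F G :: "(nat => real) => 'a :: {banach, second_countable_topology}"
  assumes "oint n F" "oint n G" "\<And>x. distinct_coords n x ==> F x = G x"
  shows "OI n F = OI n G"
  unfolding set_lebesgue_integral_def
proof (rule integral_cong_AE)
  show "AE x in lebesgue_n n. indicator (pos_orthant n) x *\<^sub>R F x = indicator (pos_orthant n) x *\<^sub>R G x"
    using AE_distinct[of n] by eventually_elim (simp add: assms(3))
qed (use assms(1,2) in \<open>auto simp: set_integrable_def\<close>)

text \<open>The common shape of the singular terms in the derivative, coming from the logarithmic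
  derivative of the weight and from the reflection part of the kernel's derivative.\<close>

definition singA :: "nat => real => complex => ((nat => real) => complex) => ((nat => real) => complex) => nat => (nat => real) => complex" where
  "singA m k s e g i x = of_real k * (e x * g x * (of_real (x m) / of_real (x m - x i)) * of_real (omega (Suc m) k x) * Dp (Suc m) s x)"

lemma oint_singA:
  assumes e: "decays (Suc m) e" and g: "expbd (Suc m) g" "g \<in> borel_measurable (lebesgue_n (Suc m))"
    and k: "k \<ge> 0" and s: "Re s > -1" and i: "i < m"
  shows "oint (Suc m) (singA m k s e g i)"
proof (cases "k = 0")
  case True
  thus ?thesis by (simp add: singA_def[abs_def] set_integrable_def)
next
  case False
  hence k': "k > 0" using k by simp
  define R where "R x = omega m k x * (\<Prod>l\<in>{..<m}-{i}. ww k (x l - x m))" for x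
  have o: "omega (Suc m) k x = R x * ww k (x i - x m)" for x
    unfolding omega_Suc R_def using i by (subst prod.remove[of _ i]) auto
  have R: "expbd (Suc m) R" unfolding R_def[abs_def] using k by (intro expbd_mult expbd_omega expbd_prod expbd_ww) auto
  have Rm: "R \<in> borel_measurable (lebesgue_n (Suc m))"
    unfolding R_def[abs_def]
    by (intro borel_measurable_times omega_meas borel_measurable_prod measurable_compose[OF _ ww_measurable] borel_measurable_diff coord_measurable) auto
  have G: "decays (Suc m) (\<lambda>x. (e x * g x) * of_real (R x))"
    by (rule decays_mult[OF decays_mult[OF e g] expbd_of_real[OF R] measurable_compose[OF Rm borel_measurable_of_real]])
  have "oint (Suc m) (\<lambda>x. (e x * g x) * of_real (R x) * of_real (x m * (ww k (x i - x m) / (x m - x i))) * Dp (Suc m) s x)"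
    using i by (intro oint_dom_sing[OF G s _ _ _ k']) auto
  hence "oint (Suc m) (\<lambda>x. of_real k * ((e x * g x) * of_real (R x) * of_real (x m * (ww k (x i - x m) / (x m - x i))) * Dp (Suc m) s x))"
    by (rule set_integrable_mult_right)
  moreover have "singA m k s e g i = (\<lambda>x. of_real k * ((e x * g x) * of_real (R x) * of_real (x m * (ww k (x i - x m) / (x m - x i))) * Dp (Suc m) s x))"
    by (auto simp: singA_def o fun_eq_iff)
  ultimately show ?thesis by simp
qed

text \<open>The weight contributes 2k E / u_i and the kernel -k (E - E_i) / u_i. Together they leave
  k (E + E_i) / u_i, one term with the kernel and one with its reflection.\<close>

lemma ibp_algebra:
  fixes E Et :: complex and Ei u :: "nat => complex" and k z y G G' W P s Q :: complex
  assumes y: "y \<noteq> 0" and Q: "Q = y * G * (W * P)"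
  shows "(E * y) * ((G * W) * (s / y * P) + (G * (W * (\<Sum>i<m. 2 * k / u i)) + G' * W) * P)
      + (E * 1 + (- z * E - (\<Sum>i<m. k * (E - Ei i) / u i)) * y) * ((G * W) * P) =
    - z * (E * (y * G) * W * P) + (\<Sum>i<m. k * (E * G * (y / u i) * W * P) + k * (Ei i * G * (y / u i) * W * P))
      + (1 + s) * (E * G * W * P) + E * (y * G') * W * P"
proof -
  have 1: "(\<Sum>i<m. k * (E * G * (y / u i) * W * P) + k * (Ei i * G * (y / u i) * W * P)) =
     E * Q * (\<Sum>i<m. 2 * k / u i) - (\<Sum>i<m. k * (E - Ei i) / u i) * Q"
    unfolding sum_distrib_left sum_distrib_right sum_subtractf[symmetric]
  proof (intro sum.cong refl)
    fix i
    have "E * Q * (2 * k / u i) - k * (E - Ei i) / u i * Q = 2 * (E * k) * (Q / u i) - k * (E - Ei i) * (Q / u i)"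
      by (simp add: mult_ac)
    also have "\<dots> = (2 * (E * k) - k * (E - Ei i)) * (Q / u i)" by (rule left_diff_distrib[symmetric])
    also have "2 * (E * k) - k * (E - Ei i) = k * E + k * Ei i" by (simp add: algebra_simps)
    finally have F: "E * Q * (2 * k / u i) - k * (E - Ei i) / u i * Q = (k * E + k * Ei i) * (Q / u i)" .
    have "k * (E * G * (y / u i) * W * P) + k * (Ei i * G * (y / u i) * W * P) = k * E * (Q / u i) + k * Ei i * (Q / u i)"
      unfolding Q by (simp add: mult_ac)
    also have "\<dots> = (k * E + k * Ei i) * (Q / u i)" by (rule distrib_right[symmetric])
    finally show "k * (E * G * (y / u i) * W * P) + k * (Ei i * G * (y / u i) * W * P) = E * Q * (2 * k / u i) - k * (E - Ei i) / u i * Q"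
      unfolding F .
  qed
  show ?thesis unfolding 1 unfolding Q using y by (simp add: field_simps)
qed

text \<open>The function differentiated is x_m times the full integrand; it vanishes at both ends
  because Re s + 1 > 0. The terms with a reflected kernel are then substituted by the transposition,
  which restores the kernel and reflects g instead. The singular terms combine into the divided
  differences of the Dunkl operator on g, and \<open>eig\<close> evaluates the sum.\<close>

lemma ibp_last:
  fixes z :: "nat => complex" and m n :: nat
  defines "n \<equiv> Suc m"
  assumes k: "k \<ge> 0" and z: "\<And>i. i < n ==> Re (z i) > 0" and s: "Re s > -1" and S: "finite S"
    and g: "g = mpoly n S c"
    and eig: "\<And>x. distinct_coords n x ==> x m * dunkl_op n k (unit_vec m) g x
       + of_real (k * (1 - real n)) * g x + of_real k * (\<Sum>i<m. g (swap_coords i m x)) = a * g x"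
  shows "oint n (hint n k s z (\<lambda>x. x m * g x))"
    "z m * OI n (hint n k s z (\<lambda>x. x m * g x)) = (a + (s + 1 + of_real (k * real m))) * OI n (hint n k s z g)"
proof -
  have mn: "m < n" by (simp add: n_def)
  define l where "l = (\<lambda>i. - z i)"
  define e where "e x = dk n k l (cvec x)" for x
  define t where "t i = Transposition.transpose i m" for i
  have t: "t i \<in> symg n" if "i < m" for i unfolding t_def using that mn by (intro swap_symg) auto
  define ei where "ei i x = dk n k l (cvec x \<circ> t i)" for i x
  define gr where "gr x = g (cvec x)" for x
  define w where "w x = complex_of_real (omega n k x)" for x
  define xg where "xg = mpoly n S (\<lambda>\<alpha>. c \<alpha> * of_nat (\<alpha> m))"
  define xgr where "xgr x = xg (cvec x)" for x
  have sg: "sep_holo n g" unfolding g by (rule sep_holo_mpoly)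
  have se: "sep_holo n (dk n k l)" by (rule sep_holo_dk[OF k])
  have de: "decays n e" unfolding e_def[abs_def] l_def by (rule decays_dk'[OF k z])
  have dei: "decays n (ei i)" if "i < m" for i unfolding ei_def[abs_def] l_def by (rule decays_dk[OF k z t[OF that]])
  have eg: "expbd n gr" "gr \<in> borel_measurable (lebesgue_n n)"
    unfolding gr_def[abs_def] g using S by (auto intro: expbd_mpoly mpoly_measurable)
  have exg: "expbd n xgr" "xgr \<in> borel_measurable (lebesgue_n n)"
    unfolding xgr_def[abs_def] xg_def using S by (auto intro: expbd_mpoly mpoly_measurable)
  have exm: "expbd n (\<lambda>x. complex_of_real (x m))" "(\<lambda>x. complex_of_real (x m)) \<in> borel_measurable (lebesgue_n n)"
    using mn by (auto intro!: expbd_coord borel_measurable_of_real coord_measurable)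
  have xpd: "x m * pderiv_n g m x = xg x" for x
  proof -
    have "pderiv_n g m x = (\<Sum>\<alpha>\<in>S. c \<alpha> * pderiv_n (mono n \<alpha>) m x)"
    proof -
      have "((\<lambda>w. \<Sum>\<alpha>\<in>S. c \<alpha> * mono n \<alpha> (x(m := w))) has_field_derivative (\<Sum>\<alpha>\<in>S. c \<alpha> * pderiv_n (mono n \<alpha>) m x)) (at (x m))"
        unfolding pderiv_n_def
        by (intro DERIV_sum DERIV_cmult field_differentiable_derivI sep_holo_diff[OF sep_holo_mono mn])
      thus ?thesis unfolding g mpoly_def pderiv_n_def[of "\<lambda>x. sum _ _"] by (simp add: DERIV_imp_deriv pderiv_n_def mpoly_def[abs_def])
    qed
    hence "x m * pderiv_n g m x = (\<Sum>\<alpha>\<in>S. c \<alpha> * (x m * pderiv_n (mono n \<alpha>) m x))"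
      by (simp add: sum_distrib_left mult.left_commute)
    also have "\<dots> = xg x" unfolding pderiv_n_mono[OF mn] xg_def mpoly_def by (simp add: mult.assoc)
    finally show ?thesis .
  qed
  define T1 where "T1 x = e x * gr x * w x * Dp n s x" for x
  define T2 where "T2 x = e x * (of_real (x m) * gr x) * w x * Dp n s x" for x
  define T3 where "T3 x = e x * xgr x * w x * Dp n s x" for x
  define A where "A i = singA m k s e gr i" for i
  define B where "B i = singA m k s (ei i) gr i" for i
  define D where "D x = - z m * T2 x + (\<Sum>i<m. A i x + B i x) + (1 + s) * T1 x + T3 x" for x
  have dT2: "decays n (\<lambda>x. e x * (of_real (x m) * gr x) * w x)"
    unfolding w_def by (intro decays_omega k decays_mult de expbd_mult exm eg borel_measurable_times)
  have i1: "oint n T1" unfolding T1_def[abs_def] w_def by (intro oint_dom s decays_omega k decays_mult de eg)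
  have i2: "oint n T2" unfolding T2_def[abs_def] by (intro oint_dom s dT2)
  have i3: "oint n T3" unfolding T3_def[abs_def] w_def by (intro oint_dom s decays_omega k decays_mult de exg)
  have iA: "oint n (A i)" if "i < m" for i
    unfolding A_def n_def by (rule oint_singA) (use de eg k s that in \<open>simp_all add: n_def\<close>)
  have iB: "oint n (B i)" if "i < m" for i
    unfolding B_def n_def by (rule oint_singA) (use dei[OF that] eg k s that in \<open>simp_all add: n_def\<close>)
  have iAB: "oint n (\<lambda>x. \<Sum>i<m. A i x + B i x)"
    by (intro set_sum(1)) (auto intro!: set_integral_add iA iB)
  have iD: "oint n D" unfolding D_def[abs_def]
    by (intro set_integral_add set_integrable_mult_right iAB i1 i2 i3)
  have hint1: "hint n k s z g = T1" by (auto simp: hint_def T1_def e_def gr_def w_def l_def fun_eq_iff)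
  have hint2: "hint n k s z (\<lambda>x. x m * g x) = T2"
    by (auto simp: hint_def T2_def e_def gr_def w_def l_def cvec_def fun_eq_iff)
  show "oint n (hint n k s z (\<lambda>x. x m * g x))" unfolding hint2 by (rule i2)
  have "OI n D = - OI m (\<lambda>_. 0)"
    unfolding n_def
  proof (rule oint_last_deriv[where \<Psi> = T2])
    show "oint (Suc m) D" using iD by (simp add: n_def)
  next
    fix x :: "nat => real" and y :: real
    assume x: "\<And>i. i < m ==> 0 < x i" and y: "y > 0" and dist: "distinct_coords (Suc m) (x(m := y))"
    define X where "X = x(m := y)"
    have dX: "distinct_coords (Suc m) (cvec X)" using dist by (auto simp: distinct_coords_def cvec_def X_def)
    have Xm: "X m = y" "cvec X m = of_real y" by (auto simp: X_def cvec_def)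
    have Xi: "X i = x i" "cvec X i = of_real (x i)" if "i < m" for i using that by (auto simp: X_def cvec_def)
    have ne: "x i \<noteq> y" if "i < m" for i
    proof -
      have "i < Suc m" "m < Suc m" "i \<noteq> m" using that by auto
      hence "(x(m := y)) i \<noteq> (x(m := y)) m" using dist unfolding distinct_coords_def by blast
      thus ?thesis using that by simp
    qed
    define E' where "E' = - z m * e X - (\<Sum>i<m. of_real k * (e X - ei i X) / of_real (y - x i))"
    have E': "pderiv_n (dk n k l) m (cvec X) = E'"
      unfolding n_def last_deriv_dk[OF k dX] E'_def e_def ei_def l_def swap_coords_eq t_def
      by (simp add: Xm Xi n_def)
    have d1: "((\<lambda>y. e (x(m := y))) has_vector_derivative E') (at y)"
      using sep_holo_real_deriv[OF se mn, of x y] unfolding e_def E'[symmetric] X_def .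
    have d2: "((\<lambda>y. complex_of_real y) has_vector_derivative 1) (at y)"
      using has_vector_derivative_of_real'[OF DERIV_ident, of y] by simp
    have d3: "((\<lambda>y. gr (x(m := y))) has_vector_derivative pderiv_n g m (cvec X)) (at y)"
      using sep_holo_real_deriv[OF sg mn, of x y] unfolding gr_def X_def .
    have d4: "((\<lambda>y. w (x(m := y))) has_vector_derivative w X * (\<Sum>i<m. 2 * of_real k / of_real (y - x i))) (at y)"
      using has_vector_derivative_of_real'[OF omega_deriv[OF ne k]] unfolding w_def X_def n_def by simp
    have d5: "((\<lambda>y. Dp n s (x(m := y))) has_vector_derivative s / of_real y * Dp n s X) (at y)"
      using Dp_deriv[OF y, of m s x] unfolding X_def n_def .
    have "((\<lambda>y. (e (x(m := y)) * of_real y) * ((gr (x(m := y)) * w (x(m := y))) * Dp n s (x(m := y)))) has_vector_derivative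
       (e X * of_real y) * ((gr X * w X) * (s / of_real y * Dp n s X) + (gr X * (w X * (\<Sum>i<m. 2 * of_real k / of_real (y - x i))) + pderiv_n g m (cvec X) * w X) * Dp n s X)
       + (e X * 1 + E' * of_real y) * ((gr X * w X) * Dp n s X)) (at y)"
      unfolding X_def using d1 d2 d3 d4 d5 unfolding X_def by (intro has_vector_derivative_mult)
    moreover have "(\<lambda>y. (e (x(m := y)) * of_real y) * ((gr (x(m := y)) * w (x(m := y))) * Dp n s (x(m := y)))) = (\<lambda>y. T2 (x(m := y)))"
      by (auto simp: T2_def fun_eq_iff)
    moreover have "(e X * of_real y) * ((gr X * w X) * (s / of_real y * Dp n s X) + (gr X * (w X * (\<Sum>i<m. 2 * of_real k / of_real (y - x i))) + pderiv_n g m (cvec X) * w X) * Dp n s X)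
       + (e X * 1 + E' * of_real y) * ((gr X * w X) * Dp n s X) = D X"
    proof -
      have y0: "complex_of_real y \<noteq> 0" using y by simp
      have "of_real y * pderiv_n g m (cvec X) = xgr X" using xpd[of "cvec X"] by (simp add: Xm xgr_def)
      moreover have "(\<Sum>i<m. A i X + B i X) = (\<Sum>i<m. of_real k * (e X * gr X * (of_real y / of_real (y - x i)) * w X * Dp n s X) + of_real k * (ei i X * gr X * (of_real y / of_real (y - x i)) * w X * Dp n s X))"
        by (intro sum.cong refl) (simp add: A_def B_def singA_def w_def n_def Xm Xi)
      ultimately show ?thesis unfolding E'_def D_def T1_def T2_def T3_def
        using ibp_algebra[where E = "e X" and G = "gr X" and W = "w X" and s = s and P = "Dp n s X" and u = "\<lambda>i. of_real (y - x i)"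
            and k = "of_real k" and m = m and G' = "pderiv_n g m (cvec X)" and z = "z m" and Ei = "\<lambda>i. ei i X", OF y0 refl]
        by (simp add: Xm)
    qed
    ultimately show "((\<lambda>y. T2 (x(m := y))) has_vector_derivative D (x(m := y))) (at y)" by (simp only: X_def)
  next
    fix x :: "nat => real" assume x: "\<And>i. i < m ==> 0 < x i"
    have c1: "continuous_on {0<..} (\<lambda>y. e (x(m := y)))" "continuous_on {0<..} (\<lambda>y. gr (x(m := y)))" "continuous_on {0<..} (\<lambda>y. Dp n s (x(m := y)))"
      using sep_holo_real_deriv[OF se mn, of x] sep_holo_real_deriv[OF sg mn, of x] Dp_deriv[of _ m s x]
      unfolding e_def gr_def n_def
      by (auto intro!: continuous_at_imp_continuous_on intro: has_vector_derivative_continuous)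
    have c2: "continuous_on {0<..} (\<lambda>y. w (x(m := y)))"
      unfolding w_def n_def by (intro continuous_intros continuous_on_subset[OF continuous_omega[OF k]]) auto
    show "continuous_on {0<..} (\<lambda>y. T2 (x(m := y)))"
      unfolding T2_def using c1 c2 by (intro continuous_intros) (auto intro: continuous_intros)
    obtain d C where d: "d > 0" "C \<ge> 0" and bd: "\<And>x. \<forall>i<n. 0 < x i ==> norm (e x * (of_real (x m) * gr x) * w x) \<le> C * exp (- d * (\<Sum>i<n. x i))"
      using dT2 by (auto simp: decays_def)
    have dg: "decays n (\<lambda>x. e x * gr x * w x)" unfolding w_def by (intro decays_omega k decays_mult de eg)
    then obtain d C where d: "d > 0" "C \<ge> 0" and bd: "\<And>x. \<forall>i<n. 0 < x i ==> norm (e x * gr x * w x) \<le> C * exp (- d * (\<Sum>i<n. x i))"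
      by (auto simp: decays_def)
    \<comment> \<open>The part of the bound that depends on the fixed coordinates. In y there
      remains y^(Re s + 1) e^(-dy), the additional power being the factor x_m.\<close>
    define K where "K = C * exp (- d * (\<Sum>i<m. x i)) * (\<Prod>i<m. x i powr Re s)"
    have K: "K \<ge> 0" unfolding K_def using d by (intro mult_nonneg_nonneg prod_nonneg) auto
    have "norm (T2 (x(m := y))) \<le> K * (y powr (Re s + 1) * exp (- d * y))" if y: "y > 0" for y
    proof -
      define X where "X = x(m := y)"
      have pX: "\<forall>i<n. 0 < X i" using x y by (auto simp: X_def n_def less_Suc_eq)
      have sX: "(\<Sum>i<n. X i) = (\<Sum>i<m. x i) + y" by (simp add: n_def X_def)
      have nD: "norm (Dp n s X) = (\<Prod>i<m. x i powr Re s) * y powr Re s"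
        using norm_Dp[of n X s] pX by (simp add: n_def X_def)
      have "norm (T2 X) = norm (e X * gr X * w X) * (y * norm (Dp n s X))"
        using y by (simp add: T2_def norm_mult X_def)
      also have "\<dots> \<le> C * exp (- d * (\<Sum>i<n. X i)) * (y * norm (Dp n s X))"
        using y by (intro mult_right_mono bd pX) auto
      also have "\<dots> = K * (y powr (Re s + 1) * exp (- d * y))"
        unfolding sX nD K_def using y by (simp add: powr_add distrib_left exp_add exp_diff exp_minus field_simps)
      finally show ?thesis by (simp add: X_def)
    qed
    thus "((\<lambda>y. T2 (x(m := y))) \<longlongrightarrow> 0) (at_right 0) \<and> ((\<lambda>y. T2 (x(m := y))) \<longlongrightarrow> 0) at_top"
      using halfline_limits[of "\<lambda>y. T2 (x(m := y))" K "Re s + 1" d] s d K by auto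
  qed simp
  hence D0: "OI n D = 0" by simp
  \<comment> \<open>The change of variables by the transposition: it leaves the integral of the term
    unchanged, as well as weight and powers, but moves the reflection from the kernel to the
    polynomial.\<close>
  define B' where "B' i x = B i (x \<circ> t i)" for i x
  have iB': "oint n (B' i)" and eB': "OI n (B' i) = OI n (B i)" if "i < m" for i
    unfolding B'_def[abs_def] using oint_permute[OF t[OF that] iB[OF that]] by auto
  have "OI n D = - z m * OI n T2 + (\<Sum>i<m. OI n (A i) + OI n (B i)) + (1 + s) * OI n T1 + OI n T3"
  proof -
    have "OI n D = OI n (\<lambda>x. - z m * T2 x + (\<Sum>i<m. A i x + B i x) + (1 + s) * T1 x) + OI n T3"
      unfolding D_def[abs_def] by (intro set_integral_add(2) set_integral_add(1) set_integrable_mult_right iAB i1 i2 i3)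
    also have "OI n (\<lambda>x. - z m * T2 x + (\<Sum>i<m. A i x + B i x) + (1 + s) * T1 x) = OI n (\<lambda>x. - z m * T2 x + (\<Sum>i<m. A i x + B i x)) + OI n (\<lambda>x. (1 + s) * T1 x)"
      by (intro set_integral_add(2) set_integral_add(1) set_integrable_mult_right iAB i1 i2)
    also have "OI n (\<lambda>x. - z m * T2 x + (\<Sum>i<m. A i x + B i x)) = OI n (\<lambda>x. - z m * T2 x) + OI n (\<lambda>x. \<Sum>i<m. A i x + B i x)"
      by (intro set_integral_add(2) set_integrable_mult_right iAB i2)
    also have "OI n (\<lambda>x. \<Sum>i<m. A i x + B i x) = (\<Sum>i<m. OI n (\<lambda>x. A i x + B i x))"
      by (intro set_sum(2)) (auto intro!: set_integral_add iA iB)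
    also have "\<dots> = (\<Sum>i<m. OI n (A i) + OI n (B i))"
      by (intro sum.cong refl set_integral_add(2)) (auto intro: iA iB)
    finally show ?thesis by (simp only: set_integral_mult_right)
  qed
  hence 1: "z m * OI n T2 = (\<Sum>i<m. OI n (A i) + OI n (B' i)) + (1 + s) * OI n T1 + OI n T3"
    unfolding D0 by (simp add: eB' algebra_simps)
  have iAB': "oint n (\<lambda>x. \<Sum>i<m. A i x + B' i x)"
    by (intro set_sum(1)) (auto intro!: set_integral_add iA iB')
  have 2: "OI n (\<lambda>x. (\<Sum>i<m. A i x + B' i x) + (1 + s) * T1 x + T3 x) = (\<Sum>i<m. OI n (A i) + OI n (B' i)) + (1 + s) * OI n T1 + OI n T3"
  proof -
    have "OI n (\<lambda>x. (\<Sum>i<m. A i x + B' i x) + (1 + s) * T1 x + T3 x) = OI n (\<lambda>x. (\<Sum>i<m. A i x + B' i x) + (1 + s) * T1 x) + OI n T3"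
      by (intro set_integral_add(2) set_integral_add(1) set_integrable_mult_right iAB' i1 i3)
    also have "OI n (\<lambda>x. (\<Sum>i<m. A i x + B' i x) + (1 + s) * T1 x) = OI n (\<lambda>x. \<Sum>i<m. A i x + B' i x) + OI n (\<lambda>x. (1 + s) * T1 x)"
      by (intro set_integral_add(2) set_integrable_mult_right iAB' i1)
    also have "OI n (\<lambda>x. \<Sum>i<m. A i x + B' i x) = (\<Sum>i<m. OI n (\<lambda>x. A i x + B' i x))"
      by (intro set_sum(2)) (auto intro!: set_integral_add iA iB')
    also have "\<dots> = (\<Sum>i<m. OI n (A i) + OI n (B' i))"
      by (intro sum.cong refl set_integral_add(2)) (auto intro: iA iB')
    finally show ?thesis by (simp only: set_integral_mult_right)
  qed
  have pw: "(\<Sum>i<m. A i x + B' i x) + (1 + s) * T1 x + T3 x = (a + (s + 1 + of_real (k * real m))) * T1 x"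
    if dist: "distinct_coords n x" for x
  proof -
    define X where "X = cvec x"
    have dX: "distinct_coords n X" using dist by (auto simp: distinct_coords_def cvec_def X_def)
    have AB: "A i x + B' i x = of_real k * (X m * ((g X - g (swap_coords i m X)) / (X m - X i)) + g (swap_coords i m X)) * (e x * w x * Dp n s x)"
      if i: "i < m" for i
    proof -
      have ne: "X m \<noteq> X i" using dX i mn by (auto simp: distinct_coords_def n_def)
      have cx: "cvec (x \<circ> t i) \<circ> t i = cvec x" by (auto simp: cvec_def t_def fun_eq_iff)
      have gt: "gr (x \<circ> t i) = g (swap_coords i m X)" by (simp add: gr_def X_def cvec_comp t_def swap_coords_eq)
      have co: "(x \<circ> t i) m = x i" "(x \<circ> t i) i = x m" by (simp_all add: t_def)
      have om: "omega (Suc m) k (x \<circ> t i) = omega n k x" "Dp (Suc m) s (x \<circ> t i) = Dp n s x"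
        using omega_permute[OF t[OF i]] Dp_permute[OF t[OF i]] by (simp_all add: n_def)
      have "A i x = of_real k * (g X * (X m / (X m - X i))) * (e x * w x * Dp n s x)"
        by (simp add: A_def singA_def gr_def w_def n_def X_def cvec_def mult_ac)
      moreover have "B' i x = of_real k * (g (swap_coords i m X) * (X i / (X i - X m))) * (e x * w x * Dp n s x)"
        unfolding B'_def B_def singA_def ei_def cx gt co om e_def w_def by (simp add: X_def cvec_def mult_ac)
      moreover have "g X * (X m / (X m - X i)) + g (swap_coords i m X) * (X i / (X i - X m)) =
         X m * ((g X - g (swap_coords i m X)) / (X m - X i)) + g (swap_coords i m X)"
      proof -
        define p q where "p = X m / (X m - X i)" and "q = X i / (X m - X i)"
        have "p = 1 + q" using ne by (simp add: p_def q_def field_simps)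
        hence "g X * p + g (swap_coords i m X) * (- q) = (p * g X - p * g (swap_coords i m X)) + g (swap_coords i m X)"
          by (simp add: algebra_simps)
        moreover have "X i / (X i - X m) = - q" unfolding q_def by (metis minus_diff_eq minus_divide_right)
        moreover have "X m * ((g X - g (swap_coords i m X)) / (X m - X i)) = p * g X - p * g (swap_coords i m X)"
          by (simp add: p_def right_diff_distrib diff_divide_distrib)
        ultimately show ?thesis by (simp add: p_def)
      qed
      ultimately show ?thesis by (simp only: distrib_left[symmetric] distrib_right[symmetric])
    qed
    define Y where "Y = X m * (\<Sum>i<m. (g X - g (swap_coords i m X)) / (X m - X i)) + (\<Sum>i<m. g (swap_coords i m X))"
    define V where "V = e x * w x * Dp n s x"
    define c' where "c' = a + of_real (k * real m)"
    define P where "P = X m * pderiv_n g m X"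
    have S1: "(\<Sum>i<m. A i x + B' i x) = (of_real k * Y) * V"
      unfolding Y_def V_def sum_distrib_left sum.distrib[symmetric] sum_distrib_right by (intro sum.cong refl AB) simp
    have T3x: "T3 x = P * V"
      by (simp add: T3_def xgr_def X_def xpd mult_ac P_def V_def)
    have T1x: "T1 x = g X * V" by (simp add: T1_def gr_def X_def V_def mult_ac)
    \<comment> \<open>The eigenvalue equation contains the constant k (1 - n) = -k m; carrying it to
      the other side adds k m to the eigenvalue a.\<close>
    have key: "P + of_real k * Y = c' * g X"
    proof -
      have "{..<n} - {m} = {..<m}" by (auto simp: n_def)
      thus ?thesis using eig[OF dX] dunkl_op_unit[OF mn, of k g X] by (simp add: n_def P_def Y_def c'_def algebra_simps)
    qed
    have "(\<Sum>i<m. A i x + B' i x) + (1 + s) * T1 x + T3 x = (of_real k * Y) * V + (1 + s) * (g X * V) + P * V"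
      by (simp only: S1 T1x T3x)
    also have "\<dots> = ((P + of_real k * Y) + (1 + s) * g X) * V" by (simp only: distrib_right mult.assoc add_ac)
    also have "\<dots> = (c' + (1 + s)) * (g X * V)" unfolding key by (simp only: distrib_right mult.assoc)
    finally show ?thesis unfolding T1x c'_def by (simp only: add_ac)
  qed
  have "OI n (\<lambda>x. (\<Sum>i<m. A i x + B' i x) + (1 + s) * T1 x + T3 x) = OI n (\<lambda>x. (a + (s + 1 + of_real (k * real m))) * T1 x)"
  proof (rule OI_cong_distinct)
    show "oint n (\<lambda>x. (\<Sum>i<m. A i x + B' i x) + (1 + s) * T1 x + T3 x)"
      by (intro set_integral_add(1) set_integrable_mult_right iAB' i1 i3)
    show "oint n (\<lambda>x. (a + (s + 1 + of_real (k * real m))) * T1 x)"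
      by (intro set_integrable_mult_right i1)
  qed (rule pw)
  thus "z m * OI n (hint n k s z (\<lambda>x. x m * g x)) = (a + (s + 1 + of_real (k * real m))) * OI n (hint n k s z g)"
    unfolding hint1 hint2 1 2[symmetric] by (simp only: set_integral_mult_right)
qed

lemma pos_poly_mpoly: "pos_poly n p ==> \<exists>S c. finite S \<and> p = mpoly n S c"
proof -
  assume "pos_poly n p"
  then obtain L where L: "p = lpoly n L" by (auto simp: pos_poly_def)
  have "p = mpoly n (snd ` set L) (\<lambda>\<alpha>. of_real (lcoeff L \<alpha>))"
    by (rule ext) (simp add: L mpoly_def lpoly_sum[OF finite_imageI[OF finite_set] subset_refl])
  thus ?thesis by blast
qed

lemma oint_hint_pos:
  assumes "k \<ge> 0" "\<And>i. i < n ==> Re (z i) > 0" "Re s > -1" "pos_poly n p"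
  shows "oint n (hint n k s z p)"
proof -
  obtain S c where "finite S" "p = mpoly n S c" using pos_poly_mpoly[OF assms(4)] by blast
  thus ?thesis using assms by (simp add: oint_hint)
qed

lemma hint_permute:
  assumes "k \<ge> 0" "\<tau> \<in> symg n"
  shows "hint n k s (z \<circ> \<tau>) g (x \<circ> \<tau>) = hint n k s z (\<lambda>x. g (x \<circ> \<tau>)) x"
proof -
  have "(\<lambda>i. - (z \<circ> \<tau>) i) = (\<lambda>i. - z i) \<circ> \<tau>" by auto
  thus ?thesis unfolding hint_def omega_permute[OF assms(2)] Dp_permute[OF assms(2)] cvec_comp
    by (simp only: dk_permute[OF assms])
qed

text \<open>Weight and powers are symmetric and the kernel is invariant under simultaneous
  permutation of both arguments. A permutation acting on the polynomial is therefore transferred to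
  z.\<close>

lemma OI_hint_permute:
  assumes "k \<ge> 0" "\<And>i. i < n ==> Re (z i) > 0" "Re s > -1" "pos_poly n p" and \<tau>: "\<tau> \<in> symg n"
  shows "OI n (hint n k s z (\<lambda>x. p (x \<circ> \<tau>))) = OI n (hint n k s (z \<circ> \<tau>) p)"
proof -
  have "oint n (hint n k s (z \<circ> \<tau>) p)"
    by (rule oint_hint_pos) (use assms in \<open>auto simp: symg_lt\<close>)
  from oint_permute(2)[OF \<tau> this] show ?thesis by (simp only: hint_permute[OF assms(1) \<tau>])
qed

text \<open>Integration by parts is applied to p after the cyclic shift, for which
  \<open>last_op_cyc\<close> turns the assumption on index 0 into the required equation. With this
  s, the constant s + 1 + k m equals mu.\<close>

lemma Phi_step:
  assumes k: "k \<ge> 0" and z: "\<And>i. i < Suc m ==> Re (z i) > 0" and \<mu>: "Re \<mu> > k * real m"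
    and p: "pos_poly (Suc m) p"
    and eig: "\<And>x. distinct_coords (Suc m) x ==> cher_op (Suc m) k 0 p x = a * p x"
    and s: "s = \<mu> - of_real (k * real m) - 1"
  shows "z m * OI (Suc m) (hint (Suc m) k s z (Phi m p)) = (a + \<mu>) * OI (Suc m) (hint (Suc m) k s (z \<circ> cyc m) p)"
proof -
  have s1: "Re s > -1" using \<mu> by (simp add: s)
  define g where "g = (\<lambda>x. p (x \<circ> cyc m))"
  have "pos_poly (Suc m) g" unfolding g_def by (rule pos_poly_permute[OF p cyc_symg])
  then obtain S c where S: "finite S" "g = mpoly (Suc m) S c" using pos_poly_mpoly by blast
  have "x m * dunkl_op (Suc m) k (unit_vec m) g x
       + of_real (k * (1 - real (Suc m))) * g x + of_real k * (\<Sum>i<m. g (swap_coords i m x)) = a * g x"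
    if "distinct_coords (Suc m) x" for x
    unfolding g_def last_op_cyc by (rule eig) (use that in \<open>simp add: distinct_coords_permute cyc_symg\<close>)
  from ibp_last(2)[OF k z s1 S this]
  have "z m * OI (Suc m) (hint (Suc m) k s z (\<lambda>x. x m * g x)) = (a + (s + 1 + of_real (k * real m))) * OI (Suc m) (hint (Suc m) k s z g)" .
  moreover have "(\<lambda>x. x m * g x) = Phi m p" by (simp add: g_def Phi_def fun_eq_iff)
  moreover have "OI (Suc m) (hint (Suc m) k s z g) = OI (Suc m) (hint (Suc m) k s (z \<circ> cyc m) p)"
    unfolding g_def by (rule OI_hint_permute[OF k z s1 p cyc_symg])
  ultimately show ?thesis by (simp add: s)
qed

section \<open>The transform of the constant polynomial\<close>

text \<open>A bound on the integrand alone suffices: the Cauchy inequality turns it into a Lipschitz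
  bound for the difference quotients, to which dominated convergence applies.\<close>

lemma deriv_under_integral:
  fixes F :: "complex => 'a => complex"
  assumes r: "r > 0"
    and meas: "\<And>w. w \<in> ball w0 r ==> F w \<in> borel_measurable M"
    and holo: "\<And>x. x \<in> space M ==> (\<lambda>w. F w x) holomorphic_on ball w0 r"
    and bd: "\<And>w x. w \<in> ball w0 r ==> x \<in> space M ==> norm (F w x) \<le> B x"
    and B: "integrable M B"
  shows "((\<lambda>w. \<integral>x. F w x \<partial>M) has_field_derivative (\<integral>x. deriv (\<lambda>w. F w x) w0 \<partial>M)) (at w0)"
proof -
  have int: "integrable M (F w)" if "w \<in> ball w0 r" for w
    using bd[OF that] by (intro Bochner_Integration.integrable_bound[OF B meas[OF that]] AE_I2)
      (smt (verit) norm_ge_zero real_norm_def)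
  have lip: "norm (F w x - F w0 x) \<le> 3 * B x / r * norm (w - w0)" if w: "w \<in> ball w0 (r / 2)" and x: "x \<in> space M" for w x
  proof (rule field_differentiable_bound[where S = "ball w0 (r / 2)" and f' = "deriv (\<lambda>w. F w x)"])
    fix v assume v: "v \<in> ball w0 (r / 2)"
    \<comment> \<open>Discs of radius r/3 about points of the half ball remain in the ball, since
      1/2 + 1/3 < 1; hence the constant 3 / r.\<close>
    have sub: "cball v (r / 3) \<subseteq> ball w0 r"
    proof
      fix u assume "u \<in> cball v (r / 3)"
      hence "dist w0 u \<le> dist w0 v + r / 3" using dist_triangle[of w0 u v] by (simp add: dist_commute)
      thus "u \<in> ball w0 r" using v r by simp
    qed
    have v': "v \<in> ball w0 r" using v r by auto
    show "((\<lambda>w. F w x) has_field_derivative deriv (\<lambda>w. F w x) v) (at v within ball w0 (r / 2))"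
      using holomorphic_derivI[OF holo[OF x] open_ball v'] by (rule has_field_derivative_at_within)
    have "norm ((deriv ^^ 1) (\<lambda>w. F w x) v) \<le> fact 1 * B x / (r / 3) ^ 1"
    proof (rule Cauchy_inequality)
      show "(\<lambda>w. F w x) holomorphic_on ball v (r / 3)"
        by (rule holomorphic_on_subset[OF holo[OF x]]) (use sub ball_subset_cball in blast)
      show "continuous_on (cball v (r / 3)) (\<lambda>w. F w x)"
        by (rule continuous_on_subset[OF holomorphic_on_imp_continuous_on[OF holo[OF x]] sub])
      show "0 < r / 3" using r by simp
      fix u assume "norm (v - u) = r / 3"
      hence "u \<in> cball v (r / 3)" by (simp add: dist_norm)
      thus "norm (F u x) \<le> B x" using sub by (intro bd x) blast
    qed
    thus "norm (deriv (\<lambda>w. F w x) v) \<le> 3 * B x / r" by (simp add: mult.commute)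
  qed (use w r in auto)
  show ?thesis
    unfolding has_field_derivative_iff tendsto_at_iff_sequentially
  proof (intro allI impI)
    fix X :: "nat => complex" assume X: "\<forall>i. X i \<in> UNIV - {w0}" "X \<longlonglongrightarrow> w0"
    have "eventually (\<lambda>i. X i \<in> ball w0 (r / 2)) sequentially"
      using r by (intro topological_tendstoD[OF X(2)]) auto
    then obtain N where N: "\<And>i. i \<ge> N ==> X i \<in> ball w0 (r / 2)" by (auto simp: eventually_sequentially)
    define Y where "Y i = X (i + N)" for i
    have Y: "Y i \<in> ball w0 (r / 2)" "Y i \<in> ball w0 r" "Y i \<noteq> w0" for i
      using N[of "i + N"] X(1) r by (auto simp: Y_def)
    have Ylim: "filterlim Y (at w0) sequentially"
      unfolding filterlim_at Y_def using LIMSEQ_ignore_initial_segment[OF X(2), of N] X(1) by auto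
    define Q where "Q i x = (F (Y i) x - F w0 x) / (Y i - w0)" for i x
    have w0: "w0 \<in> ball w0 r" using r by simp
    have lim: "(\<lambda>i. Q i x) \<longlonglongrightarrow> deriv (\<lambda>w. F w x) w0" if "x \<in> space M" for x
      using filterlim_compose[OF _ Ylim] holomorphic_derivI[OF holo[OF that] open_ball w0]
      unfolding has_field_derivative_iff Q_def by blast
    have Qm: "Q i \<in> borel_measurable M" for i
      unfolding Q_def[abs_def] using meas[OF Y(2)[of i]] meas[OF w0] by (intro borel_measurable_divide borel_measurable_diff borel_measurable_const)
    have "(\<lambda>i. \<integral>x. Q i x \<partial>M) \<longlonglongrightarrow> (\<integral>x. deriv (\<lambda>w. F w x) w0 \<partial>M)"
    proof (rule integral_dominated_convergence[where w = "\<lambda>x. 3 * B x / r"])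
      show "(\<lambda>x. deriv (\<lambda>w. F w x) w0) \<in> borel_measurable M"
        by (rule borel_measurable_LIMSEQ_metric[OF Qm lim])
      show "integrable M (\<lambda>x. 3 * B x / r)" using B by simp
      show "AE x in M. norm (Q i x) \<le> 3 * B x / r" for i
      proof (rule AE_I2)
        fix x assume "x \<in> space M"
        from lip[OF Y(1) this, of i] show "norm (Q i x) \<le> 3 * B x / r"
          using Y(3)[of i] by (simp add: Q_def norm_divide pos_divide_le_eq)
      qed
    qed (use Qm lim in auto)
    moreover have "(\<integral>x. Q i x \<partial>M) = ((\<integral>x. F (Y i) x \<partial>M) - (\<integral>x. F w0 x \<partial>M)) / (Y i - w0)" for i
      unfolding Q_def using int[OF Y(2)[of i]] int[OF w0] by simp
    ultimately have "(\<lambda>i. ((\<lambda>w. ((\<integral>x. F w x \<partial>M) - (\<integral>x. F w0 x \<partial>M)) / (w - w0)) \<circ> X) (i + N)) \<longlonglongrightarrow> (\<integral>x. deriv (\<lambda>w. F w x) w0 \<partial>M)"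
      by (simp add: Y_def)
    thus "((\<lambda>w. ((\<integral>x. F w x \<partial>M) - (\<integral>x. F w0 x \<partial>M)) / (w - w0)) \<circ> X) \<longlonglongrightarrow> (\<integral>x. deriv (\<lambda>w. F w x) w0 \<partial>M)"
      by (rule LIMSEQ_offset)
  qed
qed

lemma decays_exp: "d > 0 ==> decays n (\<lambda>x. of_real (exp (- d * (\<Sum>i<n. x i))))"
  unfolding decays_def
proof (rule conjI)
  show "(\<lambda>x. complex_of_real (exp (- d * (\<Sum>i<n. x i)))) \<in> borel_measurable (lebesgue_n n)"
    by (intro measurable_compose[OF _ borel_measurable_of_real] borel_measurable_exp borel_measurable_times
        borel_measurable_const borel_measurable_sum coord_measurable) auto
qed (rule exI[of _ d], auto intro!: exI[of _ "1::real"])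

text \<open>Symmetry of the kernel in its arguments makes it holomorphic in z. Moving one coordinate
  by at most epsilon/2 keeps it in the disc about M of radius M - epsilon/2, so exp(-(epsilon/2)(x_1
  + ... + x_n)) dominates the kernel locally uniformly.\<close>

lemma hint_1_deriv:
  assumes k: "k \<ge> 0" and z: "\<And>i. i < n ==> Re (z i) > 0" and s: "Re s > -1" and j: "j < n"
  shows "((\<lambda>w. OI n (hint n k s (z(j := w)) (\<lambda>_. 1))) has_field_derivative
    OI n (\<lambda>x. deriv (\<lambda>w. dk n k (cvec x) (\<lambda>i. - (z(j := w)) i)) (z j) * (of_real (omega n k x) * Dp n s x))) (at (z j))"
proof -
  have "\<exists>M \<epsilon>. \<epsilon> > 0 \<and> (\<forall>i<n. norm (of_real M - z i) \<le> M - \<epsilon>)" by (rule halfplane_disc) (rule z)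
  then obtain M \<epsilon> where e: "\<epsilon> > 0" and M: "\<forall>i<n. norm (of_real M - z i) \<le> M - \<epsilon>" by (elim exE conjE)
  define F where "F w x = indicator (pos_orthant n) x *\<^sub>R hint n k s (z(j := w)) (\<lambda>_. 1) x" for w x
  define B0 where "B0 x = of_real (exp (- (\<epsilon> / 2) * (\<Sum>i<n. x i))) * of_real (omega n k x) * Dp n s x" for x
  define B where "B x = norm (indicator (pos_orthant n) x *\<^sub>R B0 x)" for x
  have "oint n B0" unfolding B0_def[abs_def] by (intro oint_dom s decays_omega k decays_exp) (use e in simp)
  hence B: "integrable (lebesgue_n n) B" unfolding B_def[abs_def] set_integrable_def by (rule integrable_norm)
  have neg: "(\<lambda>i. - (z(j := w)) i) = (\<lambda>i. - z i)(j := - w)" for w by auto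
  have com: "dk n k (\<lambda>i. - (z(j := w)) i) X = dk n k X ((\<lambda>i. - z i)(j := - w))" for w X
    unfolding neg by (rule dk_commute[OF k])
  have hol: "(\<lambda>w. dk n k X ((\<lambda>i. - z i)(j := - w))) holomorphic_on UNIV" for X
    using holomorphic_on_compose[OF holomorphic_on_minus[OF holomorphic_on_ident, of UNIV], of "\<lambda>w. dk n k X ((\<lambda>i. - z i)(j := w))"]
      holomorphic_on_subset[OF sep_holoD[OF sep_holo_dk[OF k] j, of X "\<lambda>i. - z i"] subset_UNIV]
    by (simp add: comp_def)
  have "((\<lambda>w. \<integral>x. F w x \<partial>lebesgue_n n) has_field_derivative (\<integral>x. deriv (\<lambda>w. F w x) (z j) \<partial>lebesgue_n n)) (at (z j))"
  proof (rule deriv_under_integral[OF _ _ _ _ B])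
    show "\<epsilon> / 2 > 0" using e by simp
    fix w
    show "F w \<in> borel_measurable (lebesgue_n n)"
      unfolding F_def[abs_def] hint_def
      by (intro borel_measurable_scaleR borel_measurable_indicator pos_orthant_sets borel_measurable_times dk_measurable[OF k]
          cvec_coord_measurable borel_measurable_const measurable_compose[OF omega_meas borel_measurable_of_real] Dp_measurable) auto
    fix x :: "nat => real"
    assume w: "w \<in> ball (z j) (\<epsilon> / 2)"
    show "norm (F w x) \<le> B x"
    proof (cases "x \<in> pos_orthant n")
      case True
      have "norm (dk n k (\<lambda>i. - (z(j := w)) i) (cvec x)) \<le> exp (- (\<epsilon> / 2) * (\<Sum>i<n. x i))"
      proof (rule norm_dk_pos[where M = M and z = "z(j := w)" and \<epsilon> = "\<epsilon> / 2", OF k])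
        fix i assume i: "i < n"
        show "0 < x i" using True i by (rule pos_orthantD)
        have "norm (of_real M - w) \<le> norm (of_real M - z j) + norm (z j - w)"
          using norm_triangle_ineq[of "of_real M - z j" "z j - w"] by simp
        moreover have "norm (z j - w) \<le> \<epsilon> / 2" using w by (simp add: dist_norm)
        moreover have "norm (of_real M - z i) \<le> M - \<epsilon>" "norm (of_real M - z j) \<le> M - \<epsilon>" using M i j by auto
        ultimately show "norm (of_real M - (z(j := w)) i) \<le> M - \<epsilon> / 2" using e by (cases "i = j") auto
      qed
      thus ?thesis using True by (simp add: F_def B_def B0_def hint_def norm_mult mult_right_mono)
    qed (simp add: F_def B_def)
  next
    fix x
    show "(\<lambda>w. F w x) holomorphic_on ball (z j) (\<epsilon> / 2)"
      unfolding F_def hint_def com scaleR_conv_of_real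
      by (intro holomorphic_intros holomorphic_on_subset[OF hol]) auto
  qed
  moreover have "deriv (\<lambda>w. F w x) (z j) = indicator (pos_orthant n) x *\<^sub>R
     (deriv (\<lambda>w. dk n k (cvec x) (\<lambda>i. - (z(j := w)) i)) (z j) * (of_real (omega n k x) * Dp n s x))" for x
  proof -
    have d: "((\<lambda>w. dk n k (cvec x) (\<lambda>i. - (z(j := w)) i)) has_field_derivative deriv (\<lambda>w. dk n k (cvec x) (\<lambda>i. - (z(j := w)) i)) (z j)) (at (z j))"
      unfolding neg by (rule holomorphic_derivI[OF hol]) auto
    have F: "(\<lambda>w. F w x) = (\<lambda>w. dk n k (cvec x) (\<lambda>i. - (z(j := w)) i) * (indicator (pos_orthant n) x *\<^sub>R (of_real (omega n k x) * Dp n s x)))"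
      unfolding F_def hint_def unfolding com unfolding neg by (simp add: scaleR_conv_of_real mult_ac)
    show ?thesis unfolding F using DERIV_imp_deriv[OF DERIV_cmult_right[OF d]] by (simp add: scaleR_conv_of_real)
  qed
  ultimately show ?thesis unfolding F_def set_lebesgue_integral_def by simp
qed


definition gg :: "nat => real => complex => (nat => complex) => complex" where
  "gg m k \<mu> z = OI (Suc m) (hint (Suc m) k (\<mu> - of_real (k * real m) - 1) z (\<lambda>_. 1))"

lemma gg_permute:
  assumes "k \<ge> 0" "\<And>i. i < Suc m ==> Re (z i) > 0" "Re \<mu> > k * real m" "\<tau> \<in> symg (Suc m)"
  shows "gg m k \<mu> (z \<circ> \<tau>) = gg m k \<mu> z"
proof -
  let ?s = "\<mu> - of_real (k * real m) - 1"
  have "OI (Suc m) (hint (Suc m) k ?s z (\<lambda>x. (\<lambda>_. 1) (x \<circ> \<tau>))) = OI (Suc m) (hint (Suc m) k ?s (z \<circ> \<tau>) (\<lambda>_. 1))"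
    by (rule OI_hint_permute[where p = "\<lambda>_. 1"]) (use assms in \<open>auto intro: pos_poly_1\<close>)
  thus ?thesis by (simp add: gg_def)
qed

lemma gg_field_differentiable:
  assumes "k \<ge> 0" "\<And>i. i < Suc m ==> i \<noteq> j ==> Re (z i) > 0" "Re \<mu> > k * real m" "j < Suc m" "Re w > 0"
  shows "(\<lambda>w. gg m k \<mu> (z(j := w))) field_differentiable (at w)"
proof -
  have "\<exists>D. ((\<lambda>v. gg m k \<mu> ((z(j := w))(j := v))) has_field_derivative D) (at ((z(j := w)) j))"
    unfolding gg_def by (rule exI, rule hint_1_deriv) (use assms in auto)
  thus ?thesis unfolding field_differentiable_def by simp
qed

lemma hint_const: "hint n k s z (\<lambda>_. 1) x = dk n k (\<lambda>i. - z i) (cvec x) * (of_real (omega n k x) * Dp n s x)"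
  by (simp add: hint_def)

text \<open>As a function of its spectral variable the kernel obeys the same eigenvalue equations.
  The derivative in z_m therefore gives -x_m times the kernel plus differences of the kernel and its
  reflections; the latter integrate to 0 by symmetry, and \<open>ibp_last\<close> with g = 1 and a =
  0 evaluates the former as -(mu / z_m) times the transform.\<close>

lemma gg_deriv:
  assumes k: "k \<ge> 0" and z: "\<And>i. i < Suc m ==> Re (z i) > 0" and \<mu>: "Re \<mu> > k * real m" and d: "distinct_coords (Suc m) z"
  shows "((\<lambda>w. gg m k \<mu> (z(m := w))) has_field_derivative - (\<mu> / z m) * gg m k \<mu> z) (at (z m))"
proof -
  define n where "n = Suc m"
  define s where "s = \<mu> - of_real (k * real m) - 1"
  have s1: "Re s > -1" using \<mu> by (simp add: s_def)
  define W where "W x = of_real (omega n k x) * Dp n s x" for x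
  define t where "t i = Transposition.transpose i m" for i
  have t: "t i \<in> symg n" if "i < m" for i unfolding t_def n_def using that by (intro swap_symg) auto
  define H where "H = hint n k s z (\<lambda>_. 1)"
  have iH: "oint n H" unfolding H_def by (rule oint_hint_pos[OF k _ s1 pos_poly_1]) (use z in \<open>auto simp: n_def\<close>)
  define Hi where "Hi i x = H (x \<circ> t i)" for i x
  have iHi: "oint n (Hi i)" and eHi: "OI n (Hi i) = OI n H" if "i < m" for i
    unfolding Hi_def[abs_def] using oint_permute[OF t[OF that] iH] by auto
  have mon: "(\<lambda>_. 1) = mpoly n {\<lambda>_. 0} (\<lambda>_. 1)" by (auto simp: mpoly_def mono_def fun_eq_iff)
  have eig: "x m * dunkl_op n k (unit_vec m) (\<lambda>_. 1) x
       + of_real (k * (1 - real n)) * 1 + of_real k * (\<Sum>i<m. 1) = 0 * 1" for x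
    by (simp add: n_def dunkl_op_def pderiv_n_def algebra_simps)
  note ibp = ibp_last[of k m z s "{\<lambda>_. 0}" "\<lambda>_. 1" "\<lambda>_. 1" 0, folded n_def, OF k _ s1 _ mon eig]
  define X1 where "X1 = hint n k s z (\<lambda>x. x m * 1)"
  have zz: "\<And>i. i < n ==> Re (z i) > 0" using z by (simp add: n_def)
  have iX: "oint n X1" unfolding X1_def by (rule ibp(1)) (use zz in auto)
  have eX: "z m * OI n X1 = \<mu> * OI n H"
    using ibp(2) zz unfolding X1_def H_def by (simp add: s_def)
  have zm: "z m \<noteq> 0" using z[of m] by auto
  have der: "deriv (\<lambda>w. dk n k (cvec x) (\<lambda>i. - (z(m := w)) i)) (z m) * W x =
     - X1 x + (\<Sum>i<m. of_real k / (z i - z m) * (H x - Hi i x))" for x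
  proof -
    define l where "l = (\<lambda>i. - z i)"
    have dl: "distinct_coords (Suc m) l" using d by (auto simp: distinct_coords_def l_def)
    have neg: "(\<lambda>i. - (z(m := w)) i) = l(m := - w)" for w by (auto simp: l_def)
    have "((\<lambda>v. dk n k (cvec x) (l(m := v))) has_field_derivative pderiv_n (dk n k (cvec x)) m l) (at (- z m))"
      unfolding pderiv_n_def using sep_holo_diff[OF sep_holo_dk[OF k], of m n "cvec x" l "- z m"]
      by (simp add: field_differentiable_derivI n_def l_def)
    from DERIV_chain2[where f = "\<lambda>v. dk n k (cvec x) (l(m := v))" and g = "\<lambda>w. - w" and x = "z m" and Db = "-1" and s = UNIV, OF this DERIV_minus[OF DERIV_ident]]
    have "((\<lambda>w. dk n k (cvec x) (l(m := - w))) has_field_derivative - pderiv_n (dk n k (cvec x)) m l) (at (z m))"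
      by simp
    hence 1: "deriv (\<lambda>w. dk n k (cvec x) (\<lambda>i. - (z(m := w)) i)) (z m) = - pderiv_n (dk n k (cvec x)) m l"
      unfolding neg by (rule DERIV_imp_deriv)
    have sw: "dk n k (cvec x) (swap_coords i m l) = dk n k l (cvec (x \<circ> t i))" if "i < m" for i
    proof -
      have "dk n k (cvec x) (swap_coords i m l) = dk n k (l \<circ> t i) ((cvec x \<circ> t i) \<circ> t i)"
        unfolding swap_coords_eq t_def dk_commute[OF k, of n "cvec x"] by (simp add: comp_assoc)
      thus ?thesis unfolding dk_permute[OF k t[OF that]] cvec_comp .
    qed
    have Hi: "Hi i x = dk n k l (cvec (x \<circ> t i)) * W x" if "i < m" for i
      unfolding Hi_def H_def hint_const omega_permute[OF t[OF that]] Dp_permute[OF t[OF that]] W_def l_def ..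
    have "pderiv_n (dk n k (cvec x)) m l = cvec x m * dk n k (cvec x) l
       - (\<Sum>i<m. of_real k * (dk n k (cvec x) l - dk n k (cvec x) (swap_coords i m l)) / (l m - l i))"
      unfolding n_def by (rule last_deriv_dk[OF k dl])
    also have "(\<Sum>i<m. of_real k * (dk n k (cvec x) l - dk n k (cvec x) (swap_coords i m l)) / (l m - l i)) =
       (\<Sum>i<m. of_real k / (z i - z m) * (dk n k l (cvec x) - dk n k l (cvec (x \<circ> t i))))"
    proof (intro sum.cong refl)
      fix i assume "i \<in> {..<m}"
      hence i: "i < m" by simp
      have "l m - l i = z i - z m" by (simp add: l_def)
      thus "of_real k * (dk n k (cvec x) l - dk n k (cvec x) (swap_coords i m l)) / (l m - l i) =
          of_real k / (z i - z m) * (dk n k l (cvec x) - dk n k l (cvec (x \<circ> t i)))"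
        unfolding sw[OF i] dk_commute[OF k, of n "cvec x" l] by simp
    qed
    finally have "- pderiv_n (dk n k (cvec x)) m l * W x = - (cvec x m * dk n k l (cvec x)) * W x +
       (\<Sum>i<m. of_real k / (z i - z m) * (dk n k l (cvec x) - dk n k l (cvec (x \<circ> t i)))) * W x"
      unfolding dk_commute[OF k, of n "cvec x" l] by (simp add: left_diff_distrib)
    also have "- (cvec x m * dk n k l (cvec x)) * W x = - X1 x" by (simp add: X1_def hint_def W_def l_def mult_ac)
    also have "(\<Sum>i<m. of_real k / (z i - z m) * (dk n k l (cvec x) - dk n k l (cvec (x \<circ> t i)))) * W x =
       (\<Sum>i<m. of_real k / (z i - z m) * (H x - Hi i x))"
      unfolding sum_distrib_right
    proof (intro sum.cong refl)
      fix i assume "i \<in> {..<m}"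
      hence "H x - Hi i x = (dk n k l (cvec x) - dk n k l (cvec (x \<circ> t i))) * W x"
        by (simp add: Hi H_def hint_const W_def l_def left_diff_distrib)
      thus "of_real k / (z i - z m) * (dk n k l (cvec x) - dk n k l (cvec (x \<circ> t i))) * W x = of_real k / (z i - z m) * (H x - Hi i x)"
        by (simp only: mult.assoc)
    qed
    finally show ?thesis unfolding 1 .
  qed
  have iS: "oint n (\<lambda>x. of_real k / (z i - z m) * (H x - Hi i x))" if "i < m" for i
    by (intro set_integrable_mult_right set_integral_diff(1) iH iHi that)
  have "OI n (\<lambda>x. deriv (\<lambda>w. dk n k (cvec x) (\<lambda>i. - (z(m := w)) i)) (z m) * W x) =
     OI n (\<lambda>x. - 1 * X1 x + (\<Sum>i<m. of_real k / (z i - z m) * (H x - Hi i x)))"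
    by (simp only: der mult_minus1)
  also have "\<dots> = OI n (\<lambda>x. - 1 * X1 x) + OI n (\<lambda>x. \<Sum>i<m. of_real k / (z i - z m) * (H x - Hi i x))"
    by (intro set_integral_add(2) set_integrable_mult_right iX set_sum(1) iS) auto
  also have "OI n (\<lambda>x. \<Sum>i<m. of_real k / (z i - z m) * (H x - Hi i x)) = (\<Sum>i<m. OI n (\<lambda>x. of_real k / (z i - z m) * (H x - Hi i x)))"
    by (intro set_sum(2) iS) auto
  also have "\<dots> = 0"
  proof (intro sum.neutral ballI)
    fix i assume i: "i \<in> {..<m}"
    have "OI n (\<lambda>x. H x - Hi i x) = OI n H - OI n (Hi i)" using i by (intro set_integral_diff(2) iH iHi) auto
    thus "OI n (\<lambda>x. of_real k / (z i - z m) * (H x - Hi i x)) = 0" using i by (simp only: set_integral_mult_right) (simp add: eHi)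
  qed
  also have "OI n (\<lambda>x. - 1 * X1 x) + 0 = - 1 * OI n X1" by (simp only: set_integral_mult_right add_0_right)
  also have "\<dots> = - (\<mu> / z m) * OI n H" using eX zm by (simp add: field_simps)
  finally have e: "OI n (\<lambda>x. deriv (\<lambda>w. dk n k (cvec x) (\<lambda>i. - (z(m := w)) i)) (z m) * W x) = - (\<mu> / z m) * gg m k \<mu> z"
    by (simp add: gg_def H_def n_def s_def)
  have "m < n" by (simp add: n_def)
  hence "((\<lambda>w. OI n (hint n k s (z(m := w)) (\<lambda>_. 1))) has_field_derivative
      OI n (\<lambda>x. deriv (\<lambda>w. dk n k (cvec x) (\<lambda>i. - (z(m := w)) i)) (z m) * (of_real (omega n k x) * Dp n s x))) (at (z m))"
    by (intro hint_1_deriv[OF k _ s1] zz)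
  thus ?thesis unfolding W_def[symmetric] e unfolding gg_def n_def s_def .
qed

text \<open>The product with z_m^mu has derivative 0 on the half-plane except at the finitely many
  values of the other coordinates; by continuity it is constant.\<close>

lemma gg_line:
  assumes k: "k \<ge> 0" and z: "\<And>i. i < Suc m ==> Re (z i) > 0" and \<mu>: "Re \<mu> > k * real m" and d: "distinct_coords m z" and w: "Re w > 0"
  shows "gg m k \<mu> (z(m := w)) * exp (\<mu> * Ln w) = gg m k \<mu> z * exp (\<mu> * Ln (z m))"
proof -
  define f where "f v = gg m k \<mu> (z(m := v)) * exp (\<mu> * Ln v)" for v
  have "f w = f (z m)"
  proof (rule has_derivative_zero_unique_strong_convex[where f = f and c = "z m" and S = "{v. Re v > 0}" and K = "z ` {..<m}"])
    show "convex {v. Re v > 0}" by (rule convex_halfspace_Re_gt)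
    show "continuous_on {v. Re v > 0} f"
    proof (intro continuous_at_imp_continuous_on ballI)
      fix v assume v: "v \<in> {v. Re v > 0}"
      have "(\<lambda>w. gg m k \<mu> (z(m := w))) field_differentiable (at v)"
        by (rule gg_field_differentiable[OF k _ \<mu>]) (use z v in auto)
      hence "isCont (\<lambda>w. gg m k \<mu> (z(m := w))) v" by (rule field_differentiable_imp_continuous_at)
      thus "isCont f v" unfolding f_def using v by (intro continuous_intros) (auto simp: complex_nonpos_Reals_iff)
    qed
    fix v assume v: "v \<in> {v. Re v > 0} - z ` {..<m}"
    have v0: "v \<notin> \<real>\<^sub>\<le>\<^sub>0" "v \<noteq> 0" using v by (auto simp: complex_nonpos_Reals_iff)
    have "distinct_coords (Suc m) (z(m := v))" using d v by (auto simp: distinct_coords_def less_Suc_eq)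
    hence 1: "((\<lambda>w. gg m k \<mu> ((z(m := v))(m := w))) has_field_derivative - (\<mu> / (z(m := v)) m) * gg m k \<mu> (z(m := v))) (at ((z(m := v)) m))"
      by (intro gg_deriv[OF k _ \<mu>]) (use z v in auto)
    hence 1: "((\<lambda>w. gg m k \<mu> (z(m := w))) has_field_derivative - (\<mu> / v) * gg m k \<mu> (z(m := v))) (at v)" by simp
    have 2: "((\<lambda>v. exp (\<mu> * Ln v)) has_field_derivative exp (\<mu> * Ln v) * (\<mu> * (1 / v))) (at v)"
      using v0 by (auto intro!: derivative_eq_intros simp: field_simps)
    have "(f has_field_derivative 0) (at v)"
      unfolding f_def[abs_def] using DERIV_mult[OF 1 2] by (simp add: mult_ac)
    hence "(f has_derivative (\<lambda>h. 0)) (at v)" by (simp add: has_field_derivative_def lambda_zero)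
    thus "(f has_derivative (\<lambda>h. 0)) (at v within {v. Re v > 0})" by (rule has_derivative_at_withinI)
  qed (use z w in auto)
  thus ?thesis by (simp add: f_def)
qed

text \<open>Removes the assumption of distinct coordinates one index at a time: it is imposed only
  on indices from j on, and raising j amounts to perturbing z_j slightly and passing to the limit by
  continuity in this coordinate.\<close>

lemma gg_last_aux:
  assumes k: "k \<ge> 0" and \<mu>: "Re \<mu> > k * real m" and w: "Re w > 0"
  shows "(\<And>i. i < Suc m ==> Re (z i) > 0) ==> (\<And>a b. a < m ==> b < m ==> a \<noteq> b ==> j \<le> a ==> z a \<noteq> z b) ==>
    gg m k \<mu> (z(m := w)) * exp (\<mu> * Ln w) = gg m k \<mu> z * exp (\<mu> * Ln (z m))"
proof (induction j arbitrary: z)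
  case 0
  show ?case by (rule gg_line[OF k _ \<mu> _ w]) (use 0 in \<open>auto simp: distinct_coords_def\<close>)
next
  case (Suc j)
  show ?case
  proof (cases "j < m")
    case False
    show ?thesis by (rule Suc.IH) (use Suc.prems False in auto)
  next
    case True
    define h where "h v = gg m k \<mu> ((z(m := w))(j := v)) * exp (\<mu> * Ln w) - gg m k \<mu> (z(j := v)) * exp (\<mu> * Ln (z m))" for v
    have "Re (z j) > 0" using Suc.prems(1) True by simp
    note zj = this
    have c1: "isCont (\<lambda>v. gg m k \<mu> ((z(m := w))(j := v))) (z j)"
      by (intro field_differentiable_imp_continuous_at gg_field_differentiable[OF k _ \<mu>]) (use Suc.prems(1) True w zj in auto)
    have c2: "isCont (\<lambda>v. gg m k \<mu> (z(j := v))) (z j)"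
      by (intro field_differentiable_imp_continuous_at gg_field_differentiable[OF k _ \<mu>]) (use Suc.prems(1) True w zj in auto)
    have "isCont h (z j)" unfolding h_def[abs_def] using c1 c2 by (intro continuous_intros)
    hence lim: "(h \<longlongrightarrow> h (z j)) (at (z j))" by (simp add: isCont_def)
    have "open ({v. Re v > 0} \<inter> - (z ` {..<m} - {z j}))"
      by (intro open_Int open_halfspace_Re_gt open_Compl finite_imp_closed) auto
    hence "eventually (\<lambda>v. v \<in> ({v. Re v > 0} \<inter> - (z ` {..<m} - {z j})) - {z j}) (at (z j))"
      by (rule eventually_at_in_open) (use zj in auto)
    hence "eventually (\<lambda>v. h v = 0) (at (z j))"
    proof eventually_elim
      case (elim v)
      have nv: "v \<noteq> z b" if "b < m" for b using elim that by auto
      have "gg m k \<mu> ((z(j := v))(m := w)) * exp (\<mu> * Ln w) = gg m k \<mu> (z(j := v)) * exp (\<mu> * Ln ((z(j := v)) m))"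
      proof (rule Suc.IH)
        show "Re ((z(j := v)) i) > 0" if "i < Suc m" for i using elim Suc.prems(1)[OF that] by auto
        fix a b assume ab: "a < m" "b < m" "a \<noteq> b" "j \<le> a"
        show "(z(j := v)) a \<noteq> (z(j := v)) b"
          using ab nv[of a] nv[of b] Suc.prems(2)[of a b] by auto
      qed
      thus ?case using True by (simp add: h_def fun_upd_twist)
    qed
    hence "(h \<longlongrightarrow> 0) (at (z j))" by (rule tendsto_eventually)
    hence "h (z j) = 0" using tendsto_unique[OF _ lim] by (simp add: at_neq_bot)
    moreover have "(z(m := w))(j := z j) = z(m := w)" using True by auto
    ultimately show ?thesis unfolding h_def by (simp only: fun_upd_triv right_minus_eq)
  qed
qed

definition GG :: "nat => real => complex => (nat => complex) => complex" where
  "GG m k \<mu> z = gg m k \<mu> z * exp (\<mu> * (\<Sum>i<Suc m. Ln (z i)))"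

text \<open>The transform is symmetric in z, so coordinate j can be exchanged with the last one,
  where \<open>gg_last_aux\<close> applies.\<close>

lemma GG_coord:
  assumes k: "k \<ge> 0" and z: "\<And>i. i < Suc m ==> Re (z i) > 0" and \<mu>: "Re \<mu> > k * real m" and w: "Re w > 0" and j: "j < Suc m"
  shows "GG m k \<mu> (z(j := w)) = GG m k \<mu> z"
proof -
  define t where "t = Transposition.transpose j m"
  have t: "t \<in> symg (Suc m)" unfolding t_def using j by (intro swap_symg) auto
  have zt: "\<And>i. i < Suc m ==> Re ((z \<circ> t) i) > 0" using z t by (simp add: symg_lt)
  have "gg m k \<mu> ((z \<circ> t)(m := w)) * exp (\<mu> * Ln w) = gg m k \<mu> (z \<circ> t) * exp (\<mu> * Ln ((z \<circ> t) m))"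
    by (rule gg_last_aux[OF k \<mu> w, where j = m]) (use zt in auto)
  moreover have "(z \<circ> t)(m := w) = z(j := w) \<circ> t"
    by (auto simp: fun_eq_iff t_def Transposition.transpose_def)
  moreover have "gg m k \<mu> (z(j := w) \<circ> t) = gg m k \<mu> (z(j := w))" by (rule gg_permute[OF k _ \<mu> t]) (use z w in auto)
  moreover have "gg m k \<mu> (z \<circ> t) = gg m k \<mu> z" by (rule gg_permute[OF k _ \<mu> t]) (use z in auto)
  moreover have "(z \<circ> t) m = z j" by (simp add: t_def)
  ultimately have 1: "gg m k \<mu> (z(j := w)) * exp (\<mu> * Ln w) = gg m k \<mu> z * exp (\<mu> * Ln (z j))" by simp
  define R where "R = (\<Sum>i\<in>{..<Suc m} - {j}. Ln (z i))"
  have "(\<Sum>i<Suc m. Ln ((z(j := w)) i)) = Ln w + R" "(\<Sum>i<Suc m. Ln (z i)) = Ln (z j) + R"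
    unfolding R_def using j by (subst sum.remove[of _ j]; simp)+
  thus ?thesis unfolding GG_def using 1 by (simp add: distrib_left exp_add mult.assoc[symmetric])
qed

lemma hint_base:
  assumes k: "k \<ge> 0" and z: "\<And>i. i < Suc m ==> Re (z i) > 0" and \<mu>: "Re \<mu> > k * real m"
  shows "gg m k \<mu> z = gg m k \<mu> (\<lambda>_. 1) * Delta_pow (Suc m) z (- \<mu>)"
proof -
  have "GG m k \<mu> (\<lambda>i. if i < j then 1 else z i) = GG m k \<mu> z" if "j \<le> Suc m" for j
    using that
  proof (induction j)
    case (Suc j)
    have e: "(\<lambda>i. if i < Suc j then 1 else z i) = (\<lambda>i. if i < j then 1 else z i)(j := 1)" by auto
    have "GG m k \<mu> (\<lambda>i. if i < Suc j then 1 else z i) = GG m k \<mu> (\<lambda>i. if i < j then 1 else z i)"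
      unfolding e by (rule GG_coord[OF k _ \<mu>]) (use z Suc in auto)
    thus ?case using Suc by simp
  qed simp
  from this[of "Suc m"] have "GG m k \<mu> (\<lambda>i. if i < Suc m then 1 else z i) = GG m k \<mu> z" by simp
  \<comment> \<open>Beyond the first m + 1 entries z is arbitrary; the kernel does not see those
    entries, so the point may be replaced by the constant 1.\<close>
  moreover have "gg m k \<mu> (\<lambda>i. if i < Suc m then 1 else z i) = gg m k \<mu> (\<lambda>_. 1)"
  proof -
    have "dk (Suc m) k (\<lambda>i. - (if i < Suc m then 1 else z i)) X = dk (Suc m) k (\<lambda>i. - 1) X" for X
      unfolding dk_commute[OF k, of _ _ X] by (rule dk_cong) simp
    thus ?thesis unfolding gg_def hint_def by simp
  qed
  ultimately have "gg m k \<mu> (\<lambda>_. 1) = gg m k \<mu> z * exp (\<mu> * (\<Sum>i<Suc m. Ln (z i)))" by (simp add: GG_def)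
  thus ?thesis by (simp add: Delta_pow_def exp_minus)
qed

section \<open>The Selberg integral\<close>

text \<open>The Laguerre form of the Selberg integral. It is the transform of 1 at z = (1, ..., 1),
  where the kernel becomes the exponential of minus the coordinate sum.\<close>

definition In :: "nat => real => complex => complex" where
  "In n k s = OI n (\<lambda>x. of_real (exp (- (\<Sum>i<n. x i))) * of_real (omega n k x) * Dp n s x)"

lemma oint_In:
  assumes "k \<ge> 0" "Re s > -1"
  shows "oint n (\<lambda>x. of_real (exp (- (\<Sum>i<n. x i))) * of_real (omega n k x) * Dp n s x)"
  using oint_dom[OF decays_omega[OF decays_exp[of 1 n] assms(1)] assms(2)] by simp

lemma dk_minus_one: "k \<ge> 0 ==> dk n k (\<lambda>i. - 1) x = exp (- (\<Sum>i<n. x i))"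
  using dk_shift[of k n "-1" "\<lambda>_. 0" x] dk_commute[of k n "\<lambda>_. 0" x] by simp

lemma hint_one: "k \<ge> 0 ==> hint n k s (\<lambda>_. 1) g x = of_real (exp (- (\<Sum>i<n. x i))) * g (cvec x) * of_real (omega n k x) * Dp n s x"
  by (simp add: hint_def dk_minus_one cvec_def exp_of_real[symmetric] del: exp_of_real)

lemma gg_one: "k \<ge> 0 ==> gg m k \<mu> (\<lambda>_. 1) = In (Suc m) k (\<mu> - of_real (k * real m) - 1)"
proof -
  assume k: "k \<ge> 0"
  have "hint (Suc m) k s (\<lambda>_. 1) (\<lambda>_. 1) = (\<lambda>x. of_real (exp (- (\<Sum>i<Suc m. x i))) * of_real (omega (Suc m) k x) * Dp (Suc m) s x)" for s
    by (rule ext) (simp add: hint_one[OF k])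
  thus ?thesis unfolding gg_def In_def by simp
qed

text \<open>The exponent with ones in the last i places. These are what \<open>phi\<close> makes of
  0 in i steps; after m + 1 steps the monomial is the product of all coordinates.\<close>

definition colm :: "nat => nat => nat => nat" where
  "colm m i j = (if Suc m - i \<le> j \<and> j < Suc m then 1 else 0)"

lemma phi_colm: "i \<le> m ==> phi m (colm m i) = colm m (Suc i)"
  by (auto simp: fun_eq_iff phi_def colm_def icyc_def)

lemma eta_bar_colm:
  assumes "i \<le> m"
  shows "eta_bar (Suc m) k (colm m i) 0 = - k * real i"
proof -
  have "{l. 0 < l \<and> l < Suc m \<and> colm m i 0 < colm m i l} = {Suc m - i..<Suc m}"
    using assms by (auto simp: colm_def)
  thus ?thesis using assms by (simp add: eta_bar_def colm_def)
qed

lemma Dp_plus_1: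
  assumes "\<And>i. i < n ==> 0 < x i"
  shows "Dp n (s + 1) x = Dp n s x * of_real (\<Prod>i<n. x i)"
proof -
  have "exp (complex_of_real (\<Sum>i<n. ln (x i))) = of_real (\<Prod>i<n. x i)"
    unfolding exp_of_real by (subst exp_sum) (use assms in \<open>auto intro!: prod.cong\<close>)
  thus ?thesis by (simp add: Dp_def distrib_right exp_add)
qed

text \<open>Multiplying by the product of the coordinates raises s by 1, and this product arises
  from 1 by m + 1 raisings. At z = (1, ..., 1), which the cyclic shift fixes, the i-th raising
  contributes the factor mu - k i, counted from 0.\<close>

lemma In_plus_1:
  assumes k: "k \<ge> 0" and s: "Re s > -1"
  shows "In (Suc m) k (s + 1) = (\<Prod>j<Suc m. s + 1 + of_real (k * (real m - real j))) * In (Suc m) k s"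
proof -
  define \<mu> where "\<mu> = s + 1 + of_real (k * real m)"
  have \<mu>: "Re \<mu> > k * real m" using s by (simp add: \<mu>_def)
  have s': "s = \<mu> - of_real (k * real m) - 1" by (simp add: \<mu>_def)
  have "i \<le> Suc m ==> pos_poly (Suc m) (mono (Suc m) (colm m i)) \<and> jack_eigen (Suc m) k (colm m i) (mono (Suc m) (colm m i)) \<and>
     OI (Suc m) (hint (Suc m) k s (\<lambda>_. 1) (mono (Suc m) (colm m i))) = (\<Prod>j<i. \<mu> - of_real (k * real j)) * In (Suc m) k s" for i
  proof (induction i)
    case 0
    have "mono (Suc m) (colm m 0) = (\<lambda>_. 1)" "colm m 0 = (\<lambda>_. 0)" by (auto simp: mono_def colm_def fun_eq_iff)
    thus ?case using pos_poly_1[of "Suc m"] jack_eigen_1[of "Suc m" k] gg_one[OF k, of m \<mu>] by (simp add: gg_def s')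
  next
    case (Suc i)
    let ?p = "mono (Suc m) (colm m i)"
    have i: "i \<le> m" using Suc.prems by simp
    have p: "pos_poly (Suc m) ?p" and e: "jack_eigen (Suc m) k (colm m i) ?p"
      and IH: "OI (Suc m) (hint (Suc m) k s (\<lambda>_. 1) ?p) = (\<Prod>j<i. \<mu> - of_real (k * real j)) * In (Suc m) k s"
      using Suc by auto
    have Ph: "Phi m ?p = mono (Suc m) (colm m (Suc i))" by (simp add: Phi_mono phi_colm[OF i])
    have "(\<lambda>_. 1) m * OI (Suc m) (hint (Suc m) k s (\<lambda>_. 1) (Phi m ?p)) =
       (of_real (eta_bar (Suc m) k (colm m i) 0) + \<mu>) * OI (Suc m) (hint (Suc m) k s ((\<lambda>_. 1) \<circ> cyc m) ?p)"
    proof (rule Phi_step[OF k _ \<mu> p _ s'])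
      show "cher_op (Suc m) k 0 ?p x = of_real (eta_bar (Suc m) k (colm m i) 0) * ?p x" if "distinct_coords (Suc m) x" for x
        using e that unfolding jack_eigen_def by blast
    qed simp
    moreover have "(\<lambda>_. 1) \<circ> cyc m = (\<lambda>_. 1 :: complex)" by auto
    ultimately have "OI (Suc m) (hint (Suc m) k s (\<lambda>_. 1) (mono (Suc m) (colm m (Suc i)))) = (\<Prod>j<Suc i. \<mu> - of_real (k * real j)) * In (Suc m) k s"
      by (simp add: Ph eta_bar_colm[OF i] IH mult_ac)
    moreover have "pos_poly (Suc m) (mono (Suc m) (colm m (Suc i)))" unfolding Ph[symmetric] by (rule pos_poly_Phi[OF p])
    moreover have "jack_eigen (Suc m) k (colm m (Suc i)) (mono (Suc m) (colm m (Suc i)))"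
      using jack_eigen_Phi[OF sep_holo_pos_poly[OF p] e] unfolding Ph phi_colm[OF i] .
    ultimately show ?case by blast
  qed
  from this[of "Suc m"] have "OI (Suc m) (hint (Suc m) k s (\<lambda>_. 1) (mono (Suc m) (colm m (Suc m)))) = (\<Prod>j<Suc m. \<mu> - of_real (k * real j)) * In (Suc m) k s"
    by blast
  moreover have "OI (Suc m) (hint (Suc m) k s (\<lambda>_. 1) (mono (Suc m) (colm m (Suc m)))) = In (Suc m) k (s + 1)"
    unfolding In_def
  proof (rule set_lebesgue_integral_cong, goal_cases)
    case 1 show ?case by (rule pos_orthant_sets)
  next
    case 2
    show ?case
    proof (intro allI impI)
      fix x assume "x \<in> pos_orthant (Suc m)"
      hence x: "\<And>i. i < Suc m ==> 0 < x i" by (rule pos_orthantD)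
      have "mono (Suc m) (colm m (Suc m)) (cvec x) = of_real (\<Prod>i<Suc m. x i)"
        unfolding mono_def of_real_prod by (intro prod.cong) (auto simp: colm_def cvec_def)
      thus "hint (Suc m) k s (\<lambda>_. 1) (mono (Suc m) (colm m (Suc m))) x =
         of_real (exp (- (\<Sum>i<Suc m. x i))) * of_real (omega (Suc m) k x) * Dp (Suc m) (s + 1) x"
        unfolding hint_one[OF k] by (simp only: Dp_plus_1[OF x] mult_ac)
    qed
  qed
  moreover have "(\<Prod>j<Suc m. \<mu> - of_real (k * real j)) = (\<Prod>j<Suc m. s + 1 + of_real (k * (real m - real j)))"
    by (intro prod.cong) (auto simp: \<mu>_def algebra_simps)
  ultimately show ?thesis by simp
qed

text \<open>The derivative in x_m of exp(-sum) times the weight is integrated for s = 0. Its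
  singular terms are antisymmetric under exchanging i and m and integrate to 0, so minus the
  integral itself remains. At x_m = 0 the weight becomes the one for m variables times the product
  of x_i^(2k), that is, exponent 2k.\<close>

lemma In_boundary:
  assumes k: "k \<ge> 0"
  shows "In (Suc m) k 0 = In m k (of_real (2 * k))"
proof -
  let ?n = "Suc m"
  define \<Psi> where "\<Psi> x = complex_of_real (exp (- (\<Sum>i<?n. x i))) * of_real (omega ?n k x)" for x
  define Sg where "Sg i x = of_real k * (\<Psi> x / of_real (x m - x i))" for i x
  define D where "D x = - 1 * \<Psi> x + (\<Sum>i<m. 2 * Sg i x)" for x
  define L where "L x = complex_of_real (exp (- (\<Sum>i<m. x i))) * of_real (omega m k x * (\<Prod>i<m. ww k (x i)))" for x
  have Dp0: "Dp n 0 x = 1" for n x by (simp add: Dp_def)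
  have dPsi: "decays ?n \<Psi>" unfolding \<Psi>_def[abs_def] using decays_omega[OF decays_exp[of 1 ?n] k] by simp
  have iPsi: "oint ?n \<Psi>" using oint_In[OF k, of 0 ?n] by (simp add: \<Psi>_def[abs_def] Dp0)
  have iSg: "oint ?n (Sg i)" if i: "i < m" for i
  proof (cases "k = 0")
    case True
    thus ?thesis by (simp add: Sg_def[abs_def] set_integrable_def)
  next
    case False
    hence k': "k > 0" using k by simp
    define R where "R x = omega m k x * (\<Prod>l\<in>{..<m}-{i}. ww k (x l - x m))" for x
    have o: "omega ?n k x = R x * ww k (x i - x m)" for x
      unfolding omega_Suc R_def using i by (subst prod.remove[of _ i]) auto
    have R: "expbd ?n R" unfolding R_def[abs_def] using k by (intro expbd_mult expbd_omega expbd_prod expbd_ww) auto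
    have Rm: "R \<in> borel_measurable (lebesgue_n ?n)"
      unfolding R_def[abs_def]
      by (intro borel_measurable_times omega_meas borel_measurable_prod measurable_compose[OF _ ww_measurable] borel_measurable_diff coord_measurable) auto
    have G: "decays ?n (\<lambda>x. of_real (exp (- 1 * (\<Sum>i<?n. x i))) * of_real (R x))"
      by (rule decays_mult[OF decays_exp expbd_of_real[OF R] measurable_compose[OF Rm borel_measurable_of_real]]) simp
    have "oint ?n (\<lambda>x. of_real k * (complex_of_real (exp (- 1 * (\<Sum>i<?n. x i))) * of_real (R x) * of_real (ww k (x i - x m) / (x m - x i))))"
      using i by (intro set_integrable_mult_right oint_dom_sing0[OF G _ _ _ k']) auto
    moreover have "Sg i = (\<lambda>x. of_real k * (of_real (exp (- 1 * (\<Sum>i<?n. x i))) * of_real (R x) * of_real (ww k (x i - x m) / (x m - x i))))"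
      unfolding Sg_def[abs_def] \<Psi>_def o by (simp add: fun_eq_iff)
    ultimately show ?thesis by simp
  qed
  have eSg: "OI ?n (Sg i) = 0" if i: "i < m" for i
  proof -
    define t where "t = Transposition.transpose i m"
    have t: "t \<in> symg ?n" unfolding t_def using i by (intro swap_symg) auto
    have "Sg i (x \<circ> t) = - 1 * Sg i x" for x
    proof -
      have "\<Psi> (x \<circ> t) = \<Psi> x" unfolding \<Psi>_def omega_permute[OF t] sum_coords_symg[OF t] ..
      moreover have "(x \<circ> t) m = x i" "(x \<circ> t) i = x m" by (auto simp: t_def)
      moreover have "\<Psi> x / of_real (x i - x m) = - (\<Psi> x / of_real (x m - x i))"
        by (metis minus_diff_eq minus_divide_right of_real_minus)
      ultimately show ?thesis unfolding Sg_def by simp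
    qed
    hence "OI ?n (\<lambda>x. - 1 * Sg i x) = OI ?n (Sg i)" using oint_permute(2)[OF t iSg[OF i]] by simp
    hence "- 1 * OI ?n (Sg i) = OI ?n (Sg i)" by (simp only: set_integral_mult_right)
    thus ?thesis by simp
  qed
  have iS: "oint ?n (\<lambda>x. 2 * Sg i x)" if "i < m" for i by (intro set_integrable_mult_right iSg that)
  have iSS: "oint ?n (\<lambda>x. \<Sum>i<m. 2 * Sg i x)" by (intro set_sum(1) iS) auto
  have iD: "oint ?n D" unfolding D_def[abs_def] by (intro set_integral_add(1) set_integrable_mult_right iPsi iSS)
  have "OI ?n D = OI ?n (\<lambda>x. - 1 * \<Psi> x) + OI ?n (\<lambda>x. \<Sum>i<m. 2 * Sg i x)"
    unfolding D_def[abs_def] by (intro set_integral_add(2) set_integrable_mult_right iPsi iSS)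
  also have "OI ?n (\<lambda>x. \<Sum>i<m. 2 * Sg i x) = (\<Sum>i<m. OI ?n (\<lambda>x. 2 * Sg i x))" by (intro set_sum(2) iS) auto
  also have "\<dots> = 0" by (intro sum.neutral ballI) (simp only: set_integral_mult_right, simp add: eSg)
  also have "OI ?n (\<lambda>x. - 1 * \<Psi> x) = - In ?n k 0"
    unfolding In_def Dp0 by (simp only: set_integral_mult_right) (simp add: \<Psi>_def)
  finally have 1: "OI ?n D = - In ?n k 0" by simp
  have "OI ?n D = - OI m L"
  proof (rule oint_last_deriv[where \<Psi> = \<Psi>])
    show "oint ?n D" by (rule iD)
    have "(\<lambda>x. omega m k x * (\<Prod>i<m. ww k (x i))) \<in> borel_measurable (lebesgue_n m)"
      by (intro borel_measurable_times omega_meas borel_measurable_prod measurable_compose[OF _ ww_measurable] coord_measurable) auto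
    note w = this
    show "L \<in> borel_measurable (lebesgue_n m)" unfolding L_def[abs_def]
      by (intro borel_measurable_times measurable_compose[OF w borel_measurable_of_real] measurable_compose[OF _ borel_measurable_of_real]
          borel_measurable_exp borel_measurable_uminus borel_measurable_sum coord_measurable) auto
  next
    fix x :: "nat => real" and y :: real
    assume x: "\<And>i. i < m ==> 0 < x i" and y: "y > 0" and dist: "distinct_coords ?n (x(m := y))"
    have ne: "x i \<noteq> y" if "i < m" for i
    proof -
      have "i < Suc m" "m < Suc m" "i \<noteq> m" using that by auto
      hence "(x(m := y)) i \<noteq> (x(m := y)) m" using dist unfolding distinct_coords_def by blast
      thus ?thesis using that by simp
    qed
    define E where "E = (\<lambda>y. exp (- (\<Sum>i<?n. (x(m := y)) i)))"
    have E: "E = (\<lambda>y. exp (- (\<Sum>i<m. x i) - y))" by (auto simp: E_def fun_eq_iff)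
    define w where "w = (\<lambda>y. omega ?n k (x(m := y)))"
    have "(E has_real_derivative - E y) (at y)" unfolding E by (auto intro!: derivative_eq_intros)
    moreover have "(w has_real_derivative w y * (\<Sum>i<m. 2 * k / (y - x i))) (at y)"
      unfolding w_def by (rule omega_deriv[OF ne k])
    ultimately have "((\<lambda>y. E y * w y) has_real_derivative - E y * w y + w y * (\<Sum>i<m. 2 * k / (y - x i)) * E y) (at y)"
      by (rule DERIV_mult)
    from has_vector_derivative_of_real'[OF this]
    have d: "((\<lambda>y. complex_of_real (E y * w y)) has_vector_derivative of_real (- E y * w y + w y * (\<Sum>i<m. 2 * k / (y - x i)) * E y)) (at y)" .
    have P: "\<Psi> (x(m := y)) = of_real (E y * w y)" for y by (simp only: \<Psi>_def E_def w_def of_real_mult)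
    have "w y * (\<Sum>i<m. 2 * k / (y - x i)) * E y = (\<Sum>i<m. 2 * (k * (E y * w y / (y - x i))))"
      unfolding sum_distrib_left sum_distrib_right by (intro sum.cong) (auto simp: mult_ac)
    hence "complex_of_real (- E y * w y + w y * (\<Sum>i<m. 2 * k / (y - x i)) * E y) = D (x(m := y))"
      unfolding D_def Sg_def P by simp
    thus "((\<lambda>y. \<Psi> (x(m := y))) has_vector_derivative D (x(m := y))) (at y)" using d unfolding P by simp
  next
    fix x :: "nat => real" assume x: "\<And>i. i < m ==> 0 < x i"
    have P: "\<Psi> (x(m := y)) = of_real (exp (- (\<Sum>i<m. x i) - y)) * of_real (omega ?n k (x(m := y)))" for y
      by (simp add: \<Psi>_def)
    have c: "continuous_on UNIV (\<lambda>y. \<Psi> (x(m := y)))"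
      unfolding P by (intro continuous_intros continuous_omega[OF k])
    thus "continuous_on {0<..} (\<lambda>y. \<Psi> (x(m := y)))" by (rule continuous_on_subset) simp
    have "isCont (\<lambda>y. \<Psi> (x(m := y))) 0" using c by (simp add: continuous_on_eq_continuous_at)
    hence "((\<lambda>y. \<Psi> (x(m := y))) \<longlongrightarrow> \<Psi> (x(m := 0))) (at 0)" by (simp add: isCont_def)
    hence "((\<lambda>y. \<Psi> (x(m := y))) \<longlongrightarrow> \<Psi> (x(m := 0))) (at_right 0)" by (rule filterlim_mono) (auto intro: at_le)
    moreover have "\<Psi> (x(m := 0)) = L x"
      unfolding P L_def omega_Suc using omega_cong[of m "x(m := 0)" x k] by simp
    moreover have "((\<lambda>y. \<Psi> (x(m := y))) \<longlongrightarrow> 0) at_top"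
    proof -
      obtain d C where d: "d > 0" "C \<ge> 0" and bd: "\<And>x. \<forall>i<?n. 0 < x i ==> norm (\<Psi> x) \<le> C * exp (- d * (\<Sum>i<?n. x i))"
        using dPsi by (auto simp: decays_def)
      have "filterlim (\<lambda>y. - d * y) at_bot at_top"
        using d by (intro filterlim_tendsto_neg_mult_at_bot[OF tendsto_const _ filterlim_ident]) auto
      hence "((\<lambda>y. exp (- d * y)) \<longlongrightarrow> 0) at_top" by (rule filterlim_compose[OF exp_at_bot])
      hence t: "((\<lambda>y. C * exp (- d * (\<Sum>i<m. x i)) * exp (- d * y)) \<longlongrightarrow> 0) at_top" by (rule tendsto_mult_right_zero)
      have b: "norm (\<Psi> (x(m := y))) \<le> C * exp (- d * (\<Sum>i<m. x i)) * exp (- d * y)" if "y > 0" for y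
      proof -
        have "norm (\<Psi> (x(m := y))) \<le> C * exp (- d * (\<Sum>i<?n. (x(m := y)) i))" by (rule bd) (use x that in \<open>auto simp: less_Suc_eq\<close>)
        also have "(\<Sum>i<?n. (x(m := y)) i) = (\<Sum>i<m. x i) + y" by simp
        also have "C * exp (- d * ((\<Sum>i<m. x i) + y)) = C * exp (- d * (\<Sum>i<m. x i)) * exp (- d * y)"
          by (simp only: distrib_left exp_add mult.assoc)
        finally show ?thesis .
      qed
      show ?thesis
        by (rule Lim_null_comparison[OF eventually_mono[OF eventually_gt_at_top[of "0::real"]] t]) (rule b)
    qed
    ultimately show "((\<lambda>y. \<Psi> (x(m := y))) \<longlongrightarrow> L x) (at_right 0) \<and> ((\<lambda>y. \<Psi> (x(m := y))) \<longlongrightarrow> 0) at_top" by simp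
  qed
  moreover have "OI m L = In m k (of_real (2 * k))"
    unfolding In_def
  proof (rule set_lebesgue_integral_cong, goal_cases)
    case 1 show ?case by (rule pos_orthant_sets)
  next
    case 2
    show ?case
    proof (intro allI impI)
      fix x assume "x \<in> pos_orthant m"
      hence x: "\<And>i. i < m ==> 0 < x i" by (rule pos_orthantD)
      have "Dp m (of_real (2 * k)) x = of_real (exp (2 * k * (\<Sum>i<m. ln (x i))))"
        by (simp add: Dp_def exp_of_real[symmetric] del: exp_of_real)
      also have "exp (2 * k * (\<Sum>i<m. ln (x i))) = (\<Prod>i<m. ww k (x i))"
        unfolding sum_distrib_left
      proof (subst exp_sum)
        show "(\<Prod>i<m. exp (2 * k * ln (x i))) = (\<Prod>i<m. ww k (x i))"
        proof (rule prod.cong)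
          fix i assume "i \<in> {..<m}"
          thus "exp (2 * k * ln (x i)) = ww k (x i)" using x[of i] by (simp add: ww_def powr_def)
        qed simp
      qed simp
      finally show "L x = of_real (exp (- (\<Sum>i<m. x i))) * of_real (omega m k x) * Dp m (of_real (2 * k)) x"
        by (simp add: L_def)
    qed
  qed
  ultimately show ?thesis using 1 by simp
qed

lemma In_0: "In 0 k s = 1"
  by (simp add: In_def set_lebesgue_integral_def lebesgue_n_def PiM_empty lebesgue_integral_count_space_finite
      pos_orthant_def omega_def Dp_def)

section \<open>Concentration and the Gamma quotient\<close>

text \<open>The mean value inequality for t^w between 1 and y. On 1 <= Re w <= 2 the derivative is
  bounded by |w| max(1, y), without a singularity at 0.\<close>

lemma cpow_minus_1_bound:
  assumes y: "y > 0" and w: "1 \<le> Re w" "Re w \<le> 2"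
  shows "norm (exp (w * of_real (ln y)) - 1) \<le> norm w * max 1 y * \<bar>y - 1\<bar>"
proof -
  have "norm (exp (w * Ln (of_real y)) - exp (w * Ln 1)) \<le> (norm w * max 1 y) * norm (complex_of_real y - 1)"
  proof (rule field_differentiable_bound[where S = "closed_segment 1 (of_real y)" and f' = "\<lambda>t. exp (w * Ln t) * (w / t)"])
    fix t :: complex assume "t \<in> closed_segment 1 (of_real y)"
    then obtain r where r: "t = of_real r" "r \<in> closed_segment 1 y"
      using closed_segment_of_real[of 1 y, where 'a = complex] by auto
    have r0: "r > 0" and rm: "r \<le> max 1 y" using r(2) y by (auto simp: closed_segment_eq_real_ivl split: if_splits)
    show "((\<lambda>t. exp (w * Ln t)) has_field_derivative exp (w * Ln t) * (w / t)) (at t within closed_segment 1 (of_real y))"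
      using r r0 by (auto intro!: derivative_eq_intros simp: complex_nonpos_Reals_iff field_simps)
    have "norm (exp (w * Ln t) * (w / t)) = norm w * exp ((Re w - 1) * ln r)"
      using r0 by (simp add: r norm_mult norm_divide Ln_of_real left_diff_distrib exp_diff)
    also have "exp ((Re w - 1) * ln r) \<le> max 1 y"
    proof (cases "r \<le> 1")
      case True
      hence "(Re w - 1) * ln r \<le> 0" using w r0 by (intro mult_nonneg_nonpos) auto
      thus ?thesis by (simp add: le_max_iff_disj)
    next
      case False
      hence "(Re w - 1) * ln r \<le> 1 * ln r" using w by (intro mult_right_mono) auto
      hence "exp ((Re w - 1) * ln r) \<le> exp (ln r)" by simp
      thus ?thesis using rm r0 by simp
    qed
    finally show "norm (exp (w * Ln t) * (w / t)) \<le> norm w * max 1 y" by (simp add: mult_left_mono)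
  qed auto
  also have "norm (complex_of_real y - 1) = \<bar>y - 1\<bar>" by (metis norm_of_real of_real_1 of_real_diff)
  finally show ?thesis using y by (simp add: Ln_of_real)
qed

text \<open>With v = |e^u - 1|, the inequality v <= delta + v^2 / delta trades the first power for
  an arbitrarily small constant plus a square, whose integral is a combination of moments.\<close>

lemma cpow_minus_1_quadratic:
  assumes "1 \<le> Re w" "Re w \<le> 2" "\<delta> > 0"
  shows "norm (exp (w * of_real u) - 1) \<le> norm w * (\<delta> + (1 / \<delta> + 1) * (exp u - 1)\<^sup>2)"
proof -
  define v where "v = \<bar>exp u - 1\<bar>"
  have v: "v \<ge> 0" "max 1 (exp u) \<le> 1 + v" by (auto simp: v_def)
  have "norm (exp (w * of_real u) - 1) \<le> norm w * max 1 (exp u) * v"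
    using cpow_minus_1_bound[of "exp u" w] assms by (simp add: v_def)
  also have "\<dots> \<le> norm w * (1 + v) * v" using v by (intro mult_right_mono mult_left_mono) auto
  also have "\<dots> = norm w * (v + v\<^sup>2)" by (simp add: power2_eq_square algebra_simps)
  finally have 1: "norm (exp (w * of_real u) - 1) \<le> norm w * (v + v\<^sup>2)" .
  have "v \<le> \<delta> + v\<^sup>2 / \<delta>"
  proof -
    have "0 \<le> (v - \<delta>)\<^sup>2 + v * \<delta>" using v assms by simp
    also have "(v - \<delta>)\<^sup>2 + v * \<delta> = \<delta>\<^sup>2 + v\<^sup>2 - v * \<delta>" by (simp add: power2_eq_square algebra_simps)
    finally show ?thesis using assms(3) by (simp add: field_simps power2_eq_square)
  qed
  hence "norm w * (v + v\<^sup>2) \<le> norm w * ((\<delta> + v\<^sup>2 / \<delta>) + v\<^sup>2)" by (intro mult_left_mono) auto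
  with 1 have "norm (exp (w * of_real u) - 1) \<le> norm w * ((\<delta> + v\<^sup>2 / \<delta>) + v\<^sup>2)" by linarith
  also have "(\<delta> + v\<^sup>2 / \<delta>) + v\<^sup>2 = \<delta> + (1 / \<delta> + 1) * (exp u - 1)\<^sup>2" by (simp add: v_def algebra_simps)
  finally show ?thesis .
qed

definition wt :: "nat => real => real => (nat => real) => real" where
  "wt n k t x = exp (- (\<Sum>i<n. x i)) * omega n k x * exp (t * (\<Sum>i<n. ln (x i)))"

definition Ir :: "nat => real => real => real" where
  "Ir n k t = OI n (wt n k t)"

lemma wt_nonneg: "wt n k t x \<ge> 0" by (simp add: wt_def omega_nonneg)

lemma wt_complex: "complex_of_real (exp (- (\<Sum>i<n. x i))) * of_real (omega n k x) * Dp n (of_real t) x = of_real (wt n k t x)"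
  by (simp add: wt_def Dp_def exp_of_real[symmetric] del: exp_of_real)

lemma oint_wt: "k \<ge> 0 ==> t > -1 ==> oint n (wt n k t)"
proof -
  assume "k \<ge> 0" "t > -1"
  hence "oint n (\<lambda>x. complex_of_real (wt n k t x))" using oint_In[of k "of_real t" n] by (simp only: wt_complex) simp
  hence "integrable (lebesgue_n n) (\<lambda>x. complex_of_real (indicator (pos_orthant n) x * wt n k t x))"
    by (simp add: set_integrable_def scaleR_conv_of_real)
  thus ?thesis unfolding complex_of_real_integrable_eq by (simp add: set_integrable_def)
qed

lemma In_of_real: "In n k (of_real t) = of_real (Ir n k t)"
  unfolding In_def wt_complex Ir_def by (rule set_integral_complex_of_real)

lemma Ir_plus_1:
  assumes "k \<ge> 0" "t > -1"
  shows "Ir (Suc m) k (t + 1) = (\<Prod>j<Suc m. t + 1 + k * (real m - real j)) * Ir (Suc m) k t"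
proof -
  have "complex_of_real (Ir (Suc m) k (t + 1)) = of_real ((\<Prod>j<Suc m. t + 1 + k * (real m - real j)) * Ir (Suc m) k t)"
    using In_plus_1[OF assms(1), of "of_real t" m] assms(2) In_of_real[of "Suc m" k "t + 1"] In_of_real[of "Suc m" k t] by simp
  thus ?thesis by (simp only: of_real_eq_iff)
qed

text \<open>Here u is the logarithm of the product of the coordinates minus l, with l still free.
  Expanding (e^u - 1)^2 against the weight gives exactly the moments with exponents t, t + 1 and t +
  2.\<close>

lemma In_concentration:
  assumes k: "k \<ge> 0" and t: "t > -1" and w: "1 \<le> Re w" "Re w \<le> 2" and \<delta>: "\<delta> > 0"
  shows "norm (In n k (of_real t + w) - exp (w * of_real l) * In n k (of_real t)) \<le>
    norm w * exp (Re w * l) * (\<delta> * Ir n k t + (1 / \<delta> + 1) * (exp (-2 * l) * Ir n k (t + 2) - 2 * exp (- l) * Ir n k (t + 1) + Ir n k t))"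
proof -
  define \<Lambda> where "\<Lambda> x = (\<Sum>i<n. ln (x i))" for x :: "nat => real"
  define A where "A x = of_real (exp (- (\<Sum>i<n. x i))) * of_real (omega n k x) * Dp n (of_real t + w) x" for x
  define B where "B x = of_real (exp (- (\<Sum>i<n. x i))) * of_real (omega n k x) * Dp n (of_real t) x" for x
  define W where "W x = norm w * exp (Re w * l) * (\<delta> * wt n k t x + (1 / \<delta> + 1) * (exp (-2 * l) * wt n k (t + 2) x - 2 * exp (- l) * wt n k (t + 1) x + wt n k t x))" for x
  have iA: "oint n A" unfolding A_def[abs_def] by (rule oint_In[OF k]) (use t w in auto)
  have iB: "oint n B" unfolding B_def[abs_def] by (rule oint_In[OF k]) (use t in auto)
  have i0: "oint n (wt n k t)" "oint n (wt n k (t + 1))" "oint n (wt n k (t + 2))" using t by (auto intro!: oint_wt k)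
  have iAB: "oint n (\<lambda>x. A x - exp (w * of_real l) * B x)" by (intro set_integral_diff(1) set_integrable_mult_right iA iB)
  have iW: "oint n W" unfolding W_def[abs_def]
    by (intro set_integrable_mult_right set_integral_add(1) set_integral_diff(1) i0)
  have bound: "norm (A x - exp (w * of_real l) * B x) \<le> W x" for x
  proof -
    define u where "u = \<Lambda> x - l"
    have B: "B x = of_real (wt n k t x)" unfolding B_def by (rule wt_complex)
    have "A x = B x * exp (w * of_real (\<Lambda> x))" by (simp add: A_def B_def Dp_def \<Lambda>_def distrib_right exp_add)
    moreover have "exp (w * of_real (\<Lambda> x)) = exp (w * of_real l) * exp (w * of_real u)"
      unfolding exp_add[symmetric] distrib_left[symmetric] by (simp add: u_def)
    ultimately have "A x - exp (w * of_real l) * B x = B x * exp (w * of_real l) * (exp (w * of_real u) - 1)"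
      by (simp add: algebra_simps)
    hence "norm (A x - exp (w * of_real l) * B x) = wt n k t x * exp (Re w * l) * norm (exp (w * of_real u) - 1)"
      by (simp add: B norm_mult wt_nonneg)
    also have "\<dots> \<le> wt n k t x * exp (Re w * l) * (norm w * (\<delta> + (1 / \<delta> + 1) * (exp u - 1)\<^sup>2))"
      by (intro mult_left_mono cpow_minus_1_quadratic w \<delta> mult_nonneg_nonneg wt_nonneg) auto
    also have "\<dots> = norm w * exp (Re w * l) * (\<delta> * wt n k t x + (1 / \<delta> + 1) * (wt n k t x * (exp u - 1)\<^sup>2))"
      by (simp only: distrib_left mult_ac)
    also have "wt n k t x * (exp u - 1)\<^sup>2 = exp (-2 * l) * wt n k (t + 2) x - 2 * exp (- l) * wt n k (t + 1) x + wt n k t x"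
    proof -
      have 1: "wt n k (t + 1) x = wt n k t x * exp (\<Lambda> x)" "wt n k (t + 2) x = wt n k t x * (exp (\<Lambda> x))\<^sup>2"
        by (simp_all add: wt_def \<Lambda>_def distrib_right exp_add exp_double)
      have 2: "exp u = exp (\<Lambda> x) * exp (- l)" by (simp add: u_def exp_diff exp_minus divide_inverse)
      have 3: "exp (-2 * l) = (exp (- l))\<^sup>2" using exp_double[of "- l"] by simp
      show ?thesis unfolding 1 2 3 by (simp add: power2_eq_square algebra_simps)
    qed
    finally show ?thesis by (simp only: W_def)
  qed
  have "In n k (of_real t + w) - exp (w * of_real l) * In n k (of_real t) = OI n (\<lambda>x. A x - exp (w * of_real l) * B x)"
  proof -
    have "OI n (\<lambda>x. A x - exp (w * of_real l) * B x) = OI n A - OI n (\<lambda>x. exp (w * of_real l) * B x)"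
      by (intro set_integral_diff(2) set_integrable_mult_right iA iB)
    thus ?thesis by (simp only: set_integral_mult_right In_def A_def[abs_def] B_def[abs_def])
  qed
  also have "norm \<dots> \<le> OI n W"
    unfolding set_lebesgue_integral_def
  proof (rule order.trans[OF integral_norm_bound integral_mono])
    show "integrable (lebesgue_n n) (\<lambda>x. norm (indicator (pos_orthant n) x *\<^sub>R (A x - exp (w * of_real l) * B x)))"
      using iAB by (intro integrable_norm) (simp only: set_integrable_def)
    show "integrable (lebesgue_n n) (\<lambda>x. indicator (pos_orthant n) x *\<^sub>R W x)" using iW by (simp only: set_integrable_def)
    show "norm (indicator (pos_orthant n) x *\<^sub>R (A x - exp (w * of_real l) * B x)) \<le> indicator (pos_orthant n) x *\<^sub>R W x" for x
      using bound[of x] by (simp add: indicator_def)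
  qed
  also have "OI n W = norm w * exp (Re w * l) * (\<delta> * Ir n k t + (1 / \<delta> + 1) * (exp (-2 * l) * Ir n k (t + 2) - 2 * exp (- l) * Ir n k (t + 1) + Ir n k t))"
  proof -
    have "OI n (\<lambda>x. exp (-2 * l) * wt n k (t + 2) x - 2 * exp (- l) * wt n k (t + 1) x) =
       OI n (\<lambda>x. exp (-2 * l) * wt n k (t + 2) x) - OI n (\<lambda>x. 2 * exp (- l) * wt n k (t + 1) x)"
      by (intro set_integral_diff(2) set_integrable_mult_right i0)
    moreover have "OI n (\<lambda>x. exp (-2 * l) * wt n k (t + 2) x - 2 * exp (- l) * wt n k (t + 1) x + wt n k t x) =
       OI n (\<lambda>x. exp (-2 * l) * wt n k (t + 2) x - 2 * exp (- l) * wt n k (t + 1) x) + OI n (wt n k t)"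
      by (intro set_integral_diff(1) set_integral_add(2) set_integrable_mult_right i0)
    moreover have "OI n (\<lambda>x. \<delta> * wt n k t x + (1 / \<delta> + 1) * (exp (-2 * l) * wt n k (t + 2) x - 2 * exp (- l) * wt n k (t + 1) x + wt n k t x)) =
       OI n (\<lambda>x. \<delta> * wt n k t x) + OI n (\<lambda>x. (1 / \<delta> + 1) * (exp (-2 * l) * wt n k (t + 2) x - 2 * exp (- l) * wt n k (t + 1) x + wt n k t x))"
      by (intro set_integral_diff(1) set_integral_add set_integrable_mult_right i0)
    ultimately show ?thesis unfolding W_def[abs_def] Ir_def by (simp only: set_integral_mult_right)
  qed
  finally show ?thesis .
qed

lemma In_shift:
  assumes k: "k \<ge> 0" and s: "Re s > -1"
  shows "In (Suc m) k (s + of_nat L) = (\<Prod>j<Suc m. pochhammer (s + 1 + of_real (k * (real m - real j))) L) * In (Suc m) k s"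
proof (induction L)
  case (Suc L)
  have "In (Suc m) k (s + of_nat L + 1) = (\<Prod>j<Suc m. s + of_nat L + 1 + of_real (k * (real m - real j))) * In (Suc m) k (s + of_nat L)"
    by (rule In_plus_1[OF k]) (use s in simp)
  also have "\<dots> = ((\<Prod>j<Suc m. pochhammer (s + 1 + of_real (k * (real m - real j))) L) *
      (\<Prod>j<Suc m. s + of_nat L + 1 + of_real (k * (real m - real j)))) * In (Suc m) k s"
    unfolding Suc by (simp only: mult_ac)
  also have "(\<Prod>j<Suc m. pochhammer (s + 1 + of_real (k * (real m - real j))) L) *
      (\<Prod>j<Suc m. s + of_nat L + 1 + of_real (k * (real m - real j))) = (\<Prod>j<Suc m. pochhammer (s + 1 + of_real (k * (real m - real j))) (Suc L))"
    unfolding prod.distrib[symmetric] by (intro prod.cong refl) (simp only: pochhammer_Suc add_ac)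
  finally show ?case by (simp add: add_ac)
qed simp

lemma tendsto_shift_ratio: "(\<lambda>N. (a + real N) / real N) \<longlonglongrightarrow> 1"
proof (rule Lim_transform_eventually)
  show "(\<lambda>N. a / real N + 1) \<longlonglongrightarrow> 1" using tendsto_add[OF lim_const_over_n[of a] tendsto_const[of 1]] by simp
  show "\<forall>\<^sub>F N in sequentially. a / real N + 1 = (a + real N) / real N"
    using eventually_gt_at_top[of 0] by eventually_elim (simp add: field_simps)
qed

text \<open>Gauss's approximation of 1 / Gamma with index N contains N + 1 linear factors, hence the
  \<open>Suc N\<close>.\<close>

lemma pochhammer_ratio:
  fixes a w :: complex
  assumes "Re a > 0" "N > 0"
  shows "pochhammer (a + w) (Suc N) = pochhammer a (Suc N) * exp (w * of_real (ln (real N))) * (rGamma_series (a + w) N / rGamma_series a N)"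
proof -
  have "pochhammer a (Suc N) \<noteq> 0" using assms(1) by (auto simp: pochhammer_eq_0_iff)
  thus ?thesis by (simp add: rGamma_series_def distrib_right exp_add field_simps)
qed

lemma nonpos_Ints_Re: "Re a > 0 ==> a \<notin> \<int>\<^sub>\<le>\<^sub>0"
  by (auto elim!: nonpos_Ints_cases)

text \<open>Under the probability measure proportional to the weight with large exponent, the product of the
  coordinates concentrates by Chebyshev, so that its complex powers have the same growth as for Gamma functions.\<close>

lemma In_ratio:
  assumes k: "k \<ge> 0" and t: "t > -1" and w: "1 \<le> Re w" "Re w \<le> 2"
  shows "In (Suc m) k (of_real t + w) * (\<Prod>j<Suc m. Gamma (of_real t + 1 + of_real (k * (real m - real j)))) =
    In (Suc m) k (of_real t) * (\<Prod>j<Suc m. Gamma (of_real t + w + 1 + of_real (k * (real m - real j))))"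
proof -
  define n where "n = Suc m"
  define a where "a j = t + 1 + k * (real m - real j)" for j
  have a: "a j > 0" if "j < n" for j using that t k by (simp add: a_def n_def add_pos_nonneg)
  define ac where "ac j = complex_of_real (a j)" for j
  have ac: "Re (ac j) > 0" "Re (ac j + w) > 0" if "j < n" for j using a[OF that] w by (auto simp: ac_def)
  define \<rho> where "\<rho> N = (\<Prod>j<n. rGamma_series (ac j + w) N / rGamma_series (ac j) N)" for N
  define \<rho>0 where "\<rho>0 = (\<Prod>j<n. rGamma (ac j + w) / rGamma (ac j))"
  \<comment> \<open>The mean of (P / N^n - 1)^2, where P is the product of the coordinates under the
    normalised weight with exponent t + N + 1. By the shift equation its moments are explicit
    products, and it tends to 0.\<close>
  define e where "e N = (\<Prod>j<n. (a j + 2 + real N) / real N) * (\<Prod>j<n. (a j + 1 + real N) / real N) - 2 * (\<Prod>j<n. (a j + 1 + real N) / real N) + 1" for N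
  have \<rho>: "\<rho> \<longlonglongrightarrow> \<rho>0" unfolding \<rho>_def[abs_def] \<rho>0_def
  proof (intro tendsto_prod tendsto_divide rGamma_series_LIMSEQ)
    fix j assume "j \<in> {..<n}"
    thus "rGamma (ac j) \<noteq> 0" using nonpos_Ints_Re[OF ac(1)] by (simp add: rGamma_eq_zero_iff)
  qed
  have "e \<longlonglongrightarrow> (\<Prod>j<n. 1) * (\<Prod>j<n. 1) - 2 * (\<Prod>j<n. 1) + 1"
    unfolding e_def[abs_def] by (intro tendsto_intros tendsto_shift_ratio)
  hence e: "e \<longlonglongrightarrow> 0" by simp
  have main: "norm (\<rho> N * In n k (of_real t + w) - In n k (of_real t)) \<le> norm w * ((\<delta> + (1 / \<delta> + 1) * e N) * Ir n k t)"
    if \<delta>: "\<delta> > 0" and N: "N > 0" for \<delta> N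
  proof -
    \<comment> \<open>The logarithm of N^n, the typical size of the product of the coordinates at
      exponent t + N + 1.\<close>
    define l where "l = real n * ln (real N)"
    define t' where "t' = t + real (Suc N)"
    define A where "A = (\<Prod>j<n. pochhammer (a j) (Suc N))"
    have A: "A > 0" unfolding A_def using a by (intro prod_pos) (auto intro: pochhammer_pos)
    have el: "exp l = real N ^ n" using N by (simp add: l_def exp_of_nat_mult)
    have Ac: "(\<Prod>j<n. pochhammer (of_real t + 1 + of_real (k * (real m - real j))) (Suc N)) = complex_of_real A"
      unfolding A_def of_real_prod by (intro prod.cong refl) (simp add: a_def flip: pochhammer_of_real)
    have 1: "In n k (of_real t') = of_real A * In n k (of_real t)"
      using In_shift[OF k, of "of_real t" m "Suc N"] t unfolding n_def[symmetric] Ac by (simp add: t'_def)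
    hence Ir1: "Ir n k t' = A * Ir n k t" unfolding In_of_real of_real_mult[symmetric] of_real_eq_iff .
    have "(\<Prod>j<n. pochhammer (of_real t + w + 1 + of_real (k * (real m - real j))) (Suc N)) = (\<Prod>j<n. pochhammer (ac j + w) (Suc N))"
      by (intro prod.cong refl arg_cong2[of _ _ _ _ pochhammer]) (simp add: ac_def a_def)
    also have "\<dots> = (\<Prod>j<n. pochhammer (ac j) (Suc N) * exp (w * of_real (ln (real N))) * (rGamma_series (ac j + w) N / rGamma_series (ac j) N))"
      by (intro prod.cong refl pochhammer_ratio ac N) simp
    also have "\<dots> = of_real A * exp (w * of_real l) * \<rho> N"
    proof -
      have "(\<Prod>j<n. pochhammer (ac j) (Suc N)) = of_real A"
        unfolding A_def of_real_prod ac_def by (simp only: pochhammer_of_real)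
      moreover have "(\<Prod>j<n. exp (w * of_real (ln (real N)))) = exp (w * of_real l)"
        by (simp add: l_def exp_of_nat_mult[symmetric] mult_ac)
      ultimately show ?thesis unfolding prod.distrib \<rho>_def by simp
    qed
    finally have 2: "In n k (of_real t' + w) = of_real A * exp (w * of_real l) * \<rho> N * In n k (of_real t + w)"
      using In_shift[OF k, of "of_real t + w" m "Suc N"] t w unfolding n_def[symmetric] by (simp add: t'_def add_ac)
    have t'1: "t' > -1" "t' + 1 > -1" using t by (auto simp: t'_def)
    have p1: "Ir n k (t' + 1) = (\<Prod>j<n. a j + 1 + real N) * Ir n k t'"
      unfolding n_def Ir_plus_1[OF k t'1(1)] by (intro arg_cong2[of _ _ _ _ "(*)"] refl prod.cong) (auto simp: t'_def a_def)
    have "Ir n k (t' + 1 + 1) = (\<Prod>j<n. a j + 2 + real N) * Ir n k (t' + 1)"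
      unfolding n_def Ir_plus_1[OF k t'1(2)] by (intro arg_cong2[of _ _ _ _ "(*)"] refl prod.cong) (auto simp: t'_def a_def)
    hence p2: "Ir n k (t' + 2) = (\<Prod>j<n. a j + 2 + real N) * ((\<Prod>j<n. a j + 1 + real N) * Ir n k t')"
      unfolding p1 by (simp add: add.assoc)
    have em: "exp (- l) * (\<Prod>j<n. b j) = (\<Prod>j<n. b j / real N)" for b
      unfolding prod_dividef by (simp add: exp_minus el divide_inverse mult.commute)
    have em2: "exp (-2 * l) = exp (- l) * exp (- l)" by (simp flip: exp_add)
    have "exp (-2 * l) * Ir n k (t' + 2) - 2 * exp (- l) * Ir n k (t' + 1) + Ir n k t' =
       (exp (- l) * (\<Prod>j<n. a j + 2 + real N)) * (exp (- l) * (\<Prod>j<n. a j + 1 + real N)) * Ir n k t' - 2 * (exp (- l) * (\<Prod>j<n. a j + 1 + real N)) * Ir n k t' + Ir n k t'"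
      unfolding p1 p2 em2 by (simp only: mult_ac)
    also have "\<dots> = e N * Ir n k t'" unfolding em e_def by (simp only: distrib_right left_diff_distrib mult_1)
    finally have 3: "exp (-2 * l) * Ir n k (t' + 2) - 2 * exp (- l) * Ir n k (t' + 1) + Ir n k t' = e N * (A * Ir n k t)"
      unfolding Ir1 .
    have "norm (In n k (of_real t' + w) - exp (w * of_real l) * In n k (of_real t')) \<le>
      norm w * exp (Re w * l) * (\<delta> * Ir n k t' + (1 / \<delta> + 1) * (e N * (A * Ir n k t)))"
      using In_concentration[OF k t'1(1) w \<delta>, of n l] unfolding 3 .
    also have "\<dots> = (exp (Re w * l) * A) * (norm w * ((\<delta> + (1 / \<delta> + 1) * e N) * Ir n k t))"
      unfolding Ir1 by (simp only: distrib_left distrib_right mult_ac)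
    also have "In n k (of_real t' + w) - exp (w * of_real l) * In n k (of_real t') =
       exp (w * of_real l) * of_real A * (\<rho> N * In n k (of_real t + w) - In n k (of_real t))"
      unfolding 1 2 by (simp only: right_diff_distrib mult_ac)
    also have "norm \<dots> = (exp (Re w * l) * A) * norm (\<rho> N * In n k (of_real t + w) - In n k (of_real t))"
      using A by (simp add: norm_mult)
    finally show ?thesis using A by (simp add: mult_le_cancel_left_pos)
  qed
  have lim1: "(\<lambda>N. norm (\<rho> N * In n k (of_real t + w) - In n k (of_real t))) \<longlonglongrightarrow> norm (\<rho>0 * In n k (of_real t + w) - In n k (of_real t))"
    by (intro tendsto_intros \<rho>)
  \<comment> \<open>First N tends to infinity with delta fixed, which removes the second moment;
    afterwards delta tends to 0.\<close>
  have le: "norm (\<rho>0 * In n k (of_real t + w) - In n k (of_real t)) \<le> norm w * (\<delta> * Ir n k t)" if \<delta>: "\<delta> > 0" for \<delta>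
  proof (rule tendsto_le[OF _ _ lim1])
    have "(\<lambda>N. norm w * ((\<delta> + (1 / \<delta> + 1) * e N) * Ir n k t)) \<longlonglongrightarrow> norm w * ((\<delta> + (1 / \<delta> + 1) * 0) * Ir n k t)"
      by (intro tendsto_intros e)
    thus "(\<lambda>N. norm w * ((\<delta> + (1 / \<delta> + 1) * e N) * Ir n k t)) \<longlonglongrightarrow> norm w * (\<delta> * Ir n k t)" by simp
    show "\<forall>\<^sub>F N in sequentially. norm (\<rho> N * In n k (of_real t + w) - In n k (of_real t)) \<le> norm w * ((\<delta> + (1 / \<delta> + 1) * e N) * Ir n k t)"
      by (rule eventually_mono[OF eventually_gt_at_top[of 0]]) (rule main[OF \<delta>])
  qed simp
  have "norm (\<rho>0 * In n k (of_real t + w) - In n k (of_real t)) \<le> 0"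
  proof (rule tendsto_lowerbound)
    have "((\<lambda>\<delta>. norm w * (\<delta> * Ir n k t)) \<longlongrightarrow> norm w * (0 * Ir n k t)) (at_right 0)" by (intro tendsto_intros)
    thus "((\<lambda>\<delta>. norm w * (\<delta> * Ir n k t)) \<longlongrightarrow> 0) (at_right 0)" by simp
    show "\<forall>\<^sub>F \<delta> in at_right 0. norm (\<rho>0 * In n k (of_real t + w) - In n k (of_real t)) \<le> norm w * (\<delta> * Ir n k t)"
      using le by (auto simp: eventually_at_filter)
  qed simp
  hence eq: "\<rho>0 * In n k (of_real t + w) = In n k (of_real t)" by simp
  have r: "\<rho>0 = (\<Prod>j<n. Gamma (ac j)) / (\<Prod>j<n. Gamma (ac j + w))"
    unfolding \<rho>0_def prod_dividef[symmetric] by (intro prod.cong refl) (simp add: rGamma_inverse_Gamma divide_inverse mult.commute)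
  have nz: "(\<Prod>j<n. Gamma (ac j + w)) \<noteq> 0"
    using nonpos_Ints_Re[OF ac(2)] by (auto simp: Gamma_eq_zero_iff)
  have "(\<Prod>j<n. Gamma (of_real t + 1 + of_real (k * (real m - real j)))) = (\<Prod>j<n. Gamma (ac j))"
    "(\<Prod>j<n. Gamma (of_real t + w + 1 + of_real (k * (real m - real j)))) = (\<Prod>j<n. Gamma (ac j + w))"
    by (intro prod.cong refl arg_cong[of _ _ Gamma]; simp add: ac_def a_def)+
  thus ?thesis using eq nz unfolding r n_def[symmetric] by (simp add: field_simps)
qed

text \<open>The quotient Q by the Gamma product has period 1 by the shift equation and, by
  \<open>In_ratio\<close>, does not change when a real t > -1 is moved by w with 1 <= Re w <= 2.
  Integer shifts bring every admissible s into reach of 0.\<close>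

lemma In_const:
  assumes k: "k \<ge> 0" and s: "Re s > -1"
  shows "In (Suc m) k s * (\<Prod>j<Suc m. Gamma (1 + of_real (k * (real m - real j)))) =
    In (Suc m) k 0 * (\<Prod>j<Suc m. Gamma (s + 1 + of_real (k * (real m - real j))))"
proof -
  define G where "G s = (\<Prod>j<Suc m. Gamma (s + 1 + complex_of_real (k * (real m - real j))))" for s
  define Q where "Q s = In (Suc m) k s / G s" for s
  have pos: "Re (s + 1 + complex_of_real (k * (real m - real j))) > 0" if "Re s > -1" "j < Suc m" for s j
  proof -
    have "k * (real m - real j) \<ge> 0" using that k by (intro mult_nonneg_nonneg) auto
    thus ?thesis using that by simp
  qed
  have G0: "G s \<noteq> 0" if "Re s > -1" for s
  proof -
    have "Gamma (s + 1 + complex_of_real (k * (real m - real j))) \<noteq> 0" if "j < Suc m" for j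
      unfolding Gamma_eq_zero_iff by (rule nonpos_Ints_Re[OF pos[OF \<open>Re s > -1\<close> that]])
    thus ?thesis unfolding G_def by (simp only: prod_zero_iff[OF finite_lessThan]) blast
  qed
  have shift: "Q (s + of_nat L) = Q s" if s: "Re s > -1" for s L
  proof -
    have "G (s + of_nat L) = (\<Prod>j<Suc m. pochhammer (s + 1 + of_real (k * (real m - real j))) L) * G s"
      unfolding G_def prod.distrib[symmetric]
    proof (intro prod.cong refl)
      fix j assume "j \<in> {..<Suc m}"
      hence p: "s + 1 + complex_of_real (k * (real m - real j)) \<notin> \<int>\<^sub>\<le>\<^sub>0" using nonpos_Ints_Re[OF pos[OF s]] by simp
      have "Gamma (s + 1 + of_real (k * (real m - real j)) + of_nat L) =
          pochhammer (s + 1 + of_real (k * (real m - real j))) L * Gamma (s + 1 + of_real (k * (real m - real j)))"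
        unfolding pochhammer_Gamma[OF p] using p by (simp add: Gamma_eq_zero_iff)
      thus "Gamma (s + of_nat L + 1 + of_real (k * (real m - real j))) =
          pochhammer (s + 1 + of_real (k * (real m - real j))) L * Gamma (s + 1 + of_real (k * (real m - real j)))"
        by (simp only: add_ac)
    qed
    moreover have "G (s + of_nat L) \<noteq> 0" by (rule G0) (use s in simp)
    ultimately show ?thesis unfolding Q_def In_shift[OF k s] by auto
  qed
  have ratio: "Q (of_real t + w) = Q (of_real t)" if "t > -1" "1 \<le> Re w" "Re w \<le> 2" for t w
    using In_ratio[OF k that, of m] G0[of "of_real t + w"] G0[of "of_real t"] that unfolding Q_def G_def[symmetric] by (simp add: field_simps)
  have "Q s = Q 0"
  proof (cases "Re s \<le> 2")
    case True
    \<comment> \<open>The shift that brings the real part up to the strip from 1 to 2, so that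
      \<open>ratio\<close> applies with t = 0.\<close>
    define L where "L = nat \<lceil>1 - Re s\<rceil>"
    have L: "1 \<le> Re s + real L \<and> Re s + real L \<le> 2"
    proof (cases "Re s \<ge> 1")
      case False
      hence "real L = of_int \<lceil>1 - Re s\<rceil>" by (simp add: L_def)
      thus ?thesis using ceiling_correct[of "1 - Re s"] by linarith
    qed (use True in \<open>simp add: L_def\<close>)
    have "Q s = Q (s + of_nat L)" by (rule shift[OF s, symmetric])
    also have "\<dots> = Q 0" using ratio[of 0 "s + of_nat L"] L by simp
    finally show ?thesis .
  next
    case False
    \<comment> \<open>Here the integer is subtracted: s - L lies in the strip, and
      \<open>ratio\<close> applies with t = L.\<close>
    define L where "L = nat (\<lfloor>Re s\<rfloor> - 1)"
    have "2 \<le> \<lfloor>Re s\<rfloor>" using False by (simp add: le_floor_iff)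
    hence "real L = of_int \<lfloor>Re s\<rfloor> - 1" by (simp add: L_def)
    hence L: "1 \<le> Re s - real L" "Re s - real L \<le> 2" using floor_correct[of "Re s"] by linarith+
    have "Q s = Q (of_real (real L) + (s - of_nat L))" by simp
    also have "\<dots> = Q (of_real (real L))" by (rule ratio) (use L in auto)
    also have "\<dots> = Q 0" using shift[of 0 L] by simp
    finally show ?thesis .
  qed
  thus ?thesis using G0[OF s] G0[of 0] unfolding Q_def G_def[of 0] G_def[of s, symmetric] by (simp add: field_simps)
qed

section \<open>Laplace transforms of Jack polynomials\<close>

lemma d_const_Suc: "d_const (Suc m) k = d_const m k * (Gamma (1 + real (Suc m) * k) / Gamma (1 + k))"
  unfolding d_const_def by (simp add: prod.nat_ivl_Suc')

text \<open>Induction on the number of variables: \<open>In_const\<close> reduces s to 0, where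
  \<open>In_boundary\<close> passes to one variable less with exponent 2k.\<close>

theorem In_formula:
  assumes k: "k \<ge> 0"
  shows "Re s > -1 ==> In n k s = of_real (d_const n k) * (\<Prod>j<n. Gamma (s + 1 + of_real (k * (real n - 1 - real j))))"
proof (induction n arbitrary: s)
  case 0
  show ?case by (simp add: In_0 d_const_def)
next
  case (Suc m)
  define g where "g i = Gamma (1 + complex_of_real (k * real i))" for i
  have g0: "g i \<noteq> 0" for i
  proof -
    have "0 \<le> k * real i" using k by simp
    hence "Re (1 + complex_of_real (k * real i)) > 0" by simp
    from nonpos_Ints_Re[OF this] show ?thesis unfolding g_def Gamma_eq_zero_iff .
  qed
  have G: "(\<Prod>j<Suc m. Gamma (1 + of_real (k * (real m - real j)))) = (\<Prod>i<Suc m. g i)"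
    unfolding g_def by (rule prod.reindex_bij_witness[where i = "\<lambda>j. m - j" and j = "\<lambda>j. m - j"]) (auto simp: of_nat_diff)
  have "In (Suc m) k 0 = In m k (of_real (2 * k))" by (rule In_boundary[OF k])
  also have "\<dots> = of_real (d_const m k) * (\<Prod>j<m. Gamma (of_real (2 * k) + 1 + of_real (k * (real m - 1 - real j))))"
    by (rule Suc.IH) (use k in simp)
  also have "(\<Prod>j<m. Gamma (of_real (2 * k) + 1 + complex_of_real (k * (real m - 1 - real j)))) = (\<Prod>i<m. g (Suc (Suc i)))"
    unfolding g_def
  proof (rule prod.reindex_bij_witness[where i = "\<lambda>j. m - 1 - j" and j = "\<lambda>j. m - 1 - j"])
    fix j assume j: "j \<in> {..<m}"
    have "real (Suc (Suc (m - 1 - j))) = real m - 1 - real j + 2" using j by (simp add: of_nat_diff)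
    hence "1 + complex_of_real (k * real (Suc (Suc (m - 1 - j)))) = of_real (2 * k) + 1 + complex_of_real (k * (real m - 1 - real j))"
      by (simp only:) (simp add: algebra_simps)
    thus "Gamma (1 + complex_of_real (k * real (Suc (Suc (m - 1 - j))))) = Gamma (of_real (2 * k) + 1 + complex_of_real (k * (real m - 1 - real j)))" by (rule arg_cong)
  qed auto
  finally have b: "In (Suc m) k 0 = of_real (d_const m k) * (\<Prod>i<m. g (Suc (Suc i)))" .
  \<comment> \<open>The exponent 2k shifts the Gamma arguments by two steps of k. Against the
    product of g_0, ..., g_m only g_(m+1) / g_1 remains, as g_0 = 1, and this is the new factor of
    \<open>d_const\<close>.\<close>
  have p: "g 1 * (\<Prod>i<m. g (Suc (Suc i))) = (\<Prod>i<Suc m. g i) * g (Suc m)"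
  proof -
    have "g 0 = 1" by (simp add: g_def)
    have "(\<Prod>i<Suc (Suc m). g i) = g 0 * (g 1 * (\<Prod>i<m. g (Suc (Suc i))))"
      unfolding prod.lessThan_Suc_shift by simp
    thus ?thesis using \<open>g 0 = 1\<close> by simp
  qed
  have d: "complex_of_real (d_const (Suc m) k) * g 1 = of_real (d_const m k) * g (Suc m)"
  proof -
    have "complex_of_real (Gamma (1 + real i * k)) = g i" for i
      unfolding g_def by (simp add: Gamma_complex_of_real[symmetric] mult.commute)
    from this[of "Suc m"] this[of 1] show ?thesis unfolding d_const_Suc using g0[of 1] by simp
  qed
  have c: "In (Suc m) k s * (\<Prod>i<Suc m. g i) = In (Suc m) k 0 * (\<Prod>j<Suc m. Gamma (s + 1 + of_real (k * (real m - real j))))"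
    using In_const[OF k Suc.prems, of m] unfolding G .
  define R where "R = (\<Prod>j<Suc m. Gamma (s + 1 + complex_of_real (k * (real m - real j))))"
  have P0: "(\<Prod>i<Suc m. g i) \<noteq> 0" using g0 by (simp del: prod.lessThan_Suc)
  have "(In (Suc m) k s - of_real (d_const (Suc m) k) * R) * ((\<Prod>i<Suc m. g i) * g 1) = 0"
  proof -
    have "In (Suc m) k s * ((\<Prod>i<Suc m. g i) * g 1) = of_real (d_const m k) * (g 1 * (\<Prod>i<m. g (Suc (Suc i)))) * R"
      using c unfolding b R_def[symmetric] by (simp only: mult_ac)
    also have "\<dots> = (of_real (d_const m k) * g (Suc m)) * ((\<Prod>i<Suc m. g i) * R)" unfolding p by (simp only: mult_ac)
    also have "\<dots> = of_real (d_const (Suc m) k) * R * ((\<Prod>i<Suc m. g i) * g 1)" unfolding d[symmetric] by (simp only: mult_ac)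
    finally show ?thesis by (simp only: left_diff_distrib right_minus_eq)
  qed
  hence "In (Suc m) k s = of_real (d_const (Suc m) k) * R" using P0 g0[of 1] by (simp only: mult_eq_0_iff right_minus_eq) simp
  thus ?case unfolding R_def by simp
qed

section \<open>The Gamma factor along the recursion\<close>

lemma eta_plus_rk:
  assumes m: "mindex n \<eta>"
  shows "eta_plus n \<eta> = \<eta> \<circ> min_perm n \<eta>"
proof -
  let ?w = "min_perm n \<eta>"
  have w: "?w \<in> symg n" by (rule min_perm_props[OF m])
  have "is_partition n (\<eta> \<circ> ?w)"
    unfolding is_partition_def
  proof (intro conjI allI impI)
    show "mindex n (\<eta> \<circ> ?w)" by (rule mindex_comp[OF m w])
    fix i j :: nat assume ij: "i \<le> j" "j < n"
    have lt: "?w i < n" "?w j < n" using ij w by (auto simp: symg_lt)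
    have rk: "rk n \<eta> (?w i) = i" "rk n \<eta> (?w j) = j"
      using min_perm_props(2)[OF m lt(1)] min_perm_props(2)[OF m lt(2)] w by auto
    show "(\<eta> \<circ> ?w) j \<le> (\<eta> \<circ> ?w) i"
    proof (rule ccontr)
      assume "\<not> ?thesis"
      hence "before \<eta> (?w j) (?w i)" by (simp add: before_def)
      from rk_less[OF this lt(2)] show False using rk ij by simp
    qed
  qed
  from eta_plus_partition[OF this] show ?thesis by (simp add: eta_plus_comp[OF w])
qed

text \<open>Reindexed by positions of \<eta> instead of its rearrangement, the Gamma arguments
  become \<open>eta_bar\<close> at p plus mu, so that the effect of \<open>phi\<close> is visible
  factor by factor.\<close>

lemma Gamma_n_rk:
  assumes m: "mindex n \<eta>"
  shows "Gamma_n n k (\<lambda>i. of_nat (eta_plus n \<eta> i) + \<mu>) =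
    of_real (d_const n k) * (\<Prod>p<n. Gamma (of_nat (\<eta> p) + \<mu> - of_real (k * real (rk n \<eta> p))))"
proof -
  let ?w = "min_perm n \<eta>"
  have w: "?w \<in> symg n" by (rule min_perm_props[OF m])
  define h where "h j = Gamma (of_nat (eta_plus n \<eta> j) + \<mu> - complex_of_real (k * real j))" for j
  have "prod h {..<n} = prod (h \<circ> inv ?w) {..<n}"
    by (rule prod.permute) (use symg_inv[OF w] in \<open>simp add: symg_def\<close>)
  also have "\<dots> = (\<Prod>p<n. Gamma (of_nat (\<eta> p) + \<mu> - of_real (k * real (rk n \<eta> p))))"
  proof (intro prod.cong refl)
    fix p assume "p \<in> {..<n}"
    hence "inv ?w p = rk n \<eta> p" by (intro min_perm_props(2)[OF m]) simp
    moreover have "(h \<circ> inv ?w) p = Gamma (of_nat (\<eta> p) + \<mu> - complex_of_real (k * real (inv ?w p)))"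
      using w by (simp add: h_def eta_plus_rk[OF m])
    ultimately show "(h \<circ> inv ?w) p = Gamma (of_nat (\<eta> p) + \<mu> - complex_of_real (k * real (rk n \<eta> p)))" by (simp only:)
  qed
  finally show ?thesis unfolding Gamma_n_def h_def by simp
qed

text \<open>\<open>phi\<close> permutes the Gamma arguments and raises by 1 the one of the first
  entry, so the functional equation yields precisely the factor of \<open>Phi_step\<close>. That
  argument has positive real part because a rank is at most m.\<close>

lemma Gamma_n_phi:
  assumes k: "k \<ge> 0" and m: "mindex (Suc m) \<eta>" and \<mu>: "Re \<mu> > k * real m"
  shows "Gamma_n (Suc m) k (\<lambda>i. of_nat (eta_plus (Suc m) (phi m \<eta>) i) + \<mu>) =
    (of_real (eta_bar (Suc m) k \<eta> 0) + \<mu>) * Gamma_n (Suc m) k (\<lambda>i. of_nat (eta_plus (Suc m) \<eta> i) + \<mu>)"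
proof -
  let ?n = "Suc m"
  define h where "h p = Gamma (of_nat (\<eta> p) + \<mu> - complex_of_real (k * real (rk ?n \<eta> p)))" for p
  define b where "b = of_real (eta_bar ?n k \<eta> 0) + \<mu>"
  have b: "b = of_nat (\<eta> 0) + \<mu> - complex_of_real (k * real (rk ?n \<eta> 0))" by (simp add: b_def eta_bar_rk)
  have "rk ?n \<eta> 0 \<le> m"
  proof -
    have "{q. q < ?n \<and> before \<eta> q 0} \<subseteq> {1..m}" by (auto simp: before_def intro!: Suc_leI) (metis gr0I less_irrefl)
    from card_mono[OF _ this] show ?thesis by (simp add: rk_def)
  qed
  hence "k * real (rk ?n \<eta> 0) \<le> k * real m" using k by (intro mult_left_mono) auto
  hence "Re b > 0" using \<mu> by (simp add: b)
  hence Gb: "Gamma (b + 1) = b * Gamma b" by (intro Gamma_plus1 nonpos_Ints_Re)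
  have ph: "Gamma (of_nat (phi m \<eta> p) + \<mu> - complex_of_real (k * real (rk ?n (phi m \<eta>) p))) = (if p = m then b else 1) * h (icyc m p)"
    if "p \<in> {..<?n}" for p
  proof (cases "p = m")
    case True
    have e: "of_nat (phi m \<eta> m) + \<mu> - complex_of_real (k * real (rk ?n (phi m \<eta>) m)) = b + 1"
      using rk_phi[of m m \<eta>] by (simp add: phi_def icyc_def b)
    have h0: "h (icyc m m) = Gamma b" by (simp add: h_def icyc_def b)
    show ?thesis unfolding True by (simp only: e Gb h0 if_True refl)
  next
    case False
    thus ?thesis using that rk_phi[of p m \<eta>] by (simp add: phi_def h_def)
  qed
  have "(\<Prod>p<?n. Gamma (of_nat (phi m \<eta> p) + \<mu> - complex_of_real (k * real (rk ?n (phi m \<eta>) p)))) =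
      (\<Prod>p<?n. (if p = m then b else 1) * h (icyc m p))" by (rule prod.cong[OF refl ph])
  also have "\<dots> = b * prod (h \<circ> icyc m) {..<?n}" unfolding prod.distrib by (simp add: prod.delta comp_def)
  also have "prod (h \<circ> icyc m) {..<?n} = prod h {..<?n}"
    by (rule prod.permute[symmetric]) (use symg_inv[OF cyc_symg[of m]] in \<open>simp add: symg_def\<close>)
  finally show ?thesis unfolding Gamma_n_rk[OF m] Gamma_n_rk[OF mindex_phi[OF m]] h_def b_def by (simp only: mult_ac)
qed

lemma Delta_pow_permute:
  assumes "\<tau> \<in> symg n"
  shows "Delta_pow n (z \<circ> \<tau>) s = Delta_pow n z s"
proof -
  have "(\<Sum>j<n. Ln (z j)) = sum ((\<lambda>j. Ln (z j)) \<circ> \<tau>) {..<n}"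
    by (rule sum.permute) (use assms in \<open>simp add: symg_def\<close>)
  thus ?thesis by (simp add: Delta_pow_def comp_def)
qed

text \<open>The formula is carried for all z at once, because raising and exchanging replace z by a
  permutation of it. An exchange leaves the Gamma factor alone, since that depends only on the
  decreasing rearrangement, so this step is pure linearity.\<close>

lemma jack_laplace:
  assumes k: "k \<ge> 0" and m: "mindex (Suc m) \<eta>"
  shows "\<exists>p. pos_poly (Suc m) p \<and> jack_eigen (Suc m) k \<eta> p \<and> (\<forall>\<mu> z. Re \<mu> > k * real m --> (\<forall>i<Suc m. Re (z i) > 0) -->
     OI (Suc m) (hint (Suc m) k (\<mu> - of_real (k * real m) - 1) z p) =
     Gamma_n (Suc m) k (\<lambda>i. of_nat (eta_plus (Suc m) \<eta> i) + \<mu>) * p (\<lambda>i. 1 / z i) * Delta_pow (Suc m) z (- \<mu>))"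
proof (rule jack_induct[OF k m, where P = "\<lambda>\<eta> p. \<forall>\<mu> z. Re \<mu> > k * real m --> (\<forall>i<Suc m. Re (z i) > 0) -->
     OI (Suc m) (hint (Suc m) k (\<mu> - of_real (k * real m) - 1) z p) =
     Gamma_n (Suc m) k (\<lambda>i. of_nat (eta_plus (Suc m) \<eta> i) + \<mu>) * p (\<lambda>i. 1 / z i) * Delta_pow (Suc m) z (- \<mu>)"], goal_cases)
  case 1
  show ?case
  proof (intro allI impI)
    fix \<mu> and z :: "nat => complex"
    assume \<mu>: "Re \<mu> > k * real m" and z: "\<forall>i<Suc m. Re (z i) > 0"
    have e0: "eta_plus (Suc m) (\<lambda>_. 0) = (\<lambda>_. 0)" by (rule eta_plus_partition) (simp add: is_partition_def mindex_def)
    have "gg m k \<mu> (\<lambda>_. 1) = Gamma_n (Suc m) k (\<lambda>i. \<mu>)"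
      unfolding gg_one[OF k] Gamma_n_def
      by (subst In_formula[OF k]) (use \<mu> in \<open>auto intro!: prod.cong arg_cong[of _ _ Gamma] simp: algebra_simps simp del: prod.lessThan_Suc\<close>)
    moreover have "gg m k \<mu> z = gg m k \<mu> (\<lambda>_. 1) * Delta_pow (Suc m) z (- \<mu>)"
      by (rule hint_base[OF k _ \<mu>]) (use z in auto)
    ultimately show "OI (Suc m) (hint (Suc m) k (\<mu> - of_real (k * real m) - 1) z (\<lambda>_. 1)) =
       Gamma_n (Suc m) k (\<lambda>i. of_nat (eta_plus (Suc m) (\<lambda>_. 0) i) + \<mu>) * 1 * Delta_pow (Suc m) z (- \<mu>)"
      by (simp add: gg_def e0)
  qed
next
  case (2 \<eta> p)
  show ?case
  proof (intro allI impI)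
    fix \<mu> and z :: "nat => complex"
    assume \<mu>: "Re \<mu> > k * real m" and z: "\<forall>i<Suc m. Re (z i) > 0"
    define a where "a = complex_of_real (eta_bar (Suc m) k \<eta> 0)"
    define C where "C = Gamma_n (Suc m) k (\<lambda>i. of_nat (eta_plus (Suc m) \<eta> i) + \<mu>)"
    have zc: "\<forall>i<Suc m. Re ((z \<circ> cyc m) i) > 0" using z cyc_symg[of m] by (simp add: symg_lt)
    have "z m * OI (Suc m) (hint (Suc m) k (\<mu> - of_real (k * real m) - 1) z (Phi m p)) =
       (a + \<mu>) * OI (Suc m) (hint (Suc m) k (\<mu> - of_real (k * real m) - 1) (z \<circ> cyc m) p)"
    proof (rule Phi_step[OF k _ \<mu> 2(2) _ refl])
      show "cher_op (Suc m) k 0 p x = a * p x" if "distinct_coords (Suc m) x" for x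
        using 2(3) that unfolding jack_eigen_def a_def by blast
    qed (use z in auto)
    also have "OI (Suc m) (hint (Suc m) k (\<mu> - of_real (k * real m) - 1) (z \<circ> cyc m) p) =
       C * p (\<lambda>i. 1 / (z \<circ> cyc m) i) * Delta_pow (Suc m) (z \<circ> cyc m) (- \<mu>)"
      unfolding C_def using 2(4) \<mu> zc by blast
    also have "(\<lambda>i. 1 / (z \<circ> cyc m) i) = (\<lambda>i. 1 / z i) \<circ> cyc m" by auto
    also have "Delta_pow (Suc m) (z \<circ> cyc m) (- \<mu>) = Delta_pow (Suc m) z (- \<mu>)" by (rule Delta_pow_permute[OF cyc_symg])
    finally have e: "z m * OI (Suc m) (hint (Suc m) k (\<mu> - of_real (k * real m) - 1) z (Phi m p)) =
       (a + \<mu>) * (C * p ((\<lambda>i. 1 / z i) \<circ> cyc m) * Delta_pow (Suc m) z (- \<mu>))" .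
    have "Re (z m) > 0" using z by simp
    hence zm: "z m \<noteq> 0" by auto
    have "OI (Suc m) (hint (Suc m) k (\<mu> - of_real (k * real m) - 1) z (Phi m p)) =
       (1 / z m) * (z m * OI (Suc m) (hint (Suc m) k (\<mu> - of_real (k * real m) - 1) z (Phi m p)))" using zm by simp
    also have "\<dots> = ((a + \<mu>) * C) * ((1 / z m) * p ((\<lambda>i. 1 / z i) \<circ> cyc m)) * Delta_pow (Suc m) z (- \<mu>)"
      unfolding e by (simp only: mult_ac)
    finally show "OI (Suc m) (hint (Suc m) k (\<mu> - of_real (k * real m) - 1) z (Phi m p)) =
       Gamma_n (Suc m) k (\<lambda>i. of_nat (eta_plus (Suc m) (phi m \<eta>) i) + \<mu>) * Phi m p (\<lambda>i. 1 / z i) * Delta_pow (Suc m) z (- \<mu>)"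
      unfolding Gamma_n_phi[OF k 2(1) \<mu>] Phi_def a_def C_def .
  qed
next
  case (3 \<eta> p i c)
  define t where "t = Transposition.transpose i (Suc i)"
  have t: "t \<in> symg (Suc m)" unfolding t_def using 3(2) by (intro swap_symg) auto
  show ?case
    unfolding swap_coords_eq t_def[symmetric] eta_plus_comp[OF t]
  proof (intro allI impI)
    fix \<mu> and z :: "nat => complex"
    assume \<mu>: "Re \<mu> > k * real m" and z: "\<forall>i<Suc m. Re (z i) > 0"
    define s where "s = \<mu> - of_real (k * real m) - 1"
    have s: "Re s > -1" using \<mu> by (simp add: s_def)
    define C where "C = Gamma_n (Suc m) k (\<lambda>i. of_nat (eta_plus (Suc m) \<eta> i) + \<mu>)"
    have zt: "\<forall>i<Suc m. Re ((z \<circ> t) i) > 0" using z t by (simp add: symg_lt)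
    have IH: "OI (Suc m) (hint (Suc m) k s z p) = C * p (\<lambda>i. 1 / z i) * Delta_pow (Suc m) z (- \<mu>)" if "\<forall>i<Suc m. Re (z i) > 0" for z
      unfolding C_def s_def using 3(4) \<mu> that by blast
    have "OI (Suc m) (hint (Suc m) k s z (\<lambda>x. p (x \<circ> t))) = OI (Suc m) (hint (Suc m) k s (z \<circ> t) p)"
      by (rule OI_hint_permute[OF k _ s 3(3) t]) (use z in auto)
    also have "\<dots> = C * p (\<lambda>i. 1 / (z \<circ> t) i) * Delta_pow (Suc m) (z \<circ> t) (- \<mu>)" by (rule IH[OF zt])
    also have "(\<lambda>i. 1 / (z \<circ> t) i) = (\<lambda>i. 1 / z i) \<circ> t" by auto
    also have "Delta_pow (Suc m) (z \<circ> t) (- \<mu>) = Delta_pow (Suc m) z (- \<mu>)" by (rule Delta_pow_permute[OF t])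
    finally have 1: "OI (Suc m) (hint (Suc m) k s z (\<lambda>x. p (x \<circ> t))) = C * p ((\<lambda>i. 1 / z i) \<circ> t) * Delta_pow (Suc m) z (- \<mu>)" .
    have hs: "hint (Suc m) k s z (\<lambda>x. p (x \<circ> t) + of_real c * p x) = (\<lambda>x. hint (Suc m) k s z (\<lambda>x. p (x \<circ> t)) x + of_real c * hint (Suc m) k s z p x)"
      by (auto simp: hint_def fun_eq_iff algebra_simps)
    have "OI (Suc m) (hint (Suc m) k s z (\<lambda>x. p (x \<circ> t) + of_real c * p x)) =
        OI (Suc m) (hint (Suc m) k s z (\<lambda>x. p (x \<circ> t))) + OI (Suc m) (\<lambda>x. of_real c * hint (Suc m) k s z p x)"
      unfolding hs by (intro set_integral_add(2) set_integrable_mult_right oint_hint_pos k s 3(3) pos_poly_permute t) (use z in auto)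
    also have "OI (Suc m) (\<lambda>x. of_real c * hint (Suc m) k s z p x) = of_real c * (C * p (\<lambda>i. 1 / z i) * Delta_pow (Suc m) z (- \<mu>))"
      by (simp only: set_integral_mult_right IH[OF z])
    also note 1
    also have "C * p ((\<lambda>i. 1 / z i) \<circ> t) * Delta_pow (Suc m) z (- \<mu>) + of_real c * (C * p (\<lambda>i. 1 / z i) * Delta_pow (Suc m) z (- \<mu>)) =
       C * (p ((\<lambda>i. 1 / z i) \<circ> t) + of_real c * p (\<lambda>i. 1 / z i)) * Delta_pow (Suc m) z (- \<mu>)"
      by (simp only: distrib_left distrib_right mult_ac)
    finally show "OI (Suc m) (hint (Suc m) k (\<mu> - of_real (k * real m) - 1) z (\<lambda>x. p (x \<circ> t) + of_real c * p x)) =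
       Gamma_n (Suc m) k (\<lambda>i. of_nat (eta_plus (Suc m) \<eta> i) + \<mu>) * (p ((\<lambda>i. 1 / z i) \<circ> t) + of_real c * p (\<lambda>i. 1 / z i)) * Delta_pow (Suc m) z (- \<mu>)"
      unfolding s_def C_def .
  qed
qed

lemma OI_cong:
  fixes F G :: "(nat => real) => complex"
  assumes "\<And>x. x \<in> pos_orthant n ==> F x = G x"
  shows "oint n F \<longleftrightarrow> oint n G" "OI n F = OI n G"
proof -
  have "(\<lambda>x. indicator (pos_orthant n) x *\<^sub>R F x) = (\<lambda>x. indicator (pos_orthant n) x *\<^sub>R G x)"
    by (rule ext) (use assms in \<open>auto simp: indicator_def\<close>)
  thus "oint n F \<longleftrightarrow> oint n G" "OI n F = OI n G" by (simp_all only: set_integrable_def set_lebesgue_integral_def)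
qed

theorem theorem3p5:
  fixes n :: nat and k :: real and \<mu> :: complex and z :: "nat \<Rightarrow> complex"
  assumes "k \<ge> 0" and "n \<ge> 1"
    and "Re \<mu> > k * (real n - 1)"
    and "\<forall>i<n. Re (z i) > 0"
  shows
   "(\<forall>\<eta>. mindex n \<eta> \<longrightarrow>
      set_integrable (lebesgue_n n) (pos_orthant n)
        (\<lambda>x. dunkl_kernel n k (\<lambda>i. - z i) (cvec x) * nsjack n k \<eta> (cvec x)
             * Delta_pow n (cvec x) (\<mu> - complex_of_real (k * (real n - 1)) - 1)
             * complex_of_real (omega n k x)) \<and>
      (LINT x:pos_orthant n|lebesgue_n n.
           dunkl_kernel n k (\<lambda>i. - z i) (cvec x) * nsjack n k \<eta> (cvec x)
             * Delta_pow n (cvec x) (\<mu> - complex_of_real (k * (real n - 1)) - 1)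
             * complex_of_real (omega n k x))
        = Gamma_n n k (\<lambda>i. of_nat (eta_plus n \<eta> i) + \<mu>) * nsjack n k \<eta> (\<lambda>i. 1 / z i)
          * Delta_pow n z (- \<mu>))
    \<and>
    (\<forall>lam. is_partition n lam \<longrightarrow>
      set_integrable (lebesgue_n n) (pos_orthant n)
        (\<lambda>x. bessel n k (\<lambda>i. - z i) (cvec x) * symjack n k lam (cvec x)
             * Delta_pow n (cvec x) (\<mu> - complex_of_real (k * (real n - 1)) - 1)
             * complex_of_real (omega n k x)) \<and>
      (LINT x:pos_orthant n|lebesgue_n n.
           bessel n k (\<lambda>i. - z i) (cvec x) * symjack n k lam (cvec x)
             * Delta_pow n (cvec x) (\<mu> - complex_of_real (k * (real n - 1)) - 1)
             * complex_of_real (omega n k x))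
        = Gamma_n n k (\<lambda>i. of_nat (lam i) + \<mu>) * symjack n k lam (\<lambda>i. 1 / z i)
          * Delta_pow n z (- \<mu>))"
proof -
  note k = assms(1)
  obtain m where n: "n = Suc m" using assms(2) by (cases n) auto
  define s where "s = \<mu> - complex_of_real (k * (real n - 1)) - 1"
  have sm: "s = \<mu> - of_real (k * real m) - 1" by (simp add: s_def n)
  have \<mu>: "Re \<mu> > k * real m" using assms(3) by (simp add: n)
  have s: "Re s > -1" using \<mu> by (simp add: sm)
  have z: "\<And>i. i < n ==> Re (z i) > 0" using assms(4) by blast
  \<comment> \<open>The polynomial p is a positive multiple of neither normalisation yet; both
    formulas are linear in p, so the scalars for the Jack polynomials are inserted
    afterwards.\<close>
  have ex: "\<exists>p. pos_poly n p \<and> jack_eigen n k \<eta> p \<and> (\<forall>z. (\<forall>i<n. Re (z i) > 0) -->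
     OI n (hint n k s z p) = Gamma_n n k (\<lambda>i. of_nat (eta_plus n \<eta> i) + \<mu>) * p (\<lambda>i. 1 / z i) * Delta_pow n z (- \<mu>))"
    if "mindex n \<eta>" for \<eta>
    using jack_laplace[OF k, of m \<eta>] that \<mu> unfolding sm n by blast
  note dk_eq = dunkl_kernel_eq[OF k]
  have A: "oint n (\<lambda>x. dunkl_kernel n k (\<lambda>i. - z i) (cvec x) * nsjack n k \<eta> (cvec x) * Delta_pow n (cvec x) s * of_real (omega n k x)) \<and>
      OI n (\<lambda>x. dunkl_kernel n k (\<lambda>i. - z i) (cvec x) * nsjack n k \<eta> (cvec x) * Delta_pow n (cvec x) s * of_real (omega n k x))
        = Gamma_n n k (\<lambda>i. of_nat (eta_plus n \<eta> i) + \<mu>) * nsjack n k \<eta> (\<lambda>i. 1 / z i) * Delta_pow n z (- \<mu>)"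
    if m: "mindex n \<eta>" for \<eta>
  proof -
    from ex[OF m] obtain p where p: "pos_poly n p" "jack_eigen n k \<eta> p"
      and OI: "\<forall>z. (\<forall>i<n. Re (z i) > 0) --> OI n (hint n k s z p) = Gamma_n n k (\<lambda>i. of_nat (eta_plus n \<eta> i) + \<mu>) * p (\<lambda>i. 1 / z i) * Delta_pow n z (- \<mu>)"
      by blast
    from nsjack_pos[OF k m p] obtain a where ns: "nsjack n k \<eta> = (\<lambda>x. of_real a * p x)" by blast
    have e: "dunkl_kernel n k (\<lambda>i. - z i) (cvec x) * nsjack n k \<eta> (cvec x) * Delta_pow n (cvec x) s * of_real (omega n k x) = of_real a * hint n k s z p x"
      if "x \<in> pos_orthant n" for x
      using Delta_pow_Dp[of n x s] pos_orthantD[OF that] by (simp add: dk_eq ns hint_def mult_ac)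
    have iH: "oint n (hint n k s z p)" by (rule oint_hint_pos[OF k z s p(1)])
    have "OI n (\<lambda>x. of_real a * hint n k s z p x) = of_real a * OI n (hint n k s z p)" by (rule set_integral_mult_right)
    also have "\<dots> = Gamma_n n k (\<lambda>i. of_nat (eta_plus n \<eta> i) + \<mu>) * nsjack n k \<eta> (\<lambda>i. 1 / z i) * Delta_pow n z (- \<mu>)"
      using OI assms(4) by (simp add: ns)
    finally show ?thesis using OI_cong[OF e] iH by simp
  qed
  have B: "oint n (\<lambda>x. bessel n k (\<lambda>i. - z i) (cvec x) * symjack n k lam (cvec x) * Delta_pow n (cvec x) s * of_real (omega n k x)) \<and>
      OI n (\<lambda>x. bessel n k (\<lambda>i. - z i) (cvec x) * symjack n k lam (cvec x) * Delta_pow n (cvec x) s * of_real (omega n k x))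
        = Gamma_n n k (\<lambda>i. of_nat (lam i) + \<mu>) * symjack n k lam (\<lambda>i. 1 / z i) * Delta_pow n z (- \<mu>)"
    if lam: "is_partition n lam" for lam
  proof -
    have m: "mindex n lam" using lam by (simp add: is_partition_def)
    define C where "C = Gamma_n n k (\<lambda>i. of_nat (lam i) + \<mu>)"
    from ex[OF m] obtain p where p: "pos_poly n p" "jack_eigen n k lam p"
      and OI: "\<forall>z. (\<forall>i<n. Re (z i) > 0) --> OI n (hint n k s z p) = C * p (\<lambda>i. 1 / z i) * Delta_pow n z (- \<mu>)"
      unfolding eta_plus_partition[OF lam] C_def by blast
    from nsjack_pos[OF k m p] obtain a where ns: "nsjack n k lam = (\<lambda>x. of_real a * p x)" by blast
    from symjack_eq[OF k m p] obtain b where sy: "symjack n k lam = (\<lambda>x. b * (\<Sum>\<sigma>\<in>symg n. nsjack n k lam (x \<circ> \<sigma>)))" by blast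
    define c where "c = b * of_real a"
    define q where "q x = (\<Sum>\<sigma>\<in>symg n. p (x \<circ> \<sigma>))" for x
    have sq: "symjack n k lam = (\<lambda>x. c * q x)"
      unfolding sy ns q_def c_def by (simp add: sum_distrib_left mult.assoc)
    have q: "q (x \<circ> \<tau>) = q x" if "\<tau> \<in> symg n" for x \<tau>
      unfolding q_def using sum_symg_left[OF that, of "\<lambda>\<sigma>. p (x \<circ> \<sigma>)"] by (simp add: comp_assoc)
    define H where "H = hint n k s z q"
    have H: "H = (\<lambda>x. \<Sum>\<sigma>\<in>symg n. hint n k s z (\<lambda>x. p (x \<circ> \<sigma>)) x)"
      by (rule ext) (simp add: H_def hint_def q_def sum_distrib_left sum_distrib_right)
    have ip: "oint n (hint n k s z (\<lambda>x. p (x \<circ> \<sigma>)))" if "\<sigma> \<in> symg n" for \<sigma>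
      by (rule oint_hint_pos[OF k z s pos_poly_permute[OF p(1) that]])
    have iH: "oint n H" unfolding H by (rule set_sum(1)) (rule ip)
    have "OI n H = (\<Sum>\<sigma>\<in>symg n. OI n (hint n k s z (\<lambda>x. p (x \<circ> \<sigma>))))" unfolding H by (rule set_sum(2)) (rule ip)
    also have "\<dots> = (\<Sum>\<sigma>\<in>symg n. C * p ((\<lambda>i. 1 / z i) \<circ> \<sigma>) * Delta_pow n z (- \<mu>))"
    proof (intro sum.cong refl)
      fix \<sigma> assume \<sigma>: "\<sigma> \<in> symg n"
      have zs: "\<forall>i<n. Re ((z \<circ> \<sigma>) i) > 0" using z \<sigma> by (simp add: symg_lt)
      have "OI n (hint n k s z (\<lambda>x. p (x \<circ> \<sigma>))) = OI n (hint n k s (z \<circ> \<sigma>) p)" by (rule OI_hint_permute[OF k z s p(1) \<sigma>])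
      also have "\<dots> = C * p (\<lambda>i. 1 / (z \<circ> \<sigma>) i) * Delta_pow n (z \<circ> \<sigma>) (- \<mu>)" using OI zs by blast
      also have "(\<lambda>i. 1 / (z \<circ> \<sigma>) i) = (\<lambda>i. 1 / z i) \<circ> \<sigma>" by auto
      finally show "OI n (hint n k s z (\<lambda>x. p (x \<circ> \<sigma>))) = C * p ((\<lambda>i. 1 / z i) \<circ> \<sigma>) * Delta_pow n z (- \<mu>)"
        unfolding Delta_pow_permute[OF \<sigma>] .
    qed
    also have "\<dots> = C * q (\<lambda>i. 1 / z i) * Delta_pow n z (- \<mu>)" unfolding q_def sum_distrib_left sum_distrib_right ..
    finally have OH: "OI n H = C * q (\<lambda>i. 1 / z i) * Delta_pow n z (- \<mu>)" .
    define d where "d = c / of_nat (fact n)"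
    \<comment> \<open>The symmetrised polynomial q, the weight and the powers are invariant, so
      averaging the kernel over permutations equals averaging the whole integrand H. Every summand
      has the same integral as H, and their number n! cancels the 1/n! of the Bessel
      function.\<close>
    have e: "bessel n k (\<lambda>i. - z i) (cvec x) * symjack n k lam (cvec x) * Delta_pow n (cvec x) s * of_real (omega n k x) =
       d * (\<Sum>\<sigma>\<in>symg n. H (x \<circ> inv \<sigma>))" if x: "x \<in> pos_orthant n" for x
    proof -
      define V where "V = q (cvec x) * of_real (omega n k x) * Dp n s x"
      have pa: "perm_act \<sigma> (cvec x) = cvec (x \<circ> inv \<sigma>)" for \<sigma> by (auto simp: perm_act_def cvec_def)
      have Hs: "H (x \<circ> inv \<sigma>) = dk n k (\<lambda>i. - z i) (cvec (x \<circ> inv \<sigma>)) * V" if "\<sigma> \<in> symg n" for \<sigma>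
        using symg_inv[OF that] unfolding H_def hint_def V_def
        by (simp only: omega_permute Dp_permute cvec_comp q mult.assoc)
      have "(\<Sum>\<sigma>\<in>symg n. H (x \<circ> inv \<sigma>)) = (\<Sum>\<sigma>\<in>symg n. dk n k (\<lambda>i. - z i) (cvec (x \<circ> inv \<sigma>))) * V"
        unfolding sum_distrib_right by (intro sum.cong refl Hs)
      moreover have "bessel n k (\<lambda>i. - z i) (cvec x) = 1 / of_nat (fact n) * (\<Sum>\<sigma>\<in>symg n. dk n k (\<lambda>i. - z i) (cvec (x \<circ> inv \<sigma>)))"
        unfolding bessel_def pa dk_eq symg_def ..
      moreover have "Delta_pow n (cvec x) s = Dp n s x" by (rule Delta_pow_Dp) (rule pos_orthantD[OF x])
      ultimately show ?thesis unfolding sq V_def d_def by (simp add: mult_ac)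
    qed
    have io: "oint n (\<lambda>x. H (x \<circ> inv \<sigma>))" and eo: "OI n (\<lambda>x. H (x \<circ> inv \<sigma>)) = OI n H" if "\<sigma> \<in> symg n" for \<sigma>
      using oint_permute[OF symg_inv[OF that] iH] by auto
    have "OI n (\<lambda>x. d * (\<Sum>\<sigma>\<in>symg n. H (x \<circ> inv \<sigma>))) = d * OI n (\<lambda>x. \<Sum>\<sigma>\<in>symg n. H (x \<circ> inv \<sigma>))"
      by (rule set_integral_mult_right)
    also have "OI n (\<lambda>x. \<Sum>\<sigma>\<in>symg n. H (x \<circ> inv \<sigma>)) = (\<Sum>\<sigma>\<in>symg n. OI n (\<lambda>x. H (x \<circ> inv \<sigma>)))"
      by (rule set_sum(2)) (rule io)
    also have "\<dots> = of_nat (card (symg n)) * OI n H" by (simp add: eo)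
    also have "card (symg n) = fact n" unfolding symg_def by (rule card_permutations) auto
    also have "d * (of_nat (fact n) * OI n H) = C * symjack n k lam (\<lambda>i. 1 / z i) * Delta_pow n z (- \<mu>)"
      unfolding OH sq d_def by (simp add: mult_ac)
    finally have "OI n (\<lambda>x. d * (\<Sum>\<sigma>\<in>symg n. H (x \<circ> inv \<sigma>))) = C * symjack n k lam (\<lambda>i. 1 / z i) * Delta_pow n z (- \<mu>)" .
    moreover have "oint n (\<lambda>x. d * (\<Sum>\<sigma>\<in>symg n. H (x \<circ> inv \<sigma>)))"
      by (intro set_integrable_mult_right set_sum(1) io)
    ultimately show ?thesis using OI_cong[OF e] unfolding C_def by simp
  qed
  show ?thesis unfolding s_def[symmetric] using A B by blast
qed

end
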